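(* Let $d \geq 1$ and let $n_1,\dots,n_d \geq 1$ be $d$ distinct positive integers such that $q-1$ does not divide $n_i$ for each $i$ and $n_i/n_j$ is not an integral power of $p$ for each $i \neq j$. For each $i$ take $\alpha_i \in K^\times$ with $|\alpha_i|_\infty < |\theta|_\infty^{n_i q/(q-1)}$. Then the set $$\{\tilde{\pi}\} \cup \{\operatorname{Li}_{n_\ell, n_{\ell+1},\dots,n_k}(\alpha_\ell, \alpha_{\ell+1},\dots,\alpha_k) \mid 1 \leq \ell \leq k \leq d\}$$ has cardinality $1 + \frac{d(d+1)}{2}$, and its elements are algebraically independent over $\overline{K}$.
   Context: Let $\mathbb{F}_q$ be the finite field with $q$ elements, $p$ its characteristic, $K = \mathbb{F}_q(\theta)$, $K_\infty = \mathbb{F}_q((\theta^{-1}))$ with absolute value $|\cdot|_\infty$ ($|\theta|_\infty>1$), $\mathbb{C}_\infty$ the completion of an algebraic closure of $K_\infty$, and $\overline{K}$ the algebraic closure of $K$ in $\mathbb{C}_\infty$. Fixing a $(q-1)$-st root of $-\theta$, $\tilde{\pi} = (-\theta)^{q/(q-1)} \prod_{i=1}^\infty (1-\theta^{1-q^i})^{-1}$. For positive integers $m_1,\dots,m_s$, the Carlitz multiple polylogarithm is $$\operatorname{Li}_{m_1,\dots,m_s}(z_1,\dots,z_s) = \sum_{i_1 > \cdots > i_s \geq 0} \frac{z_1^{q^{i_1}} \cdots z_s^{q^{i_s}}}{L_{i_1}^{m_1}\cdots L_{i_s}^{m_s}},\quad L_0=1,\ L_i = (\theta-\theta^q)(\theta-\theta^{q^2})\cdots(\theta-\theta^{q^i}),$$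 which converges when $|z_k|_\infty < |\theta|_\infty^{m_k q/(q-1)}$ for each $k$. *)

theory Defs
  imports "HOL-Computational_Algebra.Polynomial" "HOL-Library.Cardinality"
begin

definition nonarch_abs :: "('c::field \<Rightarrow> real) \<Rightarrow> bool" where
  "nonarch_abs av \<longleftrightarrow>
     (\<forall>x. 0 \<le> av x) \<and> (\<forall>x. av x = 0 \<longleftrightarrow> x = 0) \<and>
     (\<forall>x y. av (x * y) = av x * av y) \<and>
     (\<forall>x y. av (x + y) \<le> max (av x) (av y))"

definition av_tendsto :: "('c::field \<Rightarrow> real) \<Rightarrow> (nat \<Rightarrow> 'c) \<Rightarrow> 'c \<Rightarrow> bool" where
  "av_tendsto av X L \<longleftrightarrow> (\<lambda>n. av (X n - L)) \<longlonglongrightarrow> 0"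

definition av_lim :: "('c::field \<Rightarrow> real) \<Rightarrow> (nat \<Rightarrow> 'c) \<Rightarrow> 'c" where
  "av_lim av X = (THE L. av_tendsto av X L)"

definition av_complete :: "('c::field \<Rightarrow> real) \<Rightarrow> bool" where
  "av_complete av \<longleftrightarrow>
     (\<forall>X. (\<forall>e>0. \<exists>N. \<forall>m\<ge>N. \<forall>n\<ge>N. av (X m - X n) < e) \<longrightarrow> (\<exists>L. av_tendsto av X L))"

definition alg_closed :: "'c::field itself \<Rightarrow> bool" where
  "alg_closed _ \<longleftrightarrow> (\<forall>f :: 'c poly. 0 < degree f \<longrightarrow> (\<exists>x. poly f x = 0))"

text \<open>The image of K = F_q(theta) in C, given the embedding iota of F_q and the image of theta.\<close>
definition Kset :: "('a::field \<Rightarrow> 'c::field) \<Rightarrow> 'c \<Rightarrow> 'c set" where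
  "Kset \<iota> \<theta> = {poly (map_poly \<iota> P) \<theta> / poly (map_poly \<iota> Q) \<theta> | P Q. Q \<noteq> 0}"

definition Kbar :: "('a::field \<Rightarrow> 'c::field) \<Rightarrow> 'c \<Rightarrow> 'c set" where
  "Kbar \<iota> \<theta> = {x. \<exists>f :: 'c poly. f \<noteq> 0 \<and> (\<forall>i. coeff f i \<in> Kset \<iota> \<theta>) \<and> poly f x = 0}"

text \<open>Algebraic independence of a finite set S over a subset F, with polynomials written
  as finitely supported coefficient functions on monomials (exponent functions supported on S).\<close>
definition alg_indep_over :: "'c::field set \<Rightarrow> 'c set \<Rightarrow> bool" where
  "alg_indep_over F S \<longleftrightarrow> finite S \<and>
     (\<forall>c :: ('c \<Rightarrow> nat) \<Rightarrow> 'c.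
        finite {e. c e \<noteq> 0} \<and> (\<forall>e. c e \<noteq> 0 \<longrightarrow> (\<forall>x. x \<notin> S \<longrightarrow> e x = 0)) \<and>
        (\<forall>e. c e \<in> F) \<and>
        (\<Sum>e\<in>{e. c e \<noteq> 0}. c e * (\<Prod>x\<in>S. x ^ e x)) = 0
        \<longrightarrow> (\<forall>e. c e = 0))"

definition carlitz_L :: "'c::field \<Rightarrow> nat \<Rightarrow> nat \<Rightarrow> 'c" where
  "carlitz_L \<theta> q i = (\<Prod>j\<in>{1..i}. (\<theta> - \<theta> ^ (q ^ j)))"

text \<open>Truncation: sum over N > i_1 > ... > i_s >= 0.\<close>
fun Li_trunc :: "'c::field \<Rightarrow> nat \<Rightarrow> (nat \<times> 'c) list \<Rightarrow> nat \<Rightarrow> 'c" where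
  "Li_trunc \<theta> q [] N = 1"
| "Li_trunc \<theta> q ((m, z) # rest) N =
     (\<Sum>i<N. z ^ (q ^ i) / (carlitz_L \<theta> q i) ^ m * Li_trunc \<theta> q rest i)"

definition carlitz_Li :: "('c::field \<Rightarrow> real) \<Rightarrow> 'c \<Rightarrow> nat \<Rightarrow> nat list \<Rightarrow> 'c list \<Rightarrow> 'c" where
  "carlitz_Li av \<theta> q ms zs = av_lim av (\<lambda>N. Li_trunc \<theta> q (zip ms zs) N)"

text \<open>Carlitz period: lam^q * prod_{i>=1} (1 - theta^(1-q^i))^(-1), with lam^(q-1) = -theta.\<close>
definition pi_tilde :: "('c::field \<Rightarrow> real) \<Rightarrow> 'c \<Rightarrow> nat \<Rightarrow> 'c \<Rightarrow> 'c" where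
  "pi_tilde av \<theta> q lam =
     lam ^ q * av_lim av (\<lambda>N. \<Prod>i\<in>{1..N}. inverse (1 - inverse (\<theta> ^ (q ^ i - 1))))"

end

theory Submission
  imports Defs "HOL-Computational_Algebra.Computational_Algebra" "HOL-Library.Poly_Mapping"
    "HOL-Number_Theory.Cong" "HOL-Library.Product_Lexorder"
begin

text \<open>Let \<open>T\<^sub>a\<^sub>b(k)\<close> be the truncation to indices below \<open>k\<close> of
  \<open>\<Lambda>\<^sub>a\<^sub>b = Li\<close> at \<open>(\<alpha>\<^bsub>a+1\<^esub>, \<dots>, \<alpha>\<^sub>b)\<close>. The germs at \<open>k = \<infinity>\<close> of
  \<open>\<theta>\<^bsup>q\<^sup>k\<^esup>\<close>, \<open>L\<^sub>k\<close> and the \<open>T\<^sub>a\<^sub>b(k)\<close> are algebraically independent over \<open>K\<close>: the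
  \<open>T\<^sub>a\<^sub>b\<close> are the entries of a unipotent matrix solving a linear difference equation, and a relation of
  minimal weight is changed only by a constant under the unipotent matrices commuting with the shift. So it
  yields an additive relation between the depth one sums, which the scaling \<open>L\<^sub>k \<mapsto> \<theta> L\<^sub>k\<close> splits
  into single terms; a look at poles and at the growth in \<open>k\<close> excludes these.

  Put \<open>X = \<lambda>\<^bsup>-q\<^sup>k\<^esup>\<close>. The numbers \<open>\<pi>\<close> and \<open>\<Lambda>\<^sub>a\<^sub>b\<close>, multiplied by suitable powers
  of \<open>X\<close>, have for \<open>k \<rightarrow> \<infinity>\<close> asymptotic expansions in powers of \<open>X\<close> whose coefficients are
  polynomials in \<open>1/L\<^sub>k\<close> and the \<open>T\<^sub>a\<^sub>b(k)\<close>. A relation over \<open>K\<close> between them turns into a nonzero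
  power series \<open>F\<close> of this kind that represents \<open>0\<close>. Following Loxton and van der Poorten, choose a
  polynomial in \<open>X\<^bsup>q-1\<^esup>\<close>, the parameters and \<open>F\<close> that vanishes to high order, and divide by a power of
  \<open>F\<close>: the part free of \<open>F\<close> is a small element of \<open>K\<close>, nonzero for infinitely many \<open>k\<close> by the
  independence of the parameters, and this contradicts a Liouville estimate. A dimension count extends the
  independence from \<open>K\<close> to its algebraic closure.\<close>

section \<open>Ring homomorphisms, fractions and linear systems\<close>

text \<open>Independence is first proved over K because the lower bound rests on nonzero polynomials
  in theta having absolute value at least 1; over an extension, conjugates would have to be
  controlled. So every coefficient of an expansion must lie in K, although \<pi> and the \<Lambda>'s
  do not. The parameters achieve this: their values for each k are in K, and as X^q L_k tends to
  1/\<pi>, the factor 1/L_k absorbs \<pi>, just as the truncations absorb the \<Lambda>'s. What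
  remains obeys recursions a(k) = A(k) a(k+1) + B(k), and X(k+1) = X(k)^q multiplies the precision
  by q at each use. F enters the auxiliary polynomial as an additional variable. With exponents up
  to N and v parameters there are about N^2 N^v unknowns, while each order of vanishing costs (const
  N)^v conditions, so the order can be of size N^2. The Liouville bound and the division by a power
  of F cost only multiples of N. The parameters are sequences, which have zero divisors. Hence
  germs, into which fraction fields are mapped by sending nonzero elements to units.\<close>

definition rhom :: "('x::comm_ring_1 \<Rightarrow> 'y::comm_ring_1) \<Rightarrow> bool" where
  "rhom f \<longleftrightarrow> f 1 = 1 \<and> (\<forall>x y. f (x + y) = f x + f y) \<and> (\<forall>x y. f (x * y) = f x * f y)"

lemma rhomI:
  assumes "f 1 = 1" "\<And>x y. f (x + y) = f x + f y" "\<And>x y. f (x * y) = f x * f y"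
  shows "rhom f"
  using assms by (auto simp: rhom_def)

lemma rhom_1: "rhom f \<Longrightarrow> f 1 = 1"
  and rhom_add: "rhom f \<Longrightarrow> f (x + y) = f x + f y"
  and rhom_mult: "rhom f \<Longrightarrow> f (x * y) = f x * f y"
  by (auto simp: rhom_def)

lemma rhom_0: assumes "rhom f" shows "f 0 = 0"
  using rhom_add[OF assms, of 0 0] by simp

lemma rhom_uminus: assumes "rhom f" shows "f (- x) = - f x"
  using rhom_add[OF assms, of x "- x"] rhom_0[OF assms] by (metis add.right_inverse minus_unique)

lemma rhom_diff: assumes "rhom f" shows "f (x - y) = f x - f y"
  using rhom_add[OF assms, of x "- y"] rhom_uminus[OF assms, of y] by simp

lemma rhom_sum: assumes "rhom f" shows "f (sum g A) = (\<Sum>x\<in>A. f (g x))"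
  by (induction A rule: infinite_finite_induct) (auto simp: rhom_0[OF assms] rhom_add[OF assms])

lemma rhom_prod: assumes "rhom f" shows "f (prod g A) = (\<Prod>x\<in>A. f (g x))"
  by (induction A rule: infinite_finite_induct) (auto simp: rhom_1[OF assms] rhom_mult[OF assms])

lemma rhom_power: assumes "rhom f" shows "f (x ^ n) = f x ^ n"
  by (induction n) (auto simp: rhom_1[OF assms] rhom_mult[OF assms])

lemma rhom_of_nat: assumes "rhom f" shows "f (of_nat n) = of_nat n"
  by (induction n) (auto simp: rhom_0[OF assms] rhom_1[OF assms] rhom_add[OF assms])

lemmas rhom_simps = rhom_0 rhom_1 rhom_add rhom_mult rhom_uminus rhom_diff rhom_sum rhom_prod rhom_power
  rhom_of_nat

lemma rhom_comp: "rhom f \<Longrightarrow> rhom g \<Longrightarrow> rhom (\<lambda>x. g (f x))"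
  by (auto simp: rhom_def)

lemma rhom_field_eq_0_iff:
  fixes f :: "'x::field \<Rightarrow> 'y::comm_ring_1"
  assumes "rhom f" shows "f x = 0 \<longleftrightarrow> x = 0"
proof
  assume "f x = 0"
  show "x = 0"
  proof (rule ccontr)
    assume "x \<noteq> 0"
    then have "f x * f (inverse x) = 1"
      using rhom_mult[OF assms, of x "inverse x"] rhom_1[OF assms] by simp
    then show False using \<open>f x = 0\<close> by simp
  qed
qed (simp add: rhom_0[OF assms])

lemma rhom_field_inj:
  fixes f :: "'x::field \<Rightarrow> 'y::comm_ring_1"
  assumes "rhom f" shows "f x = f y \<longleftrightarrow> x = y"
  using rhom_field_eq_0_iff[OF assms, of "x - y"] rhom_diff[OF assms, of x y] by auto

lemma rhom_inverse:
  fixes f :: "'x::field \<Rightarrow> 'y::field"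
  assumes "rhom f" shows "f (inverse x) = inverse (f x)"
proof (cases "x = 0")
  case False
  then have "f x * f (inverse x) = 1"
    using rhom_mult[OF assms, of x "inverse x"] rhom_1[OF assms] by simp
  then show ?thesis by (metis inverse_unique)
qed (simp add: rhom_0[OF assms])

lemma rhom_divide:
  fixes f :: "'x::field \<Rightarrow> 'y::field"
  assumes "rhom f" shows "f (x / y) = f x / f y"
  by (simp add: divide_inverse rhom_inverse[OF assms] rhom_mult[OF assms])

lemma rhom_CHAR:
  fixes f :: "'x::comm_ring_1 \<Rightarrow> 'y::comm_ring_1"
  assumes "rhom f" "\<And>n. f (of_nat n) = 0 \<Longrightarrow> (of_nat n :: 'x) = 0"
  shows "CHAR('y) = CHAR('x)"
proof -
  have "(of_nat n :: 'y) = 0 \<longleftrightarrow> (of_nat n :: 'x) = 0" for n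
    using assms(2)[of n] rhom_of_nat[OF assms(1), of n] rhom_0[OF assms(1)] by auto
  then show ?thesis
    by (simp add: of_nat_eq_0_iff_char_dvd) (metis dvd_antisym dvd_refl)
qed

text \<open>The extension of f to the fraction field. The target is only a ring, with zero divisors
  in the case of germs, so the value is characterised by \<open>y * f b = f a\<close> for every
  representation; it is unique as soon as f sends nonzero elements to units.\<close>

definition fract_lift :: "('x::idom \<Rightarrow> 'y::comm_ring_1) \<Rightarrow> 'x fract \<Rightarrow> 'y" where
  "fract_lift f x = (THE y. \<forall>a b. b \<noteq> 0 \<longrightarrow> x = Fract a b \<longrightarrow> y * f b = f a)"

lemma fract_lift_Fract:
  fixes f :: "'x::idom \<Rightarrow> 'y::comm_ring_1"
  assumes f: "rhom f" and unit: "\<And>x. x \<noteq> 0 \<Longrightarrow> f x dvd 1" and b: "b \<noteq> 0"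
  shows "fract_lift f (Fract a b) * f b = f a"
proof -
  obtain z where z: "1 = f b * z" using unit[OF b] by (auto simp: dvd_def)
  let ?P = "\<lambda>y. \<forall>a' b'. b' \<noteq> 0 \<longrightarrow> Fract a b = Fract a' b' \<longrightarrow> y * f b' = f a'"
  have "?P (f a * z)"
  proof (intro allI impI)
    fix a' b' assume b': "b' \<noteq> 0" and "Fract a b = Fract a' b'"
    then have "a * b' = a' * b" using b by (simp add: eq_fract)
    then have "f a * f b' = f a' * f b" by (metis rhom_mult[OF f])
    then have "f a * z * f b' = f a' * (f b * z)" by (simp add: mult_ac)
    then show "f a * z * f b' = f a'" using z by simp
  qed
  moreover have "y = f a * z" if "?P y" for y
  proof -
    have "y * f b = f a" using that b by blast
    then have "y * f b * z = f a * z" by simp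
    then show ?thesis using z by (simp add: mult_ac)
  qed
  ultimately have "?P (THE y. ?P y)" by (rule theI)
  then show ?thesis using b by (simp add: fract_lift_def)
qed

lemma rhom_fract_lift:
  fixes f :: "'x::idom \<Rightarrow> 'y::comm_ring_1"
  assumes f: "rhom f" and unit: "\<And>x. x \<noteq> 0 \<Longrightarrow> f x dvd 1"
  shows "rhom (fract_lift f)"
proof -
  have L: "fract_lift f (Fract a b) * f b = f a" if "b \<noteq> 0" for a b
    by (rule fract_lift_Fract[OF f]) (use unit that in auto)
  have cancel: "y = y'" if e: "y * f b = y' * f b" and b: "b \<noteq> 0" for y y' b
  proof -
    obtain z where z: "1 = f b * z" using unit[OF b] by (auto simp: dvd_def)
    have "y * f b * z = y' * f b * z" using e by simp
    then show ?thesis using z by (simp add: mult.assoc)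
  qed
  show ?thesis
  proof (rule rhomI)
    show "fract_lift f 1 = 1"
      using L[of 1 1] rhom_1[OF f] by (simp add: One_fract_def)
    fix x y :: "'x fract"
    obtain a b where x: "x = Fract a b" "b \<noteq> 0" by (cases x) auto
    obtain c d where y: "y = Fract c d" "d \<noteq> 0" by (cases y) auto
    have bd: "b * d \<noteq> 0" using x y by simp
    have 1: "fract_lift f x * f b = f a" "fract_lift f y * f d = f c"
      using L x y by auto
    have "fract_lift f (x + y) * f (b * d) = f (a * d + c * b)"
      using L[OF bd, of "a * d + c * b"] x y by simp
    also have "\<dots> = (fract_lift f x * f b) * f d + (fract_lift f y * f d) * f b"
      unfolding 1 by (simp add: rhom_simps[OF f])
    also have "\<dots> = (fract_lift f x + fract_lift f y) * f (b * d)"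
      by (simp add: rhom_simps[OF f] algebra_simps)
    finally show "fract_lift f (x + y) = fract_lift f x + fract_lift f y"
      using cancel bd by blast
    have "fract_lift f (x * y) * f (b * d) = f (a * c)"
      using L[OF bd, of "a * c"] x y by simp
    also have "\<dots> = (fract_lift f x * f b) * (fract_lift f y * f d)"
      unfolding 1 by (simp add: rhom_simps[OF f])
    also have "\<dots> = (fract_lift f x * fract_lift f y) * f (b * d)"
      by (simp add: rhom_simps[OF f] algebra_simps)
    finally show "fract_lift f (x * y) = fract_lift f x * fract_lift f y"
      using cancel bd by blast
  qed
qed

lemma fract_lift_of:
  fixes f :: "'x::idom \<Rightarrow> 'y::comm_ring_1"
  assumes f: "rhom f" and unit: "\<And>x. x \<noteq> 0 \<Longrightarrow> f x dvd 1"
  shows "fract_lift f (Fract a 1) = f a"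
  using fract_lift_Fract[OF f, of 1 a] unit rhom_1[OF f] by simp

lemma rhom_Fract_1: "rhom (\<lambda>a::'x::idom. Fract a 1)"
  by (rule rhomI) (auto simp: One_fract_def)

text \<open>Gaussian elimination, one equation at a time: the equation \<open>i0\<close> is solved
  for the unknown \<open>j0\<close>, which is then removed from the others.\<close>

lemma homogeneous_system_solvable:
  fixes A :: "'i \<Rightarrow> 'j \<Rightarrow> 'k::field"
  assumes "finite I" "finite J" "card I < card J"
  shows "\<exists>x. (\<exists>j\<in>J. x j \<noteq> 0) \<and> (\<forall>i\<in>I. (\<Sum>j\<in>J. A i j * x j) = 0)"
  using assms
proof (induction I arbitrary: J A rule: finite_induct)
  case empty
  then obtain j where "j \<in> J" by fastforce
  then show ?case by (intro exI[of _ "\<lambda>_. 1"]) auto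
next
  case (insert i0 I)
  show ?case
  proof (cases "\<forall>j\<in>J. A i0 j = 0")
    case True
    have "card I < card J" using insert by auto
    then obtain x where "\<exists>j\<in>J. x j \<noteq> 0" "\<forall>i\<in>I. (\<Sum>j\<in>J. A i j * x j) = 0"
      using insert.IH[OF insert.prems(1), of A] by blast
    then show ?thesis using True by (intro exI[of _ x]) auto
  next
    case False
    then obtain j0 where j0: "j0 \<in> J" "A i0 j0 \<noteq> 0" by blast
    define J' where "J' = J - {j0}"
    have J': "finite J'" "card I < card J'" "J = insert j0 J'" "j0 \<notin> J'"
      using insert j0 by (auto simp: J'_def)
    obtain x where x: "\<exists>j\<in>J'. x j \<noteq> 0"
      "\<forall>i\<in>I. (\<Sum>j\<in>J'. (A i j - A i j0 / A i0 j0 * A i0 j) * x j) = 0"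
      using insert.IH[OF J'(1,2), of "\<lambda>i j. A i j - A i j0 / A i0 j0 * A i0 j"] by blast
    define y where "y = x(j0 := - (\<Sum>j\<in>J'. A i0 j * x j) / A i0 j0)"
    have S: "(\<Sum>j\<in>J. A i j * y j) = A i j0 * y j0 + (\<Sum>j\<in>J'. A i j * x j)" for i
    proof -
      have "(\<Sum>j\<in>J'. A i j * y j) = (\<Sum>j\<in>J'. A i j * x j)"
        using J'(4) by (intro sum.cong) (auto simp: y_def)
      then show ?thesis using J' by simp
    qed
    have "(\<Sum>j\<in>J. A i0 j * y j) = 0"
      unfolding S using j0 by (simp add: y_def)
    moreover have "(\<Sum>j\<in>J. A i j * y j) = 0" if "i \<in> I" for i
    proof -
      have "0 = (\<Sum>j\<in>J'. A i j * x j) - A i j0 / A i0 j0 * (\<Sum>j\<in>J'. A i0 j * x j)"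
        using x(2) that by (auto simp: algebra_simps sum_subtractf sum_distrib_left)
      then show ?thesis unfolding S by (simp add: y_def)
    qed
    moreover have "\<exists>j\<in>J. y j \<noteq> 0" using x(1) J' by (auto simp: y_def)
    ultimately show ?thesis by blast
  qed
qed

section \<open>Multivariate polynomials\<close>

abbreviation lookup :: "('a \<Rightarrow>\<^sub>0 'b::zero) \<Rightarrow> 'a \<Rightarrow> 'b" where "lookup \<equiv> Poly_Mapping.lookup"
abbreviation keys :: "('a \<Rightarrow>\<^sub>0 'b::zero) \<Rightarrow> 'a set" where "keys \<equiv> Poly_Mapping.keys"

type_synonym ('v, 'k) mpol = "('v \<Rightarrow>\<^sub>0 nat) \<Rightarrow>\<^sub>0 'k"

definition mon :: "('v \<Rightarrow> 's::comm_monoid_mult) \<Rightarrow> ('v \<Rightarrow>\<^sub>0 nat) \<Rightarrow> 's" where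
  "mon f e = (\<Prod>v\<in>keys e. f v ^ lookup e v)"

lemma mon_superset:
  assumes "finite A" "keys e \<subseteq> A"
  shows "mon f e = (\<Prod>v\<in>A. f v ^ lookup e v)"
  unfolding mon_def using assms
  by (intro prod.mono_neutral_left) (auto simp: in_keys_iff)

lemma mon_0 [simp]: "mon f 0 = 1"
  by (simp add: mon_def)

lemma mon_add: "mon f (e + e') = mon f e * mon f e'"
proof -
  let ?A = "keys e \<union> keys e'"
  have "keys (e + e') \<subseteq> ?A" by (rule keys_add)
  then show ?thesis
    by (simp add: mon_superset[of ?A] power_add prod.distrib lookup_add)
qed

lemma mon_single: "mon f (Poly_Mapping.single v n) = f v ^ n"
  by (simp add: mon_superset[of "{v}"])

lemma mon_cong: "(\<And>v. v \<in> keys e \<Longrightarrow> f v = g v) \<Longrightarrow> mon f e = mon g e"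
  by (auto simp: mon_def intro: prod.cong)

lemma rhom_mon: "rhom h \<Longrightarrow> h (mon f e) = mon (\<lambda>v. h (f v)) e"
  by (simp add: mon_def rhom_simps)

definition meval :: "('k::zero \<Rightarrow> 's::comm_ring_1) \<Rightarrow> ('v \<Rightarrow> 's) \<Rightarrow> ('v, 'k) mpol \<Rightarrow> 's" where
  "meval h f P = (\<Sum>e\<in>keys P. h (lookup P e) * mon f e)"

lemma meval_superset:
  fixes h :: "'k::comm_ring_1 \<Rightarrow> 's::comm_ring_1"
  assumes "h 0 = 0" "finite A" "keys P \<subseteq> A"
  shows "meval h f P = (\<Sum>e\<in>A. h (lookup P e) * mon f e)"
  unfolding meval_def using assms
  by (intro sum.mono_neutral_left) (auto simp: in_keys_iff)

lemma meval_add: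
  fixes h :: "'k::comm_ring_1 \<Rightarrow> 's::comm_ring_1"
  assumes "rhom h"
  shows "meval h f (P + Q) = meval h f P + meval h f Q"
proof -
  let ?A = "keys P \<union> keys Q"
  have "keys (P + Q) \<subseteq> ?A" by (rule keys_add)
  then show ?thesis
    using rhom_0[OF assms]
    by (simp add: meval_superset[of h ?A] lookup_add rhom_add[OF assms] distrib_right sum.distrib)
qed

lemma meval_0 [simp]: "meval h f 0 = 0"
  by (simp add: meval_def)

lemma meval_single:
  fixes h :: "'k::comm_ring_1 \<Rightarrow> 's::comm_ring_1"
  assumes "rhom h"
  shows "meval h f (Poly_Mapping.single e c) = h c * mon f e"
  using rhom_0[OF assms] by (simp add: meval_superset[of h "{e}"])

lemma meval_sum:
  fixes h :: "'k::comm_ring_1 \<Rightarrow> 's::comm_ring_1"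
  assumes "rhom h"
  shows "meval h f (sum g A) = (\<Sum>x\<in>A. meval h f (g x))"
  by (induction A rule: infinite_finite_induct) (auto simp: meval_add[OF assms])

lemma mpol_eq_sum: "P = (\<Sum>e\<in>keys P. Poly_Mapping.single e (lookup P e))"
proof (rule poly_mapping_eqI)
  fix e
  have "(\<Sum>x\<in>keys P. lookup P x when x = e)
      = (if e \<in> keys P then lookup P e else 0)"
    by (subst sum.delta[symmetric, OF finite_keys]) (auto intro!: sum.cong simp: when_def)
  then show "lookup P e = lookup (\<Sum>e\<in>keys P. Poly_Mapping.single e (lookup P e)) e"
    by (auto simp: lookup_sum lookup_single in_keys_iff)
qed

lemma rhom_meval:
  fixes h :: "'k::comm_ring_1 \<Rightarrow> 's::comm_ring_1"
  assumes h: "rhom h"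
  shows "rhom (meval h f)"
proof (rule rhomI)
  show "meval h f 1 = 1"
    using meval_single[OF h, of f 0 1] rhom_1[OF h] by simp
  fix P Q :: "('a, 'k) mpol"
  show "meval h f (P + Q) = meval h f P + meval h f Q" by (rule meval_add[OF h])
  have "P * Q = (\<Sum>e\<in>keys P. \<Sum>e'\<in>keys Q.
      Poly_Mapping.single (e + e') (lookup P e * lookup Q e'))"
    by (subst mpol_eq_sum[of P], subst mpol_eq_sum[of Q]) (simp add: sum_product mult_single)
  then have "meval h f (P * Q) = (\<Sum>e\<in>keys P. \<Sum>e'\<in>keys Q.
      h (lookup P e * lookup Q e') * mon f (e + e'))"
    by (simp add: meval_sum[OF h] meval_single[OF h])
  also have "\<dots> = meval h f P * meval h f Q"
    by (simp add: meval_def sum_product rhom_mult[OF h] mon_add mult_ac)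
  finally show "meval h f (P * Q) = meval h f P * meval h f Q" .
qed

lemma rhom_comp_meval:
  fixes h :: "'k::comm_ring_1 \<Rightarrow> 's::comm_ring_1" and g :: "'s \<Rightarrow> 't::comm_ring_1"
  assumes "rhom g"
  shows "g (meval h f P) = meval (\<lambda>x. g (h x)) (\<lambda>v. g (f v)) P"
  by (simp add: meval_def rhom_simps[OF assms] rhom_mon[OF assms])

definition mC :: "'k::zero \<Rightarrow> ('v, 'k) mpol" where "mC c = Poly_Mapping.single 0 c"
definition mX :: "'v \<Rightarrow> ('v, 'k::comm_ring_1) mpol" where
  "mX v = Poly_Mapping.single (Poly_Mapping.single v 1) 1"

lemma rhom_mC: "rhom (mC :: 'k::comm_ring_1 \<Rightarrow> ('v, 'k) mpol)"
  by (rule rhomI) (auto simp: mC_def single_add mult_single)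

lemma meval_mC [simp]: "rhom h \<Longrightarrow> meval h f (mC c) = h c"
  by (simp add: mC_def meval_single)

lemma meval_mX [simp]: "rhom h \<Longrightarrow> meval h f (mX v) = f v"
  by (simp add: mX_def meval_single mon_single rhom_1)

lemma mon_mX: "mon mX e = Poly_Mapping.single e (1::'k::comm_ring_1)"
proof -
  have P: "(mX v :: ('a,'k) mpol) ^ n = Poly_Mapping.single (Poly_Mapping.single v n) 1" for v :: 'a and n
    by (induction n) (auto simp: mX_def mult_single simp flip: single_add)
  have "(\<Prod>v\<in>A. Poly_Mapping.single (Poly_Mapping.single v (lookup e v)) (1::'k))
     = Poly_Mapping.single (\<Sum>v\<in>A. Poly_Mapping.single v (lookup e v)) 1" if "finite A" for A
    using that by (induction A rule: finite_induct) (auto simp: mult_single)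
  then have "mon mX e = Poly_Mapping.single (\<Sum>v\<in>keys e. Poly_Mapping.single v (lookup e v)) (1::'k)"
    by (simp add: mon_def P)
  then show ?thesis using mpol_eq_sum[of e] by simp
qed

lemma meval_mC_mX: "meval mC mX P = (P :: ('v, 'k::comm_ring_1) mpol)"
proof -
  have "meval mC mX P = (\<Sum>e\<in>keys P. Poly_Mapping.single e (lookup P e))"
    unfolding meval_def mon_mX by (simp add: mC_def mult_single)
  then show ?thesis using mpol_eq_sum[of P] by simp
qed

text \<open>A finite field is a vector space over its prime field: a maximal additive subset of \<open>p\<close>-power
  size is everything.\<close>
lemma CARD_finite_field_eq_power:
  "\<exists>f. CARD('a::{field,finite}) = CHAR('a) ^ f"
proof -
  let ?p = "CHAR('a)"
  have "?p > 0" by (rule finite_imp_CHAR_pos) simp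
  then have p: "prime ?p" by (rule prime_CHAR_semidom)
  define \<S> where "\<S> = {S::'a set. 0 \<in> S \<and> (\<forall>x\<in>S. \<forall>y\<in>S. x + y \<in> S) \<and> (\<exists>f. card S = ?p ^ f)}"
  have "{0} \<in> \<S>" by (auto simp: \<S>_def intro: exI[of _ 0])
  moreover have fin: "finite (card ` \<S>)" by simp
  ultimately have "Max (card ` \<S>) \<in> card ` \<S>" by (intro Max_in) auto
  then obtain S where S: "S \<in> \<S>" "\<And>S'. S' \<in> \<S> \<Longrightarrow> card S' \<le> card S"
    using fin by (smt (verit, best) Max_ge imageE imageI)
  then obtain f where f: "card S = ?p ^ f" by (auto simp: \<S>_def)
  have add: "x + y \<in> S" if "x \<in> S" "y \<in> S" for x y using S(1) that by (auto simp: \<S>_def)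
  have zero: "0 \<in> S" using S(1) by (auto simp: \<S>_def)
  have mul: "of_nat n * x \<in> S" if "x \<in> S" for n x
    using that by (induction n) (auto simp: zero add distrib_right)
  have neg: "- x \<in> S" if "x \<in> S" for x
  proof -
    have "of_nat (?p - 1) * x = - x"
      using \<open>?p > 0\<close> by (simp add: of_nat_diff)
    then show ?thesis using mul[OF that, of "?p - 1"] by simp
  qed
  have "S = UNIV"
  proof (rule ccontr)
    assume "S \<noteq> UNIV"
    then obtain x where x: "x \<notin> S" by auto
    define g where "g = (\<lambda>(i::nat, s). of_nat i * x + s)"
    define S' where "S' = g ` ({..<?p} \<times> S)"
    \<comment> \<open>For i < j < p a common coset would put (j - i) x into S; a multiple of j - i
      is 1 modulo p, so x itself would lie in S.\<close>
    have key: "i = j" if "i < ?p" "j < ?p" "of_nat i * x - of_nat j * x \<in> S" "i \<le> j" for i j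
    proof (rule ccontr)
      assume "i \<noteq> j"
      with that have ij: "i < j" by simp
      have D: "of_nat (j - i) * x \<in> S"
        using neg[OF that(3)] ij by (simp add: of_nat_diff algebra_simps)
      have "coprime (j - i) ?p"
        using p ij that by (metis coprime_commute diff_le_self dual_order.strict_trans1 less_imp_diff_less nat_dvd_not_less prime_imp_coprime zero_less_diff)
      then obtain m where "[(j - i) * m = 1] (mod ?p)"
        using cong_solve_coprime_nat by auto
      then have m: "(of_nat ((j - i) * m) :: 'a) = of_nat 1"
        by (metis of_nat_eq_iff_cong_CHAR)
      have "of_nat m * (of_nat (j - i) * x) = of_nat ((j - i) * m) * x"
        by (simp only: of_nat_mult mult_ac)
      then have "of_nat m * (of_nat (j - i) * x) = x" unfolding m by simp
      then show False using mul[OF D, of m] x by metis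
    qed
    have inj: "inj_on g ({..<?p} \<times> S)"
    proof (rule inj_onI, clarify)
      fix i s j t assume A: "i < ?p" "s \<in> S" "j < ?p" "t \<in> S" "g (i, s) = g (j, t)"
      then have "of_nat i * x - of_nat j * x = t + - s" "of_nat j * x - of_nat i * x = s + - t"
        by (auto simp: g_def algebra_simps)
      then have "of_nat i * x - of_nat j * x \<in> S" "of_nat j * x - of_nat i * x \<in> S"
        using A add neg by metis+
      then have "i = j" using key[of i j] key[of j i] A by (metis nat_le_linear)
      then show "i = j \<and> s = t" using A by (auto simp: g_def)
    qed
    then have "card S' = ?p ^ Suc f"
      by (simp add: S'_def card_image card_cartesian_product f)
    moreover have "0 \<in> S'" unfolding S'_def
      using zero \<open>?p > 0\<close> by (intro image_eqI[of _ _ "(0,0)"]) (auto simp: g_def)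
    moreover have "y + z \<in> S'" if "y \<in> S'" "z \<in> S'" for y z
    proof -
      from that obtain i s j t where A: "i < ?p" "s \<in> S" "j < ?p" "t \<in> S"
        "y = of_nat i * x + s" "z = of_nat j * x + t"
        by (auto simp: S'_def g_def)
      have "(of_nat (i + j) :: 'a) = of_nat ((i + j) mod ?p)"
        by (simp add: of_nat_eq_iff_cong_CHAR cong_def del: of_nat_add)
      then have "y + z = g ((i + j) mod ?p, s + t)"
        using A by (simp add: g_def algebra_simps) (metis distrib_left of_nat_add add.assoc)
      then show ?thesis unfolding S'_def using A add \<open>?p > 0\<close> by auto
    qed
    ultimately have "S' \<in> \<S>" by (auto simp: \<S>_def intro: exI[of _ "Suc f"])
    then have "?p ^ Suc f \<le> ?p ^ f" using S(2) f \<open>card S' = _\<close> by metis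
    then show False using p prime_gt_1_nat by (metis Suc_n_not_le_n power_le_imp_le_exp)
  qed
  then show ?thesis using f by auto
qed

section \<open>Polynomials determined by infinitely many values; additive polynomials\<close>

lemma poly_eq_if_eq_on_infinite:
  fixes f g :: "'b::idom poly"
  assumes "infinite S" "\<And>x. x \<in> S \<Longrightarrow> poly f x = poly g x"
  shows "f = g"
proof (rule ccontr)
  assume "f \<noteq> g"
  then have "finite {x. poly (f - g) x = 0}" by (intro poly_roots_finite) simp
  moreover have "S \<subseteq> {x. poly (f - g) x = 0}" using assms(2) by auto
  ultimately show False using assms(1) finite_subset by blast
qed

lemma rhom_poly: "rhom (\<lambda>p::'k::comm_ring_1 poly. poly p x)"
  by (rule rhomI) auto

lemma rhom_const_poly: "rhom (\<lambda>c::'k::comm_ring_1. [:c:])"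
  by (rule rhomI) (auto simp: one_pCons)

lemma poly_map_poly_rhom:
  assumes "rhom h" shows "poly (map_poly h g) (h x) = h (poly g x)"
proof (induction g)
  case 0
  then show ?case by (simp add: rhom_0[OF assms])
next
  case (pCons a p)
  then show ?case by (simp add: map_poly_pCons rhom_simps[OF assms])
qed

text \<open>Additivity makes the derivative invariant under all translations by S, hence constant,
  so only the exponent 1 and multiples of p survive. The latter form a polynomial in x^p that is
  additive on the p-th powers of S, and the induction goes on with j / p. This change of set is why
  S is any infinite set closed under addition.\<close>

lemma coeff_0_if_power_additive:
  fixes g :: "'b::field poly"
  assumes "infinite S" "0 \<in> S" "\<And>x y. x \<in> S \<Longrightarrow> y \<in> S \<Longrightarrow> x + y \<in> S"
    and "\<And>x y. x \<in> S \<Longrightarrow> y \<in> S \<Longrightarrow> poly g (x + y) = poly g x + poly g y"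
    and "prime CHAR('b)" and "coeff g j \<noteq> 0"
  shows "\<exists>m. j = CHAR('b) ^ m"
  using assms(1-4,6)
proof (induction j arbitrary: g S rule: less_induct)
  case (less j g S)
  let ?p = "CHAR('b)"
  have g0: "poly g 0 = 0" using less.prems(2,4) by (metis add_cancel_right_left)
  have "pcompose g [:y, 1:] = g + [:poly g y:]" if "y \<in> S" for y
    by (rule poly_eq_if_eq_on_infinite[OF less.prems(1)])
      (use less.prems(4) that in \<open>auto simp: poly_pcompose add.commute\<close>)
  then have "pcompose (pderiv g) [:y, 1:] = pderiv g" if "y \<in> S" for y
    using that by (metis (no_types, lifting) add.right_neutral mult.right_neutral one_pCons pderiv_1
        pderiv_add pderiv_pCons pderiv_pcompose pderiv_singleton pCons_0_0)
  then have "poly (pderiv g) y = poly (pderiv g) 0" if "y \<in> S" for y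
    using that by (metis add.right_neutral mult_zero_left poly_pCons poly_pcompose)
  then have const: "pderiv g = [:poly (pderiv g) 0:]"
    by (intro poly_eq_if_eq_on_infinite[OF less.prems(1)]) auto
  consider "j = 0" | "j = 1" | "j \<ge> 2" by linarith
  then show ?case
  proof cases
    case 1
    then show ?thesis using g0 less.prems(5) by (simp add: poly_0_coeff_0)
  next
    case 2
    then show ?thesis by (intro exI[of _ 0]) simp
  next
    case 3
    then obtain i where i: "j = Suc (Suc i)" by (metis add_2_eq_Suc nat_le_iff_add)
    have "coeff (pderiv g) (Suc i) = 0" by (subst const) simp
    then have "of_nat j * coeff g j = 0" by (simp add: coeff_pderiv i)
    then have "?p dvd j" using less.prems(5) by (simp add: of_nat_eq_0_iff_char_dvd)
    then obtain j' where j': "j = ?p * j'" by auto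
    have p2: "?p \<ge> 2" using assms(5) prime_ge_2_nat by blast
    have "j' \<noteq> 0" using j' 3 by (metis mult_0_right not_numeral_le_zero)
    then have "2 * j' \<le> j" using j' p2 by simp
    then have lt: "j' < j" using \<open>j' \<noteq> 0\<close> by linarith
    have pd: "coeff g k = 0" if "k \<noteq> 1" "\<not> ?p dvd k" for k
    proof -
      have k2: "k \<ge> 2" using that by (cases k) auto
      then obtain i where i: "k = Suc (Suc i)" by (metis add_2_eq_Suc nat_le_iff_add)
      have "coeff (pderiv g) (Suc i) = 0" by (subst const) simp
      then have "of_nat k * coeff g k = 0" by (simp add: coeff_pderiv i)
      then show ?thesis using that by (simp add: of_nat_eq_0_iff_char_dvd)
    qed
    \<comment> \<open>The part with exponents divisible by p, with x^p renamed to x.\<close>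
    define G where "G = (\<Sum>k\<le>degree g. monom (coeff g (?p * k)) k)"
    have cG: "coeff G k = coeff g (?p * k)" for k
    proof (cases "k \<le> degree g")
      case True
      then show ?thesis by (simp add: G_def coeff_sum)
    next
      case False
      then have "?p * k > degree g" using p2 by (metis Suc_1 le_trans linorder_not_le mult_le_mono1 mult_1 Suc_leD)
      then show ?thesis using False by (simp add: G_def coeff_sum coeff_eq_0)
    qed
    have gG: "poly g x = coeff g 1 * x + poly G (x ^ ?p)" for x
    proof -
      define H where "H = (\<Sum>l\<le>degree g. monom (coeff g (?p * l)) (?p * l))"
      have "g = monom (coeff g 1) 1 + H"
      proof (rule poly_eqI)
        fix k
        have C: "coeff H k = (\<Sum>l\<le>degree g. if ?p * l = k then coeff g k else 0)"
          unfolding H_def by (simp add: coeff_sum) (intro sum.cong, auto)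
        show "coeff g k = coeff (monom (coeff g 1) 1 + H) k"
        proof (cases "?p dvd k")
          case True
          then obtain l0 where l0: "k = ?p * l0" by auto
          have k1: "k \<noteq> 1" using True p2 by auto
          have "(\<Sum>l\<le>degree g. if ?p * l = k then coeff g k else 0) = (\<Sum>l\<le>degree g. if l = l0 then coeff g k else 0)"
            using l0 p2 by (intro sum.cong) auto
          also have "\<dots> = coeff g k"
          proof (cases "l0 \<le> degree g")
            case False
            then have "k > degree g" using l0 p2
              by (metis Suc_1 le_trans linorder_not_le mult_le_mono1 mult_1 Suc_leD)
            then show ?thesis by (simp add: coeff_eq_0)
          qed simp
          finally show ?thesis using C k1 by simp
        next
          case False
          then have "(\<Sum>l\<le>degree g. if ?p * l = k then coeff g k else 0) = 0"
            by (intro sum.neutral) auto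
          then show ?thesis using C pd[of k] False by auto
        qed
      qed
      then have "poly g x = poly (monom (coeff g 1) 1 + H) x" by simp
      then show ?thesis by (simp add: poly_monom H_def G_def poly_sum power_mult)
    qed
    have frob: "(x + y) ^ ?p = x ^ ?p + y ^ ?p" for x y :: 'b
      by (rule freshmans_dream) (use assms(5) in auto)
    have injp: "inj_on (\<lambda>x::'b. x ^ ?p) S"
    proof (rule inj_onI)
      fix x y :: 'b assume "x ^ ?p = y ^ ?p"
      then have "(x - y) ^ ?p = 0" using frob[of "x - y" y] by simp
      then show "x = y" by simp
    qed
    have "\<exists>m. j' = ?p ^ m"
    proof (rule less.IH[OF lt, of "(\<lambda>x. x ^ ?p) ` S" G])
      show "infinite ((\<lambda>x. x ^ ?p) ` S)" using less.prems(1) injp finite_image_iff by blast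
      show "0 \<in> (\<lambda>x. x ^ ?p) ` S" using less.prems(2) p2 by (auto intro!: image_eqI[of _ _ 0])
      show "coeff G j' \<noteq> 0" using cG j' less.prems(5) by simp
      fix x y assume "x \<in> (\<lambda>x. x ^ ?p) ` S" "y \<in> (\<lambda>x. x ^ ?p) ` S"
      then obtain x' y' where xy: "x' \<in> S" "y' \<in> S" "x = x' ^ ?p" "y = y' ^ ?p" by auto
      show "x + y \<in> (\<lambda>x. x ^ ?p) ` S" using less.prems(3)[OF xy(1,2)] xy frob by (metis image_eqI)
      have "poly G (x + y) = poly g (x' + y') - coeff g 1 * (x' + y')"
        using gG[of "x' + y'"] xy frob by simp
      also have "\<dots> = poly G x + poly G y"
        using less.prems(4)[OF xy(1,2)] gG[of x'] gG[of y'] xy by (simp add: algebra_simps)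
      finally show "poly G (x + y) = poly G x + poly G y" .
    qed
    then obtain m where "j' = ?p ^ m" by blast
    then show ?thesis using j' by (intro exI[of _ "Suc m"]) simp
  qed
qed

section \<open>Injective weights on monomials\<close>

lemma digits_inj:
  fixes e e' :: "nat \<Rightarrow> nat"
  assumes "\<And>i. i < n \<Longrightarrow> e i < N" "\<And>i. i < n \<Longrightarrow> e' i < N"
    "(\<Sum>i<n. e i * N ^ i) = (\<Sum>i<n. e' i * N ^ i)" "i < n"
  shows "e i = e' i"
  using assms
proof (induction n arbitrary: e e' i)
  case (Suc n)
  have S: "(\<Sum>i<Suc n. f i * N ^ i) = f 0 + N * (\<Sum>i<n. f (Suc i) * N ^ i)" for f :: "nat \<Rightarrow> nat"
    by (subst sum.lessThan_Suc_shift) (simp add: sum_distrib_left mult_ac)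
  have eq: "e 0 + N * (\<Sum>i<n. e (Suc i) * N ^ i) = e' 0 + N * (\<Sum>i<n. e' (Suc i) * N ^ i)"
    using Suc.prems(3) by (simp only: S)
  then have "(e 0 + N * (\<Sum>i<n. e (Suc i) * N ^ i)) mod N = (e' 0 + N * (\<Sum>i<n. e' (Suc i) * N ^ i)) mod N" by simp
  then have 0: "e 0 = e' 0" using Suc.prems(1)[of 0] Suc.prems(2)[of 0] by simp
  then have "(\<Sum>i<n. e (Suc i) * N ^ i) = (\<Sum>i<n. e' (Suc i) * N ^ i)"
    using eq Suc.prems(1)[of 0] by simp
  then have "e (Suc i) = e' (Suc i)" if "i < n" for i
    using Suc.IH[of "\<lambda>i. e (Suc i)" "\<lambda>i. e' (Suc i)" i] Suc.prems(1,2) that by simp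
  then show ?case using 0 Suc.prems(4) by (cases i) auto
qed simp

definition wsum :: "('v \<Rightarrow> nat) \<Rightarrow> ('v \<Rightarrow>\<^sub>0 nat) \<Rightarrow> nat" where
  "wsum w e = (\<Sum>v\<in>keys e. lookup e v * w v)"

lemma wsum_superset:
  assumes "finite A" "keys e \<subseteq> A"
  shows "wsum w e = (\<Sum>v\<in>A. lookup e v * w v)"
  unfolding wsum_def using assms
  by (intro sum.mono_neutral_left) (auto simp: in_keys_iff)

lemma wsum_0 [simp]: "wsum w 0 = 0"
  by (simp add: wsum_def)

lemma wsum_add: "wsum w (e + e') = wsum w e + wsum w e'"
proof -
  let ?A = "keys e \<union> keys e'"
  have "keys (e + e') \<subseteq> ?A" by (rule keys_add)
  then show ?thesis
    by (simp add: wsum_superset[of ?A] distrib_right sum.distrib lookup_add)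
qed

lemma wsum_single [simp]: "wsum w (Poly_Mapping.single v n) = n * w v"
  by (simp add: wsum_superset[of "{v}"])

text \<open>The weights are powers of a base N exceeding all exponents in S, so the weight of a
  monomial has its exponents as digits. Positive weights ensure that a weight bounds every exponent
  of its monomial.\<close>

lemma ex_injective_weight:
  fixes S :: "('v \<Rightarrow>\<^sub>0 nat) set"
  assumes "finite S"
  shows "\<exists>w. (\<forall>v. w v \<ge> 1) \<and> inj_on (wsum w) S"
proof -
  define V where "V = (\<Union>e\<in>S. keys e)"
  have V: "finite V" using assms by (auto simp: V_def)
  define N where "N = Suc (Max (insert 0 ((\<lambda>(e, v). lookup e v) ` (S \<times> V))))"
  have N: "lookup e v < N" if "e \<in> S" "v \<in> V" for e v
  proof -
    have "lookup e v \<le> Max (insert 0 ((\<lambda>(e, v). lookup e v) ` (S \<times> V)))"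
      using that assms V by (intro Max_ge) auto
    then show ?thesis by (simp add: N_def)
  qed
  obtain h where h: "bij_betw h {0..<card V} V" using ex_bij_betw_nat_finite[OF V] by blast
  define w where "w v = N ^ (inv_into {0..<card V} h v)" for v
  have W: "wsum w e = (\<Sum>i<card V. lookup e (h i) * N ^ i)" if "e \<in> S" for e
  proof -
    have "wsum w e = (\<Sum>v\<in>V. lookup e v * w v)"
      using that V by (intro wsum_superset) (auto simp: V_def)
    also have "\<dots> = (\<Sum>i\<in>{0..<card V}. lookup e (h i) * w (h i))"
      by (rule sum.reindex_bij_betw[OF h, symmetric])
    also have "\<dots> = (\<Sum>i<card V. lookup e (h i) * N ^ i)"
      using h by (intro sum.cong) (auto simp: w_def bij_betw_def)
    finally show ?thesis .
  qed
  have "inj_on (wsum w) S"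
  proof (rule inj_onI)
    fix e e' assume A: "e \<in> S" "e' \<in> S" "wsum w e = wsum w e'"
    have hV: "h i \<in> V" if "i < card V" for i using h that by (auto simp: bij_betw_def)
    have "lookup e (h i) = lookup e' (h i)" if "i < card V" for i
      by (rule digits_inj[of "card V" "\<lambda>i. lookup e (h i)" N "\<lambda>i. lookup e' (h i)"])
        (use A W N hV that in auto)
    then have "lookup e v = lookup e' v" if "v \<in> V" for v
      using h that by (metis atLeast0LessThan bij_betw_def imageE lessThan_iff)
    moreover have "lookup e v = 0 \<and> lookup e' v = 0" if "v \<notin> V" for v
      using A that by (auto simp: V_def in_keys_iff)
    ultimately show "e = e'" by (intro poly_mapping_eqI) metis
  qed
  moreover have "w v \<ge> 1" for v by (simp add: w_def N_def)
  ultimately show ?thesis by blast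
qed

text \<open>Kronecker substitution: x^(w v) for the variable v sends distinct monomials of P to
  distinct powers of x, which leaves a nonzero polynomial in one variable.\<close>

lemma mpol_nonvanishing:
  fixes P :: "('v, 'k::field) mpol"
  assumes "infinite (UNIV :: 'k set)" "P \<noteq> 0"
  shows "\<exists>t. meval (\<lambda>x. x) t P \<noteq> 0"
proof -
  obtain w where w: "inj_on (wsum w) (keys P)"
    using ex_injective_weight[of "keys P"] by auto
  have m: "mon (\<lambda>v. x ^ w v) e = x ^ wsum w e" for x :: 'k and e
    by (simp add: mon_def wsum_def power_sum power_mult[symmetric] mult.commute)
  define g where "g = (\<Sum>e\<in>keys P. monom (lookup P e) (wsum w e))"
  obtain e0 where e0: "e0 \<in> keys P" using assms(2) by fastforce
  have "coeff g (wsum w e0) = (\<Sum>e\<in>keys P. if e = e0 then lookup P e else 0)"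
    unfolding g_def coeff_sum using w e0 by (intro sum.cong) (auto dest: inj_onD)
  also have "\<dots> \<noteq> 0" using e0 by (simp add: in_keys_iff)
  finally have "g \<noteq> 0" by auto
  then obtain x where "poly g x \<noteq> 0"
    using poly_eq_if_eq_on_infinite[OF assms(1), of g 0] by auto
  moreover have "poly g x = meval (\<lambda>x. x) (\<lambda>v. x ^ w v) P"
    by (simp add: g_def meval_def m poly_sum poly_monom)
  ultimately show ?thesis by metis
qed

section \<open>Algebraic relations between iterated sums\<close>

text \<open>The bound is strict, so that \<open>wless w 0\<close> consists of 0 alone; the bound n +
  1 then means weight at most n.\<close>

definition wless :: "('v \<Rightarrow> nat) \<Rightarrow> nat \<Rightarrow> ('v, 'k::zero) mpol set" where
  "wless w n = {P. \<forall>e\<in>keys P. wsum w e < n}"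

lemma wless_add: "P \<in> wless w n \<Longrightarrow> Q \<in> wless w n \<Longrightarrow> P + Q \<in> wless w (n::nat)"
  using keys_add[of P Q] by (auto simp: wless_def)

lemma wless_uminus: "P \<in> wless w n \<Longrightarrow> - P \<in> wless w (n::nat)"
  for P :: "('v, 'k::comm_ring_1) mpol"
  by (auto simp: wless_def in_keys_iff)

lemma wless_diff: "P \<in> wless w n \<Longrightarrow> Q \<in> wless w n \<Longrightarrow> P - Q \<in> wless w (n::nat)"
  for P :: "('v, 'k::comm_ring_1) mpol"
  using wless_add[of P w n "- Q"] wless_uminus[of Q w n] by simp

lemma wless_0 [simp]: "0 \<in> wless w n"
  by (simp add: wless_def)

lemma wless_sum: "(\<And>x. x \<in> A \<Longrightarrow> f x \<in> wless w n) \<Longrightarrow> sum f A \<in> wless w n"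
  by (induction A rule: infinite_finite_induct) (auto intro: wless_add)

lemma wless_mono: "P \<in> wless w m \<Longrightarrow> m \<le> n \<Longrightarrow> P \<in> wless w n"
  by (force simp: wless_def)

lemma wless_mult:
  fixes P Q :: "('v, 'k::comm_ring_1) mpol"
  assumes "P \<in> wless w (Suc m)" "Q \<in> wless w n" shows "P * Q \<in> wless w (m + n)"
  unfolding wless_def
proof (rule CollectI, rule ballI)
  fix e assume "e \<in> keys (P * Q)"
  then obtain e1 e2 where "e = e1 + e2" "e1 \<in> keys P" "e2 \<in> keys Q"
    using keys_mult[of P Q] by blast
  moreover from this have "wsum w e1 < Suc m" "wsum w e2 < n" using assms by (auto simp: wless_def)
  ultimately show "wsum w e < m + n" by (auto simp: wsum_add)
qed

lemma wless_mC: "n > 0 \<Longrightarrow> mC c \<in> wless w n"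
  by (auto simp: wless_def mC_def)

lemma mC_1: "mC 1 = (1 :: ('v, 'k::comm_ring_1) mpol)"
  by (simp add: mC_def)

lemma wless_1: "n > 0 \<Longrightarrow> (1 :: ('v, 'k::comm_ring_1) mpol) \<in> wless w n"
  using wless_mC[of n "1::'k" w] by (simp add: mC_1)

lemma ex_in_keys: "e \<noteq> 0 \<Longrightarrow> \<exists>v. v \<in> keys e"
  by (metis in_keys_iff lookup_zero poly_mapping_eqI)

lemma wless_mX: "mX v \<in> wless w (Suc (w v))"
  by (auto simp: wless_def mX_def)

lemma wless_single: "Poly_Mapping.single e c \<in> wless w (Suc (wsum w e))"
  by (auto simp: wless_def)

lemma lookup_mC_mult:
  fixes P :: "('v, 'k::comm_ring_1) mpol"
  shows "lookup (mC c * P) e = c * lookup P e"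
proof -
  have "mC c * P = (\<Sum>e\<in>keys P. Poly_Mapping.single e (c * lookup P e))"
    by (subst mpol_eq_sum[of P]) (simp add: sum_distrib_left mC_def mult_single)
  then have "lookup (mC c * P) e = (\<Sum>e'\<in>keys P. (if e' = e then c * lookup P e else 0))"
    by (simp add: lookup_sum lookup_single when_def)
  also have "\<dots> = c * lookup P e"
    by (cases "e \<in> keys P") (auto simp: in_keys_iff)
  finally show ?thesis .
qed

text \<open>Equality of the parts of weight n of two polynomials of weight at most n. In this form
  it passes to products, with weights adding.\<close>

definition wnear :: "('v \<Rightarrow> nat) \<Rightarrow> nat \<Rightarrow> ('v, 'k::comm_ring_1) mpol \<Rightarrow> ('v, 'k) mpol \<Rightarrow> bool" where
  "wnear w n P Q \<longleftrightarrow> P - Q \<in> wless w n \<and> Q \<in> wless w (Suc n)"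

lemma wnear_mult:
  assumes "wnear w m P P'" "wnear w n Q Q'" shows "wnear w (m + n) (P * Q) (P' * Q')"
proof -
  have "Q = Q' + (Q - Q')" by simp
  moreover have "Q' + (Q - Q') \<in> wless w (Suc n)"
    using assms(2) by (intro wless_add) (auto simp: wnear_def intro: wless_mono)
  ultimately have Q: "Q \<in> wless w (Suc n)" by metis
  have "P * Q - P' * Q' = Q * (P - P') + P' * (Q - Q')" by (simp add: algebra_simps)
  moreover have "Q * (P - P') \<in> wless w (n + m)" using Q assms(1) by (intro wless_mult) (auto simp: wnear_def)
  moreover have "P' * (Q - Q') \<in> wless w (m + n)" using assms by (intro wless_mult) (auto simp: wnear_def)
  ultimately have "P * Q - P' * Q' \<in> wless w (m + n)" by (simp add: wless_add add.commute)
  moreover have "P' * Q' \<in> wless w (m + Suc n)" using assms by (intro wless_mult) (auto simp: wnear_def)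
  ultimately show ?thesis by (simp add: wnear_def)
qed

lemma wnear_1: "wnear w 0 1 1"
  by (simp add: wnear_def wless_1)

lemma wnear_power: "wnear w m P P' \<Longrightarrow> wnear w (n * m) (P ^ n) (P' ^ n)"
  by (induction n) (auto simp: wnear_1 intro: wnear_mult)

lemma wnear_mon:
  assumes "\<And>v. F v - mX v \<in> wless w (w v)"
  shows "wnear w (wsum w e) (mon F e) (Poly_Mapping.single e (1::'k::comm_ring_1))"
proof -
  have v: "wnear w (w v) (F v) (mX v)" for v
    using assms by (simp add: wnear_def wless_mX)
  have "wnear w (\<Sum>v\<in>A. lookup e v * w v) (\<Prod>v\<in>A. F v ^ lookup e v)
      (\<Prod>v\<in>A. mX v ^ lookup e v)" if "finite A" for A
    using that by (induction A rule: finite_induct) (auto simp: wnear_1 intro: wnear_mult wnear_power v)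
  from this[of "keys e"] show ?thesis by (simp add: mon_mX[symmetric] mon_def wsum_def)
qed

text \<open>A variable goes to itself plus lower weight, so such a triangular substitution cannot
  disturb the leading part except through g. The shift and the unipotent substitutions are both of
  this kind, which lets minimality act on P minus its image.\<close>

lemma subst_top:
  fixes P :: "('v, 'k::comm_ring_1) mpol"
  assumes g: "rhom g" and F: "\<And>v. F v - mX v \<in> wless w (w v)" and P: "P \<in> wless w (Suc n)"
  shows "meval (\<lambda>x. mC (g x)) F P \<in> wless w (Suc n)"
    and "wsum w e = n \<Longrightarrow> lookup (meval (\<lambda>x. mC (g x)) F P) e = g (lookup P e)"
proof -
  define D where "D = (\<Sum>e\<in>keys P. mC (g (lookup P e)) * (mon F e - Poly_Mapping.single e 1))"
  define G where "G = (\<Sum>e\<in>keys P. Poly_Mapping.single e (g (lookup P e)))"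
  have eq: "meval (\<lambda>x. mC (g x)) F P = D + G"
    unfolding meval_def D_def G_def
    by (simp add: mC_def mult_single sum.distrib[symmetric] right_diff_distrib)
  have D: "D \<in> wless w n" unfolding D_def
  proof (intro wless_sum)
    fix e assume e: "e \<in> keys P"
    have "mC (g (lookup P e)) * (mon F e - Poly_Mapping.single e 1) \<in> wless w (0 + wsum w e)"
      using wnear_mon[of F w e, OF F] by (intro wless_mult wless_mC) (auto simp: wnear_def)
    then show "mC (g (lookup P e)) * (mon F e - Poly_Mapping.single e 1) \<in> wless w n"
      by (rule wless_mono) (use P e in \<open>auto simp: wless_def\<close>)
  qed
  have "G \<in> wless w (Suc n)" unfolding G_def
    using P by (intro wless_sum wless_mono[OF wless_single]) (auto simp: wless_def)
  then show "meval (\<lambda>x. mC (g x)) F P \<in> wless w (Suc n)"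
    unfolding eq using D by (intro wless_add) (auto intro: wless_mono)
  assume e: "wsum w e = n"
  then have "lookup D e = 0" using D by (auto simp: wless_def in_keys_iff)
  moreover have "lookup G e = (\<Sum>e'\<in>keys P. if e' = e then g (lookup P e) else 0)"
    unfolding G_def lookup_sum lookup_single by (intro sum.cong) (auto simp: when_def)
  then have "lookup G e = g (lookup P e)"
    by (cases "e \<in> keys P") (auto simp: in_keys_iff rhom_0[OF g])
  ultimately show "lookup (meval (\<lambda>x. mC (g x)) F P) e = g (lookup P e)"
    by (simp add: eq lookup_add)
qed

text \<open>Entries on and above the diagonal of the unipotent matrix \<open>I + t\<close>.\<close>
definition uent :: "(nat \<times> nat \<Rightarrow> 's::comm_ring_1) \<Rightarrow> nat \<Rightarrow> nat \<Rightarrow> 's" where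
  "uent t a b = (if a = b then 1 else t (a, b))"

text \<open>\<open>T_rec\<close> says that s (I + T) = (I + N) (I + T), where N has the entry
  \<open>\<rho> (e (Suc a))\<close> in position (a, a + 1) and zeros elsewhere. The assumption
  \<open>fixed\<close> makes the image of \<kappa> the ring of constants. The values T lie in a ring
  with zero divisors, the coefficients of relations in a field.\<close>

locale diff_sys =
  fixes \<sigma> :: "'b::field \<Rightarrow> 'b" and s :: "'g::comm_ring_1 \<Rightarrow> 'g" and \<rho> :: "'b \<Rightarrow> 'g"
    and \<kappa> :: "'k::field \<Rightarrow> 'b" and d :: nat and e :: "nat \<Rightarrow> 'b" and T :: "nat \<times> nat \<Rightarrow> 'g"
  assumes hom: "rhom \<sigma>" "rhom s" "rhom \<rho>" "rhom \<kappa>"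
    and rho_sigma: "\<rho> (\<sigma> x) = s (\<rho> x)"
    and sigma_kappa: "\<sigma> (\<kappa> c) = \<kappa> c"
    and fixed: "s y = y \<Longrightarrow> \<exists>c. y = \<rho> (\<kappa> c)"
    and infin: "infinite (UNIV :: 'k set)"
    and char: "prime CHAR('b)"
    and T_rec: "a < b \<Longrightarrow> b \<le> d \<Longrightarrow> s (T (a, b)) = T (a, b) + \<rho> (e (Suc a)) * uent T (Suc a) b"
begin

definition Ix :: "(nat \<times> nat) set" where "Ix = {(a, b). a < b \<and> b \<le> d}"
definition wt :: "nat \<times> nat \<Rightarrow> nat" where "wt v = snd v - fst v"
definition ev :: "(nat \<times> nat, 'b) mpol \<Rightarrow> 'g" where "ev = meval \<rho> T"
definition Sv :: "nat \<times> nat \<Rightarrow> (nat \<times> nat, 'b) mpol" where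
  "Sv v = (if v \<in> Ix then mX v + mC (e (Suc (fst v))) * uent mX (Suc (fst v)) (snd v) else mX v)"
text \<open>\<open>\<Phi>\<close> lifts the shift \<open>s\<close>, which multiplies the unipotent matrix \<open>T\<close> from the left. \<open>\<Gamma> c b h\<close>
  multiplies it from the right by \<open>I + h E\<^sub>c\<^sub>b\<close> and therefore commutes with \<open>\<Phi>\<close>.\<close>
definition \<Phi> :: "(nat \<times> nat, 'b) mpol \<Rightarrow> (nat \<times> nat, 'b) mpol" where
  "\<Phi> = meval (\<lambda>x. mC (\<sigma> x)) Sv"
definition Rv :: "nat \<Rightarrow> nat \<Rightarrow> 'k \<Rightarrow> nat \<times> nat \<Rightarrow> (nat \<times> nat, 'b) mpol" where
  "Rv c b h v = (if snd v = b \<and> fst v \<le> c then mX v + mC (\<kappa> h) * uent mX (fst v) c else mX v)"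
definition \<Gamma> :: "nat \<Rightarrow> nat \<Rightarrow> 'k \<Rightarrow> (nat \<times> nat, 'b) mpol \<Rightarrow> (nat \<times> nat, 'b) mpol" where
  "\<Gamma> c b h = meval mC (Rv c b h)"
text \<open>Variables are indexed by all pairs; \<open>kill P = P\<close> expresses that P involves
  only the entries strictly above the diagonal with column at most d.\<close>

definition kill :: "(nat \<times> nat, 'b) mpol \<Rightarrow> (nat \<times> nat, 'b) mpol" where
  "kill = meval mC (\<lambda>v. if v \<in> Ix then mX v else 0)"

lemma rhom_mC_sigma: "rhom (\<lambda>x. mC (\<sigma> x))"
  by (rule rhom_comp[OF hom(1) rhom_mC])

lemma rhoms: "rhom ev" "rhom \<Phi>" "rhom (\<Gamma> c b h)" "rhom kill"
  unfolding ev_def \<Phi>_def \<Gamma>_def kill_def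
  by (auto intro!: rhom_meval hom rhom_mC_sigma rhom_mC)

lemma mC_values [simp]: "ev (mC x) = \<rho> x" "\<Phi> (mC x) = mC (\<sigma> x)" "\<Gamma> c b h (mC x) = mC x" "kill (mC x) = mC x"
  unfolding ev_def \<Phi>_def \<Gamma>_def kill_def
  by (simp_all add: hom rhom_mC_sigma rhom_mC)

lemma mX_values [simp]: "ev (mX v) = T v" "\<Phi> (mX v) = Sv v" "\<Gamma> c b h (mX v) = Rv c b h v"
  "kill (mX v) = (if v \<in> Ix then mX v else 0)"
  unfolding ev_def \<Phi>_def \<Gamma>_def kill_def
  by (simp_all add: hom rhom_mC_sigma rhom_mC)

lemma uent_hom: "rhom f \<Longrightarrow> f (uent t a b) = uent (\<lambda>v. f (t v)) a b"
  by (simp add: uent_def rhom_1)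

lemma kill_meval: "kill (meval (\<lambda>x. mC (g x)) F P) = meval (\<lambda>x. mC (g x)) (\<lambda>v. kill (F v)) P"
  for g :: "'x::comm_ring_1 \<Rightarrow> 'b"
  using rhom_comp_meval[OF rhoms(4), of "\<lambda>x. mC (g x)" F P] by simp

lemma Phi_meval: "\<Phi> (meval (\<lambda>x. mC (g x)) F P) = meval (\<lambda>x. mC (\<sigma> (g x))) (\<lambda>v. \<Phi> (F v)) P"
  for g :: "'x::comm_ring_1 \<Rightarrow> 'b"
  using rhom_comp_meval[OF rhoms(2), of "\<lambda>x. mC (g x)" F P] by simp

lemma Gamma_meval: "\<Gamma> c b h (meval (\<lambda>x. mC (g x)) F P) = meval (\<lambda>x. mC (g x)) (\<lambda>v. \<Gamma> c b h (F v)) P"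
  for g :: "'x::comm_ring_1 \<Rightarrow> 'b"
  using rhom_comp_meval[OF rhoms(3), of c b h "\<lambda>x. mC (g x)" F P] by simp

lemma ev_meval: "ev (meval (\<lambda>x. mC (g x)) F P) = meval (\<lambda>x. \<rho> (g x)) (\<lambda>v. ev (F v)) P"
  for g :: "'x::comm_ring_1 \<Rightarrow> 'b"
  using rhom_comp_meval[OF rhoms(1), of "\<lambda>x. mC (g x)" F P] by simp

lemma kill_eq: "kill P = meval (\<lambda>x. mC x) (\<lambda>v. kill (mX v)) P"
proof -
  have "(\<lambda>v. kill (mX v)) = (\<lambda>v. if v \<in> Ix then mX v else 0)" by auto
  then show ?thesis by (simp add: kill_def)
qed

lemma Phi_eq: "\<Phi> P = meval (\<lambda>x. mC (\<sigma> x)) Sv P"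
  by (simp add: \<Phi>_def)

lemma Gamma_eq: "\<Gamma> c b h P = meval (\<lambda>x. mC x) (Rv c b h) P"
  by (simp add: \<Gamma>_def)

lemma kill_Sv: "kill (Sv v) = \<Phi> (kill (mX v))"
proof (cases "v \<in> Ix")
  case True
  then have "kill (uent mX (Suc (fst v)) (snd v)) = uent mX (Suc (fst v)) (snd v)"
    by (auto simp: uent_def rhom_1[OF rhoms(4)] Ix_def)
  then show ?thesis using True by (simp add: Sv_def rhom_simps[OF rhoms(4)])
next
  case False
  then show ?thesis by (simp add: Sv_def rhom_0[OF rhoms(2)])
qed

lemma kill_Rv:
  assumes "(c, b) \<in> Ix"
  shows "kill (Rv c b h v) = \<Gamma> c b h (kill (mX v))"
proof (cases "v \<in> Ix")
  case True
  have "kill (uent mX (fst v) c) = uent mX (fst v) c" if "fst v \<le> c"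
    using that assms by (auto simp: uent_def rhom_1[OF rhoms(4)] Ix_def)
  then show ?thesis using True by (simp add: Rv_def rhom_simps[OF rhoms(4)])
next
  case False
  then show ?thesis using assms by (auto simp: Rv_def rhom_0[OF rhoms(3)] Ix_def)
qed

lemma kill_Phi: "kill (\<Phi> P) = \<Phi> (kill P)"
  unfolding Phi_eq[of P] kill_meval kill_Sv kill_eq[of P] Phi_meval ..

lemma kill_Gamma:
  assumes "(c, b) \<in> Ix"
  shows "kill (\<Gamma> c b h P) = \<Gamma> c b h (kill P)"
  unfolding Gamma_eq[of c b h P] kill_meval kill_Rv[OF assms] kill_eq[of P] Gamma_meval ..

text \<open>Multiplications from the left and from the right commute. The identity is checked on
  variables indexed by \<open>Ix\<close>; passing through \<open>kill\<close> discards the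
  others.\<close>

lemma Phi_Gamma:
  assumes "(c, b) \<in> Ix" "kill P = P"
  shows "\<Phi> (\<Gamma> c b h P) = \<Gamma> c b h (\<Phi> P)"
proof -
  have R: "\<Phi> (Rv c b h (a, b')) = \<Gamma> c b h (Sv (a, b'))" if "(a, b') \<in> Ix" for a b'
  proof -
    have cb: "c < b" "b \<le> d" "a < b'" "b' \<le> d" using assms that by (auto simp: Ix_def)
    consider "b' \<noteq> b \<or> a > c" | "b' = b" "a < c" | "b' = b" "a = c" by linarith
    then show ?thesis
    proof cases
      case 1
      then show ?thesis using cb that
        by (auto simp: Rv_def Sv_def rhom_simps[OF rhoms(3)] uent_hom[OF rhoms(3)] uent_def)
    next
      case 2
      have ac: "(a, c) \<in> Ix" using 2 cb by (auto simp: Ix_def)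
      show ?thesis using 2 cb that ac
        by (auto simp: Rv_def Sv_def rhom_simps[OF rhoms(3)] rhom_simps[OF rhoms(2)] uent_hom[OF rhoms(3)]
            uent_hom[OF rhoms(2)] uent_def sigma_kappa algebra_simps)
    next
      case 3
      then show ?thesis using cb that
        by (auto simp: Rv_def Sv_def rhom_simps[OF rhoms(3)] rhom_simps[OF rhoms(2)] uent_hom[OF rhoms(3)]
            uent_hom[OF rhoms(2)] uent_def sigma_kappa algebra_simps)
    qed
  qed
  have Rk: "\<Phi> (kill (Rv c b h v)) = \<Gamma> c b h (kill (Sv v))" for v
  proof (cases "v \<in> Ix")
    case True
    then show ?thesis using R[of "fst v" "snd v"] by (simp add: kill_Sv kill_Rv[OF assms(1)])
  next
    case False
    then show ?thesis
      by (simp add: kill_Sv kill_Rv[OF assms(1)] rhom_0[OF rhoms(2)] rhom_0[OF rhoms(3)])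
  qed
  have "\<Phi> (\<Gamma> c b h P) = \<Phi> (kill (\<Gamma> c b h P))"
    using kill_Gamma[OF assms(1)] assms(2) by simp
  also have "\<dots> = \<Gamma> c b h (kill (\<Phi> P))"
    unfolding Gamma_eq[of c b h P] Phi_eq[of P] kill_meval Phi_meval Gamma_meval Rk ..
  also have "kill (\<Phi> P) = \<Phi> P" using kill_Phi assms(2) by simp
  finally show ?thesis .
qed

lemma ev_Phi:
  assumes "kill P = P"
  shows "ev (\<Phi> P) = s (ev P)"
proof -
  have K: "ev (kill (Sv v)) = s (ev (kill (mX v)))" for v
  proof (cases "v \<in> Ix")
    case True
    then have "kill (Sv v) = Sv v" by (simp add: kill_Sv)
    then show ?thesis using True T_rec[of "fst v" "snd v"]
      by (cases v) (auto simp: Sv_def rhom_simps[OF rhoms(1)] uent_hom[OF rhoms(1)] Ix_def)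
  next
    case False
    then show ?thesis by (simp add: kill_Sv rhom_0[OF rhoms(1)] rhom_0[OF rhoms(2)] rhom_0[OF hom(2)])
  qed
  have "ev (\<Phi> P) = ev (kill (\<Phi> P))" using kill_Phi assms by simp
  also have "\<dots> = meval (\<lambda>x. s (\<rho> x)) (\<lambda>v. s (ev (kill (mX v)))) P"
    unfolding Phi_eq[of P] kill_meval ev_meval K rho_sigma ..
  also have "\<dots> = s (ev (kill P))"
    unfolding kill_eq[of P] ev_meval rhom_comp_meval[OF hom(2)] ..
  finally show ?thesis using assms by simp
qed

lemma rho_inj: "\<rho> x = \<rho> y \<longleftrightarrow> x = y"
  by (rule rhom_field_inj[OF hom(3)])

lemma Sv_wless: "Sv v - mX v \<in> wless wt (wt v)"
proof -
  obtain a b where v: "v = (a, b)" by (cases v)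
  show ?thesis
  proof (cases "v \<in> Ix")
    case True
    then have ab: "a < b" by (auto simp: v Ix_def)
    have "uent mX (Suc a) b \<in> wless wt (wt v)"
    proof (cases "Suc a = b")
      case True
      then show ?thesis using ab by (simp add: v wt_def uent_def wless_1)
    next
      case False
      then show ?thesis using ab wless_mX[of "(Suc a, b)" wt] by (simp add: v wt_def uent_def Suc_diff_Suc)
    qed
    then have "mC (e (Suc a)) * uent mX (Suc a) b \<in> wless wt (0 + wt v)"
      by (intro wless_mult wless_mC) auto
    then show ?thesis using True by (simp add: Sv_def v)
  qed (simp add: Sv_def)
qed

lemma Rv_wless:
  assumes "c < b"
  shows "Rv c b h v - mX v \<in> wless wt (wt v)"
proof -
  obtain a b' where v: "v = (a, b')" by (cases v)
  show ?thesis
  proof (cases "b' = b \<and> a \<le> c")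
    case True
    have "uent mX a c \<in> wless wt (wt v)"
    proof (cases "a = c")
      case True
      then show ?thesis using assms \<open>b' = b \<and> a \<le> c\<close> by (simp add: v wt_def uent_def wless_1)
    next
      case False
      have "Suc (c - a) \<le> b - a" using assms True by linarith
      then show ?thesis using False True wless_mono[OF wless_mX[of "(a, c)" wt], of "wt v"]
        by (simp add: v wt_def uent_def)
    qed
    then have "mC (\<kappa> h) * uent mX a c \<in> wless wt (0 + wt v)"
      by (intro wless_mult wless_mC) auto
    then show ?thesis using True by (simp add: Rv_def v)
  qed (auto simp: Rv_def v)
qed

lemma wless_kill_const:
  assumes "P \<in> wless wt 1" "kill P = P"
  shows "\<exists>a. P = mC a"
proof -
  have "kill P = (\<Sum>e\<in>keys P. mC (if e = 0 then lookup P e else 0))"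
    unfolding kill_def meval_def
  proof (intro sum.cong refl)
    fix e :: "nat \<times> nat \<Rightarrow>\<^sub>0 nat" assume e: "e \<in> keys P"
    show "mC (lookup P e) * mon (\<lambda>v. if v \<in> Ix then mX v else 0) e
      = mC (if e = 0 then lookup P e else 0)"
    proof (cases "e = 0")
      case False
      then obtain v where v: "v \<in> keys e" using ex_in_keys by blast
      have "wsum wt e = 0" using assms(1) e by (auto simp: wless_def)
      then have "wt v = 0" using v by (auto simp: wsum_def in_keys_iff)
      then have "v \<notin> Ix" by (auto simp: Ix_def wt_def)
      then have "mon (\<lambda>v. if v \<in> Ix then mX v else (0::(nat \<times> nat, 'b) mpol)) e = 0"
        using v by (auto simp: mon_def in_keys_iff intro!: prod_zero)
      then show ?thesis using False by (simp add: mC_def)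
    qed simp
  qed
  also have "\<dots> = mC (\<Sum>e\<in>keys P. if e = 0 then lookup P e else 0)"
    by (rule rhom_sum[OF rhom_mC, symmetric])
  finally show ?thesis using assms(2) by metis
qed

text \<open>Among the relations of least weight take one with the fewest monomials of that weight,
  and scale a coefficient of top weight to 1. Then P minus its shift is a relation with fewer such
  monomials, hence 0. It follows that the value of \<Gamma> P is fixed by the shift, so it is a
  constant, and \<Gamma> P - P minus this constant is a relation of smaller weight, hence 0.\<close>

lemma minimal_relation:
  assumes "P0 \<noteq> 0" "kill P0 = P0" "ev P0 = 0"
  obtains P where "P \<notin> range mC" "kill P = P" "\<Phi> P = P"
    "\<And>c b h. (c, b) \<in> Ix \<Longrightarrow> \<exists>k. \<Gamma> c b h P = P + mC (\<kappa> k)"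
proof -
  define Rel where "Rel = {P. P \<noteq> 0 \<and> kill P = P \<and> ev P = 0}"
  define ok where "ok n = (\<exists>P\<in>Rel. P \<in> wless wt (Suc n))" for n
  have "\<exists>n. P0 \<in> wless wt (Suc n)"
    by (intro exI[of _ "Max (insert 0 (wsum wt ` keys P0))"])
      (auto simp: wless_def less_Suc_eq_le intro: Max_ge)
  then have "\<exists>n. ok n" using assms by (auto simp: ok_def Rel_def)
  define n where "n = (LEAST n. ok n)"
  have n: "ok n" unfolding n_def by (rule LeastI_ex) fact
  have nmin: "\<not> ok m" if "m < n" for m using that not_less_Least[of m ok] by (simp add: n_def)
  have m1: "Q = 0" if "Q \<in> wless wt n" "kill Q = Q" "ev Q = 0" for Q
  proof (rule ccontr)
    assume "Q \<noteq> 0"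
    then have "n > 0" using that(1) by (cases n) (auto simp: wless_def)
    then have "ok (n - 1)" using that \<open>Q \<noteq> 0\<close> by (auto simp: ok_def Rel_def)
    then show False using nmin \<open>n > 0\<close> by simp
  qed
  define top where "top P = {e \<in> keys P. wsum wt e = n}" for P :: "(nat \<times> nat, 'b) mpol"
  have fintop: "finite (top P)" for P by (simp add: top_def)
  define okc where "okc c = (\<exists>P\<in>Rel. P \<in> wless wt (Suc n) \<and> card (top P) = c)" for c
  have "\<exists>c. okc c" using n by (auto simp: ok_def okc_def)
  define c where "c = (LEAST c. okc c)"
  have c: "okc c" unfolding c_def by (rule LeastI_ex) fact
  have m2: "Q = 0" if "Q \<in> wless wt (Suc n)" "kill Q = Q" "ev Q = 0" "card (top Q) < c" for Q
  proof (rule ccontr)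
    assume "Q \<noteq> 0"
    then have "okc (card (top Q))" using that by (auto simp: okc_def Rel_def)
    then show False using that(4) not_less_Least[of "card (top Q)" okc] by (simp add: c_def)
  qed
  obtain P1 where P1: "P1 \<noteq> 0" "kill P1 = P1" "ev P1 = 0" "P1 \<in> wless wt (Suc n)" "card (top P1) = c"
    using c by (auto simp: okc_def Rel_def)
  have "top P1 \<noteq> {}"
  proof
    assume "top P1 = {}"
    then have "P1 \<in> wless wt n" using P1(4) by (auto simp: top_def wless_def less_Suc_eq)
    then show False using m1 P1 by blast
  qed
  then obtain e0 where e0: "e0 \<in> top P1" by blast
  define a where "a = lookup P1 e0"
  have a: "a \<noteq> 0" using e0 by (simp add: a_def top_def in_keys_iff)
  \<comment> \<open>After scaling, the coefficient at \<open>e0\<close> is 1 and is fixed by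
    \<sigma>, so \<open>e0\<close> drops out of P minus its shift.\<close>
  define P where "P = mC (inverse a) * P1"
  have lk: "lookup P x = inverse a * lookup P1 x" for x
    by (simp add: P_def lookup_mC_mult)
  have keysP: "keys P = keys P1" using a by (auto simp: in_keys_iff lk)
  have P: "P \<noteq> 0" "kill P = P" "ev P = 0" "P \<in> wless wt (Suc n)" "card (top P) = c"
    "lookup P e0 = 1" "e0 \<in> top P"
    using P1 keysP a e0
    by (auto simp: P_def rhom_mult[OF rhoms(4)] rhom_mult[OF rhoms(1)] wless_def top_def lookup_mC_mult a_def)
  have PhiP: "\<Phi> P = P"
  proof -
    define Q where "Q = P - \<Phi> P"
    have "Q = 0"
    proof (rule m2)
      have "\<Phi> P \<in> wless wt (Suc n)" unfolding \<Phi>_def by (rule subst_top(1)[OF hom(1) Sv_wless P(4)])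
      then show "Q \<in> wless wt (Suc n)" unfolding Q_def using P(4) by (intro wless_diff)
      show "kill Q = Q" using P(2) by (simp add: Q_def rhom_diff[OF rhoms(4)] kill_Phi)
      show "ev Q = 0" using P(2,3) by (simp add: Q_def rhom_diff[OF rhoms(1)] ev_Phi rhom_0[OF hom(2)])
      have lkQ: "lookup Q x = lookup P x - \<sigma> (lookup P x)" if "wsum wt x = n" for x
        using subst_top(2)[OF hom(1) Sv_wless P(4) that] by (simp add: Q_def lookup_minus \<Phi>_def)
      have "top Q \<subseteq> top P - {e0}"
        using lkQ P(6) by (auto simp: top_def in_keys_iff rhom_1[OF hom(1)] rhom_0[OF hom(1)])
      then have "card (top Q) \<le> card (top P - {e0})" by (intro card_mono) (auto simp: fintop)
      also have "\<dots> < c" using P(5,7) fintop by (metis card_Diff1_less)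
      finally show "card (top Q) < c" .
    qed
    then show ?thesis by (simp add: Q_def)
  qed
  have nconst: "P \<notin> range mC"
  proof
    assume "P \<in> range mC"
    then obtain x where x: "P = mC x" by auto
    then have "\<rho> x = 0" using P(3) by simp
    then have "x = 0" using rhom_field_eq_0_iff[OF hom(3)] by blast
    then show False using P(1) x by (simp add: mC_def)
  qed
  have n0: "n > 0"
  proof (rule ccontr)
    assume "\<not> n > 0"
    then have "P \<in> wless wt 1" using P(4) by simp
    then show False using wless_kill_const P(2) nconst by auto
  qed
  have "\<exists>k. \<Gamma> c b h P = P + mC (\<kappa> k)" if cb: "(c, b) \<in> Ix" for c b h
  proof -
    have k: "kill (\<Gamma> c b h P) = \<Gamma> c b h P" using kill_Gamma[OF cb] P(2) by simp
    have "s (ev (\<Gamma> c b h P)) = ev (\<Gamma> c b h P)"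
      using ev_Phi[OF k] Phi_Gamma[OF cb P(2)] PhiP by simp
    then obtain x where x: "ev (\<Gamma> c b h P) = \<rho> (\<kappa> x)" using fixed by blast
    define Q where "Q = \<Gamma> c b h P - P - mC (\<kappa> x)"
    have "Q = 0"
    proof (rule m1)
      have c: "c < b" using cb by (auto simp: Ix_def)
      have id: "rhom (\<lambda>x::'b. x)" by (rule rhomI) auto
      have W: "\<Gamma> c b h P \<in> wless wt (Suc n)"
        unfolding \<Gamma>_def using subst_top(1)[OF id Rv_wless[OF c] P(4)] by simp
      have L: "lookup (\<Gamma> c b h P) x = lookup P x" if "wsum wt x = n" for x
        unfolding \<Gamma>_def using subst_top(2)[OF id Rv_wless[OF c] P(4) that] by simp
      have "\<Gamma> c b h P - P \<in> wless wt (Suc n)" using W P(4) by (rule wless_diff)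
      then have "\<Gamma> c b h P - P \<in> wless wt n"
        using L by (auto simp: wless_def less_Suc_eq in_keys_iff lookup_minus)
      then show "Q \<in> wless wt n" unfolding Q_def by (rule wless_diff[OF _ wless_mC[OF n0]])
      show "kill Q = Q" using P(2) k by (simp add: Q_def rhom_diff[OF rhoms(4)])
      show "ev Q = 0" using P(3) x by (simp add: Q_def rhom_diff[OF rhoms(1)])
    qed
    then show ?thesis by (intro exI[of _ x]) (simp add: Q_def algebra_simps)
  qed
  with that nconst P(2) PhiP show thesis by blast
qed

section \<open>The minimal relation as a function on unipotent matrices\<close>

definition Rm :: "nat \<Rightarrow> nat \<Rightarrow> 'k \<Rightarrow> (nat \<times> nat \<Rightarrow> 'b) \<Rightarrow> nat \<times> nat \<Rightarrow> 'b" where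
  "Rm c b h t v = (if snd v = b \<and> fst v \<le> c then t v + \<kappa> h * uent t (fst v) c else t v)"

abbreviation pe :: "(nat \<times> nat \<Rightarrow> 'b) \<Rightarrow> (nat \<times> nat, 'b) mpol \<Rightarrow> 'b" where
  "pe t \<equiv> meval (\<lambda>x. x) t"

lemma rhom_id: "rhom (\<lambda>x::'b. x)"
  by (rule rhomI) auto

lemma rhom_pe: "rhom (pe t)"
  by (rule rhom_meval[OF rhom_id])

lemma pe_meval:
  fixes g :: "'x::comm_ring_1 \<Rightarrow> 'b"
  shows "pe t (meval (\<lambda>x. mC (g x)) F Q) = meval g (\<lambda>v. pe t (F v)) Q"
  using rhom_comp_meval[OF rhom_pe, of t "\<lambda>x. mC (g x)" F Q] by (simp add: rhom_id)

lemma pe_Gamma: "pe t (\<Gamma> c b h Q) = pe (Rm c b h t) Q"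
proof -
  have "pe t (Rv c b h v) = Rm c b h t v" for v
    by (simp add: Rv_def Rm_def rhom_simps[OF rhom_pe] uent_hom[OF rhom_pe] rhom_id)
  then show ?thesis unfolding Gamma_eq[of c b h Q] pe_meval by simp
qed

lemma pe_kill: "pe t (kill Q) = pe (\<lambda>v. if v \<in> Ix then t v else 0) Q"
proof -
  have "(\<lambda>v. pe t (kill (mX v))) = (\<lambda>v. if v \<in> Ix then t v else 0)"
    by (auto simp: rhom_id)
  then show ?thesis unfolding kill_eq[of Q] pe_meval by simp
qed

text \<open>Restriction to a line in the direction v. The coefficients pass through h, since below
  the relation is also evaluated with its coefficients moved by \<sigma> and the point left in
  place.\<close>

lemma ex_univariate:
  fixes h :: "'b \<Rightarrow> 'b"
  assumes "rhom h"
  shows "\<exists>g. \<forall>x. poly g x = meval h (t(v := x)) Q"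
proof -
  have "rhom (\<lambda>x. [:h x:])" using rhom_comp[OF assms rhom_const_poly] .
  have "poly (meval (\<lambda>x. [:h x:]) (\<lambda>w. if w = v then [:0, 1:] else [:t w:]) Q) x = meval h (t(v := x)) Q" for x
  proof -
    have "(\<lambda>w. poly (if w = v then [:0, 1:] else [:t w:]) x) = t(v := x)" by auto
    then show ?thesis
      using rhom_comp_meval[OF rhom_poly[of x], of "\<lambda>x. [:h x:]" "\<lambda>w. if w = v then [:0, 1:] else [:t w:]" Q]
      by simp
  qed
  then show ?thesis by blast
qed

lemma infinite_kappa: "infinite (range \<kappa>)"
  using infin rhom_field_inj[OF hom(4)] by (metis finite_imageD injI)

definition agree :: "nat \<Rightarrow> (nat \<times> nat \<Rightarrow> 'b) \<Rightarrow> (nat \<times> nat \<Rightarrow> 'b) \<Rightarrow> bool" where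
  "agree l t t' \<longleftrightarrow> (\<forall>v\<in>Ix. wt v \<le> l \<longrightarrow> t v = t' v)"

context
  fixes P
  assumes P: "P \<notin> range mC" "kill P = P" "\<Phi> P = P"
    and inv: "\<And>c b h. (c, b) \<in> Ix \<Longrightarrow> \<exists>k. \<Gamma> c b h P = P + mC (\<kappa> k)"
begin

lemma shift: "(c, b) \<in> Ix \<Longrightarrow> \<exists>k. \<forall>t. pe (Rm c b h t) P = pe t P + \<kappa> k"
  using inv[of c b h] pe_Gamma[of _ c b h P] by (metis rhom_add[OF rhom_pe] meval_mC[OF rhom_id])

text \<open>The cocycle is additive, so it vanishes on the commutators \<open>[I + h E\<^sub>c\<^sub>m, I + E\<^sub>m\<^sub>b] = I + h E\<^sub>c\<^sub>b\<close>.\<close>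
lemma shift_deep:
  assumes "(c, b) \<in> Ix" "b - c \<ge> 2"
  shows "pe (Rm c b h t) P = pe t P"
proof -
  define m where "m = Suc c"
  have m: "c < m" "m < b" using assms by (auto simp: m_def Ix_def)
  have I: "(c, m) \<in> Ix" "(m, b) \<in> Ix" using assms m by (auto simp: Ix_def)
  obtain k1 where k1: "\<forall>t. pe (Rm c m h t) P = pe t P + \<kappa> k1" using shift[OF I(1)] by blast
  obtain k2 where k2: "\<forall>t. pe (Rm m b 1 t) P = pe t P + \<kappa> k2" using shift[OF I(2)] by blast
  obtain k3 where k3: "\<forall>t. pe (Rm c b h t) P = pe t P + \<kappa> k3" using shift[OF assms(1)] by blast
  \<comment> \<open>The cocycle does not depend on the point, so the commutator identity is needed
    at the identity matrix only.\<close>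
  let ?z = "\<lambda>_. 0 :: 'b"
  have "Rm m b 1 (Rm c m h ?z) v = Rm c b h (Rm c m h (Rm m b 1 ?z)) v" for v
    using m by (cases v) (auto simp: Rm_def uent_def rhom_1[OF hom(4)])
  then have "Rm m b 1 (Rm c m h ?z) = Rm c b h (Rm c m h (Rm m b 1 ?z))" by blast
  then have "pe ?z P + \<kappa> k1 + \<kappa> k2 = pe ?z P + \<kappa> k2 + \<kappa> k1 + \<kappa> k3"
    using k1 k2 k3 by metis
  then have "\<kappa> k3 = 0" by (simp add: algebra_simps)
  then show ?thesis using k3 by simp
qed

lemma single_update_const:
  assumes "(c, b) \<in> Ix" "\<And>t h. pe (t((c, b) := t (c, b) + \<kappa> h)) P = pe t P"
  shows "pe (t((c, b) := x)) P = pe (t((c, b) := y)) P"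
proof -
  obtain g where g: "\<forall>x. poly g x = pe (t((c, b) := x)) P"
    using ex_univariate[OF rhom_id, of t "(c, b)" P] by blast
  have "g = [:poly g 0:]"
  proof (rule poly_eq_if_eq_on_infinite[OF infinite_kappa])
    fix x assume "x \<in> range \<kappa>"
    then obtain h where h: "x = \<kappa> h" by auto
    have "pe (t((c, b) := x)) P = pe (t((c, b) := 0)) P"
      using assms(2)[of "t((c, b) := 0)" h] h by simp
    then show "poly g x = poly [:poly g 0:] x" using g by simp
  qed
  then have "poly g x = poly g y" by (metis poly_pCons mult_zero_right poly_0)
  then show ?thesis using g by simp
qed

text \<open>Downward induction on the distance l from the diagonal. If P ignores entries further
  away than l + 1, then \<Gamma> at a position of distance l + 1 moves, among the entries seen by P,
  only that one; as l + 1 is at least 2, P is invariant under this and so ignores the entry too. In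
  the end only the first superdiagonal matters.\<close>

lemma depends_shallow: "l \<ge> 1 \<Longrightarrow> l + k \<ge> d \<Longrightarrow> agree l t t' \<Longrightarrow> pe t P = pe t' P"
proof (induction k arbitrary: l t t')
  case 0
  have "(\<lambda>v. if v \<in> Ix then t v else 0) = (\<lambda>v. if v \<in> Ix then t' v else 0)"
    using 0 by (auto simp: agree_def wt_def Ix_def fun_eq_iff)
  then have "pe t (kill P) = pe t' (kill P)" unfolding pe_kill by simp
  then show ?case using P(2) by simp
next
  case (Suc k l t t')
  have IH: "pe t P = pe t' P" if "agree (Suc l) t t'" for t t'
    using Suc.IH[of "Suc l"] Suc.prems that by simp
  define A where "A = {v \<in> Ix. wt v = Suc l}"
  have "Ix \<subseteq> {..d} \<times> {..d}" by (auto simp: Ix_def)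
  then have finA: "finite A" by (auto simp: A_def intro: finite_subset)
  have upd: "pe (t(v := x)) P = pe (t(v := y)) P" if v: "v \<in> A" for v t x y
  proof -
    obtain c b where cb: "v = (c, b)" "(c, b) \<in> Ix" "b - c = Suc l" using v by (cases v) (auto simp: A_def wt_def)
    show ?thesis unfolding cb
    proof (rule single_update_const[OF cb(2)])
      fix t h
      have "agree (Suc l) (Rm c b h t) (t((c, b) := t (c, b) + \<kappa> h))"
        using cb by (auto simp: agree_def Rm_def uent_def wt_def Ix_def)
      then have "pe (Rm c b h t) P = pe (t((c, b) := t (c, b) + \<kappa> h)) P" by (rule IH)
      moreover have "b - c \<ge> 2" using cb Suc.prems by simp
      ultimately show "pe (t((c, b) := t (c, b) + \<kappa> h)) P = pe t P"
        using shift_deep[OF cb(2)] by metis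
    qed
  qed
  have "pe (override_on t t' B) P = pe t P" if "B \<subseteq> A" for B
  proof -
    have "finite B" using finA that finite_subset by blast
    then show ?thesis using that
    proof (induction B rule: finite_induct)
      case (insert v B)
      have e1: "override_on t t' (insert v B) = (override_on t t' B)(v := t' v)"
        by (auto simp: override_on_def)
      have e2: "(override_on t t' B)(v := t v) = override_on t t' B"
        using insert(2) by (auto simp: override_on_def)
      have "pe (override_on t t' (insert v B)) P = pe ((override_on t t' B)(v := t v)) P"
        unfolding e1 using upd[of v] insert by blast
      also have "\<dots> = pe t P" unfolding e2 using insert by blast
      finally show ?case .
    qed (simp add: override_on_def)
  qed
  then have "pe (override_on t t' A) P = pe t P" by simp
  moreover have "agree (Suc l) (override_on t t' A) t'"
    using Suc.prems by (auto simp: agree_def override_on_def A_def le_Suc_eq)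
  ultimately show ?case using IH by metis
qed

text \<open>The change of P when the entry (i - 1, i) of the identity matrix is moved to x. These
  polynomials turn out to be additive, and P is a constant plus their sum over the
  superdiagonal.\<close>

definition gp :: "nat \<Rightarrow> 'b poly" where
  "gp i = (SOME g. \<forall>x. poly g x = pe ((\<lambda>_. 0)((i - 1, i) := x)) P - pe (\<lambda>_. 0) P)"

lemma gp: "poly (gp i) x = pe ((\<lambda>_. 0)((i - 1, i) := x)) P - pe (\<lambda>_. 0) P"
proof -
  obtain g where g: "\<forall>x. poly g x = pe ((\<lambda>_. 0)((i - 1, i) := x)) P"
    using ex_univariate[OF rhom_id, of "\<lambda>_. 0" "(i - 1, i)" P] by blast
  then have "\<forall>x. poly (g - [:pe (\<lambda>_. 0) P:]) x = pe ((\<lambda>_. 0)((i - 1, i) := x)) P - pe (\<lambda>_. 0) P" by simp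
  then have "\<forall>x. poly (gp i) x = pe ((\<lambda>_. 0)((i - 1, i) := x)) P - pe (\<lambda>_. 0) P"
    unfolding gp_def by (rule someI)
  then show ?thesis by simp
qed

lemma shift_shallow:
  assumes "i \<in> {1..d}"
  shows "pe (t((i - 1, i) := t (i - 1, i) + \<kappa> h)) P = pe t P + poly (gp i) (\<kappa> h)"
    and "poly (gp i) (\<kappa> h) \<in> range \<kappa>"
proof -
  have I: "(i - 1, i) \<in> Ix" using assms by (auto simp: Ix_def)
  obtain k where k: "\<forall>t. pe (Rm (i - 1) i h t) P = pe t P + \<kappa> k" using shift[OF I] by blast
  have A: "pe (t((i - 1, i) := t (i - 1, i) + \<kappa> h)) P = pe t P + \<kappa> k" for t
  proof -
    have "agree 1 (Rm (i - 1) i h t) (t((i - 1, i) := t (i - 1, i) + \<kappa> h))"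
      using assms by (auto simp: agree_def Rm_def uent_def wt_def Ix_def)
    then have "pe (Rm (i - 1) i h t) P = pe (t((i - 1, i) := t (i - 1, i) + \<kappa> h)) P"
      by (intro depends_shallow[of 1 d]) auto
    then show ?thesis using k by metis
  qed
  have "poly (gp i) (\<kappa> h) = \<kappa> k" using A[of "\<lambda>_. 0"] by (simp add: gp)
  then show "pe (t((i - 1, i) := t (i - 1, i) + \<kappa> h)) P = pe t P + poly (gp i) (\<kappa> h)"
    and "poly (gp i) (\<kappa> h) \<in> range \<kappa>" using A by auto
qed

text \<open>For constants x this is the cocycle; both sides are polynomials in x and there are
  infinitely many constants.\<close>

lemma shift_general:
  assumes "i \<in> {1..d}"
  shows "pe (t((i - 1, i) := x)) P = pe (t((i - 1, i) := 0)) P + poly (gp i) x"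
proof -
  obtain g where g: "\<forall>x. poly g x = pe (t((i - 1, i) := x)) P"
    using ex_univariate[OF rhom_id, of t "(i - 1, i)" P] by blast
  have "g = [:poly g 0:] + gp i"
  proof (rule poly_eq_if_eq_on_infinite[OF infinite_kappa])
    fix x assume "x \<in> range \<kappa>"
    then obtain h where h: "x = \<kappa> h" by auto
    show "poly g x = poly ([:poly g 0:] + gp i) x"
      using shift_shallow(1)[OF assms, of "t((i - 1, i) := 0)" h] g h by simp
  qed
  then have "poly g x = poly ([:poly g 0:] + gp i) x" by simp
  then show ?thesis using g by simp
qed

definition diagpt :: "nat set \<Rightarrow> (nat \<Rightarrow> 'b) \<Rightarrow> nat \<times> nat \<Rightarrow> 'b" where
  "diagpt B x v = (if snd v \<in> B \<and> fst v = snd v - 1 then x (snd v) else 0)"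

lemma diagpt_insert: "i \<notin> B \<Longrightarrow> diagpt (insert i B) x = (diagpt B x)((i - 1, i) := x i)"
  "i \<notin> B \<Longrightarrow> (diagpt B x)((i - 1, i) := 0) = diagpt B x"
  by (auto simp: diagpt_def fun_eq_iff)

lemma pe_diagpt:
  assumes "B \<subseteq> {1..d}"
  shows "pe (diagpt B x) P = pe (\<lambda>_. 0) P + (\<Sum>i\<in>B. poly (gp i) (x i))"
proof -
  have "finite B" using assms finite_subset by blast
  then show ?thesis using assms
  proof (induction B rule: finite_induct)
    case empty
    have "diagpt {} x = (\<lambda>_. 0)" by (auto simp: diagpt_def)
    then show ?case by simp
  next
    case (insert i B)
    have "pe (diagpt (insert i B) x) P = pe ((diagpt B x)((i - 1, i) := x i)) P"
      by (simp only: diagpt_insert(1)[OF insert(2)])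
    also have "\<dots> = pe (diagpt B x) P + poly (gp i) (x i)"
      using shift_general[of i "diagpt B x" "x i"] insert by (simp only: diagpt_insert(2)[OF insert(2)]) simp
    finally show ?case using insert by (simp add: algebra_simps)
  qed
qed

lemma pe_general: "pe t P = pe (\<lambda>_. 0) P + (\<Sum>i=1..d. poly (gp i) (t (i - 1, i)))"
proof -
  have "agree 1 t (diagpt {1..d} (\<lambda>i. t (i - 1, i)))"
  proof (unfold agree_def, intro ballI impI)
    fix v assume v: "v \<in> Ix" "wt v \<le> 1"
    obtain a b where ab: "v = (a, b)" by (cases v)
    have "b = Suc a" "b \<le> d" using v by (auto simp: ab Ix_def wt_def)
    then show "t v = diagpt {1..d} (\<lambda>i. t (i - 1, i)) v" by (simp add: diagpt_def ab)
  qed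
  then have "pe t P = pe (diagpt {1..d} (\<lambda>i. t (i - 1, i))) P"
    by (intro depends_shallow[of 1 d]) auto
  then show ?thesis by (simp add: pe_diagpt)
qed

text \<open>The polynomials \<open>gp i\<close> take constants to constants, hence have constant coefficients.\<close>
lemma gp_coeffs: "i \<in> {1..d} \<Longrightarrow> map_poly \<sigma> (gp i) = gp i"
proof (rule poly_eq_if_eq_on_infinite[OF infinite_kappa])
  fix x assume i: "i \<in> {1..d}" and "x \<in> range \<kappa>"
  then obtain h where h: "x = \<kappa> h" by auto
  have "poly (map_poly \<sigma> (gp i)) (\<sigma> x) = \<sigma> (poly (gp i) x)" by (rule poly_map_poly_rhom[OF hom(1)])
  moreover obtain k where "poly (gp i) x = \<kappa> k" using shift_shallow(2)[OF i, of h] h by auto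
  ultimately show "poly (map_poly \<sigma> (gp i)) x = poly (gp i) x" by (simp add: h sigma_kappa)
qed

lemma gp_power:
  assumes "i \<in> {1..d}" "coeff (gp i) j \<noteq> 0"
  shows "\<exists>m. j = CHAR('b) ^ m"
proof (rule coeff_0_if_power_additive[OF infinite_kappa _ _ _ char assms(2)])
  show "0 \<in> range \<kappa>" using rhom_0[OF hom(4)] by (metis rangeI)
  fix x y assume "x \<in> range \<kappa>" "y \<in> range \<kappa>"
  then obtain h k where hk: "x = \<kappa> h" "y = \<kappa> k" by auto
  show "x + y \<in> range \<kappa>" by (simp add: hk flip: rhom_add[OF hom(4)])
  show "poly (gp i) (x + y) = poly (gp i) x + poly (gp i) y"
    using shift_shallow(1)[OF assms(1), of "(\<lambda>_. 0)((i - 1, i) := x)" k] gp[of i x] gp[of i "x + y"] hk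
    by simp
qed

text \<open>For a point with entries in the constants, \<sigma> commutes with evaluation and fixes
  the values of the \<open>gp\<close>. The entries are then freed one by one, each time by a
  polynomial identity valid at infinitely many constants; \<open>B'\<close> holds the entries freed
  so far.\<close>

lemma sigma_relation:
  assumes "B \<subseteq> {1..d}" "B' \<subseteq> B" "\<And>i. i \<in> B - B' \<Longrightarrow> x i \<in> range \<kappa>"
  shows "meval \<sigma> (diagpt B x) P = \<sigma> (pe (\<lambda>_. 0) P) + (\<Sum>i\<in>B. poly (gp i) (x i))"
proof -
  have finB: "finite B" using assms finite_subset by blast
  then have "finite B'" using assms(2) finite_subset by blast
  then show ?thesis using assms(2,3)
  proof (induction B' arbitrary: x rule: finite_induct)
    case empty
    have "\<forall>i\<in>B. \<exists>k. x i = \<kappa> k" using empty by auto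
    then obtain k where k: "\<forall>i\<in>B. x i = \<kappa> (k i)" by metis
    have "\<sigma> (diagpt B x v) = diagpt B x v" for v
      using k by (auto simp: diagpt_def sigma_kappa rhom_0[OF hom(1)])
    then have "meval \<sigma> (diagpt B x) P = \<sigma> (pe (diagpt B x) P)"
      using rhom_comp_meval[OF hom(1), of "\<lambda>x. x" "diagpt B x" P] by simp
    also have "\<dots> = \<sigma> (pe (\<lambda>_. 0) P) + (\<Sum>i\<in>B. \<sigma> (poly (gp i) (x i)))"
      by (simp add: pe_diagpt[OF assms(1)] rhom_simps[OF hom(1)])
    also have "(\<Sum>i\<in>B. \<sigma> (poly (gp i) (x i))) = (\<Sum>i\<in>B. poly (gp i) (x i))"
    proof (intro sum.cong refl)
      fix i assume i: "i \<in> B"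
      have "i \<in> {1..d}" using i assms(1) by blast
      then have "poly (gp i) (x i) \<in> range \<kappa>" using shift_shallow(2)[of i "k i"] k i by simp
      then obtain k' where "poly (gp i) (x i) = \<kappa> k'" by blast
      then show "\<sigma> (poly (gp i) (x i)) = poly (gp i) (x i)" by (simp add: sigma_kappa)
    qed
    finally show ?case .
  next
    case (insert i0 B')
    have i0: "i0 \<in> B" using insert by auto
    obtain g where g: "\<forall>y. poly g y = meval \<sigma> ((diagpt B x)((i0 - 1, i0) := y)) P"
      using ex_univariate[OF hom(1), of "diagpt B x" "(i0 - 1, i0)" P] by blast
    have D: "(diagpt B x)((i0 - 1, i0) := y) = diagpt B (x(i0 := y))" for y
      using i0 by (auto simp: diagpt_def fun_eq_iff)
    have G: "poly g y = meval \<sigma> (diagpt B (x(i0 := y))) P" for y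
      using g by (simp only: D)
    have S: "(\<Sum>i\<in>B. poly (gp i) ((x(i0 := y)) i)) = (\<Sum>i\<in>B - {i0}. poly (gp i) (x i)) + poly (gp i0) y" for y
      using i0 finB by (subst sum.remove[of _ i0]) (auto intro!: sum.cong simp: add.commute)
    have "g = [:\<sigma> (pe (\<lambda>_. 0) P) + (\<Sum>i\<in>B - {i0}. poly (gp i) (x i)):] + gp i0"
    proof (rule poly_eq_if_eq_on_infinite[OF infinite_kappa])
      fix y assume y: "y \<in> range \<kappa>"
      have "meval \<sigma> (diagpt B (x(i0 := y))) P = \<sigma> (pe (\<lambda>_. 0) P) + (\<Sum>i\<in>B. poly (gp i) ((x(i0 := y)) i))"
        by (rule insert.IH) (use insert y in auto)
      then have "poly g y = \<sigma> (pe (\<lambda>_. 0) P) + ((\<Sum>i\<in>B - {i0}. poly (gp i) (x i)) + poly (gp i0) y)"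
        unfolding G S .
      then show "poly g y = poly ([:\<sigma> (pe (\<lambda>_. 0) P) + (\<Sum>i\<in>B - {i0}. poly (gp i) (x i)):] + gp i0) y"
        by simp
    qed
    then have "poly g (x i0) = \<sigma> (pe (\<lambda>_. 0) P) + (\<Sum>i\<in>B - {i0}. poly (gp i) (x i)) + poly (gp i0) (x i0)" by simp
    then show ?case unfolding G using S[of "x i0"] by simp
  qed
qed

text \<open>The identity \<Phi> P = P read at the identity matrix, which the substitution moves to
  the matrix with superdiagonal e.\<close>

lemma constant_relation: "pe (\<lambda>_. 0) P = \<sigma> (pe (\<lambda>_. 0) P) + (\<Sum>i=1..d. poly (gp i) (e i))"
proof -
  have "pe (\<lambda>_. 0) (Sv v) = diagpt {1..d} e v" if "v \<in> Ix" for v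
    using that by (cases v) (auto simp: Sv_def diagpt_def Ix_def rhom_simps[OF rhom_pe] uent_hom[OF rhom_pe] uent_def rhom_id)
  then have K: "pe (\<lambda>_. 0) (kill (Sv v)) = diagpt {1..d} e v" for v
  proof (cases "v \<in> Ix")
    case True
    then show ?thesis using \<open>v \<in> Ix \<Longrightarrow> pe (\<lambda>_. 0) (Sv v) = diagpt {1..d} e v\<close> by (simp add: kill_Sv)
  next
    case False
    then show ?thesis by (cases v) (auto simp: kill_Sv rhom_0[OF rhoms(2)] diagpt_def Ix_def)
  qed
  have "pe (\<lambda>_. 0) P = pe (\<lambda>_. 0) (kill (\<Phi> P))" using P by simp
  also have "\<dots> = meval \<sigma> (diagpt {1..d} e) P"
    unfolding Phi_eq[of P] kill_meval pe_meval K ..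
  also have "\<dots> = \<sigma> (pe (\<lambda>_. 0) P) + (\<Sum>i=1..d. poly (gp i) (e i))"
    by (rule sigma_relation[of _ "{1..d}"]) auto
  finally show ?thesis .
qed

lemma gp_expansion:
  "\<exists>b J. \<forall>i\<in>{1..d}. (gp i \<noteq> 0 \<longrightarrow> (\<exists>j<J. b i j \<noteq> 0)) \<and> (\<forall>x. poly (gp i) x = (\<Sum>j<J. \<kappa> (b i j) * x ^ (CHAR('b) ^ j)))"
proof -
  let ?p = "CHAR('b)"
  have p1: "?p > 1" using char prime_gt_1_nat by blast
  have "\<exists>k. \<kappa> k = coeff (gp i) j" if "i \<in> {1..d}" for i j
  proof -
    have "\<sigma> (coeff (gp i) j) = coeff (gp i) j"
      using gp_coeffs[OF that] by (metis coeff_map_poly rhom_0[OF hom(1)])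
    then have "s (\<rho> (coeff (gp i) j)) = \<rho> (coeff (gp i) j)" by (metis rho_sigma)
    then show ?thesis using fixed rho_inj by metis
  qed
  then obtain k where k: "\<And>i j. i \<in> {1..d} \<Longrightarrow> \<kappa> (k i j) = coeff (gp i) j" by metis
  define D where "D = Max (insert 0 ((\<lambda>i. degree (gp i)) ` {1..d}))"
  have D: "degree (gp i) \<le> D" if "i \<in> {1..d}" for i
    unfolding D_def using that by (intro Max_ge) auto
  \<comment> \<open>Hence every power p^m up to the maximal degree D has m < D + 1, and
    \<open>Suc D\<close> terms suffice.\<close>
  have big: "j < ?p ^ j" for j using power_gt_expt[of ?p j] p1 by simp
  define b where "b i j = k i (?p ^ j)" for i j
  have "poly (gp i) x = (\<Sum>j<Suc D. \<kappa> (b i j) * x ^ (?p ^ j))" if i: "i \<in> {1..d}" for i x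
  proof -
    have "poly (gp i) x = (\<Sum>j\<in>{..degree (gp i)}. coeff (gp i) j * x ^ j)" by (rule poly_altdef)
    also have "\<dots> = (\<Sum>j\<in>(\<lambda>j. ?p ^ j) ` {..<Suc D}. coeff (gp i) j * x ^ j)"
    proof (rule sum.mono_neutral_cong)
      fix j assume j: "j \<in> {..degree (gp i)} - (\<lambda>j. ?p ^ j) ` {..<Suc D}"
      have "coeff (gp i) j = 0"
      proof (rule ccontr)
        assume "coeff (gp i) j \<noteq> 0"
        then obtain m where m: "j = ?p ^ m" using gp_power[OF i] by blast
        then have "m < j" using big by simp
        then have "m < Suc D" using j D[OF i] by simp
        then show False using j m by blast
      qed
      then show "coeff (gp i) j * x ^ j = 0" by simp
    qed (auto simp: coeff_eq_0)
    also have "\<dots> = (\<Sum>j<Suc D. coeff (gp i) (?p ^ j) * x ^ (?p ^ j))"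
      using p1 by (subst sum.reindex) (auto intro!: inj_onI dest: power_inject_exp)
    also have "\<dots> = (\<Sum>j<Suc D. \<kappa> (b i j) * x ^ (?p ^ j))"
      using k[OF i] by (simp add: b_def)
    finally show ?thesis .
  qed
  moreover have "\<exists>j<Suc D. b i j \<noteq> 0" if "i \<in> {1..d}" "gp i \<noteq> 0" for i
  proof (rule ccontr)
    assume "\<not> (\<exists>j<Suc D. b i j \<noteq> 0)"
    then have "poly (gp i) x = 0" for x
      using calculation[OF that(1), of x] by (simp add: rhom_0[OF hom(4)])
    then have "gp i = 0" by (metis poly_eq_if_eq_on_infinite[OF infinite_kappa] poly_0)
    then show False using that by simp
  qed
  ultimately show ?thesis by blast
qed

text \<open>Otherwise P would take one value at all points, and over an infinite field it would be a
  constant polynomial.\<close>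

lemma gp_nonzero: "\<exists>i\<in>{1..d}. gp i \<noteq> 0"
proof (rule ccontr)
  assume "\<not> ?thesis"
  then have c: "pe t P = pe (\<lambda>_. 0) P" for t using pe_general[of t] by simp
  define c0 where "c0 = pe (\<lambda>_. 0) P"
  have z: "pe t (P - mC c0) = 0" for t
    using c[of t] rhom_diff[OF rhom_pe, of t P "mC c0"] by (simp add: rhom_id c0_def)
  have "infinite (UNIV :: 'b set)" using infinite_kappa by (metis finite_subset subset_UNIV)
  then have "P - mC c0 = 0" using mpol_nonvanishing[of "P - mC c0"] z by metis
  then show False using P(1) by auto
qed

end

text \<open>Here r is the value of the minimal relation at the identity matrix, and the exponents
  are powers of p because the \<open>gp\<close> are additive.\<close>

theorem relation_imp_additive_relation:
  assumes "P0 \<noteq> 0" "kill P0 = P0" "ev P0 = 0"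
  shows "\<exists>r b J. (\<exists>i\<in>{1..d}. \<exists>j<J. b i j \<noteq> 0) \<and>
    r = \<sigma> r + (\<Sum>i=1..d. \<Sum>j<J. \<kappa> (b i j) * e i ^ (CHAR('b) ^ j))"
proof (rule minimal_relation[OF assms])
  fix P
  assume P: "P \<notin> range mC" "kill P = P" "\<Phi> P = P"
    "\<And>c b h. (c, b) \<in> Ix \<Longrightarrow> \<exists>k. \<Gamma> c b h P = P + mC (\<kappa> k)"
  obtain b J where b: "\<forall>i\<in>{1..d}. (gp P i \<noteq> 0 \<longrightarrow> (\<exists>j<J. b i j \<noteq> 0)) \<and>
      (\<forall>x. poly (gp P i) x = (\<Sum>j<J. \<kappa> (b i j) * x ^ (CHAR('b) ^ j)))"
    using gp_expansion[OF P] by blast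
  have "pe (\<lambda>_. 0) P = \<sigma> (pe (\<lambda>_. 0) P) + (\<Sum>i=1..d. \<Sum>j<J. \<kappa> (b i j) * e i ^ (CHAR('b) ^ j))"
    using constant_relation[OF P] b by simp
  moreover have "\<exists>i\<in>{1..d}. \<exists>j<J. b i j \<noteq> 0" using gp_nonzero[OF P] b by blast
  ultimately show ?thesis by blast
qed

lemma kill_eq_self:
  assumes "\<And>m. m \<in> keys Q \<Longrightarrow> keys m \<subseteq> Ix"
  shows "kill Q = Q"
proof -
  have "kill Q = meval mC mX Q"
    unfolding kill_def meval_def using assms
    by (intro sum.cong refl arg_cong2[where f = "(*)"] mon_cong) auto
  then show ?thesis by (simp add: meval_mC_mX)
qed

end

section \<open>Germs of sequences\<close>

quotient_type 'k germ = "nat \<Rightarrow> 'k" / "\<lambda>f g. eventually (\<lambda>k. f k = g k) sequentially"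
  morphisms rep_germ germ
proof (rule equivpI)
  show "reflp (\<lambda>f g. eventually (\<lambda>k. f k = g k) sequentially)" by (auto simp: reflp_def)
  show "symp (\<lambda>f g. eventually (\<lambda>k. f k = g k) sequentially)"
    by (auto simp: symp_def elim: eventually_mono)
  show "transp (\<lambda>f g. eventually (\<lambda>k. f k = g k) sequentially)"
    by (auto simp: transp_def elim: eventually_elim2)
qed

instantiation germ :: (comm_ring_1) comm_ring_1
begin
lift_definition zero_germ :: "'a germ" is "\<lambda>_. 0" .
lift_definition one_germ :: "'a germ" is "\<lambda>_. 1" .
lift_definition plus_germ :: "'a germ \<Rightarrow> 'a germ \<Rightarrow> 'a germ" is "\<lambda>f g k. f k + g k"
  by (auto elim: eventually_elim2)
lift_definition times_germ :: "'a germ \<Rightarrow> 'a germ \<Rightarrow> 'a germ" is "\<lambda>f g k. f k * g k"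
  by (auto elim: eventually_elim2)
lift_definition uminus_germ :: "'a germ \<Rightarrow> 'a germ" is "\<lambda>f k. - f k"
  by (auto elim: eventually_mono)
lift_definition minus_germ :: "'a germ \<Rightarrow> 'a germ \<Rightarrow> 'a germ" is "\<lambda>f g k. f k - g k"
  by (auto elim: eventually_elim2)
instance
  by standard (transfer, auto simp: algebra_simps)+
end

lift_definition germ_shift :: "'k germ \<Rightarrow> 'k germ" is "\<lambda>f k. f (Suc k)"
proof -
  fix f g :: "nat \<Rightarrow> 'k" assume "\<forall>\<^sub>F k in sequentially. f k = g k"
  then show "\<forall>\<^sub>F k in sequentially. f (Suc k) = g (Suc k)"
    using eventually_sequentially_Suc[of "\<lambda>k. f k = g k"] by blast
qed

lemma germ_eq_iff: "germ f = germ g \<longleftrightarrow> eventually (\<lambda>k. f k = g k) sequentially"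
  by (rule germ.abs_eq_iff)

lemma germ_ops:
  fixes f g :: "nat \<Rightarrow> 'k::comm_ring_1"
  shows "germ f + germ g = germ (\<lambda>k. f k + g k)" "germ f * germ g = germ (\<lambda>k. f k * g k)"
    "germ_shift (germ h) = germ (\<lambda>k. h (Suc k))" "0 = germ (\<lambda>_. 0::'k)" "1 = germ (\<lambda>_. 1::'k)"
  by (simp_all add: plus_germ.abs_eq times_germ.abs_eq germ_shift.abs_eq zero_germ.abs_eq one_germ.abs_eq)

lemma germ_cases: obtains f where "x = germ f"
proof -
  have "\<exists>f. x = germ f" by (rule germ.abs_induct[of "\<lambda>x. \<exists>f. x = germ f"]) auto
  then show thesis using that by blast
qed

lemma rhom_germ_shift: "rhom (germ_shift :: 'k::comm_ring_1 germ \<Rightarrow> 'k germ)"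
proof (rule rhomI)
  show "germ_shift (1 :: 'k germ) = 1" by (simp add: germ_ops)
  fix x y :: "'k germ"
  obtain f where x: "x = germ f" by (rule germ_cases)
  obtain g where y: "y = germ g" by (rule germ_cases)
  show "germ_shift (x + y) = germ_shift x + germ_shift y" "germ_shift (x * y) = germ_shift x * germ_shift y"
    by (simp_all add: x y germ_ops)
qed

lemma germ_shift_eq_0: "germ_shift x = 0 \<Longrightarrow> x = (0 :: 'k::comm_ring_1 germ)"
proof -
  assume 0: "germ_shift x = 0"
  obtain f where x: "x = germ f" by (rule germ_cases)
  show "x = 0" using 0 eventually_sequentially_Suc[of "\<lambda>k. f k = 0"] by (simp add: x germ_ops germ_eq_iff)
qed

text \<open>This identifies the constants of the difference ring: a shift-invariant sequence is
  eventually constant.\<close>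

lemma germ_shift_fixed:
  assumes "germ_shift x = x" shows "\<exists>c. x = germ (\<lambda>_. c)"
proof -
  obtain f where x: "x = germ f" by (rule germ_cases)
  have "eventually (\<lambda>k. f (Suc k) = f k) sequentially"
    using assms by (simp add: x germ_shift.abs_eq germ_eq_iff)
  then obtain N where N: "\<And>k. k \<ge> N \<Longrightarrow> f (Suc k) = f k" by (auto simp: eventually_sequentially)
  have "f k = f N" if "k \<ge> N" for k
    using that by (induction k rule: dec_induct) (auto simp: N)
  then show ?thesis unfolding x germ_eq_iff eventually_sequentially by blast
qed

lemma rhom_germ_const: "rhom (\<lambda>c::'k::comm_ring_1. germ (\<lambda>_. c))"
  by (rule rhomI) (simp_all add: germ_ops)

lemma germ_power: "germ f ^ n = germ (\<lambda>k. f k ^ n)" for f :: "nat \<Rightarrow> 'k::comm_ring_1"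
  by (induction n) (simp_all add: germ_ops)

lemma germ_sum: "(\<Sum>x\<in>A. germ (f x)) = germ (\<lambda>k. \<Sum>x\<in>A. f x k)" for f :: "'i \<Rightarrow> nat \<Rightarrow> 'k::comm_ring_1"
  by (induction A rule: infinite_finite_induct) (simp_all add: germ_ops)

lemma germ_prod: "(\<Prod>x\<in>A. germ (f x)) = germ (\<lambda>k. \<Prod>x\<in>A. f x k)" for f :: "'i \<Rightarrow> nat \<Rightarrow> 'k::comm_ring_1"
  by (induction A rule: infinite_finite_induct) (simp_all add: germ_ops)

lemma germ_dvd_1:
  fixes f :: "nat \<Rightarrow> 'k::field"
  assumes "eventually (\<lambda>k. f k \<noteq> 0) sequentially"
  shows "germ f dvd 1"
proof (rule dvdI)
  have "eventually (\<lambda>k. 1 = f k * inverse (f k)) sequentially"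
    using assms by eventually_elim simp
  then show "1 = germ f * germ (\<lambda>k. inverse (f k))" by (simp add: germ_ops germ_eq_iff)
qed

section \<open>Polynomial and rational functions in two variables\<close>

definition peval :: "('k::zero \<Rightarrow> 's::comm_ring_1) \<Rightarrow> 's \<Rightarrow> 'k poly \<Rightarrow> 's" where
  "peval h y P = poly (map_poly h P) y"

lemma peval_0 [simp]: "peval h y 0 = 0"
  by (simp add: peval_def)

lemma peval_pCons: "h 0 = 0 \<Longrightarrow> peval h y (pCons a P) = h a + y * peval h y P"
  by (simp add: peval_def map_poly_pCons)

lemma peval_altdef:
  assumes "h 0 = 0" shows "peval h y P = (\<Sum>i\<le>degree P. h (coeff P i) * y ^ i)"
proof -
  have "peval h y P = (\<Sum>i\<le>degree (map_poly h P). h (coeff P i) * y ^ i)"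
    using assms by (simp add: peval_def poly_altdef coeff_map_poly)
  also have "\<dots> = (\<Sum>i\<le>degree P. h (coeff P i) * y ^ i)"
  proof (rule sum.mono_neutral_left)
    show "{..degree (map_poly h P)} \<subseteq> {..degree P}"
      by (auto intro!: degree_le intro: order_trans simp: coeff_map_poly assms coeff_eq_0)
    show "\<forall>i\<in>{..degree P} - {..degree (map_poly h P)}. h (coeff P i) * y ^ i = 0"
      using coeff_map_poly[of h P] assms by (metis DiffD2 atMost_iff coeff_eq_0 mult_zero_left not_le)
  qed simp
  finally show ?thesis .
qed

lemma rhom_peval:
  fixes h :: "'k::comm_ring_1 \<Rightarrow> 's::comm_ring_1"
  assumes h: "rhom h" shows "rhom (peval h y)"
proof (rule rhomI)
  note [simp] = peval_pCons[of h, OF rhom_0[OF h]] rhom_simps[OF h]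
  show "peval h y 1 = 1" by (simp add: one_pCons)
  show add: "peval h y (P + Q) = peval h y P + peval h y Q" for P Q
    by (induction P Q rule: poly_induct2) (simp_all add: algebra_simps)
  have smult: "peval h y (smult c P) = h c * peval h y P" for c P
    by (induction P) (simp_all add: algebra_simps)
  show "peval h y (P * Q) = peval h y P * peval h y Q" for P Q
    by (induction P) (simp_all add: add smult algebra_simps)
qed

lemma rhom_comp_peval:
  fixes h :: "'k::comm_ring_1 \<Rightarrow> 's::comm_ring_1"
  assumes g: "rhom g" and h: "rhom h" shows "g (peval h y P) = peval (\<lambda>c. g (h c)) (g y) P"
  by (induction P) (simp_all add: peval_pCons rhom_simps[OF g] rhom_0[OF h])

lemma peval_const [simp]: "rhom h \<Longrightarrow> peval h y [:c:] = h c"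
  by (simp add: peval_pCons rhom_0)

lemma peval_X [simp]: "rhom h \<Longrightarrow> peval h y [:0, 1:] = y"
  by (simp add: peval_pCons rhom_0 rhom_1)

lemma pcompose_peval: "pcompose P Q = peval (\<lambda>c. [:c:]) Q P"
  by (simp add: peval_def pcompose_altdef)

lemma rhom_peval_ext:
  fixes f :: "'k::comm_ring_1 poly \<Rightarrow> 's::comm_ring_1"
  assumes "rhom f" shows "f P = peval (\<lambda>c. f [:c:]) (f [:0, 1:]) P"
proof -
  have c: "rhom (\<lambda>c. f [:c:])" by (rule rhom_comp[OF rhom_const_poly assms])
  show ?thesis
  proof (induction P)
    case (pCons a P)
    have "f (pCons a P) = f ([:a:] + [:0, 1:] * P)" by simp
    then show ?case using pCons by (simp only: rhom_add[OF assms] rhom_mult[OF assms] peval_pCons[of "\<lambda>c. f [:c:]", OF rhom_0[OF c]])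
  qed (simp add: rhom_0[OF assms])
qed

definition ev2 :: "('k::comm_ring_1 \<Rightarrow> 's::comm_ring_1) \<Rightarrow> 's \<Rightarrow> 's \<Rightarrow> 'k poly poly \<Rightarrow> 's" where
  "ev2 c u l = peval (peval c u) l"

lemma rhom_ev2: "rhom c \<Longrightarrow> rhom (ev2 c u l)"
  unfolding ev2_def by (intro rhom_peval)

lemma rhom_comp_ev2:
  assumes "rhom g" "rhom c" shows "g (ev2 c u l P) = ev2 (\<lambda>x. g (c x)) (g u) (g l) P"
proof -
  have "(\<lambda>x. g (peval c u x)) = peval (\<lambda>x. g (c x)) (g u)"
    using rhom_comp_peval[OF assms] by blast
  then show ?thesis unfolding ev2_def using rhom_comp_peval[OF assms(1) rhom_peval[OF assms(2)], of u l P] by simp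
qed

lemma rhom_ev2_ext:
  fixes f :: "'k::comm_ring_1 poly poly \<Rightarrow> 's::comm_ring_1"
  assumes "rhom f" shows "f P = ev2 (\<lambda>c. f [:[:c:]:]) (f [:[:0, 1:]:]) (f [:0, 1:]) P"
proof -
  have "rhom (\<lambda>p. f [:p:])" by (rule rhom_comp[OF rhom_const_poly assms])
  then have "(\<lambda>p. f [:p:]) = peval (\<lambda>c. f [:[:c:]:]) (f [:[:0, 1:]:])"
    using rhom_peval_ext[of "\<lambda>p. f [:p:]"] by blast
  then show ?thesis unfolding ev2_def using rhom_peval_ext[OF assms, of P] by simp
qed

lemma ev2_values [simp]:
  assumes "rhom c" shows "ev2 c u l [:[:x:]:] = c x" "ev2 c u l [:[:0, 1:]:] = u" "ev2 c u l [:0, 1:] = l"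
  using assms rhom_peval[OF assms, of u] by (simp_all add: ev2_def)

type_synonym 'k rat2 = "'k poly poly fract"

text \<open>\<open>rU\<close> and \<open>rL\<close> stand for \<open>\<theta>\<^bsup>q\<^sup>k\<^esup>\<close> and \<open>L\<^sub>k\<close>.\<close>
definition rC :: "'k::field \<Rightarrow> 'k rat2" where "rC c = Fract [:[:c:]:] 1"
definition rU :: "'k::field rat2" where "rU = Fract [:[:0, 1:]:] 1"
definition rL :: "'k::field rat2" where "rL = Fract [:0, 1:] 1"

lemma rhom_rC: "rhom rC"
  unfolding rC_def by (rule rhom_comp[OF rhom_comp[OF rhom_const_poly rhom_const_poly] rhom_Fract_1])

lemma rU_nonzero: "rU \<noteq> 0" and rL_nonzero: "rL \<noteq> 0"
  by (simp_all add: rU_def rL_def Zero_fract_def eq_fract)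

definition rat2_hom :: "('k::field \<Rightarrow> 's::comm_ring_1) \<Rightarrow> 's \<Rightarrow> 's \<Rightarrow> 'k rat2 \<Rightarrow> 's" where
  "rat2_hom c u l = fract_lift (ev2 c u l)"

lemma rat2_hom:
  assumes "rhom c" "\<And>P. P \<noteq> 0 \<Longrightarrow> ev2 c u l P dvd 1"
  shows "rhom (rat2_hom c u l)" "rat2_hom c u l (rC x) = c x" "rat2_hom c u l rU = u" "rat2_hom c u l rL = l"
    "rat2_hom c u l (Fract P 1) = ev2 c u l P"
proof -
  have h: "rhom (ev2 c u l)" by (rule rhom_ev2[OF assms(1)])
  show "rhom (rat2_hom c u l)" unfolding rat2_hom_def by (rule rhom_fract_lift[OF h assms(2)])
  show *: "rat2_hom c u l (Fract P 1) = ev2 c u l P" for P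
    unfolding rat2_hom_def by (rule fract_lift_of[OF h assms(2)])
  show "rat2_hom c u l (rC x) = c x" "rat2_hom c u l rU = u" "rat2_hom c u l rL = l"
    by (simp_all add: rC_def rU_def rL_def * assms(1))
qed

text \<open>Scalars, U and L generate the field; as the target is a mere ring, images of inverses
  are compared through products equal to 1.\<close>

lemma rat2_hom_ext:
  fixes f g :: "'k::field rat2 \<Rightarrow> 's::comm_ring_1"
  assumes f: "rhom f" and g: "rhom g"
    and eq: "\<And>c. f (rC c) = g (rC c)" "f rU = g rU" "f rL = g rL"
  shows "f x = g x"
proof -
  have E: "f (Fract P 1) = g (Fract P 1)" for P
    using rhom_ev2_ext[OF rhom_comp[OF rhom_Fract_1 f], of P] rhom_ev2_ext[OF rhom_comp[OF rhom_Fract_1 g], of P] eq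
    by (simp add: rC_def rU_def rL_def)
  obtain a b where x: "x = Fract a b" "b \<noteq> 0" by (cases x) auto
  have xb: "x * Fract b 1 = Fract a 1" using x by (simp add: eq_fract)
  have b1: "Fract b 1 * Fract 1 b = 1" using x by (simp add: One_fract_def eq_fract)
  have "f x = f (x * Fract b 1) * f (Fract 1 b)"
    using b1 by (simp add: rhom_mult[OF f, symmetric] mult.assoc)
  moreover have "f (Fract 1 b) = g (Fract 1 b)"
  proof -
    have "f (Fract 1 b) = f (Fract 1 b) * g (Fract b 1 * Fract 1 b)" using b1 rhom_1[OF g] by simp
    also have "\<dots> = f (Fract 1 b * Fract b 1) * g (Fract 1 b)"
      using E[of b] by (simp add: rhom_mult[OF g] rhom_mult[OF f] mult_ac del: mult_fract)
    also have "\<dots> = g (Fract 1 b)" using b1 rhom_1[OF f] by (simp add: mult.commute del: mult_fract)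
    finally show ?thesis .
  qed
  moreover have "g x = g (x * Fract b 1) * g (Fract 1 b)"
    using b1 by (simp add: rhom_mult[OF g, symmetric] mult.assoc)
  ultimately show ?thesis using E[of a] xb by simp
qed

section \<open>The rational function field and its valuation at the origin\<close>

definition tvar :: "'a::field poly fract" where "tvar = Fract [:0, 1:] 1"

definition lau :: "'a::field poly fract \<Rightarrow> 'a fls" where
  "lau = fract_lift (\<lambda>p. fps_to_fls (fps_of_poly p))"

lemma rhom_fls_of_poly: "rhom (\<lambda>p::'a::field poly. fps_to_fls (fps_of_poly p))"
  by (rule rhomI) (simp_all add: fps_of_poly_add fps_of_poly_mult fls_times_fps_to_fls)

lemma rhom_lau: "rhom (lau :: 'a::field poly fract \<Rightarrow> 'a fls)"
  and lau_tvar: "lau (tvar :: 'a poly fract) = fls_X"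
proof -
  have u: "fps_to_fls (fps_of_poly p) dvd 1" if "p \<noteq> 0" for p :: "'a poly"
    using that by (simp add: dvd_field_iff)
  show "rhom (lau :: 'a poly fract \<Rightarrow> _)" unfolding lau_def by (rule rhom_fract_lift[OF rhom_fls_of_poly u])
  have "lau tvar = fps_to_fls (fps_of_poly [:0, 1::'a:])"
    unfolding lau_def tvar_def by (rule fract_lift_of[OF rhom_fls_of_poly u])
  then show "lau tvar = (fls_X :: 'a fls)" by (simp add: fps_of_poly_fps_X)
qed

lemma lau_eq_0_iff: "lau x = 0 \<longleftrightarrow> x = 0"
  by (rule rhom_field_eq_0_iff[OF rhom_lau])

lemma fls_sum_nonzero:
  fixes f :: "'i \<Rightarrow> 'a::field fls"
  assumes "finite A" "x0 \<in> A" "f x0 \<noteq> 0"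
    "\<And>x. x \<in> A \<Longrightarrow> x \<noteq> x0 \<Longrightarrow> f x = 0 \<or> fls_subdegree (f x) > fls_subdegree (f x0)"
  shows "sum f A \<noteq> 0"
proof
  assume "sum f A = 0"
  then have "0 = (\<Sum>x\<in>A. fls_nth (f x) (fls_subdegree (f x0)))" by (metis fls_nth_sum fls_zero_nth)
  also have "\<dots> = fls_nth (f x0) (fls_subdegree (f x0)) + (\<Sum>x\<in>A - {x0}. fls_nth (f x) (fls_subdegree (f x0)))"
    using assms(1,2) by (rule sum.remove)
  also have "(\<Sum>x\<in>A - {x0}. fls_nth (f x) (fls_subdegree (f x0))) = 0"
    using assms(4) by (intro sum.neutral) fastforce
  finally show False using assms(3) by simp
qed

lemma eventually_linear_less_power:
  assumes "q \<ge> (2::nat)"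
  shows "eventually (\<lambda>k. A + B * int k < int q ^ k) sequentially"
proof -
  have "(\<lambda>k. real_of_int \<bar>A\<bar> * (1/2) ^ k + real_of_int \<bar>B\<bar> * (of_nat k * (1/2) ^ k)) \<longlonglongrightarrow> real_of_int \<bar>A\<bar> * 0 + real_of_int \<bar>B\<bar> * 0"
    by (intro tendsto_intros powser_times_n_limit_0 LIMSEQ_realpow_zero) auto
  then have "eventually (\<lambda>k. real_of_int \<bar>A\<bar> * (1/2) ^ k + real_of_int \<bar>B\<bar> * (of_nat k * (1/2) ^ k) < 1) sequentially"
    by (intro order_tendstoD(2)) auto
  then show ?thesis
  proof eventually_elim
    case (elim k)
    have "real_of_int \<bar>A\<bar> + real_of_int \<bar>B\<bar> * real k < 2 ^ k"
      using elim by (simp add: power_divide divide_simps)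
    then have "real_of_int (\<bar>A\<bar> + \<bar>B\<bar> * int k) < real_of_int (2 ^ k)" by simp
    then have "\<bar>A\<bar> + \<bar>B\<bar> * int k < 2 ^ k" by linarith
    moreover have "(2::int) ^ k \<le> int q ^ k" using assms by (intro power_mono) auto
    moreover have "A + B * int k \<le> \<bar>A\<bar> + \<bar>B\<bar> * int k"
      by (intro add_mono mult_right_mono) auto
    ultimately show ?case by linarith
  qed
qed

text \<open>Every factor theta - theta^(q^j) with j at least 1 has a simple zero at theta =
  0.\<close>

lemma subdegree_carlitz_L:
  assumes "q \<ge> 2"
  shows "fls_subdegree (lau (carlitz_L (tvar :: 'a::field poly fract) q k)) = int k"
    "lau (carlitz_L (tvar :: 'a poly fract) q k) \<noteq> 0"
proof -
  have f: "fls_subdegree (fls_X - fls_X ^ (q ^ j) :: 'a fls) = 1" if "j \<ge> 1" for j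
  proof -
    have "int q ^ j > 1" using assms that by (intro one_less_power) auto
    then show ?thesis by (intro fls_subdegree_eqI) (auto simp: fls_X_nth)
  qed
  then have nz: "(fls_X - fls_X ^ (q ^ j) :: 'a fls) \<noteq> 0" if "j \<ge> 1" for j using that by force
  have L: "lau (carlitz_L tvar q k) = (\<Prod>j\<in>{1..k}. (fls_X - fls_X ^ (q ^ j) :: 'a fls))" for k
    by (simp add: carlitz_L_def rhom_simps[OF rhom_lau] lau_tvar)
  show nz': "lau (carlitz_L (tvar :: 'a poly fract) q k) \<noteq> 0" for k unfolding L using nz by (simp add: prod_zero_iff)
  show "fls_subdegree (lau (carlitz_L (tvar :: 'a poly fract) q k)) = int k"
  proof (induction k)
    case (Suc k)
    have "lau (carlitz_L (tvar :: 'a poly fract) q (Suc k)) = lau (carlitz_L tvar q k) * (fls_X - fls_X ^ (q ^ Suc k))"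
      unfolding L by (simp add: mult.commute)
    then show ?case using Suc nz'[of k] nz[of "Suc k"] f[of "Suc k"] by simp
  qed (simp add: L)
qed

text \<open>At the place \<open>\<theta> = 0\<close> the orders of \<open>\<theta>\<^bsup>q\<^sup>k\<^esup>\<close> and \<open>L\<^sub>k\<close> are \<open>q\<^sup>k\<close> and \<open>k\<close>, so for large \<open>k\<close> a
  single monomial of a polynomial in the two dominates.\<close>
lemma two_variable_nonvanishing:
  fixes P :: "'a::field poly fract poly poly"
  assumes q: "q \<ge> 2" and P: "P \<noteq> 0" and c: "c \<noteq> 0"
  shows "eventually (\<lambda>k. ev2 (\<lambda>x. x) (tvar ^ (q ^ k)) (c * carlitz_L tvar q k) P \<noteq> 0) sequentially"
proof -
  define M where "M = Max (insert 0 ((\<lambda>j. degree (coeff P j)) ` {..degree P}))"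
  have M: "degree (coeff P j) \<le> M" for j
  proof (cases "j \<le> degree P")
    case True
    then show ?thesis unfolding M_def by (intro Max_ge) auto
  qed (simp add: coeff_eq_0)
  define a where "a = (\<lambda>(i, j). coeff (coeff P j) i)"
  define A where "A = {..M} \<times> {..degree P}"
  define t where "t k = (\<lambda>(i, j). a (i, j) * (tvar ^ (q ^ k)) ^ i * (c * carlitz_L tvar q k) ^ j)" for k
  have id: "rhom (\<lambda>x::'a poly fract. x)" by (rule rhomI) auto
  have S: "ev2 (\<lambda>x. x) (tvar ^ (q ^ k)) (c * carlitz_L tvar q k) P = sum (t k) A" for k
  proof -
    have "peval (\<lambda>x. x) u p = (\<Sum>i\<le>M. coeff p i * u ^ i)" if "degree p \<le> M" for u :: "'a poly fract" and p
      using that by (subst peval_altdef) (auto intro!: sum.mono_neutral_left le_degree)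
    then show ?thesis
      unfolding ev2_def A_def t_def
      by (subst peval_altdef) (auto simp: a_def M sum_distrib_right sum.swap[of _ "{..M}"] sum.cartesian_product[symmetric])
  qed
  define Z where "Z = {x \<in> A. a x \<noteq> 0}"
  have "Z \<noteq> {}"
  proof -
    have "coeff (lead_coeff P) (degree (lead_coeff P)) \<noteq> 0" using P by simp
    then have "(degree (lead_coeff P), degree P) \<in> Z" using M by (auto simp: Z_def A_def a_def)
    then show ?thesis by blast
  qed
  moreover have finZ: "finite Z" by (simp add: Z_def A_def)
  \<comment> \<open>The order on pairs is lexicographic: the least power of theta^(q^k) decides
    because q^k outgrows everything linear in k, and among equal ones the least power of L
    wins.\<close>
  ultimately have x0: "Min Z \<in> Z" "\<And>x. x \<in> Z \<Longrightarrow> Min Z \<le> x" by auto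
  obtain i0 j0 where ij0: "Min Z = (i0, j0)" by (cases "Min Z")
  define v where "v x = fls_subdegree (lau (a x))" for x
  define w where "w = fls_subdegree (lau c)"
  have T0: "lau (t k x) \<noteq> 0 \<longleftrightarrow> a x \<noteq> 0" for k x
  proof -
    have "(tvar :: 'a poly fract) \<noteq> 0" by (simp add: tvar_def Zero_fract_def eq_fract)
    moreover have "carlitz_L (tvar :: 'a poly fract) q k \<noteq> 0"
      using subdegree_carlitz_L(2)[OF q, where ?'a = 'a, of k] rhom_0[OF rhom_lau] by metis
    ultimately show ?thesis using c by (cases x) (auto simp: t_def lau_eq_0_iff)
  qed
  have T: "fls_subdegree (lau (t k (i, j))) = v (i, j) + int i * int q ^ k + int j * (w + int k)"
    if "a (i, j) \<noteq> 0" for k i j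
    using that c subdegree_carlitz_L[OF q, where ?'a = 'a, of k]
    by (simp add: t_def rhom_simps[OF rhom_lau] lau_tvar v_def w_def lau_eq_0_iff fls_subdegree_pow algebra_simps flip: power_mult)
  have "eventually (\<lambda>k. \<forall>x\<in>Z - {Min Z}. fls_subdegree (lau (t k x)) > fls_subdegree (lau (t k (Min Z)))) sequentially"
  proof (rule eventually_ball_finite, use finZ in simp, rule ballI)
    fix x assume x: "x \<in> Z - {Min Z}"
    obtain i j where ij: "x = (i, j)" by (cases x)
    have az: "a (i, j) \<noteq> 0" "a (i0, j0) \<noteq> 0" using x x0(1) ij ij0 by (auto simp: Z_def)
    have "(i0, j0) \<le> (i, j)" "(i, j) \<noteq> (i0, j0)" using x x0(2)[of x] ij ij0 by auto
    then have "i0 < i \<or> i = i0 \<and> j0 < j" by (auto simp: less_le)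
    then consider "i0 < i" | "i = i0" "j0 < j" by blast
    then show "eventually (\<lambda>k. fls_subdegree (lau (t k x)) > fls_subdegree (lau (t k (Min Z)))) sequentially"
    proof cases
      case 1
      have "eventually (\<lambda>k. (v (i0, j0) - v (i, j) + (int j0 - int j) * w) + (int j0 - int j) * int k < int q ^ k) sequentially"
        by (rule eventually_linear_less_power[OF q])
      then show ?thesis
      proof eventually_elim
        case (elim k)
        have "int q ^ k \<ge> 0" by simp
        then have "int q ^ k \<le> (int i - int i0) * int q ^ k"
          using 1 by (metis int_ops(6) mult_le_cancel_right1 of_nat_less_0_iff zle_add1_eq_le zero_less_diff of_nat_less_iff linorder_not_less diff_gt_0_iff_gt add_0 int_one_le_iff_zero_less order_le_less)
        then show ?case using elim az by (simp add: ij ij0 T algebra_simps)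
      qed
    next
      case 2
      have "eventually (\<lambda>k. int k > v (i0, j0) - v (i, j) + \<bar>w\<bar> * (int j - int j0)) sequentially"
        by (rule eventually_mono[OF eventually_gt_at_top[of "nat \<bar>v (i0, j0) - v (i, j) + \<bar>w\<bar> * (int j - int j0)\<bar>"]]) linarith
      then show ?thesis
      proof eventually_elim
        case (elim k)
        have "int k \<le> (int j - int j0) * int k"
          using 2 by (intro mult_le_cancel_right1[THEN iffD2]) auto
        moreover have "(int j - int j0) * w \<ge> - (\<bar>w\<bar> * (int j - int j0))"
          using 2 by (metis abs_ge_minus_self abs_mult abs_of_pos diff_gt_0_iff_gt minus_le_iff mult.commute of_nat_less_iff abs_minus_cancel)
        ultimately show ?case using elim az 2 by (simp add: ij ij0 T algebra_simps)
      qed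
    qed
  qed
  then show ?thesis
  proof eventually_elim
    case (elim k)
    have "(\<Sum>x\<in>A. lau (t k x)) \<noteq> 0"
    proof (rule fls_sum_nonzero[of _ "Min Z"])
      show "lau (t k (Min Z)) \<noteq> 0" using x0(1) T0 by (simp add: Z_def)
      fix x assume "x \<in> A" "x \<noteq> Min Z"
      then show "lau (t k x) = 0 \<or> fls_subdegree (lau (t k x)) > fls_subdegree (lau (t k (Min Z)))"
        using elim T0[of k x] by (auto simp: Z_def)
    qed (use x0(1) in \<open>auto simp: Z_def A_def\<close>)
    then show ?case unfolding S by (metis rhom_sum[OF rhom_lau] rhom_0[OF rhom_lau])
  qed
qed

section \<open>The absolute value and the function field\<close>

lemma finite_field_power_card:
  fixes x :: "'a::{field,finite}"
  shows "x ^ CARD('a) = x"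
proof (cases "x = 0")
  case False
  have "x * (\<Prod>y\<in>UNIV-{0}. x * y) = x * x ^ (CARD('a) - 1) * \<Prod>(UNIV-{0})"
    by (simp add: prod.distrib mult_ac)
  also have "x * x ^ (CARD('a) - 1) = x ^ CARD('a)"
    by (metis One_nat_def Suc_pred power_Suc zero_less_card_finite)
  also have "(\<Prod>y\<in>UNIV-{0}. x * y) = (\<Prod>y\<in>UNIV-{0}. y)"
    by (rule prod.reindex_bij_witness[of _ "\<lambda>y. y / x" "\<lambda>y. x * y"]) (use False in auto)
  finally show ?thesis by simp
qed simp

lemma CHAR_finite_field: "prime CHAR('a::{field,finite})"
  by (rule prime_CHAR_semidom, rule finite_imp_CHAR_pos) simp

lemma CHAR_hom: "rhom (h :: 'a::{field,finite} \<Rightarrow> 's::comm_ring_1) \<Longrightarrow> CHAR('s) = CHAR('a)"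
  using rhom_CHAR[of h] rhom_field_eq_0_iff[of h] by blast

lemma frobenius_add:
  fixes x y :: "'s::comm_ring_1"
  assumes "rhom (h :: 'a::{field,finite} \<Rightarrow> 's)"
  shows "(x + y) ^ (CARD('a) ^ k) = x ^ (CARD('a) ^ k) + y ^ (CARD('a) ^ k)"
proof -
  obtain f where f: "CARD('a) = CHAR('a) ^ f" using CARD_finite_field_eq_power by blast
  show ?thesis
    by (rule freshmans_dream'[where n = "f * k"])
      (auto simp: CHAR_hom[OF assms] CHAR_finite_field f power_mult)
qed

lemma peval_frobenius:
  assumes "rhom (h :: 'a::{field,finite} \<Rightarrow> 's::comm_ring_1)"
  shows "peval h (u ^ (CARD('a) ^ k)) A = peval h u A ^ (CARD('a) ^ k)"
proof (induction A)
  case 0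
  then show ?case by (simp add: zero_power)
next
  case (pCons a A)
  have "a ^ (CARD('a) ^ k) = a" by (induction k) (simp_all add: power_mult finite_field_power_card mult.commute)
  then have "h a ^ (CARD('a) ^ k) = h a" by (metis rhom_power[OF assms])
  then show ?case using pCons
    by (simp add: peval_pCons rhom_0[OF assms] frobenius_add[OF assms] power_mult_distrib)
qed

lemma CARD_field_ge_2: "CARD('a::{field,finite}) \<ge> 2"
proof -
  have "card {0, 1 :: 'a} \<le> CARD('a)" by (intro card_mono) auto
  then show ?thesis by simp
qed

lemma coprime_CARD_pred: "coprime (CHAR('a::{field,finite}) ^ (j::nat)) (CARD('a) - 1)"
proof -
  obtain f where f: "CARD('a) = CHAR('a) ^ f" using CARD_finite_field_eq_power by blast
  have "f \<noteq> 0" using f CARD_field_ge_2[where ?'a = 'a] by (cases f) auto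
  then have "CHAR('a) dvd CARD('a)" by (simp add: f dvd_power)
  moreover have "coprime CARD('a) (CARD('a) - 1)"
    using coprime_diff_one_right_nat[of "CARD('a)"] by simp
  ultimately have "coprime CHAR('a) (CARD('a) - 1)" by (metis coprime_divisors dvd_refl)
  then show ?thesis by simp
qed

section \<open>Nonarchimedean absolute values\<close>

locale nonarch =
  fixes av :: "'c::field \<Rightarrow> real"
  assumes av: "nonarch_abs av"
begin

lemma av_nonneg [simp]: "av x \<ge> 0" using av by (auto simp: nonarch_abs_def)
lemma av_eq_0 [simp]: "av x = 0 \<longleftrightarrow> x = 0" using av by (auto simp: nonarch_abs_def)
lemma av_0 [simp]: "av 0 = 0" using av_eq_0[of 0] by blast
lemma av_mult: "av (x * y) = av x * av y" using av by (auto simp: nonarch_abs_def)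
lemma av_add_le: "av (x + y) \<le> max (av x) (av y)" using av by (auto simp: nonarch_abs_def)
lemma av_pos: "x \<noteq> 0 \<Longrightarrow> av x > 0" using av_nonneg[of x] av_eq_0[of x] by linarith

lemma av_1 [simp]: "av 1 = 1"
  using av_mult[of 1 1] av_eq_0[of 1] by auto

lemma av_minus [simp]: "av (- x) = av x"
proof -
  have "av (-1) * av (-1) = 1" using av_mult[of "-1" "-1"] by simp
  then have "av (-1) = 1" using av_nonneg[of "-1"] by (metis abs_of_nonneg power2_eq_1_iff abs_1 abs_minus power2_eq_square)
  then show ?thesis using av_mult[of "-1" x] by simp
qed

lemma av_diff_le: "av (x - y) \<le> max (av x) (av y)"
  using av_add_le[of x "- y"] by simp

lemma av_add_lt: "av x < c \<Longrightarrow> av y < c \<Longrightarrow> av (x + y) < c"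
  using av_add_le[of x y] by linarith

lemma av_add_bound: "av x \<le> c \<Longrightarrow> av y \<le> c \<Longrightarrow> av (x + y) \<le> c"
  using av_add_le[of x y] by linarith

lemma av_diff_bound: "av x \<le> c \<Longrightarrow> av y \<le> c \<Longrightarrow> av (x - y) \<le> c"
  using av_diff_le[of x y] by linarith

lemma av_add_eq: assumes "av y < av x" shows "av (x + y) = av x"
proof (rule antisym)
  show "av (x + y) \<le> av x" using av_add_le[of x y] assms by simp
  show "av x \<le> av (x + y)" using av_diff_le[of "x + y" y] assms by (auto simp: max_def split: if_splits)
qed

lemma av_add_eq': "av x < av y \<Longrightarrow> av (x + y) = av y"
  using av_add_eq[of x y] by (simp add: add.commute)

lemma av_power: "av (x ^ n) = av x ^ n"
  by (induction n) (auto simp: av_mult)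

lemma av_prod: "av (prod f A) = (\<Prod>x\<in>A. av (f x))"
  by (induction A rule: infinite_finite_induct) (auto simp: av_mult)

lemma av_inverse: "av (inverse x) = inverse (av x)"
proof (cases "x = 0")
  case False
  then have "av x * av (inverse x) = 1" using av_mult[of x "inverse x"] by simp
  then show ?thesis by (metis inverse_unique)
qed simp

lemma av_divide: "av (x / y) = av x / av y"
  by (simp add: divide_inverse av_mult av_inverse)

lemma av_poly_large:
  assumes "A \<noteq> 0"
  shows "\<exists>R. \<forall>x. av x > R \<longrightarrow> av (poly A x) = av (lead_coeff A) * av x ^ degree A"
  using assms
proof (induction A)
  case (pCons a A)
  show ?case
  proof (cases "A = 0")
    case False
    then obtain R where R: "\<And>x. av x > R \<Longrightarrow> av (poly A x) = av (lead_coeff A) * av x ^ degree A"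
      using pCons by blast
    define l where "l = av (lead_coeff A)"
    have l: "l > 0" using False by (simp add: l_def av_pos)
    have "av (poly (pCons a A) x) = av (lead_coeff (pCons a A)) * av x ^ degree (pCons a A)"
      if x: "av x > max R (max 1 (av a / l))" for x
    proof -
      have e: "av (x * poly A x) = l * av x ^ Suc (degree A)" using R[of x] x by (simp add: av_mult l_def)
      have "av a < l * av x" using x l by (simp add: field_simps)
      also have "\<dots> \<le> l * av x ^ Suc (degree A)"
        using x l by (intro mult_left_mono) (auto intro: self_le_power)
      finally have "av (a + x * poly A x) = av (x * poly A x)" using e by (intro av_add_eq') simp
      then show ?thesis using False e by (simp add: l_def)
    qed
    then show ?thesis by blast
  qed auto
qed auto

lemma av_poly_units:
  assumes "A \<noteq> 0" "\<And>i. coeff A i = 0 \<or> av (coeff A i) = 1" "av x > 1"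
  shows "av (poly A x) = av x ^ degree A"
  using assms
proof (induction A)
  case (pCons a A)
  show ?case
  proof (cases "A = 0")
    case True
    then show ?thesis using pCons.prems(2)[of 0] pCons.hyps by auto
  next
    case False
    have "coeff A i = 0 \<or> av (coeff A i) = 1" for i using pCons.prems(2)[of "Suc i"] by simp
    then have e: "av (x * poly A x) = av x ^ Suc (degree A)" using pCons.IH False assms(3) by (simp add: av_mult)
    have "av a \<le> 1" using pCons.prems(2)[of 0] by auto
    also have "\<dots> < av x ^ Suc (degree A)" using assms(3) by (intro one_less_power) auto
    finally have "av (a + x * poly A x) = av (x * poly A x)" using e by (intro av_add_eq') simp
    then show ?thesis using False e by simp
  qed
qed auto

end

section \<open>The embedding of K and the sizes of the Carlitz factors\<close>

locale carlitz =
  fixes \<iota> :: "'a::{field,finite} \<Rightarrow> 'c::field" and av :: "'c \<Rightarrow> real" and \<theta> lam :: 'c and q p :: nat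
  assumes q: "q = CARD('a)" and p: "p = CHAR('a)"
    and iota: "rhom \<iota>"
    and av: "nonarch_abs av"
    and theta_gt: "av \<theta> > 1"
    and complete: "av_complete av"
    and closed: "alg_closed TYPE('c)"
    and lam: "lam ^ (q - 1) = - \<theta>"
begin

sublocale nonarch av by unfold_locales (rule av)

lemma q_ge_2: "q \<ge> 2" unfolding q by (rule CARD_field_ge_2)

lemma CHAR_c: "CHAR('c) = p" unfolding p by (rule CHAR_hom[OF iota])

lemma prime_p: "prime p" unfolding p by (rule CHAR_finite_field)

lemma coprime_p: "coprime (p ^ j) (q - 1)" unfolding p q by (rule coprime_CARD_pred)

lemma iota_frobenius: "peval \<iota> (u ^ (q ^ k)) A = peval \<iota> u A ^ (q ^ k)"
  unfolding q by (rule peval_frobenius[OF iota])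

text \<open>Nonzero elements of the finite field are roots of unity.\<close>

lemma av_iota: "x \<noteq> 0 \<Longrightarrow> av (\<iota> x) = 1"
proof -
  assume x: "x \<noteq> 0"
  have "\<iota> x ^ q = \<iota> x" using rhom_power[OF iota, of x q] by (simp add: finite_field_power_card q)
  then have "av (\<iota> x) ^ q = av (\<iota> x)" by (metis av_power)
  moreover have "\<iota> x \<noteq> 0" using x rhom_field_eq_0_iff[OF iota] by blast
  moreover have "av (\<iota> x) ^ q = av (\<iota> x) * av (\<iota> x) ^ (q - 1)"
    using q_ge_2 by (metis One_nat_def Suc_pred less_le_trans pos2 power_Suc)
  ultimately have "av (\<iota> x) ^ (q - 1) = 1" using av_pos by fastforce
  moreover have "q - 1 > 0" using q_ge_2 by simp
  ultimately show ?thesis using power_eq_imp_eq_base[of "av (\<iota> x)" "q - 1" 1] by simp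
qed

lemma av_peval: 
  assumes "A \<noteq> 0" "av x > 1" shows "av (peval \<iota> x A) = av x ^ degree A"
proof -
  have c: "coeff (map_poly \<iota> A) i = \<iota> (coeff A i)" for i by (simp add: coeff_map_poly rhom_0[OF iota])
  have nz: "map_poly \<iota> A \<noteq> 0" using assms(1) c rhom_field_eq_0_iff[OF iota] by (metis coeff_0 leading_coeff_0_iff)
  have "degree (map_poly \<iota> A) = degree A"
    by (rule degree_map_poly) (use rhom_field_eq_0_iff[OF iota] in auto)
  moreover have "coeff (map_poly \<iota> A) i = 0 \<or> av (coeff (map_poly \<iota> A) i) = 1" for i
    using c[of i] av_iota[of "coeff A i"] rhom_0[OF iota] by (cases "coeff A i = 0") auto
  ultimately show ?thesis unfolding peval_def
    using av_poly_units[OF nz _ assms(2)] by simp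
qed

lemma peval_nonzero: "A \<noteq> 0 \<Longrightarrow> av x > 1 \<Longrightarrow> peval \<iota> x A \<noteq> 0"
  using av_peval[of A x] av_eq_0[of "peval \<iota> x A"] by fastforce

text \<open>K is handled as the abstract fraction field of the polynomials over F_q. Since |theta| >
  1 and scalars have absolute value 0 or 1, no nonzero polynomial vanishes at theta, so K
  embeds.\<close>

definition phi :: "'a poly fract \<Rightarrow> 'c" where "phi = fract_lift (peval \<iota> \<theta>)"

lemma peval_theta_unit: "A \<noteq> 0 \<Longrightarrow> peval \<iota> \<theta> A dvd 1"
  using peval_nonzero[OF _ theta_gt] by (simp add: dvd_field_iff)

lemma rhom_phi: "rhom phi"
  unfolding phi_def by (rule rhom_fract_lift[OF rhom_peval[OF iota] peval_theta_unit])

lemma phi_Fract_1: "phi (Fract A 1) = peval \<iota> \<theta> A"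
  unfolding phi_def by (rule fract_lift_of[OF rhom_peval[OF iota] peval_theta_unit])

lemma phi_Fract: "B \<noteq> 0 \<Longrightarrow> phi (Fract A B) = peval \<iota> \<theta> A / peval \<iota> \<theta> B"
  unfolding phi_def
  using fract_lift_Fract[OF rhom_peval[OF iota] peval_theta_unit, of B A] peval_nonzero[OF _ theta_gt]
  by (simp add: field_simps)

lemma phi_tvar: "phi tvar = \<theta>"
  by (simp add: tvar_def phi_Fract_1 iota)

lemma phi_carlitz_L: "phi (carlitz_L tvar q k) = carlitz_L \<theta> q k"
  by (simp add: carlitz_L_def rhom_simps[OF rhom_phi] phi_tvar)

lemma Kset_eq: "Kset \<iota> \<theta> = range phi"
proof (intro equalityI subsetI)
  fix x assume "x \<in> Kset \<iota> \<theta>"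
  then obtain P Q where "x = peval \<iota> \<theta> P / peval \<iota> \<theta> Q" "Q \<noteq> 0" by (auto simp: Kset_def peval_def)
  then show "x \<in> range phi" using phi_Fract by (metis rangeI)
next
  fix x assume "x \<in> range phi"
  then obtain y where y: "x = phi y" by auto
  obtain P Q where "y = Fract P Q" "Q \<noteq> 0" by (cases y) auto
  then show "x \<in> Kset \<iota> \<theta>" using y phi_Fract[of Q P] by (auto simp: Kset_def peval_def)
qed

text \<open>The exponent of |L_k| in base |theta|; in closed form (q^(k+1) - q) / (q - 1).\<close>

definition qs :: "nat \<Rightarrow> nat" where "qs k = (\<Sum>j\<in>{1..k}. q ^ j)"

lemma qs_Suc: "qs (Suc k) = qs k + q ^ Suc k"
  by (simp add: qs_def)

lemma qs_closed: "qs k * (q - 1) + q = q ^ Suc k"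
proof (induction k)
  case (Suc k)
  have "qs (Suc k) * (q - 1) + q = (qs k * (q - 1) + q) + q ^ Suc k * (q - 1)"
    by (subst qs_Suc) (simp only: distrib_right add.assoc add.commute add.left_commute)
  also have "\<dots> = q ^ Suc k * (1 + (q - 1))" unfolding Suc by (simp only: distrib_left mult_1_right)
  finally show ?case using q_ge_2 by simp
qed (simp add: qs_def)

lemma av_theta_power_gt: "j \<ge> 1 \<Longrightarrow> av \<theta> < av \<theta> ^ (q ^ j)"
proof -
  assume "j \<ge> 1"
  then have "q ^ j > 1" using q_ge_2 by (intro one_less_power) auto
  then show ?thesis using power_strict_increasing[of 1 "q ^ j" "av \<theta>"] theta_gt by simp
qed

lemma av_carlitz_L: "av (carlitz_L \<theta> q k) = av \<theta> ^ qs k"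
proof -
  have "av (\<theta> - \<theta> ^ (q ^ j)) = av \<theta> ^ (q ^ j)" if "j \<ge> 1" for j
    using av_add_eq'[of \<theta> "- (\<theta> ^ (q ^ j))"] av_theta_power_gt[OF that] by (simp add: av_power)
  then have "av (carlitz_L \<theta> q k) = (\<Prod>j\<in>{1..k}. av \<theta> ^ (q ^ j))"
    unfolding carlitz_L_def av_prod by (intro prod.cong) auto
  then show ?thesis by (simp add: qs_def power_sum)
qed

lemma carlitz_L_nonzero: "carlitz_L \<theta> q k \<noteq> 0"
  using av_carlitz_L[of k] theta_gt by (metis av_0 power_eq_0_iff zero_less_one not_less_iff_gr_or_eq order_less_trans)

lemma carlitz_L_Suc: "carlitz_L t q (Suc k) = carlitz_L t q k * (t - t ^ (q ^ Suc k))"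
  by (simp add: carlitz_L_def mult.commute)

text \<open>With q^i = 1 + m (q - 1) the exponent of |L_i| is q m, and the m-th power of the size
  condition gives the claim. So the term of index 0 strictly dominates, and all nonempty partial
  sums of a depth one series have the absolute value of a.\<close>

lemma av_term_less:
  assumes "av a ^ (q - 1) < av \<theta> ^ (n * q)" "a \<noteq> 0" "i \<ge> 1"
  shows "av (a ^ (q ^ i) / carlitz_L \<theta> q i ^ n) < av a"
proof -
  obtain m where m: "q ^ i = 1 + m * (q - 1)" "m > 0" "qs i = q * m"
  proof -
    define m where "m = (\<Sum>j<i. q ^ j)"
    have "qs i = q * m" unfolding qs_def m_def sum_distrib_left
      by (rule sum.reindex_bij_witness[of _ Suc "\<lambda>j. j - 1"]) (auto simp flip: power_Suc)
    moreover have "m > 0" using assms(3) by (cases i) (auto simp: m_def lessThan_Suc_eq_insert_0)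
    moreover have "q * q ^ i = q * (1 + m * (q - 1))" using qs_closed[of i] \<open>qs i = q * m\<close> by (simp add: algebra_simps)
    then have "q ^ i = 1 + m * (q - 1) \<or> q = 0" by (simp only: mult_cancel1)
    then have "q ^ i = 1 + m * (q - 1)" using q_ge_2 by simp
    ultimately show ?thesis using that by blast
  qed
  have "(av a ^ (q - 1)) ^ m < (av \<theta> ^ (n * q)) ^ m"
    using assms(1) m(2) by (intro power_strict_mono) auto
  then have "av a * av a ^ (m * (q - 1)) < av a * av \<theta> ^ (qs i * n)"
    using av_pos[OF assms(2)] by (simp add: m(3) power_mult[symmetric] mult_ac)
  then have "av a ^ (q ^ i) < av a * (av \<theta> ^ qs i) ^ n" by (simp add: m(1) power_add power_mult)
  moreover have "(av \<theta> ^ qs i) ^ n > 0" using theta_gt by simp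
  ultimately show ?thesis by (simp add: av_divide av_power av_carlitz_L divide_simps)
qed

lemma av_depth_one:
  assumes "av a ^ (q - 1) < av \<theta> ^ (n * q)" "a \<noteq> 0" "k \<ge> 1"
  shows "av (\<Sum>i<k. a ^ (q ^ i) / carlitz_L \<theta> q i ^ n) = av a"
  using assms(3)
proof (induction k rule: dec_induct)
  case base
  then show ?case by (simp add: carlitz_L_def)
next
  case (step k)
  then show ?case using av_term_less[OF assms(1,2), of k] av_add_eq by simp
qed

text \<open>A solution \<open>R = A/B\<close> of \<open>(\<theta> - x\<^sup>q)\<^sup>N (R(x) - b \<alpha>(x)\<^sup>P) = R(x\<^sup>q)\<close> has no pole outside the unit disc,
  since a pole at \<open>s\<close> would propagate to the \<open>q\<close>-th root of \<open>s\<close>. Hence \<open>R(\<theta>) = 0\<close>, and the values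
  \<open>R(\<theta>\<^bsup>q\<^sup>k\<^esup>) = - b L\<^sub>k\<^sup>N T\<^sub>k\<^sup>P\<close> grow at a rate excluded for rational functions.\<close>
lemma no_rational_solution:
  fixes A B :: "'c poly" and a1 a2 :: "'a poly"
  assumes B: "B \<noteq> 0" and b: "b \<noteq> 0" and a: "a1 \<noteq> 0" "a2 \<noteq> 0" and P: "P = p ^ j" and n: "n \<ge> 1" "\<not> (q - 1) dvd n"
    and size: "av (phi (Fract a1 a2)) ^ (q - 1) < av \<theta> ^ (n * q)"
    and E: "([:\<theta>:] - monom 1 q) ^ (n * P) * (A * map_poly \<iota> a2 ^ P - smult b (map_poly \<iota> a1 ^ P * B)) * pcompose B (monom 1 q)
      = pcompose A (monom 1 q) * B * map_poly \<iota> a2 ^ P"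
  shows False
proof -
  define S where "S A B \<longleftrightarrow> B \<noteq> 0 \<and> ([:\<theta>:] - monom 1 q) ^ (n * P) * (A * map_poly \<iota> a2 ^ P - smult b (map_poly \<iota> a1 ^ P * B)) * pcompose B (monom 1 q)
      = pcompose A (monom 1 q) * B * map_poly \<iota> a2 ^ P" for A B
  \<comment> \<open>A denominator of least degree is taken, so that A and B have no common zero: a
    common linear factor could be cancelled in the equation.\<close>
  have "\<exists>m A B. S A B \<and> degree B = m" using B E by (auto simp: S_def)
  then obtain m where m: "\<exists>A B. S A B \<and> degree B = m" "\<And>m'. m' < m \<Longrightarrow> \<not> (\<exists>A B. S A B \<and> degree B = m')"
    using exists_least_iff[of "\<lambda>m. \<exists>A B. S A B \<and> degree B = m"] by blast
  then obtain A B where AB: "S A B" "degree B = m" by blast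
  have Bnz: "B \<noteq> 0" using AB by (simp add: S_def)
  have P1: "P \<ge> 1" using prime_p by (simp add: P Suc_le_eq prime_gt_0_nat)
  define \<alpha> where "\<alpha> = phi (Fract a1 a2)"
  have coprime: "\<not> (poly A s = 0 \<and> poly B s = 0)" for s
  proof
    assume s: "poly A s = 0 \<and> poly B s = 0"
    then obtain A' B' where A': "A = [:- s, 1:] * A'" and B': "B = [:- s, 1:] * B'"
      using poly_eq_0_iff_dvd by (metis dvdE)
    have c: "pcompose [:- s, 1:] (monom 1 q) \<noteq> (0 :: 'c poly)"
    proof
      assume "pcompose [:- s, 1:] (monom 1 q) = (0 :: 'c poly)"
      then have "poly (pcompose [:- s, 1:] (monom 1 q)) (s + 1) = 0" "poly (pcompose [:- s, 1:] (monom 1 q)) 0 = 0"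
         "poly (pcompose [:- s, 1:] (monom 1 q)) 1 = 0"
        by simp_all
      then show False using q_ge_2 by (simp add: poly_pcompose poly_monom power_0_left)
    qed
    have nz: "pcompose [:- s, 1:] (monom 1 q) * [:- s, 1:] \<noteq> 0"
      by (rule no_zero_divisors[OF c]) simp
    have eq: "pcompose [:- s, 1:] (monom 1 q) * [:- s, 1:] * (([:\<theta>:] - monom 1 q) ^ (n * P) * (A' * map_poly \<iota> a2 ^ P - smult b (map_poly \<iota> a1 ^ P * B')) * pcompose B' (monom 1 q))
      = pcompose [:- s, 1:] (monom 1 q) * [:- s, 1:] * (pcompose A' (monom 1 q) * B' * map_poly \<iota> a2 ^ P)"
    proof -
      have sm: "smult b Z = [:b:] * Z" for Z :: "'c poly" by simp
      show ?thesis using AB(1) unfolding S_def A' B' pcompose_mult sm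
        by (simp only: algebra_simps)
    qed
    have "B' \<noteq> 0" using Bnz B' by auto
    then have "S A' B'" unfolding S_def using eq by (simp only: mult_left_cancel[OF nz]) simp
    moreover have "degree B' < m" 
      using AB(2) degree_mult_eq[of "[:- s, 1:]" B'] \<open>B' \<noteq> 0\<close> unfolding B'[symmetric] by simp
    ultimately show False using m(2) by blast
  qed
  have point: "(\<theta> - x ^ q) ^ (n * P) * (poly A x * peval \<iota> x a2 ^ P - b * (peval \<iota> x a1 ^ P * poly B x)) * poly B (x ^ q)
      = poly A (x ^ q) * poly B x * peval \<iota> x a2 ^ P" for x
    using arg_cong[OF conjunct2[OF AB(1)[unfolded S_def]], of "\<lambda>f. poly f x"]
    by (simp add: peval_def poly_pcompose poly_monom)
  have root: "\<exists>t. t ^ q = s" for s :: 'c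
  proof -
    have "degree (monom 1 q - [:s:] :: 'c poly) = q"
      using q_ge_2 by (intro antisym degree_le le_degree) (auto simp: coeff_pCons split: nat.splits)
    then have "\<exists>x. poly (monom 1 q - [:s:]) x = 0"
      using q_ge_2 by (intro closed[unfolded alg_closed_def, rule_format]) simp
    then show ?thesis by (auto simp: poly_monom)
  qed
  define rt where "rt s = (SOME t. t ^ q = s)" for s :: 'c
  have rt: "rt s ^ q = s" for s unfolding rt_def using root by (rule someI_ex)
  have av_rt: "av (rt s) > 1" "av (rt s) < av s" if "av s > 1" for s
  proof -
    have e: "av (rt s) ^ q = av s" by (metis rt av_power)
    show 1: "av (rt s) > 1"
    proof (rule ccontr)
      assume "\<not> av (rt s) > 1"
      then have "av (rt s) ^ q \<le> 1" by (intro power_le_one) auto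
      then show False using e that by simp
    qed
    show "av (rt s) < av s"
      using power_strict_increasing[of 1 q "av (rt s)"] 1 q_ge_2 e by simp
  qed
  \<comment> \<open>Repeated q-th roots of a pole outside the unit disc stay outside with strictly
    decreasing absolute values, hence would be infinitely many zeros of B.\<close>
  have nopole: "poly B s \<noteq> 0" if s: "av s > 1" for s
  proof
    assume "poly B s = 0"
    have step: "poly B (rt s) = 0" if "poly B s = 0" "av s > 1" for s
      using point[of "rt s"] that coprime[of s] peval_nonzero[OF a(2) av_rt(1)[OF that(2)]] by (simp add: rt)
    have it: "poly B ((rt ^^ i) s) = 0 \<and> av ((rt ^^ i) s) > 1" for i
      by (induction i) (use \<open>poly B s = 0\<close> s step av_rt in auto)
    then have dec: "av ((rt ^^ Suc i) s) < av ((rt ^^ i) s)" for i using av_rt(2) by simp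
    have "strict_mono (\<lambda>i. - av ((rt ^^ i) s))" using dec by (intro strict_mono_Suc_iff[THEN iffD2]) simp
    then have "inj (\<lambda>i. (rt ^^ i) s)" by (intro injI) (metis strict_mono_eq)
    then have "infinite (range (\<lambda>i. (rt ^^ i) s))" by (rule range_inj_infinite)
    moreover have "range (\<lambda>i. (rt ^^ i) s) \<subseteq> {x. poly B x = 0}" using it by auto
    ultimately show False using poly_roots_finite[OF Bnz] finite_subset by blast
  qed
  \<comment> \<open>At a q-th root of theta the factor theta - x^q vanishes, while B and the
    denominator \<open>a2\<close> do not.\<close>
  have "poly A \<theta> = 0"
    using point[of "rt \<theta>"] rt[of \<theta>] nopole av_rt(1)[OF theta_gt] peval_nonzero[OF a(2)] n P1 by (simp add: zero_power)
  define u where "u k = \<theta> ^ (q ^ k)" for k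
  have u1: "av (u k) > 1" for k unfolding u_def av_power using theta_gt q_ge_2 by (intro one_less_power) auto
  define R where "R k = poly A (u k) / poly B (u k)" for k
  have alpha_u: "peval \<iota> (u k) a1 / peval \<iota> (u k) a2 = \<alpha> ^ (q ^ k)" for k
    by (simp add: \<alpha>_def u_def iota_frobenius phi_Fract a(2) power_divide)
  have Rrec: "R (Suc k) = (\<theta> - u (Suc k)) ^ (n * P) * (R k - b * (\<alpha> ^ (q ^ k)) ^ P)" for k
  proof -
    have us: "u k ^ q = u (Suc k)" by (simp add: u_def power_mult[symmetric] mult.commute)
    have nz: "poly B (u k) \<noteq> 0" "poly B (u (Suc k)) \<noteq> 0" "peval \<iota> (u k) a2 \<noteq> 0"
      using nopole u1 peval_nonzero[OF a(2)] by auto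
    then show ?thesis using point[of "u k"] unfolding us R_def alpha_u[symmetric]
      by (simp add: divide_simps power_divide) (simp add: algebra_simps)
  qed
  define T where "T k = (\<Sum>i<k. \<alpha> ^ (q ^ i) / carlitz_L \<theta> q i ^ n)" for k
  have frob: "(x + y) ^ P = x ^ P + y ^ P" for x y :: 'c
    by (rule freshmans_dream'[where n = j]) (auto simp: CHAR_c prime_p P)
  \<comment> \<open>Raising to the power P is additive, so the recursion solves to a P-th power of
    the truncated depth one sum, whose absolute value is known.\<close>
  have RT: "R k = - b * carlitz_L \<theta> q k ^ (n * P) * T k ^ P" for k
  proof (induction k)
    case 0
    then show ?case using \<open>poly A \<theta> = 0\<close> P1 by (simp add: R_def u_def T_def zero_power)
  next
    case (Suc k)
    have "R (Suc k) = (\<theta> - u (Suc k)) ^ (n * P) * (- b * carlitz_L \<theta> q k ^ (n * P) * T k ^ P - b * (\<alpha> ^ (q ^ k)) ^ P)"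
      by (simp add: Rrec Suc)
    also have "\<dots> = - b * carlitz_L \<theta> q (Suc k) ^ (n * P) * (T k ^ P + (\<alpha> ^ (q ^ k) / carlitz_L \<theta> q k ^ n) ^ P)"
    proof -
      have aux: "D ^ (n * P) * (- b * L ^ (n * P) * t ^ P - b * a ^ P) = - b * (L * D) ^ (n * P) * (t ^ P + (a / L ^ n) ^ P)"
        if "L \<noteq> 0" for D L t a :: 'c
      proof -
        have "L ^ (n * P) * (a / L ^ n) ^ P = a ^ P" using that by (simp add: power_divide power_mult)
        then have "- b * (L * D) ^ (n * P) * (t ^ P + (a / L ^ n) ^ P) = D ^ (n * P) * (- b * L ^ (n * P) * t ^ P - b * a ^ P)"
          by (simp add: power_mult_distrib distrib_left algebra_simps)
        then show ?thesis ..
      qed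
      show ?thesis unfolding carlitz_L_Suc u_def by (rule aux[OF carlitz_L_nonzero])
    qed
    also have "T k ^ P + (\<alpha> ^ (q ^ k) / carlitz_L \<theta> q k ^ n) ^ P = T (Suc k) ^ P"
      by (simp add: T_def frob)
    finally show ?case .
  qed
  have alpha_nz: "\<alpha> \<noteq> 0" using a peval_nonzero[OF _ theta_gt] by (simp add: \<alpha>_def phi_Fract)
  have avR: "av (R k) = av b * av \<alpha> ^ P * av \<theta> ^ (qs k * (n * P))" if "k \<ge> 1" for k
    using av_depth_one[of \<alpha> n k] size alpha_nz that
    by (simp add: RT av_mult av_power av_carlitz_L T_def \<alpha>_def power_mult)
  have Anz: "A \<noteq> 0"
  proof
    assume "A = 0"
    then have "av (R 1) = 0" by (simp add: R_def)
    then show False using avR[of 1] b alpha_nz theta_gt by simp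
  qed
  obtain R1 where R1: "\<And>x. av x > R1 \<Longrightarrow> av (poly A x) = av (lead_coeff A) * av x ^ degree A"
    using av_poly_large[OF Anz] by blast
  obtain R2 where R2: "\<And>x. av x > R2 \<Longrightarrow> av (poly B x) = av (lead_coeff B) * av x ^ degree B"
    using av_poly_large[OF Bnz] by blast
  obtain k where k: "av \<theta> ^ k > max R1 R2" "k \<ge> 1"
  proof -
    obtain k where "max R1 R2 < av \<theta> ^ k" using real_arch_pow[OF theta_gt] by blast
    moreover have "av \<theta> ^ k \<le> av \<theta> ^ Suc k" using theta_gt by simp
    ultimately show ?thesis using that[of "Suc k"] by linarith
  qed
  have large: "av (u i) > max R1 R2" if "i \<ge> k" for i
  proof -
    have "k \<le> q ^ i" using that q_ge_2 power_gt_expt[of q i] by linarith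
    then have "av \<theta> ^ k \<le> av (u i)" unfolding u_def av_power using theta_gt by (intro power_increasing) auto
    then show ?thesis using k by linarith
  qed
  define C where "C = av b * av \<alpha> ^ P * av (lead_coeff B) / av (lead_coeff A)"
  have Cpos: "C > 0" using b alpha_nz Anz Bnz by (simp add: C_def av_pos)
  have eq: "av \<theta> ^ (q ^ i * degree A) = C * av \<theta> ^ (qs i * (n * P) + q ^ i * degree B)" if "i \<ge> k" for i
  proof -
    have Ri: "av (R i) = av (lead_coeff A) * av (u i) ^ degree A / (av (lead_coeff B) * av (u i) ^ degree B)"
      using R1[of "u i"] R2[of "u i"] large[OF that] by (simp add: R_def av_divide)
    have "av (lead_coeff A) * av (u i) ^ degree A = av b * av \<alpha> ^ P * av \<theta> ^ (qs i * (n * P)) * (av (lead_coeff B) * av (u i) ^ degree B)"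
    proof -
      have pos: "av (lead_coeff B) * av (u i) ^ degree B > 0"
        using Bnz u1[of i] av_pos[of "lead_coeff B"] by simp
      have "av (lead_coeff A) * av (u i) ^ degree A = av (R i) * (av (lead_coeff B) * av (u i) ^ degree B)"
      proof -
        have "X = X / D * D" if "D > 0" for X D :: real using that by simp
        from this[OF pos] show ?thesis unfolding Ri .
      qed
      then show ?thesis using avR[of i] that k by simp
    qed
    then show ?thesis using Anz
      by (simp add: C_def u_def av_power power_mult[symmetric] power_add field_simps)
  qed
  \<comment> \<open>Comparing consecutive k eliminates the constant C. Equality of exponents then
    reads (q - 1) deg A = (q - 1) deg B + q n P, which is impossible modulo q - 1.\<close>
  have "av \<theta> ^ (q ^ Suc k * degree A) * av \<theta> ^ (qs k * (n * P) + q ^ k * degree B)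
      = av \<theta> ^ (q ^ k * degree A) * av \<theta> ^ (qs (Suc k) * (n * P) + q ^ Suc k * degree B)"
    using eq[of k] eq[of "Suc k"] Cpos by simp
  then have "av \<theta> ^ (q ^ Suc k * degree A + (qs k * (n * P) + q ^ k * degree B))
      = av \<theta> ^ (q ^ k * degree A + (qs (Suc k) * (n * P) + q ^ Suc k * degree B))"
    by (simp only: power_add)
  then have "q ^ Suc k * degree A + (qs k * (n * P) + q ^ k * degree B)
      = q ^ k * degree A + (qs (Suc k) * (n * P) + q ^ Suc k * degree B)"
    using theta_gt power_inject_exp by blast
  then have "q ^ k * (q * degree A + degree B) = q ^ k * (degree A + q * (n * P) + q * degree B)"
    by (simp add: qs_Suc algebra_simps)
  then have "q * degree A + degree B = degree A + q * (n * P) + q * degree B" using q_ge_2 by simp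
  then have "(q - 1) * degree A = (q - 1) * degree B + q * (n * P)"
    using q_ge_2 by (simp add: diff_mult_distrib)
  then have "(q - 1) dvd q * (n * P)"
    by (metis dvd_add_right_iff dvd_triv_left)
  moreover have "coprime (q - 1) q" using coprime_diff_one_right_nat[of q] q_ge_2 by (simp add: coprime_commute)
  ultimately have "(q - 1) dvd n * P" using coprime_dvd_mult_right_iff by blast
  moreover have "coprime (q - 1) P" using coprime_p[of j] by (simp add: P coprime_commute)
  ultimately show False using n(2) coprime_dvd_mult_left_iff by blast
qed

end

section \<open>Scalars, polynomials in U, and invariance under scaling of L\<close>

lemma map_poly_eq_peval: "h 0 = 0 \<Longrightarrow> map_poly h A = peval (\<lambda>c. [:h c:]) [:0, 1:] A"
  for h :: "'k::comm_ring_1 \<Rightarrow> 's::comm_ring_1"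
  by (induction A) (simp_all add: peval_pCons map_poly_pCons)

lemma rhom_map_poly: "rhom h \<Longrightarrow> rhom (map_poly h)"
  for h :: "'k::comm_ring_1 \<Rightarrow> 's::comm_ring_1"
proof -
  assume h: "rhom h"
  have "map_poly h = peval (\<lambda>c. [:h c:]) [:0, 1:]"
    using map_poly_eq_peval[of h] rhom_0[OF h] by blast
  then show "rhom (map_poly h)" using rhom_peval[OF rhom_comp[OF h rhom_const_poly]] by simp
qed

lemma peval_map_poly: "h 0 = 0 \<Longrightarrow> g 0 = 0 \<Longrightarrow> peval g y (map_poly h A) = peval (\<lambda>c. g (h c)) y A"
  for h :: "'k::comm_ring_1 \<Rightarrow> 's::comm_ring_1" and g :: "'s \<Rightarrow> 't::comm_ring_1"
  by (induction A) (simp_all add: peval_pCons map_poly_pCons)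

lemma map_poly_pcompose_monom:
  assumes h: "rhom h"
  shows "map_poly h (pcompose A (monom 1 m)) = pcompose (map_poly h A) (monom 1 m)"
proof -
  have "map_poly h (monom 1 m) = monom 1 m"
    using rhom_0[OF h] rhom_1[OF h] by (simp add: map_poly_monom)
  then show ?thesis
    unfolding pcompose_peval rhom_comp_peval[OF rhom_map_poly[OF h] rhom_const_poly]
    using rhom_0[OF h] by (simp add: peval_map_poly map_poly_pCons)
qed

definition cst :: "'a::field \<Rightarrow> 'a poly fract" where "cst a = Fract [:a:] 1"

lemma rhom_cst: "rhom cst"
  unfolding cst_def by (rule rhom_comp[OF rhom_const_poly rhom_Fract_1])

lemma peval_cst_tvar: "peval cst tvar A = Fract A 1"
  using rhom_peval_ext[OF rhom_Fract_1, of A] by (simp add: cst_def[abs_def] tvar_def)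

lemma Fract_1_eq_0: "Fract A 1 = 0 \<longleftrightarrow> A = 0"
  by (simp add: Zero_fract_def eq_fract)

lemma Fract_eq_divide: "B \<noteq> 0 \<Longrightarrow> Fract A B = Fract A 1 / Fract B 1"
  by simp

definition rP :: "'k::field poly \<Rightarrow> 'k rat2" where "rP A = Fract [:A:] 1"

lemma rhom_rP: "rhom rP"
  unfolding rP_def by (rule rhom_comp[OF rhom_const_poly rhom_Fract_1])

lemma rP_eq: "rP A = peval rC rU A"
  using rhom_peval_ext[OF rhom_rP, of A] by (simp add: rP_def rC_def[abs_def] rU_def)

lemma rP_inj: "rP A = rP B \<longleftrightarrow> A = B"
  by (simp add: rP_def eq_fract)

lemma rP_eq_0: "rP A = 0 \<longleftrightarrow> A = 0"
  using rP_inj[of A 0] rhom_0[OF rhom_rP] by metis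

text \<open>A rational function of \<open>l\<close> taking the same value at all \<open>c\<^sup>m l\<close> is constant in \<open>l\<close>.\<close>
lemma torus_invariant:
  fixes c :: "'k::field" and R :: "'k rat2"
  assumes c: "\<And>i j. c ^ i = c ^ j \<Longrightarrow> i = j" "c \<noteq> 0"
    and tau: "rhom \<tau>" "\<And>x. \<tau> (rC x) = rC x" "\<tau> rU = rU" "\<tau> rL = rC c * rL" and R: "\<tau> R = R"
  shows "\<exists>A B. B \<noteq> 0 \<and> R = rP A / rP B"
proof -
  obtain A B where AB: "R = Fract A B" "B \<noteq> 0" by (cases R) auto
  define g :: "'k poly poly" where "g = [:0, [:c:]:]"
  have tP: "\<tau> (Fract P 1) = Fract (pcompose P g) 1" for P
  proof -
    have "rhom (\<lambda>P. Fract (pcompose P g) 1)"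
      unfolding pcompose_peval by (rule rhom_comp[OF rhom_peval[OF rhom_const_poly] rhom_Fract_1])
    then have "Fract (pcompose P g) 1 = ev2 (\<lambda>x. rC x) rU (rC c * rL) P"
      using rhom_ev2_ext[of "\<lambda>P. Fract (pcompose P g) 1" P]
      by (simp add: pcompose_pCons rC_def[abs_def] rU_def rL_def g_def)
    moreover have "\<tau> (Fract P 1) = ev2 (\<lambda>x. rC x) rU (rC c * rL) P"
      using rhom_ev2_ext[OF rhom_comp[OF rhom_Fract_1 tau(1)], of P] tau(2-4)
      by (simp add: rC_def[abs_def] rU_def rL_def)
    ultimately show ?thesis by simp
  qed
  have "R * Fract B 1 = Fract A 1" using AB by (simp add: eq_fract)
  then have "\<tau> (R * Fract B 1) = \<tau> (Fract A 1)" by simp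
  then have "R * Fract (pcompose B g) 1 = Fract (pcompose A g) 1"
    by (simp only: rhom_mult[OF tau(1)] R tP)
  then have eq: "A * pcompose B g = pcompose A g * B"
    using AB by (simp add: eq_fract)
  define x where "x m = [:c ^ m:]" for m
  have x_Suc: "poly g (x m) = x (Suc m)" for m by (simp add: g_def x_def)
  have step: "poly A (x m) * poly B (x (Suc m)) = poly A (x (Suc m)) * poly B (x m)" for m
    using arg_cong[OF eq, of "\<lambda>f. poly f (x m)"] by (simp add: poly_pcompose x_Suc)
  have injx: "inj x" by (rule injI) (use c in \<open>auto simp: x_def\<close>)
  \<comment> \<open>From M on the points c^m avoid the zeros of B, and the relation between
    consecutive points makes A/B constant along them.\<close>
  have "finite (x -` {y. poly B y = 0})"
    using poly_roots_finite[OF AB(2)] injx by (intro finite_vimageI)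
  then obtain M where "\<forall>m\<in>x -` {y. poly B y = 0}. m < M"
    using finite_nat_set_iff_bounded by blast
  then have M: "\<And>m. poly B (x m) = 0 \<Longrightarrow> m < M" by auto
  have nz: "poly B (x m) \<noteq> 0" if "m \<ge> M" for m using M[of m] that by linarith
  have "poly A (x m) * poly B (x M) = poly A (x M) * poly B (x m)" if "m \<ge> M" for m
    using that
  proof (induction m rule: dec_induct)
    case (step m)
    have "poly A (x (Suc m)) * poly B (x M) * poly B (x m) = poly A (x m) * poly B (x (Suc m)) * poly B (x M)"
      using \<open>\<And>m. poly A (x m) * poly B (x (Suc m)) = poly A (x (Suc m)) * poly B (x m)\<close>[of m] by (simp add: mult_ac)
    also have "\<dots> = poly A (x M) * poly B (x (Suc m)) * poly B (x m)"
      using step.IH by (simp add: mult_ac)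
    finally show ?case using nz[of m] step.hyps by simp
  qed simp
  then have "poly (A * [:poly B (x M):]) y = poly (B * [:poly A (x M):]) y" if "y \<in> x ` {M..}" for y
    using that by (auto simp: mult_ac)
  moreover have "infinite (x ` {M..})"
    using infinite_Ici[of M] injx finite_image_iff[of x "{M..}"] inj_on_subset by blast
  ultimately have e: "A * [:poly B (x M):] = B * [:poly A (x M):]"
    by (intro poly_eq_if_eq_on_infinite[of "x ` {M..}"]) auto
  have "R = Fract [:poly A (x M):] [:poly B (x M):]"
    using AB nz[of M] e by (simp add: eq_fract mult.commute)
  also have "\<dots> = rP (poly A (x M)) / rP (poly B (x M))" using nz[of M] by (simp add: rP_def)
  finally show ?thesis using nz[of M] by blast
qed

text \<open>The hypotheses in the form used: \<open>n_inj\<close> is the condition on ratios written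
  without division, and \<open>alpha_size\<close> is the convergence condition raised to the power q
  - 1, which avoids real exponents. The \<alpha> are taken in the abstract K.\<close>

locale carlitz_li = carlitz \<iota> av \<theta> lam q p
  for \<iota> :: "'a::{field,finite} \<Rightarrow> 'c::field" and av \<theta> lam q p +
  fixes d :: nat and n :: "nat \<Rightarrow> nat" and \<alpha> :: "nat \<Rightarrow> 'a poly fract"
  assumes n_pos: "i \<in> {1..d} \<Longrightarrow> n i \<ge> 1"
    and n_ndvd: "i \<in> {1..d} \<Longrightarrow> \<not> (q - 1) dvd n i"
    and n_inj: "i \<in> {1..d} \<Longrightarrow> i' \<in> {1..d} \<Longrightarrow> n i * p ^ j = n i' * p ^ j' \<Longrightarrow> i = i'"
    and alpha_nz: "i \<in> {1..d} \<Longrightarrow> \<alpha> i \<noteq> 0"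
    and alpha_size: "i \<in> {1..d} \<Longrightarrow> av (phi (\<alpha> i)) ^ (q - 1) < av \<theta> ^ (n i * q)"
begin

definition uu :: "nat \<Rightarrow> 'a poly fract" where "uu k = tvar ^ (q ^ k)"
definition LL :: "nat \<Rightarrow> 'a poly fract" where "LL k = carlitz_L tvar q k"
definition Tr :: "nat \<Rightarrow> nat \<Rightarrow> nat \<Rightarrow> 'a poly fract" where
  "Tr a b k = Li_trunc tvar q (map (\<lambda>i. (n i, \<alpha> i)) [Suc a..<Suc b]) k"

lemma Tr_refl [simp]: "Tr a a k = 1" by (simp add: Tr_def)

lemma Tr_refl': "Tr a a = (\<lambda>_. 1)" by auto

lemma Tr_Suc:
  assumes "a < b"
  shows "Tr a b (Suc k) = Tr a b k + \<alpha> (Suc a) ^ (q ^ k) / LL k ^ n (Suc a) * Tr (Suc a) b k"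
  using assms by (simp add: Tr_def upt_conv_Cons[of "Suc a" "Suc b"] LL_def del: upt_Suc)

lemma LL_nonzero: "LL k \<noteq> 0"
  using carlitz_L_nonzero[of k] phi_carlitz_L[of k] rhom_0[OF rhom_phi] by (metis LL_def)

lemma uu_nonzero: "uu k \<noteq> 0"
  using phi_tvar theta_gt rhom_0[OF rhom_phi] by (metis uu_def power_eq_0_iff av_0 not_one_less_zero)

lemma tvar_power_inj: "tvar ^ i = (tvar :: 'a poly fract) ^ j \<Longrightarrow> i = j"
proof -
  assume "tvar ^ i = (tvar :: 'a poly fract) ^ j"
  then have "av \<theta> ^ i = av \<theta> ^ j" by (metis phi_tvar rhom_power[OF rhom_phi] av_power)
  then show ?thesis using theta_gt power_inject_exp by blast
qed

lemma tvar_nz: "(tvar :: 'a poly fract) \<noteq> 0"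
  using uu_nonzero[of 0] by (simp add: uu_def)

abbreviation gc :: "'a poly fract \<Rightarrow> 'a poly fract germ" where "gc c \<equiv> germ (\<lambda>_. c)"

lemma ev2_germ: "ev2 gc (germ f) (germ g) P = germ (\<lambda>k. ev2 (\<lambda>x. x) (f k) (g k) P)"
proof -
  have pe: "peval gc (germ f) P = germ (\<lambda>k. peval (\<lambda>x. x) (f k) P)" for P
    by (induction P) (simp_all add: peval_pCons germ_ops)
  show ?thesis unfolding ev2_def
    by (induction P) (simp_all add: peval_pCons germ_ops pe)
qed

text \<open>Nonzero polynomials in theta^(q^k) and c L_k vanish for finitely many k only, hence are
  invertible as germs. The factor c is needed for the scaling \<open>\<tau>\<close> of L.\<close>

lemma ev2_germ_unit: "P \<noteq> 0 \<Longrightarrow> c \<noteq> 0 \<Longrightarrow> ev2 gc (germ uu) (germ (\<lambda>k. c * LL k)) P dvd 1"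
  unfolding ev2_germ
  using two_variable_nonvanishing[OF q_ge_2, of P c] by (intro germ_dvd_1) (simp add: uu_def LL_def)

definition \<rho> :: "'a poly fract rat2 \<Rightarrow> 'a poly fract germ" where
  "\<rho> = rat2_hom gc (germ uu) (germ LL)"

lemma rho: "rhom \<rho>" "\<rho> (rC x) = gc x" "\<rho> rU = germ uu" "\<rho> rL = germ LL" "\<rho> (Fract P 1) = ev2 gc (germ uu) (germ LL) P"
proof -
  have u: "P \<noteq> 0 \<Longrightarrow> ev2 gc (germ uu) (germ LL) P dvd 1" for P using ev2_germ_unit[of P 1] by simp
  show "rhom \<rho>" "\<rho> (rC x) = gc x" "\<rho> rU = germ uu" "\<rho> rL = germ LL" "\<rho> (Fract P 1) = ev2 gc (germ uu) (germ LL) P"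
    unfolding \<rho>_def by (rule rat2_hom[OF rhom_germ_const u]; simp)+
qed

text \<open>The lift of the shift, by theta^(q^(k+1)) = (theta^(q^k))^q and L_(k+1) = (theta -
  theta^(q^(k+1))) L_k.\<close>

definition \<sigma> :: "'a poly fract rat2 \<Rightarrow> 'a poly fract rat2" where
  "\<sigma> = rat2_hom rC (rU ^ q) ((rC tvar - rU ^ q) * rL)"

lemma uu_Suc: "uu (Suc k) = uu k ^ q"
  by (simp add: uu_def power_mult[symmetric] mult.commute)

lemma LL_Suc: "LL (Suc k) = (tvar - uu k ^ q) * LL k"
  unfolding LL_def carlitz_L_Suc uu_Suc[symmetric] by (simp add: uu_def mult.commute)

lemma germ_diff: "germ f - germ g = germ (\<lambda>k. f k - g k)" for f g :: "nat \<Rightarrow> 'k::comm_ring_1"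
  by (simp add: minus_germ.abs_eq)

lemma rho_sigma_values: "\<rho> (rU ^ q) = germ_shift (germ uu)" "\<rho> ((rC tvar - rU ^ q) * rL) = germ_shift (germ LL)"
  by (simp_all add: rhom_simps[OF rho(1)] rho germ_power germ_diff germ_ops uu_Suc LL_Suc)

lemma sigma: "rhom \<sigma>" "\<sigma> (rC x) = rC x" "\<sigma> rU = rU ^ q" "\<sigma> rL = (rC tvar - rU ^ q) * rL"
proof -
  \<comment> \<open>Were the image 0, then the shift of the germ of P would be 0; but the shift of
    germs is injective and that germ is a unit.\<close>
  have u: "ev2 rC (rU ^ q) ((rC tvar - rU ^ q) * rL) P dvd 1" if P: "P \<noteq> 0" for P :: "'a poly fract poly poly"
  proof (rule ccontr)
    assume "\<not> ?thesis"
    then have "ev2 rC (rU ^ q) ((rC tvar - rU ^ q) * rL) P = 0" by (simp add: dvd_field_iff)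
    then have "ev2 gc (germ_shift (germ uu)) (germ_shift (germ LL)) P = 0"
      using rhom_comp_ev2[OF rho(1) rhom_rC, of "rU ^ q" "(rC tvar - rU ^ q) * rL" P]
      by (simp add: rho(2) rho_sigma_values rhom_0[OF rho(1)])
    moreover have "germ_shift (ev2 gc (germ uu) (germ LL) P) = ev2 gc (germ_shift (germ uu)) (germ_shift (germ LL)) P"
      using rhom_comp_ev2[OF rhom_germ_shift rhom_germ_const, of "germ uu" "germ LL" P] by (simp add: germ_ops)
    ultimately have "ev2 gc (germ uu) (germ LL) P = 0" using germ_shift_eq_0 by metis
    then show False using ev2_germ_unit[OF P, of 1] by simp
  qed
  show "rhom \<sigma>" "\<sigma> (rC x) = rC x" "\<sigma> rU = rU ^ q" "\<sigma> rL = (rC tvar - rU ^ q) * rL"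
    unfolding \<sigma>_def by (rule rat2_hom[OF rhom_rC u]; simp)+
qed

text \<open>It commutes with \<sigma>, which multiplies L by a factor free of L. The term
  \<open>ee i\<close> is an eigenvector with eigenvalue theta^(-n i); the powers that occur involve
  the exponents \<open>n i * p ^ j\<close>, pairwise distinct by hypothesis, so \<tau> separates
  them.\<close>

definition \<tau> :: "'a poly fract rat2 \<Rightarrow> 'a poly fract rat2" where
  "\<tau> = rat2_hom rC rU (rC tvar * rL)"

lemma tau: "rhom \<tau>" "\<tau> (rC x) = rC x" "\<tau> rU = rU" "\<tau> rL = rC tvar * rL"
proof -
  have u: "ev2 rC rU (rC tvar * rL) P dvd 1" if P: "P \<noteq> 0" for P :: "'a poly fract poly poly"
  proof (rule ccontr)
    assume "\<not> ?thesis"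
    then have "ev2 rC rU (rC tvar * rL) P = 0" by (simp add: dvd_field_iff)
    then have "ev2 gc (germ uu) (germ (\<lambda>k. tvar * LL k)) P = 0"
      using rhom_comp_ev2[OF rho(1) rhom_rC, of rU "rC tvar * rL" P]
      by (simp add: rho rhom_simps[OF rho(1)] germ_ops)
    then show False using ev2_germ_unit[OF P tvar_nz] by simp
  qed
  show "rhom \<tau>" "\<tau> (rC x) = rC x" "\<tau> rU = rU" "\<tau> rL = rC tvar * rL"
    unfolding \<tau>_def by (rule rat2_hom[OF rhom_rC u]; simp)+
qed

lemma rho_sigma: "\<rho> (\<sigma> x) = germ_shift (\<rho> x)"
  by (rule rat2_hom_ext[OF rhom_comp[OF sigma(1) rho(1)] rhom_comp[OF rho(1) rhom_germ_shift]])
    (simp_all add: sigma rho rho_sigma_values germ_ops)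

lemma sigma_tau: "\<sigma> (\<tau> x) = \<tau> (\<sigma> x)"
  by (rule rat2_hom_ext[OF rhom_comp[OF tau(1) sigma(1)] rhom_comp[OF sigma(1) tau(1)]])
    (simp_all add: sigma tau rhom_simps[OF sigma(1)] rhom_simps[OF tau(1)] mult_ac)

lemma rho_inj: "\<rho> x = \<rho> y \<longleftrightarrow> x = y"
  by (rule rhom_field_inj[OF rho(1)])

lemma sigma_fixed: "\<sigma> x = x \<Longrightarrow> \<exists>c. x = rC c"
  using germ_shift_fixed[of "\<rho> x"] rho_sigma[of x] rho(2) rho_inj by metis

lemma rho_divide:
  assumes "y \<noteq> 0" "\<rho> x = germ f" "\<rho> y = germ g"
  shows "\<rho> (x / y) = germ (\<lambda>k. f k / g k)"
proof -
  have 1: "germ g * \<rho> (inverse y) = 1"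
    using rhom_mult[OF rho(1), of y "inverse y"] assms rhom_1[OF rho(1)] by simp
  obtain h where h: "\<rho> (inverse y) = germ h" by (rule germ_cases)
  have ev: "eventually (\<lambda>k. g k * h k = 1) sequentially" using 1 by (simp add: h germ_ops germ_eq_iff)
  have "\<rho> (x / y) = germ (\<lambda>k. f k * h k)"
    by (simp add: divide_inverse rhom_mult[OF rho(1)] assms h germ_ops)
  also have "\<dots> = germ (\<lambda>k. f k / g k)" unfolding germ_eq_iff
    using ev
  proof eventually_elim
    case (elim k)
    then have "h k = inverse (g k)" by (metis inverse_unique)
    then show ?case by (simp add: divide_inverse)
  qed
  finally show ?thesis .
qed

definition num :: "nat \<Rightarrow> 'a poly" where "num i = fst (SOME (A, B). B \<noteq> 0 \<and> \<alpha> i = Fract A B)"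
definition den :: "nat \<Rightarrow> 'a poly" where "den i = snd (SOME (A, B). B \<noteq> 0 \<and> \<alpha> i = Fract A B)"

lemma num_den: "den i \<noteq> 0" "\<alpha> i = Fract (num i) (den i)"
proof -
  obtain A B where "\<alpha> i = Fract A B" "B \<noteq> 0" by (cases "\<alpha> i") auto
  then have "\<exists>x. case x of (A, B) \<Rightarrow> B \<noteq> 0 \<and> \<alpha> i = Fract A B" by auto
  then have "case (SOME (A, B). B \<noteq> 0 \<and> \<alpha> i = Fract A B) of (A, B) \<Rightarrow> B \<noteq> 0 \<and> \<alpha> i = Fract A B"
    by (rule someI_ex)
  then show "den i \<noteq> 0" "\<alpha> i = Fract (num i) (den i)" by (auto simp: num_def den_def split: prod.splits)
qed

lemma num_nz: "i \<in> {1..d} \<Longrightarrow> num i \<noteq> 0"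
  using alpha_nz[of i] num_den[of i] by (auto simp: fract_collapse)

text \<open>The polynomial A with theta replaced by U. Because its coefficients lie in F_q,
  A(theta)^(q^k) = A(theta^(q^k)); this makes \<alpha>^(q^k) a rational function of U.\<close>

definition hA :: "'a poly \<Rightarrow> 'a poly fract rat2" where "hA A = rP (map_poly cst A)"

lemma hA_eq: "hA A = peval (\<lambda>a. rC (cst a)) rU A"
  unfolding hA_def rP_eq by (rule peval_map_poly) (simp_all add: rhom_0[OF rhom_cst] rhom_0[OF rhom_rC])

lemma rho_hA: "\<rho> (hA A) = germ (\<lambda>k. Fract A 1 ^ (q ^ k))"
proof -
  have pe: "peval (\<lambda>a. gc (cst a)) (germ uu) A = germ (\<lambda>k. peval cst (uu k) A)" for A
    by (induction A) (simp_all add: peval_pCons rhom_0[OF rhom_cst] germ_ops)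
  have "\<rho> (hA A) = peval (\<lambda>a. gc (cst a)) (germ uu) A"
    unfolding hA_eq using rhom_comp_peval[OF rho(1) rhom_comp[OF rhom_cst rhom_rC]] by (simp add: rho)
  moreover have "peval cst (uu k) A = Fract A 1 ^ (q ^ k)" for k
    unfolding uu_def using peval_frobenius[OF rhom_cst, of tvar k A] by (simp add: q peval_cst_tvar)
  ultimately show ?thesis by (simp add: pe)
qed

lemma hA_nz: "A \<noteq> 0 \<Longrightarrow> hA A \<noteq> 0"
proof
  assume "A \<noteq> 0" "hA A = 0"
  then have "germ (\<lambda>k. Fract A 1 ^ (q ^ k)) = germ (\<lambda>_. 0)"
    using rho_hA[of A] rhom_0[OF rho(1)] by (simp add: germ_ops)
  then have "eventually (\<lambda>k. Fract A 1 ^ (q ^ k) = 0) sequentially" by (simp only: germ_eq_iff)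
  then have "Fract A 1 = 0" by (auto simp: eventually_sequentially)
  then show False using \<open>A \<noteq> 0\<close> Fract_1_eq_0 by blast
qed

definition ee :: "nat \<Rightarrow> 'a poly fract rat2" where "ee i = hA (num i) / hA (den i) / rL ^ n i"

lemma rho_ee: "\<rho> (ee i) = germ (\<lambda>k. \<alpha> i ^ (q ^ k) / LL k ^ n i)"
proof -
  have 1: "\<rho> (hA (num i) / hA (den i)) = germ (\<lambda>k. Fract (num i) 1 ^ (q ^ k) / Fract (den i) 1 ^ (q ^ k))"
    by (rule rho_divide[OF hA_nz[OF num_den(1)] rho_hA rho_hA])
  have 2: "\<rho> (rL ^ n i) = germ (\<lambda>k. LL k ^ n i)" by (simp add: rhom_power[OF rho(1)] rho germ_power)
  have "\<rho> (ee i) = germ (\<lambda>k. Fract (num i) 1 ^ (q ^ k) / Fract (den i) 1 ^ (q ^ k) / LL k ^ n i)"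
    unfolding ee_def by (rule rho_divide[OF _ 1 2]) (simp add: rL_nonzero)
  moreover have "Fract (num i) 1 ^ (q ^ k) / Fract (den i) 1 ^ (q ^ k) = \<alpha> i ^ (q ^ k)" for k
  proof -
    have "\<alpha> i = Fract (num i) 1 / Fract (den i) 1"
      using num_den(2) Fract_eq_divide[OF num_den(1)] by (rule trans)
    then show ?thesis by (simp only: power_divide)
  qed
  ultimately show ?thesis by simp
qed

lemma tau_hA: "\<tau> (hA A) = hA A"
  unfolding hA_eq using rhom_comp_peval[OF tau(1) rhom_comp[OF rhom_cst rhom_rC]] by (simp add: tau)

lemma tau_ee_power: "\<tau> (ee i ^ m) = rC (inverse (tvar ^ (n i * m))) * ee i ^ m"
proof -
  have "\<tau> (ee i) = rC (inverse (tvar ^ n i)) * ee i"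
    unfolding ee_def
    by (simp add: divide_inverse rhom_mult[OF tau(1)] rhom_inverse[OF tau(1)] tau_hA rhom_power[OF tau(1)]
        tau power_mult_distrib rhom_inverse[OF rhom_rC] rhom_power[OF rhom_rC])
  then have "\<tau> (ee i ^ m) = (rC (inverse (tvar ^ n i)) * ee i) ^ m" by (simp only: rhom_power[OF tau(1)])
  then show ?thesis
    by (simp add: power_mult_distrib rhom_power[OF rhom_rC, symmetric] power_mult power_inverse)
qed

text \<open>Applying \<tau> minus the eigenvalue of one term removes this term and multiplies the
  others by differences of eigenvalues, nonzero because N is injective; the form of the equation
  persists since \<tau> commutes with \<sigma>. In the end only \<open>x0\<close> is left.\<close>

lemma torus_isolate:
  assumes "finite S" "x0 \<in> S" "inj_on N S" "b x0 \<noteq> 0"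
    "\<And>x. x \<in> S \<Longrightarrow> \<tau> (\<epsilon> x) = rC (inverse (tvar ^ N x)) * \<epsilon> x"
    "r = \<sigma> r + (\<Sum>x\<in>S. rC (b x) * \<epsilon> x)"
  shows "\<exists>r' b'. b' \<noteq> 0 \<and> r' = \<sigma> r' + rC b' * \<epsilon> x0"
proof -
  define S' where "S' = S - {x0}"
  have S: "S = insert x0 S'" "x0 \<notin> S'" "finite S'" using assms by (auto simp: S'_def)
  have "inj_on N (insert x0 S')" "\<And>x. x \<in> insert x0 S' \<Longrightarrow> \<tau> (\<epsilon> x) = rC (inverse (tvar ^ N x)) * \<epsilon> x"
    "r = \<sigma> r + (\<Sum>x\<in>insert x0 S'. rC (b x) * \<epsilon> x)"
    using assms S by auto
  with S(3) show ?thesis using S(2) assms(4)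
  proof (induction S' arbitrary: r b rule: finite_induct)
    case empty
    then show ?case by auto
  next
    case (insert y S')
    define c where "c = inverse (tvar ^ N y :: 'a poly fract)"
    define r1 where "r1 = \<tau> r - rC c * r"
    define b1 where "b1 x = b x * (inverse (tvar ^ N x) - c)" for x
    let ?S = "insert x0 (insert y S')"
    have "\<tau> r = \<sigma> (\<tau> r) + (\<Sum>x\<in>?S. rC (b x) * (rC (inverse (tvar ^ N x)) * \<epsilon> x))"
    proof -
      have "\<tau> r = \<tau> (\<sigma> r + (\<Sum>x\<in>?S. rC (b x) * \<epsilon> x))" using insert.prems(3) by simp
      also have "\<dots> = \<sigma> (\<tau> r) + (\<Sum>x\<in>?S. rC (b x) * \<tau> (\<epsilon> x))"
        by (simp only: rhom_add[OF tau(1)] rhom_sum[OF tau(1)] rhom_mult[OF tau(1)] tau sigma_tau)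
      also have "(\<Sum>x\<in>?S. rC (b x) * \<tau> (\<epsilon> x)) = (\<Sum>x\<in>?S. rC (b x) * (rC (inverse (tvar ^ N x)) * \<epsilon> x))"
        using insert.prems(2) by (intro sum.cong) auto
      finally show ?thesis .
    qed
    moreover have "rC c * r = \<sigma> (rC c * r) + (\<Sum>x\<in>?S. rC (b x) * (rC c * \<epsilon> x))"
    proof -
      have "rC c * r = rC c * (\<sigma> r + (\<Sum>x\<in>?S. rC (b x) * \<epsilon> x))" using insert.prems(3) by simp
      also have "\<dots> = \<sigma> (rC c * r) + (\<Sum>x\<in>?S. rC (b x) * (rC c * \<epsilon> x))"
        by (simp only: rhom_mult[OF sigma(1)] sigma distrib_left sum_distrib_left mult.left_commute)
      finally show ?thesis .
    qed
    ultimately have "r1 = \<sigma> (\<tau> r) + (\<Sum>x\<in>?S. rC (b x) * (rC (inverse (tvar ^ N x)) * \<epsilon> x))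
        - (\<sigma> (rC c * r) + (\<Sum>x\<in>?S. rC (b x) * (rC c * \<epsilon> x)))"
      unfolding r1_def by presburger
    also have "\<dots> = \<sigma> r1 + (\<Sum>x\<in>?S. rC (b1 x) * \<epsilon> x)"
      unfolding r1_def rhom_diff[OF sigma(1)] b1_def
      by (simp only: rhom_mult[OF rhom_rC] rhom_diff[OF rhom_rC] sum_subtractf[symmetric] left_diff_distrib
          right_diff_distrib mult.assoc diff_add_eq add_diff_eq diff_diff_eq add.assoc add.commute)
        (simp add: sum_subtractf algebra_simps)
    also have "(\<Sum>x\<in>?S. rC (b1 x) * \<epsilon> x) = (\<Sum>x\<in>insert x0 S'. rC (b1 x) * \<epsilon> x)"
      using insert.hyps insert.prems(4)
      by (intro sum.mono_neutral_right) (auto simp: b1_def c_def rhom_0[OF rhom_rC])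
    finally have r1: "r1 = \<sigma> r1 + (\<Sum>x\<in>insert x0 S'. rC (b1 x) * \<epsilon> x)" .
    have "N x0 \<noteq> N y" using insert.prems(1,4) by (auto dest: inj_onD)
    then have "b1 x0 \<noteq> 0" using insert.prems(5) tvar_power_inj[of "N x0" "N y"] by (auto simp: b1_def c_def)
    moreover have "inj_on N (insert x0 S')" using insert.prems(1) by (auto simp: inj_on_def)
    ultimately show ?case using insert.IH[of r1 b1] insert.prems r1 by auto
  qed
qed

lemma no_additive_relation:
  assumes "\<exists>i\<in>{1..d}. \<exists>j<J. b i j \<noteq> 0"
    and "r = \<sigma> r + (\<Sum>i=1..d. \<Sum>j<J. rC (b i j) * ee i ^ (p ^ j))"
  shows False
proof -
  obtain i j where ij: "i \<in> {1..d}" "j < J" "b i j \<noteq> 0" using assms(1) by blast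
  define P where "P = p ^ j"
  define N where "N = n i * P"
  have inj: "inj_on (\<lambda>(i, j). n i * p ^ j) ({1..d} \<times> {..<J})"
  proof (rule inj_onI, clarify)
    fix i j i' j' assume A: "i \<in> {1..d}" "i' \<in> {1..d}" "n i * p ^ j = n i' * p ^ j'"
    then have "i = i'" by (rule n_inj)
    then have "p ^ j = p ^ j'" using A n_pos[of i] by simp
    then show "i = i' \<and> j = j'" using \<open>i = i'\<close> prime_gt_1_nat[OF prime_p] power_inject_exp by blast
  qed
  have "\<exists>r' b'. b' \<noteq> 0 \<and> r' = \<sigma> r' + rC b' * (\<lambda>(i, j). ee i ^ (p ^ j)) (i, j)"
  proof (rule torus_isolate[of "{1..d} \<times> {..<J}" "(i, j)" "\<lambda>(i, j). n i * p ^ j" "\<lambda>(i, j). b i j"])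
    show "r = \<sigma> r + (\<Sum>x\<in>{1..d} \<times> {..<J}. rC (case x of (i, j) \<Rightarrow> b i j) * (case x of (i, j) \<Rightarrow> ee i ^ p ^ j))"
      using assms(2) by (simp add: sum.cartesian_product case_prod_unfold)
  qed (use ij inj in \<open>auto simp: tau_ee_power\<close>)
  then obtain r' b' where b': "b' \<noteq> 0" "r' = \<sigma> r' + rC b' * ee i ^ P" by (auto simp: P_def)
  define w where "w = inverse (tvar ^ N :: 'a poly fract)"
  have P1: "P \<ge> 1" using prime_p by (simp add: P_def Suc_le_eq prime_gt_0_nat)
  have w1: "w \<noteq> 1"
  proof
    assume "w = 1"
    then have "tvar ^ N = (tvar :: 'a poly fract) ^ 0" by (simp add: w_def)
    then show False using tvar_power_inj[of N 0] n_pos[OF ij(1)] P1 by (simp add: N_def)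
  qed
  \<comment> \<open>Both \<tau> r' and w r' solve the equation with the same inhomogeneous term, so
    their difference is fixed by \<sigma>, hence a constant. Subtracting a constant from r' then
    gives an eigenvector of \<tau>.\<close>
  have "\<sigma> (\<tau> r' - rC w * r') = \<tau> r' - rC w * r'"
  proof -
    have sr: "\<sigma> r' = r' - rC b' * ee i ^ P" using b'(2) by (simp add: eq_diff_eq)
    have "\<sigma> (\<tau> r') = \<tau> r' - rC b' * (rC w * ee i ^ P)"
      unfolding sigma_tau sr rhom_diff[OF tau(1)] rhom_mult[OF tau(1)] tau_ee_power by (simp add: tau w_def N_def)
    then show ?thesis by (simp add: rhom_simps[OF sigma(1)] sigma sr algebra_simps)
  qed
  then obtain c where c: "\<tau> r' - rC w * r' = rC c" using sigma_fixed by blast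
  define r1 where "r1 = r' - rC (c / (1 - w))"
  have t1: "\<tau> r1 = rC w * r1"
  proof -
    have "c - c / (1 - w) = - (w * (c / (1 - w)))" using w1 by (simp add: field_simps)
    then have e: "rC c - rC (c / (1 - w)) = - (rC w * rC (c / (1 - w)))"
      by (metis rhom_diff[OF rhom_rC] rhom_mult[OF rhom_rC] rhom_uminus[OF rhom_rC])
    have "\<tau> r1 = rC w * r' + (rC c - rC (c / (1 - w)))"
      using c by (simp add: r1_def rhom_diff[OF tau(1)] tau algebra_simps)
    then show ?thesis unfolding e r1_def by (simp add: right_diff_distrib)
  qed
  have s1: "r1 = \<sigma> r1 + rC b' * ee i ^ P"
    using b'(2) by (simp add: r1_def rhom_diff[OF sigma(1)] sigma algebra_simps)
  \<comment> \<open>Multiplication by L^N cancels the eigenvalue, so R is a rational function of U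
    alone.\<close>
  define R where "R = r1 * rL ^ N"
  have "\<tau> R = rC (w * tvar ^ N) * R"
    by (simp add: R_def rhom_simps[OF tau(1)] tau t1 power_mult_distrib rhom_mult[OF rhom_rC] rhom_power[OF rhom_rC] mult_ac)
  then have "\<tau> R = R" using tvar_nz by (simp add: w_def rhom_1[OF rhom_rC])
  then obtain A B where AB: "B \<noteq> 0" "R = rP A / rP B"
    using torus_invariant[OF tvar_power_inj tvar_nz tau] by blast
  define Z where "Z = rC tvar - (rU :: 'a poly fract rat2) ^ q"
  have Zr: "Z = rP ([:tvar:] - monom 1 q)"
    by (simp add: Z_def rhom_diff[OF rhom_rP]) (simp add: rP_def rC_def rU_def monom_altdef rhom_power[OF rhom_Fract_1, symmetric] poly_const_pow)
  have Znz: "Z \<noteq> 0"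
  proof -
    have "[:tvar:] - monom 1 q \<noteq> (0 :: 'a poly fract poly)"
    proof
      assume "[:tvar:] - monom 1 q = (0 :: 'a poly fract poly)"
      then have "coeff ([:tvar:] - monom 1 q) q = (0 :: 'a poly fract)" by simp
      then show False using q_ge_2 by (simp add: coeff_pCons split: nat.splits)
    qed
    then show ?thesis by (simp add: Zr rP_eq_0)
  qed
  have sr1: "\<sigma> r1 = \<sigma> R / (Z * rL) ^ N"
    by (simp add: R_def rhom_simps[OF sigma(1)] sigma Z_def rL_nonzero Znz[unfolded Z_def right_minus_eq])
  define hn hd where "hn = map_poly cst (num i)" and "hd = map_poly cst (den i)"
  have hd: "rP hd \<noteq> 0" using hA_nz[OF num_den(1)] by (simp add: hA_def hd_def)
  have eeP: "ee i ^ P = (rP hn / rP hd) ^ P / rL ^ N"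
    by (simp add: ee_def hA_def hn_def hd_def N_def power_divide power_mult power_mult_distrib)
  have main: "Z ^ N * (R - rC b' * (rP hn / rP hd) ^ P) = \<sigma> R"
  proof -
    have "R / rL ^ N = \<sigma> R / (Z * rL) ^ N + rC b' * ((rP hn / rP hd) ^ P / rL ^ N)"
      using s1 unfolding sr1 eeP by (simp add: R_def rL_nonzero)
    then have "R / rL ^ N * (Z * rL) ^ N = \<sigma> R + rC b' * ((rP hn / rP hd) ^ P / rL ^ N) * (Z * rL) ^ N"
    proof -
      have cancel: "x / y * y = x" if "y \<noteq> 0" for x y :: "'a poly fract rat2" using that by simp
      have "(Z * rL) ^ N \<noteq> 0" by (simp add: Znz rL_nonzero)
      from cancel[OF this, of "\<sigma> R"] \<open>R / rL ^ N = _\<close> show ?thesis by (simp only: distrib_right)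
    qed
    then show ?thesis by (simp add: rL_nonzero power_mult_distrib right_diff_distrib mult_ac eq_diff_eq)
  qed
  have srP: "\<sigma> (rP X) = rP (pcompose X (monom 1 q))" for X
  proof -
    have "\<sigma> (rP X) = peval rC (rU ^ q) X"
      unfolding rP_eq using rhom_comp_peval[OF sigma(1) rhom_rC] by (simp add: sigma)
    moreover have "rP (pcompose X (monom 1 q)) = peval (\<lambda>c. rP [:c:]) (rP (monom 1 q)) X"
      unfolding pcompose_peval by (rule rhom_comp_peval[OF rhom_rP rhom_const_poly])
    moreover have "rP [:c:] = rC c" for c :: "'a poly fract" by (simp add: rP_def rC_def)
    moreover have "rP (monom 1 q) = (rU :: 'a poly fract rat2) ^ q"
      by (simp add: rP_def rU_def monom_altdef rhom_power[OF rhom_Fract_1, symmetric] poly_const_pow)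
    ultimately show ?thesis by simp
  qed
  have "\<sigma> R = rP (pcompose A (monom 1 q)) / rP (pcompose B (monom 1 q))"
    using AB by (simp add: rhom_divide[OF sigma(1)] srP)
  moreover have Bq: "rP (pcompose B (monom 1 q)) \<noteq> 0"
    using rhom_field_eq_0_iff[OF sigma(1), of "rP B"] AB(1) srP rP_eq_0 by metis
  moreover have rPB: "rP B \<noteq> 0" using AB(1) rP_eq_0 by blast
  ultimately have "Z ^ N * (rP A / rP B - rC b' * (rP hn / rP hd) ^ P) * rP (pcompose B (monom 1 q)) = rP (pcompose A (monom 1 q))"
    using main AB(2) by (simp add: field_simps)
  then have "Z ^ N * (rP A / rP B - rC b' * (rP hn ^ P / rP hd ^ P)) * rP (pcompose B (monom 1 q)) * (rP B * rP hd ^ P) = rP (pcompose A (monom 1 q)) * (rP B * rP hd ^ P)"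
    by (simp only: power_divide)
  then have "Z ^ N * (rP A / rP B - rC b' * (rP hn ^ P / rP hd ^ P)) * (rP B * rP hd ^ P) * rP (pcompose B (monom 1 q)) = rP (pcompose A (monom 1 q)) * (rP B * rP hd ^ P)"
    by (simp only: mult_ac)
  moreover have "(rP A / rP B - rC b' * (rP hn ^ P / rP hd ^ P)) * (rP B * rP hd ^ P) = rP A * rP hd ^ P - rC b' * (rP hn ^ P * rP B)"
    using rPB hd by (simp add: left_diff_distrib)
  ultimately have "Z ^ N * (rP A * rP hd ^ P - rC b' * (rP hn ^ P * rP B)) * rP (pcompose B (monom 1 q)) = rP (pcompose A (monom 1 q)) * (rP B * rP hd ^ P)"
    by (simp only: mult.assoc)
  moreover have "rC b' = rP [:b':]" by (simp add: rP_def rC_def)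
  ultimately have "rP (([:tvar:] - monom 1 q) ^ N * (A * hd ^ P - [:b':] * (hn ^ P * B)) * pcompose B (monom 1 q))
      = rP (pcompose A (monom 1 q) * (B * hd ^ P))"
    by (simp only: Zr rhom_mult[OF rhom_rP] rhom_diff[OF rhom_rP] rhom_power[OF rhom_rP])
  then have "([:tvar:] - monom 1 q) ^ N * (A * hd ^ P - [:b':] * (hn ^ P * B)) * pcompose B (monom 1 q)
      = pcompose A (monom 1 q) * (B * hd ^ P)" by (simp only: rP_inj)
  \<comment> \<open>The equation is moved from K to the algebraically closed field, where q-th roots
    of poles exist.\<close>
  then have "map_poly phi (([:tvar:] - monom 1 q) ^ N * (A * hd ^ P - [:b':] * (hn ^ P * B)) * pcompose B (monom 1 q))
      = map_poly phi (pcompose A (monom 1 q) * (B * hd ^ P))" by simp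
  moreover have "map_poly phi ([:tvar:] - monom 1 q) = [:\<theta>:] - monom 1 q"
    using rhom_diff[OF rhom_map_poly[OF rhom_phi]] rhom_0[OF rhom_phi] rhom_1[OF rhom_phi]
    by (simp add: map_poly_monom map_poly_pCons phi_tvar)
  moreover have cphi: "map_poly phi (map_poly cst X) = map_poly \<iota> X" for X
  proof (rule poly_eqI)
    fix k
    have "phi (cst a) = \<iota> a" for a by (simp add: cst_def phi_Fract_1 iota)
    then show "coeff (map_poly phi (map_poly cst X)) k = coeff (map_poly \<iota> X) k"
      by (simp add: coeff_map_poly rhom_0[OF rhom_phi] rhom_0[OF rhom_cst] rhom_0[OF iota])
  qed
  moreover have "map_poly phi [:b':] = [:phi b':]" using rhom_0[OF rhom_phi] by (simp add: map_poly_pCons)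
  ultimately have E: "([:\<theta>:] - monom 1 q) ^ N * (map_poly phi A * map_poly \<iota> (den i) ^ P - [:phi b':] * (map_poly \<iota> (num i) ^ P * map_poly phi B)) * pcompose (map_poly phi B) (monom 1 q)
      = pcompose (map_poly phi A) (monom 1 q) * (map_poly phi B * map_poly \<iota> (den i) ^ P)"
    by (simp only: rhom_mult[OF rhom_map_poly[OF rhom_phi]] rhom_diff[OF rhom_map_poly[OF rhom_phi]]
        rhom_power[OF rhom_map_poly[OF rhom_phi]] map_poly_pcompose_monom[OF rhom_phi] hn_def hd_def)
  show False
  proof (rule no_rational_solution[of "map_poly phi B" "phi b'" "num i" "den i" P j "n i" "map_poly phi A"])
    show "map_poly phi B \<noteq> 0"
      using AB(1) rhom_0[OF rhom_phi] rhom_field_eq_0_iff[OF rhom_phi] by (metis coeff_map_poly leading_coeff_0_iff coeff_0)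
    show "phi b' \<noteq> 0" using b'(1) rhom_field_eq_0_iff[OF rhom_phi] by blast
    show "av (phi (Fract (num i) (den i))) ^ (q - 1) < av \<theta> ^ (n i * q)"
      using alpha_size[OF ij(1)] num_den(2)[of i] by simp
    show "([:\<theta>:] - monom 1 q) ^ (n i * P) * (map_poly phi A * map_poly \<iota> (den i) ^ P - smult (phi b') (map_poly \<iota> (num i) ^ P * map_poly phi B)) * pcompose (map_poly phi B) (monom 1 q)
      = pcompose (map_poly phi A) (monom 1 q) * map_poly phi B * map_poly \<iota> (den i) ^ P"
      using E by (simp add: N_def mult.assoc)
  qed (use ij num_nz num_den n_pos n_ndvd in \<open>auto simp: P_def\<close>)
qed

definition Tg :: "nat \<times> nat \<Rightarrow> 'a poly fract germ" where "Tg v = germ (Tr (fst v) (snd v))"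

definition gk :: "nat \<Rightarrow> nat \<times> nat \<Rightarrow> 'a poly fract" where
  "gk k v = (if v = (0, 0) then 1 / LL k else Tr (fst v) (snd v) k)"

text \<open>The index \<open>(0, 0)\<close> is free and stands for \<open>1/L\<^sub>k\<close>, later for \<open>\<pi>\<close>.\<close>
definition Vx :: "(nat \<times> nat) set" where "Vx = insert (0, 0) {(a, b). a < b \<and> b \<le> d}"

lemma infinite_K: "infinite (UNIV :: 'a poly fract set)"
proof -
  have "inj (\<lambda>i::nat. (tvar :: 'a poly fract) ^ i)" by (rule injI) (rule tvar_power_inj)
  then show ?thesis by (metis range_inj_infinite finite_subset subset_UNIV)
qed

lemma diff_sys: "diff_sys \<sigma> germ_shift \<rho> rC d ee Tg"
proof
  show "rhom \<sigma>" "rhom (germ_shift :: 'a poly fract germ \<Rightarrow> _)" "rhom \<rho>" "rhom (rC :: 'a poly fract \<Rightarrow> _)"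
    by (rule sigma(1) rhom_germ_shift rho(1) rhom_rC)+
  show "\<rho> (\<sigma> x) = germ_shift (\<rho> x)" for x by (rule rho_sigma)
  show "\<sigma> (rC c) = rC c" for c by (rule sigma)
  show "\<exists>c. y = \<rho> (rC c)" if "germ_shift y = y" for y using germ_shift_fixed[OF that] by (simp add: rho)
  show "infinite (UNIV :: 'a poly fract set)" by (rule infinite_K)
  show "prime CHAR('a poly fract rat2)"
    using CHAR_hom[OF rhom_comp[OF rhom_cst rhom_rC]] prime_p p by metis
  fix a b assume ab: "a < b" "b \<le> d"
  have u: "uent Tg (Suc a) b = germ (Tr (Suc a) b)" using ab by (auto simp: uent_def Tg_def germ_ops Tr_refl')
  show "germ_shift (Tg (a, b)) = Tg (a, b) + \<rho> (ee (Suc a)) * uent Tg (Suc a) b"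
    unfolding u rho_ee using ab by (simp add: Tg_def germ_ops Tr_Suc)
qed

text \<open>The first exponent counts -1 / theta^(q^k) = X^(q - 1), a power of X lying in K. A
  relation is read as a polynomial in the T with coefficients rational in U and L; it vanishes by
  the theory of difference systems, and its coefficients are then compared as polynomials in U and
  L.\<close>

theorem parameters_independent:
  fixes S :: "(nat \<times> (nat \<times> nat \<Rightarrow>\<^sub>0 nat)) set" and c :: "nat \<times> (nat \<times> nat \<Rightarrow>\<^sub>0 nat) \<Rightarrow> 'a poly fract"
  assumes S: "finite S" "\<And>a m. (a, m) \<in> S \<Longrightarrow> keys m \<subseteq> Vx"
    and zero: "eventually (\<lambda>k. (\<Sum>(a, m)\<in>S. c (a, m) * (- 1 / uu k) ^ a * mon (gk k) m) = 0) sequentially"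
    and x0: "x0 \<in> S"
  shows "c x0 = 0"
proof -
  interpret ds: diff_sys \<sigma> germ_shift \<rho> rC d ee Tg by (rule diff_sys)
  define z where "z m = lookup m (0::nat, 0::nat)" for m :: "nat \<times> nat \<Rightarrow>\<^sub>0 nat"
  define m' where "m' m = Poly_Mapping.update (0, 0) 0 m" for m :: "nat \<times> nat \<Rightarrow>\<^sub>0 nat"
  have split: "m = m' m + Poly_Mapping.single (0, 0) (z m)" for m
    by (rule poly_mapping_eqI) (auto simp: m'_def z_def lookup_add lookup_single lookup_update)
  have k0: "(0, 0) \<notin> keys (m' m)" for m by (simp add: m'_def in_keys_iff lookup_update)
  have kI: "keys (m' m) \<subseteq> ds.Ix" if "(a, m) \<in> S" for a m
    using S(2)[OF that] k0[of m] by (auto simp: m'_def keys_update Vx_def ds.Ix_def)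
  define co where "co = (\<lambda>(a, m). rC (c (a, m)) * (- 1 / rU) ^ a * (1 / rL) ^ z m)"
  define P0 where "P0 = (\<Sum>x\<in>S. Poly_Mapping.single (m' (snd x)) (co x))"
  have rco: "\<rho> (co (a, m)) = germ (\<lambda>k. c (a, m) * (- 1 / uu k) ^ a * (1 / LL k) ^ z m)" for a m
  proof -
    have 1: "\<rho> (- 1 / rU) = germ (\<lambda>k. - 1 / uu k)"
      by (rule rho_divide[OF rU_nonzero _ rho(3)]) (simp add: rhom_simps[OF rho(1)] one_germ.abs_eq uminus_germ.abs_eq)
    have 2: "\<rho> (1 / rL) = germ (\<lambda>k. 1 / LL k)"
      by (rule rho_divide[OF rL_nonzero _ rho(4)]) (simp add: rhom_simps[OF rho(1)] one_germ.abs_eq)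
    show ?thesis
      unfolding co_def prod.case rhom_mult[OF rho(1)] rhom_power[OF rho(1)] 1 2 rho(2) germ_power
      by (simp add: germ_ops)
  qed
  have "ds.ev P0 = (\<Sum>(a, m)\<in>S. germ (\<lambda>k. c (a, m) * (- 1 / uu k) ^ a * mon (gk k) m))"
  proof -
    have mT: "mon Tg (m' m) = germ (\<lambda>k. mon (gk k) (m' m))" for m
    proof -
      have "mon Tg (m' m) = germ (\<lambda>k. \<Prod>v\<in>keys (m' m). Tr (fst v) (snd v) k ^ lookup (m' m) v)"
        by (simp add: mon_def Tg_def germ_power germ_prod)
      also have "\<dots> = germ (\<lambda>k. mon (gk k) (m' m))"
        unfolding mon_def using k0[of m] by (intro arg_cong[where f = germ] ext prod.cong) (auto simp: gk_def)
      finally show ?thesis .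
    qed
    have gm: "mon (gk k) m = (1 / LL k) ^ z m * mon (gk k) (m' m)" for k m
      by (subst split[of m]) (simp add: mon_add mon_single gk_def)
    have "\<rho> (co (a, m)) * mon Tg (m' m) = germ (\<lambda>k. c (a, m) * (- 1 / uu k) ^ a * mon (gk k) m)" for a m
      unfolding rco mT germ_ops(2) by (simp only: gm[of _ m] mult.assoc)
    then show ?thesis
      unfolding P0_def rhom_sum[OF ds.rhoms(1)] unfolding ds.ev_def
      by (auto simp: meval_single[OF rho(1)] case_prod_unfold intro!: sum.cong)
  qed
  also have "\<dots> = germ (\<lambda>k. \<Sum>(a, m)\<in>S. c (a, m) * (- 1 / uu k) ^ a * mon (gk k) m)"
    unfolding case_prod_unfold by (rule germ_sum)
  also have "\<dots> = 0" using zero by (simp add: germ_ops germ_eq_iff)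
  finally have ev0: "ds.ev P0 = 0" .
  have "ds.kill P0 = P0"
  proof (rule ds.kill_eq_self)
    fix m assume "m \<in> keys P0"
    then have "(\<Sum>x\<in>S. lookup (Poly_Mapping.single (m' (snd x)) (co x)) m) \<noteq> 0"
      by (simp add: in_keys_iff P0_def lookup_sum)
    then obtain x where "x \<in> S" "lookup (Poly_Mapping.single (m' (snd x)) (co x)) m \<noteq> 0"
      by (metis (no_types, lifting) sum.neutral)
    then have "x \<in> S" "m \<in> keys (Poly_Mapping.single (m' (snd x)) (co x))"
      by (simp_all only: in_keys_iff not_False_eq_True)
    then have "m = m' (snd x)" "x \<in> S" by (auto split: if_splits)
    then show "keys m \<subseteq> ds.Ix" using kI by (cases x) auto
  qed
  have "P0 = 0"
  proof (rule ccontr)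
    assume "P0 \<noteq> 0"
    from ds.relation_imp_additive_relation[OF this \<open>ds.kill P0 = P0\<close> ev0]
    obtain r b J where r: "\<exists>i\<in>{1..d}. \<exists>j<J. b i j \<noteq> 0"
      "r = \<sigma> r + (\<Sum>i = 1..d. \<Sum>j<J. rC (b i j) * ee i ^ CHAR('a poly fract rat2) ^ j)" by blast
    have C: "CHAR('a poly fract rat2) = p" unfolding p by (rule CHAR_hom[OF rhom_comp[OF rhom_cst rhom_rC]])
    show False by (rule no_additive_relation[OF r(1) r(2)[unfolded C]])
  qed
  obtain a0 m0 where a0: "x0 = (a0, m0)" by (cases x0)
  define S0 where "S0 = {x \<in> S. m' (snd x) = m' m0}"
  have finS0: "finite S0" using S(1) by (simp add: S0_def)
  have "0 = lookup P0 (m' m0)" using \<open>P0 = 0\<close> by simp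
  also have "\<dots> = (\<Sum>x\<in>S. if m' (snd x) = m' m0 then co x else 0)"
    unfolding P0_def lookup_sum lookup_single by (intro sum.cong) (auto simp: when_def)
  also have "\<dots> = (\<Sum>x\<in>S0. co x)" unfolding S0_def by (rule sum.inter_filter[OF S(1), symmetric])
  finally have co0: "(\<Sum>x\<in>S0. co x) = 0" ..
  \<comment> \<open>Multiplication by U^M L^M clears the negative powers in the coefficient of one
    monomial in the T.\<close>
  define M where "M = Max (insert 0 ((\<lambda>x. fst x + z (snd x)) ` S0))"
  have M: "fst x \<le> M" "z (snd x) \<le> M" if "x \<in> S0" for x
  proof -
    have "fst x + z (snd x) \<le> M" unfolding M_def using finS0 that by (intro Max_ge) auto
    then show "fst x \<le> M" "z (snd x) \<le> M" by auto
  qed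
  define G where "G = (\<Sum>x\<in>S0. monom (monom (c x * (-1) ^ fst x) (M - fst x)) (M - z (snd x)))"
  have rm: "Fract (monom (monom y i) j) 1 = rC y * rU ^ i * rL ^ j" for y :: "'a poly fract" and i j
  proof -
    have "monom (monom y i) j = [:[:y:]:] * [:[:0, 1:]:] ^ i * [:0, 1:] ^ j"
      by (simp add: monom_altdef poly_const_pow smult_power)
    then show ?thesis by (simp only: rhom_mult[OF rhom_Fract_1] rhom_power[OF rhom_Fract_1] rC_def rU_def rL_def)
  qed
  have "Fract G 1 = (\<Sum>x\<in>S0. co x * (rU ^ M * rL ^ M))"
    unfolding G_def rhom_sum[OF rhom_Fract_1] rm
  proof (intro sum.cong refl)
    fix x assume x: "x \<in> S0"
    obtain a m where am: "x = (a, m)" by (cases x)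
    have "rU ^ M = rU ^ (M - a) * (rU :: 'a poly fract rat2) ^ a" "rL ^ M = rL ^ (M - z m) * (rL :: 'a poly fract rat2) ^ z m"
      using M[OF x] am by (simp_all flip: power_add)
    then show "rC (c x * (- 1) ^ fst x) * rU ^ (M - fst x) * rL ^ (M - z (snd x)) = co x * (rU ^ M * rL ^ M)"
    proof -
      have 1: "(- 1 / rU) ^ a * rU ^ a = (- 1 :: 'a poly fract rat2) ^ a"
        by (simp add: rU_nonzero flip: power_mult_distrib)
      have 2: "(1 / rL) ^ z m * rL ^ z m = (1 :: 'a poly fract rat2)"
        by (simp add: rL_nonzero flip: power_mult_distrib)
      have "co x * (rU ^ M * rL ^ M) = rC (c x) * ((- 1 / rU) ^ a * rU ^ a) * rU ^ (M - a) * (((1 / rL) ^ z m * rL ^ z m) * rL ^ (M - z m))"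
        unfolding \<open>rU ^ M = _\<close> \<open>rL ^ M = _\<close> by (simp only: am co_def prod.case mult_ac)
      also have "\<dots> = rC (c x * (- 1) ^ a) * rU ^ (M - a) * rL ^ (M - z m)"
        unfolding 1 2 by (simp add: rhom_mult[OF rhom_rC] rhom_power[OF rhom_rC] rhom_uminus[OF rhom_rC] rhom_1[OF rhom_rC])
      finally show ?thesis by (simp add: am)
    qed
  qed
  also have "\<dots> = 0" using co0 by (simp flip: sum_distrib_right)
  finally have "G = 0" using Fract_1_eq_0 by blast
  have inj: "x = x0" if "x \<in> S0" "fst x = a0" "z (snd x) = z m0" for x
    using that split[of "snd x"] split[of m0] by (cases x) (auto simp: S0_def a0)
  have "x0 \<in> S0" using x0 by (simp add: S0_def a0)
  have "0 = coeff (coeff G (M - z m0)) (M - a0)" using \<open>G = 0\<close> by simp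
  also have "\<dots> = (\<Sum>x\<in>S0. if x = x0 then c x * (-1) ^ fst x else 0)"
    unfolding G_def coeff_sum
  proof (intro sum.cong refl)
    fix x assume x: "x \<in> S0"
    show "coeff (coeff (monom (monom (c x * (- 1) ^ fst x) (M - fst x)) (M - z (snd x))) (M - z m0)) (M - a0)
      = (if x = x0 then c x * (- 1) ^ fst x else 0)"
    proof (cases "x = x0")
      case False
      then have "fst x \<noteq> a0 \<or> z (snd x) \<noteq> z m0" using inj x by blast
      then have "M - fst x \<noteq> M - a0 \<or> M - z (snd x) \<noteq> M - z m0" using M[OF x] M[OF \<open>x0 \<in> S0\<close>] a0 by auto
      then show ?thesis using False by auto
    qed (simp add: a0)
  qed
  also have "\<dots> = c x0 * (-1) ^ a0" using finS0 \<open>x0 \<in> S0\<close> by (simp add: a0)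
  finally show ?thesis by simp
qed

end

section \<open>Asymptotic expansions\<close>

text \<open>X is the small quantity of the expansions and \<open>\<psi> k\<close> evaluates a
  coefficient at the index k. One instance has coefficients in K, independent of k; the others have
  polynomials in the parameters.\<close>

locale asy = nonarch av for av :: "'c::field \<Rightarrow> real" +
  fixes X :: "nat \<Rightarrow> 'c" and \<psi> :: "nat \<Rightarrow> 'm::idom \<Rightarrow> 'c"
  assumes psi: "rhom (\<psi> k)" and psi_bounded: "\<exists>C. \<forall>k. av (\<psi> k m) \<le> C"
    and X_nz: "X k \<noteq> 0" and X_lt: "av (X k) < 1" and X_lim: "\<epsilon> > 0 \<Longrightarrow> \<exists>k0. \<forall>k\<ge>k0. av (X k) < \<epsilon>"
begin

definition bdd :: "(nat \<Rightarrow> 'c) \<Rightarrow> bool" where "bdd a \<longleftrightarrow> (\<exists>C. \<forall>k. av (a k) \<le> C)"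

lemma bdd_psi: "bdd (\<lambda>k. \<psi> k m)" using psi_bounded by (simp add: bdd_def)

lemma bdd_add: "bdd a \<Longrightarrow> bdd b \<Longrightarrow> bdd (\<lambda>k. a k + b k)"
  unfolding bdd_def by (metis av_add_bound max.cobounded1 max.cobounded2 order_trans)

lemma bdd_minus: "bdd a \<Longrightarrow> bdd (\<lambda>k. - a k)"
  by (simp add: bdd_def)

lemma bdd_diff: "bdd a \<Longrightarrow> bdd b \<Longrightarrow> bdd (\<lambda>k. a k - b k)"
  using bdd_add[of a "\<lambda>k. - b k"] bdd_minus[of b] by simp

lemma bdd_mult: "bdd a \<Longrightarrow> bdd b \<Longrightarrow> bdd (\<lambda>k. a k * b k)"
proof -
  assume "bdd a" "bdd b"
  then obtain C D where CD: "\<And>k. av (a k) \<le> C" "\<And>k. av (b k) \<le> D" by (auto simp: bdd_def)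
  have "av (a k * b k) \<le> C * D" for k
    unfolding av_mult using CD order_trans[OF av_nonneg CD(1)] by (intro mult_mono) auto
  then show ?thesis by (auto simp: bdd_def)
qed

lemma bdd_const: "bdd (\<lambda>k. c)" by (auto simp: bdd_def)

lemma bdd_X: "bdd X" using X_lt by (auto simp: bdd_def intro: less_imp_le)

lemma bdd_power: "bdd a \<Longrightarrow> bdd (\<lambda>k. a k ^ n)"
  by (induction n) (auto intro: bdd_mult bdd_const)

lemma bdd_sum: "(\<And>x. x \<in> A \<Longrightarrow> bdd (a x)) \<Longrightarrow> bdd (\<lambda>k. \<Sum>x\<in>A. a x k)"
  by (induction A rule: infinite_finite_induct) (auto intro: bdd_add bdd_const)

lemma bdd_prod: "(\<And>x. x \<in> A \<Longrightarrow> bdd (a x)) \<Longrightarrow> bdd (\<lambda>k. \<Prod>x\<in>A. a x k)"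
  by (induction A rule: infinite_finite_induct) (auto intro: bdd_mult bdd_const)

lemma bdd_Suc: "bdd a \<Longrightarrow> bdd (\<lambda>k. a (Suc k))"
  by (auto simp: bdd_def)

text \<open>\<open>asyS S a f\<close>: the expansion \<open>a k = \<psi> k f\<^sub>0 + \<psi> k f\<^sub>1 X k + \<dots>\<close> holds up to \<open>O(X k ^ S)\<close>;
  the coefficients may depend on \<open>k\<close> through \<open>\<psi> k\<close>.\<close>
primrec asyS :: "nat \<Rightarrow> (nat \<Rightarrow> 'c) \<Rightarrow> 'm fps \<Rightarrow> bool" where
  "asyS 0 a f \<longleftrightarrow> bdd a"
| "asyS (Suc S) a f \<longleftrightarrow> asyS S (\<lambda>k. (a k - \<psi> k (fps_nth f 0)) / X k) (fps_shift 1 f)"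

definition Asy :: "(nat \<Rightarrow> 'c) \<Rightarrow> 'm fps \<Rightarrow> bool" where "Asy a f \<longleftrightarrow> (\<forall>S. asyS S a f)"

lemma asyS_pred: "asyS (Suc S) a f \<Longrightarrow> asyS S a f"
proof (induction S arbitrary: a f)
  case 0
  then have "bdd (\<lambda>k. (a k - \<psi> k (fps_nth f 0)) / X k * X k + \<psi> k (fps_nth f 0))"
    by (intro bdd_add bdd_mult bdd_X bdd_psi) simp
  then show ?case by (simp add: X_nz)
qed simp

lemma asyS_le: "S' \<le> S \<Longrightarrow> asyS S a f \<Longrightarrow> asyS S' a f"
proof (induction S rule: dec_induct)
  case (step n)
  then show ?case using asyS_pred by blast
qed

lemma asyS_bdd: "asyS S a f \<Longrightarrow> bdd a"
  using asyS_le[of 0 S] by simp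

lemma asyS_0: "asyS S (\<lambda>_. 0) 0"
  by (induction S) (auto simp: bdd_const rhom_0[OF psi])

lemma asyS_const: "asyS S (\<lambda>k. \<psi> k m) (fps_const m)"
proof (cases S)
  case (Suc S)
  have "fps_shift 1 (fps_const m) = 0" by (rule fps_ext) simp
  then show ?thesis using asyS_0[of S] Suc by simp
qed (simp add: bdd_psi)

lemma asyS_add: "asyS S a f \<Longrightarrow> asyS S b g \<Longrightarrow> asyS S (\<lambda>k. a k + b k) (f + g)"
proof (induction S arbitrary: a b f g)
  case (Suc S)
  have "(\<lambda>k. (a k + b k - \<psi> k (fps_nth (f + g) 0)) / X k)
     = (\<lambda>k. (a k - \<psi> k (fps_nth f 0)) / X k + (b k - \<psi> k (fps_nth g 0)) / X k)"
    by (rule ext) (simp add: rhom_add[OF psi] diff_divide_distrib add_divide_distrib)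
  moreover have "fps_shift 1 (f + g) = fps_shift 1 f + fps_shift 1 g" by (rule fps_ext) simp
  ultimately show ?case using Suc by simp
qed (simp add: bdd_add)

lemma asyS_X_mult: "asyS S b g \<Longrightarrow> asyS (Suc S) (\<lambda>k. X k * b k) (fps_X * g)"
proof -
  have "fps_shift 1 (fps_X * g) = g" by (rule fps_ext) simp
  then show "asyS S b g \<Longrightarrow> ?thesis" by (simp add: X_nz rhom_0[OF psi])
qed

lemma fps_head_shift: "(f :: 'm fps) = fps_const (fps_nth f 0) + fps_X * fps_shift 1 f"
proof (rule fps_ext)
  fix n
  show "fps_nth f n = fps_nth (fps_const (fps_nth f 0) + fps_X * fps_shift 1 f) n" by (cases n) simp_all
qed

lemma asyS_mult: "asyS S a f \<Longrightarrow> asyS S b g \<Longrightarrow> asyS S (\<lambda>k. a k * b k) (f * g)"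
proof (induction S arbitrary: a b f g)
  case (Suc S)
  define a' where "a' k = (a k - \<psi> k (fps_nth f 0)) / X k" for k
  define b' where "b' k = (b k - \<psi> k (fps_nth g 0)) / X k" for k
  have "(\<lambda>k. (a k * b k - \<psi> k (fps_nth (f * g) 0)) / X k) = (\<lambda>k. \<psi> k (fps_nth f 0) * b' k + a' k * b k)"
  proof
    fix k
    have "a k * b k - \<psi> k (fps_nth (f * g) 0)
      = \<psi> k (fps_nth f 0) * (b k - \<psi> k (fps_nth g 0)) + (a k - \<psi> k (fps_nth f 0)) * b k"
      by (simp add: rhom_mult[OF psi] algebra_simps)
    then show "(a k * b k - \<psi> k (fps_nth (f * g) 0)) / X k = \<psi> k (fps_nth f 0) * b' k + a' k * b k"
      by (simp add: a'_def b'_def add_divide_distrib)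
  qed
  \<comment> \<open>A Leibniz rule for removing the constant term: with f', g' the shifted series,
    (f g)' = f0 g' + f' g.\<close>
  moreover have "fps_shift 1 (f * g) = fps_const (fps_nth f 0) * fps_shift 1 g + fps_shift 1 f * g"
  proof -
    have "f * g = (fps_const (fps_nth f 0) + fps_X * fps_shift 1 f) * g"
      using fps_head_shift[of f] by simp
    also have "\<dots> = fps_const (fps_nth f 0) * (fps_const (fps_nth g 0) + fps_X * fps_shift 1 g) + fps_X * (fps_shift 1 f * g)"
      using fps_head_shift[of g] by (simp add: distrib_right mult.assoc)
    also have "\<dots> = fps_const (fps_nth f 0 * fps_nth g 0) + fps_X * (fps_const (fps_nth f 0) * fps_shift 1 g + fps_shift 1 f * g)"
      by (simp add: distrib_left mult.left_commute)
    finally show ?thesis by (intro fps_ext) simp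
  qed
  moreover have "asyS S (\<lambda>k. \<psi> k (fps_nth f 0) * b' k + a' k * b k) (fps_const (fps_nth f 0) * fps_shift 1 g + fps_shift 1 f * g)"
    using Suc.prems asyS_pred[OF Suc.prems(2)]
    by (intro asyS_add Suc.IH asyS_const) (simp_all add: a'_def[abs_def] b'_def[abs_def])
  ultimately show ?case by simp
qed (simp add: bdd_mult)

lemma Asy_0: "Asy (\<lambda>_. 0) 0" by (simp add: Asy_def asyS_0)
lemma Asy_const: "Asy (\<lambda>k. \<psi> k m) (fps_const m)" by (simp add: Asy_def asyS_const)
lemma Asy_1: "Asy (\<lambda>_. 1) 1" using Asy_const[of 1] by (simp add: rhom_1[OF psi])
lemma Asy_add: "Asy a f \<Longrightarrow> Asy b g \<Longrightarrow> Asy (\<lambda>k. a k + b k) (f + g)" by (simp add: Asy_def asyS_add)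
lemma Asy_mult: "Asy a f \<Longrightarrow> Asy b g \<Longrightarrow> Asy (\<lambda>k. a k * b k) (f * g)" by (simp add: Asy_def asyS_mult)
lemma Asy_X: "Asy X fps_X"
proof -
  have "asyS S X fps_X" for S
  proof (cases S)
    case (Suc S')
    then show ?thesis using asyS_X_mult[of S' "\<lambda>_. 1" 1] Asy_1 by (simp add: Asy_def)
  qed (simp add: bdd_X)
  then show ?thesis by (simp add: Asy_def)
qed
lemma Asy_power: "Asy a f \<Longrightarrow> Asy (\<lambda>k. a k ^ n) (f ^ n)"
  by (induction n) (auto intro: Asy_mult Asy_1)
lemma Asy_sum: "(\<And>x. x \<in> A \<Longrightarrow> Asy (a x) (f x)) \<Longrightarrow> Asy (\<lambda>k. \<Sum>x\<in>A. a x k) (\<Sum>x\<in>A. f x)"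
  by (induction A rule: infinite_finite_induct) (auto intro: Asy_add Asy_0)
lemma Asy_prod: "(\<And>x. x \<in> A \<Longrightarrow> Asy (a x) (f x)) \<Longrightarrow> Asy (\<lambda>k. \<Prod>x\<in>A. a x k) (\<Prod>x\<in>A. f x)"
  by (induction A rule: infinite_finite_induct) (auto intro: Asy_mult Asy_1)

text \<open>Turns formal order of vanishing into an estimate; through it the auxiliary series yields
  small numbers.\<close>

lemma asyS_small:
  "asyS S a f \<Longrightarrow> (\<And>n. n < S \<Longrightarrow> fps_nth f n = 0) \<Longrightarrow> \<exists>C. \<forall>k. av (a k) \<le> C * av (X k) ^ S"
proof (induction S arbitrary: a f)
  case (Suc S)
  have f0: "fps_nth f 0 = 0" using Suc.prems(2) by blast
  have "asyS S (\<lambda>k. a k / X k) (fps_shift 1 f)"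
    using Suc.prems(1) f0 by (simp add: rhom_0[OF psi])
  moreover have "fps_nth (fps_shift 1 f) n = 0" if "n < S" for n using Suc.prems(2)[of "Suc n"] that by simp
  ultimately obtain C where C: "\<And>k. av (a k / X k) \<le> C * av (X k) ^ S" using Suc.IH by blast
  have "av (a k) \<le> C * av (X k) ^ Suc S" for k
  proof -
    have "av (a k) = av (a k / X k) * av (X k)" using X_nz[of k] by (simp flip: av_mult)
    also have "\<dots> \<le> C * av (X k) ^ S * av (X k)" using C by (intro mult_right_mono) auto
    finally show ?thesis by (simp add: mult_ac)
  qed
  then show ?case by blast
qed (simp add: bdd_def)

lemma asyS_cong: "(\<And>n. n < S \<Longrightarrow> fps_nth f n = fps_nth g n) \<Longrightarrow> asyS S a f \<longleftrightarrow> asyS S a g"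
proof (induction S arbitrary: a f g)
  case (Suc S)
  have "asyS S b (fps_shift 1 f) \<longleftrightarrow> asyS S b (fps_shift 1 g)" for b
    using Suc.prems by (intro Suc.IH) simp
  then show ?case using Suc.prems[of 0] by simp
qed simp

end

section \<open>Expansions with coefficients in K\<close>

locale asy_const = asy av X "\<lambda>_. \<phi>" for av :: "'c::field \<Rightarrow> real" and X and \<phi> :: "'k::field \<Rightarrow> 'c" +
  fixes q :: nat
  assumes q2: "q \<ge> 2" and X_Suc: "X (Suc k) = X k ^ q"
begin

lemma phi_hom: "rhom \<phi>" using psi by simp

lemma X_small_const: "(\<And>k. av c \<le> C * av (X k)) \<Longrightarrow> c = 0"
proof (rule ccontr)
  assume A: "\<And>k. av c \<le> C * av (X k)" and "c \<noteq> 0"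
  then have c: "av c > 0" by (simp add: av_pos)
  define D where "D = max C 1"
  obtain k where k: "av (X k) < av c / D" using X_lim[of "av c / D"] c by (auto simp: D_def)
  have "av c \<le> D * av (X k)"
    using A[of k] mult_right_mono[of C D "av (X k)"] by (simp add: D_def)
  also have "\<dots> < av c" using k by (simp add: D_def field_simps)
  finally show False by simp
qed

text \<open>The difference of two leading constants is O(X) and does not depend on k, hence is
  0.\<close>

lemma asyS_unique: "asyS S a f \<Longrightarrow> asyS S a g \<Longrightarrow> n < S \<Longrightarrow> fps_nth f n = fps_nth g n"
proof (induction S arbitrary: a f g n)
  case (Suc S)
  have 0: "fps_nth f 0 = fps_nth g 0"
  proof -
    have "bdd (\<lambda>k. (a k - \<phi> (fps_nth f 0)) / X k - (a k - \<phi> (fps_nth g 0)) / X k)"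
      using Suc.prems(1,2) by (intro bdd_diff) (auto dest: asyS_bdd)
    then obtain C where C: "\<And>k. av (\<phi> (fps_nth g 0 - fps_nth f 0) / X k) \<le> C"
      by (auto simp: bdd_def rhom_diff[OF phi_hom] simp flip: diff_divide_distrib)
    have "av (\<phi> (fps_nth g 0 - fps_nth f 0)) \<le> C * av (X k)" for k
      using C[of k] X_nz[of k] av_pos[of "X k"] by (simp add: av_divide field_simps)
    then have "\<phi> (fps_nth g 0 - fps_nth f 0) = 0" by (rule X_small_const)
    then show ?thesis using rhom_field_eq_0_iff[OF phi_hom] by (metis eq_iff_diff_eq_0)
  qed
  show ?case
  proof (cases n)
    case (Suc m)
    then show ?thesis using Suc.IH[of "\<lambda>k. (a k - \<phi> (fps_nth f 0)) / X k" "fps_shift 1 f" "fps_shift 1 g" m] Suc.prems 0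
      by simp
  qed (simp add: 0)
qed simp

text \<open>The substitution of X^q for X, which describes the shifted sequence and multiplies the
  precision by q.\<close>

definition dil :: "'k fps \<Rightarrow> 'k fps" where
  "dil f = Abs_fps (\<lambda>n. if q dvd n then fps_nth f (n div q) else 0)"

lemma dil_head: "dil f = fps_const (fps_nth f 0) + fps_X ^ q * dil (fps_shift 1 f)"
proof (rule fps_ext)
  fix n
  show "fps_nth (dil f) n = fps_nth (fps_const (fps_nth f 0) + fps_X ^ q * dil (fps_shift 1 f)) n"
  proof (cases "n < q")
    case True
    then show ?thesis using q2 by (auto simp: dil_def fps_X_power_mult_nth dest: dvd_imp_le)
  next
    case False
    then have "n div q = Suc ((n - q) div q)" using q2 by (simp add: le_div_geq)
    moreover have "q dvd n \<longleftrightarrow> q dvd n - q" using False by (simp add: dvd_minus_self)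
    ultimately show ?thesis using False q2 by (simp add: dil_def fps_X_power_mult_nth)
  qed
qed

lemma asyS_X_power_mult: "asyS S b g \<Longrightarrow> asyS (m + S) (\<lambda>k. X k ^ m * b k) (fps_X ^ m * g)"
proof (induction m)
  case (Suc m)
  then have "asyS (Suc (m + S)) (\<lambda>k. X k * (X k ^ m * b k)) (fps_X * (fps_X ^ m * g))"
    by (intro asyS_X_mult) simp
  then show ?case by (simp only: power_Suc mult.assoc add_Suc)
qed simp

lemma asyS_dil: "asyS S a f \<Longrightarrow> asyS (q * S) (\<lambda>k. a (Suc k)) (dil f)"
proof (induction S arbitrary: a f)
  case (Suc S)
  define a' where "a' k = (a k - \<phi> (fps_nth f 0)) / X k" for k
  have "asyS (q + q * S) (\<lambda>k. \<phi> (fps_nth f 0) + X k ^ q * a' (Suc k)) (fps_const (fps_nth f 0) + fps_X ^ q * dil (fps_shift 1 f))"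
    using Suc.prems by (intro asyS_add asyS_const asyS_X_power_mult Suc.IH) (simp add: a'_def[abs_def])
  moreover have "\<phi> (fps_nth f 0) + X k ^ q * a' (Suc k) = a (Suc k)" for k
    using X_nz[of "Suc k"] by (simp add: a'_def X_Suc)
  ultimately show ?case by (simp add: dil_head[of f])
qed (simp add: bdd_Suc)

lemma Asy_dil: "Asy a f \<Longrightarrow> Asy (\<lambda>k. a (Suc k)) (dil f)"
  unfolding Asy_def
proof
  fix S assume "\<forall>S. asyS S a f"
  then have "asyS (q * S) (\<lambda>k. a (Suc k)) (dil f)" using asyS_dil by blast
  moreover have "S \<le> q * S" using q2 by simp
  ultimately show "asyS S (\<lambda>k. a (Suc k)) (dil f)" using asyS_le by blast
qed

lemma Asy_limit:
  assumes "\<And>S. asyS (Suc S) a (F S)" shows "\<exists>f. Asy a f"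
proof -
  \<comment> \<open>The n-th coefficient is read off the n-th approximation; by uniqueness all later
    ones agree with it.\<close>
  define f where "f = Abs_fps (\<lambda>n. fps_nth (F n) n)"
  have "asyS (Suc S) a f" for S
  proof -
    have "fps_nth f n = fps_nth (F S) n" if "n < Suc S" for n
    proof -
      have "asyS (Suc n) a (F S)" using asyS_le[of "Suc n" "Suc S"] assms that by simp
      then show ?thesis using asyS_unique[OF assms[of n], of "F S" n] by (simp add: f_def)
    qed
    then show ?thesis using asyS_cong[of "Suc S" f "F S" a] assms by simp
  qed
  then show ?thesis unfolding Asy_def using asyS_pred by blast
qed

text \<open>Fixed point iteration: an expansion of a to precision S + 1 gives, through the
  recursion, one to precision q (S + 1), because X(k+1) = X(k)^q. The start is the constant
  \<open>c0\<close>.\<close>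

lemma Asy_recursion:
  assumes rec: "\<And>k. a k = A k * a (Suc k) + B k" and A: "Asy A fA" and B: "Asy B fB"
    and base: "bdd (\<lambda>k. (a k - \<phi> c0) / X k)"
  shows "\<exists>f. Asy a f"
proof -
  define F where "F = rec_nat (fps_const c0) (\<lambda>_ f. fA * dil f + fB)"
  have F: "F 0 = fps_const c0" "F (Suc S) = fA * dil (F S) + fB" for S by (simp_all add: F_def)
  have "asyS (Suc S) a (F S)" for S
  proof (induction S)
    case 0
    then show ?case using base by (simp add: F)
  next
    case (Suc S)
    have "asyS (q * Suc S) (\<lambda>k. A k * a (Suc k) + B k) (fA * dil (F S) + fB)"
      using A B asyS_dil[OF Suc] by (intro asyS_add asyS_mult) (auto simp: Asy_def)
    moreover have "Suc (Suc S) \<le> 2 * Suc S" by simp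
    then have "Suc (Suc S) \<le> q * Suc S" using q2 by (meson le_trans mult_le_mono1)
    ultimately have "asyS (Suc (Suc S)) (\<lambda>k. A k * a (Suc k) + B k) (F (Suc S))"
      using asyS_le by (simp only: F)
    then show ?case using rec by (metis (no_types, lifting) ext)
  qed
  then show ?thesis by (rule Asy_limit)
qed

lemma Asy_inverse:
  assumes a: "Asy a f" and f0: "fps_nth f 0 \<noteq> 0" and b: "bdd (\<lambda>k. inverse (a k))" and nz: "\<And>k. a k \<noteq> 0"
  shows "Asy (\<lambda>k. inverse (a k)) (inverse f)"
proof -
  define g where "g = inverse f"
  have fg: "f * g = 1" using f0 by (simp add: g_def inverse_mult_eq_1')
  then have g0: "fps_nth f 0 * fps_nth g 0 = 1" by (metis fps_mult_nth_0 fps_one_nth)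
  have sg: "fps_shift 1 g = fps_const (- fps_nth g 0) * (fps_shift 1 f * g)"
  proof -
    have "(fps_const (fps_nth f 0) + fps_X * fps_shift 1 f) * g = 1"
      using fg fps_head_shift[of f] by simp
    then have c0: "fps_const (fps_nth f 0) * g = 1 - fps_X * (fps_shift 1 f * g)"
      by (simp add: distrib_right mult.assoc eq_diff_eq)
    have c1: "fps_const (fps_nth g 0) * fps_const (fps_nth f 0) = 1"
      using g0 by (simp add: mult.commute)
    have "g = fps_const (fps_nth g 0) * fps_const (fps_nth f 0) * g" unfolding c1 by simp
    also have "\<dots> = fps_const (fps_nth g 0) * (1 - fps_X * (fps_shift 1 f * g))"
      unfolding mult.assoc c0 ..
    also have "\<dots> = fps_const (fps_nth g 0) - fps_X * (fps_const (fps_nth g 0) * (fps_shift 1 f * g))"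
      by (simp only: right_diff_distrib mult_1_right mult.left_commute)
    finally have e: "g = fps_const (fps_nth g 0) - fps_X * (fps_const (fps_nth g 0) * (fps_shift 1 f * g))" .
    have "fps_nth (fps_shift 1 g) n = fps_nth (fps_const (- fps_nth g 0) * (fps_shift 1 f * g)) n" for n
    proof -
      have "fps_nth (fps_shift 1 g) n = fps_nth g (Suc n)" by simp
      also have "\<dots> = - fps_nth (fps_const (fps_nth g 0) * (fps_shift 1 f * g)) n" by (subst e) simp
      finally show ?thesis by simp
    qed
    then show ?thesis by (rule fps_ext)
  qed
  have "asyS S (\<lambda>k. inverse (a k)) g" for S
  proof (induction S)
    case (Suc S)
    define a' where "a' k = (a k - \<phi> (fps_nth f 0)) / X k" for k
    have "asyS (Suc S) a f" using a by (simp add: Asy_def)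
    then have a': "asyS S a' (fps_shift 1 f)" by (simp add: a'_def[abs_def])
    have "(inverse (a k) - \<phi> (fps_nth g 0)) / X k = \<phi> (- fps_nth g 0) * (a' k * inverse (a k))" for k
    proof -
      have "\<phi> (fps_nth f 0) * \<phi> (fps_nth g 0) = 1" using g0 by (metis rhom_mult[OF phi_hom] rhom_1[OF phi_hom])
      then have "inverse (a k) - \<phi> (fps_nth g 0) = - \<phi> (fps_nth g 0) * ((a k - \<phi> (fps_nth f 0)) * inverse (a k))"
        using nz[of k] by (simp add: field_simps)
      then show ?thesis by (simp add: a'_def rhom_uminus[OF phi_hom])
    qed
    moreover have "asyS S (\<lambda>k. \<phi> (- fps_nth g 0) * (a' k * inverse (a k))) (fps_const (- fps_nth g 0) * (fps_shift 1 f * g))"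
      by (intro asyS_mult asyS_const a' Suc)
    ultimately show ?case unfolding asyS.simps sg by (simp only:)
  qed (use b in simp)
  then show ?thesis by (simp add: Asy_def g_def)
qed

text \<open>Iterating the recursion m times bounds |a k| by the maximum of |a (k + m)| and C |X k|,
  and the former vanishes as m grows. This upgrades convergence to 0 to the rate required at the
  start of \<open>Asy_recursion\<close>.\<close>

lemma decay:
  assumes rec: "\<And>k. a k = A k * a (Suc k) + B k" and A: "\<And>k. av (A k) \<le> 1"
    and B: "bdd (\<lambda>k. B k / X k)" and lim: "\<And>\<epsilon>. \<epsilon> > 0 \<Longrightarrow> \<exists>k0. \<forall>k\<ge>k0. av (a k) < \<epsilon>"
  shows "bdd (\<lambda>k. a k / X k)"
proof -
  obtain C0 where C0: "\<And>k. av (B k / X k) \<le> C0" using B by (auto simp: bdd_def)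
  define C where "C = max C0 1"
  have Xp: "av (X k) > 0" for k using X_nz by (simp add: av_pos)
  have Bk: "av (B k) \<le> C * av (X k)" for k
  proof -
    have "av (B k / X k) \<le> C" using C0[of k] by (simp add: C_def)
    then show ?thesis using Xp[of k] by (simp add: av_divide field_simps)
  qed
  have dec: "av (X (Suc k)) \<le> av (X k)" for k
    using X_lt[of k] q2 power_decreasing[of 1 q "av (X k)"] by (simp add: X_Suc av_power)
  have dec': "av (X (k + m)) \<le> av (X k)" for k m
    by (induction m) (auto intro: order_trans[OF dec])
  have it: "av (a k) \<le> max (av (a (k + m))) (C * av (X k))" for k m
  proof (induction m)
    case (Suc m)
    have "av (a (k + m)) \<le> max (av (A (k + m) * a (Suc (k + m)))) (av (B (k + m)))"
      by (subst rec) (rule av_add_le)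
    also have "\<dots> \<le> max (av (a (k + Suc m))) (C * av (X k))"
    proof (intro max.mono)
      show "av (A (k + m) * a (Suc (k + m))) \<le> av (a (k + Suc m))"
        using A[of "k + m"] mult_right_mono[of "av (A (k + m))" 1 "av (a (Suc (k + m)))"] by (simp add: av_mult)
      show "av (B (k + m)) \<le> C * av (X k)"
      proof (rule order_trans[OF Bk])
        show "C * av (X (k + m)) \<le> C * av (X k)" using dec'[of k m] by (intro mult_left_mono) (auto simp: C_def)
      qed
    qed
    finally show ?case using Suc by auto
  qed simp
  have "av (a k / X k) \<le> C" for k
  proof -
    have "C * av (X k) > 0" using Xp by (simp add: C_def)
    then obtain k0 where k0: "\<And>l. l \<ge> k0 \<Longrightarrow> av (a l) < C * av (X k)" using lim by blast
    have "av (a k) \<le> C * av (X k)" using it[of k k0] k0[of "k + k0"] by simp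
    then show ?thesis using Xp[of k] by (simp add: av_divide field_simps)
  qed
  then show ?thesis by (auto simp: bdd_def)
qed

end

section \<open>Sequences tending to 0\<close>

context nonarch
begin

definition van :: "(nat \<Rightarrow> 'c) \<Rightarrow> bool" where
  "van a \<longleftrightarrow> (\<forall>\<epsilon>>0. \<exists>k0. \<forall>k\<ge>k0. av (a k) < \<epsilon>)"

lemma van_add: assumes "van a" "van b" shows "van (\<lambda>k. a k + b k)"
  unfolding van_def
proof (intro allI impI)
  fix \<epsilon> :: real assume "\<epsilon> > 0"
  then obtain k0 k1 where "\<forall>k\<ge>k0. av (a k) < \<epsilon>" "\<forall>k\<ge>k1. av (b k) < \<epsilon>" using assms unfolding van_def by blast
  then show "\<exists>k0. \<forall>k\<ge>k0. av (a k + b k) < \<epsilon>"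
    by (intro exI[of _ "max k0 k1"]) (auto intro: av_add_lt)
qed

lemma van_minus: "van a \<Longrightarrow> van (\<lambda>k. - a k)" by (simp add: van_def)

lemma van_diff: "van a \<Longrightarrow> van b \<Longrightarrow> van (\<lambda>k. a k - b k)"
  using van_add[of a "\<lambda>k. - b k"] van_minus[of b] by simp

lemma van_0: "van (\<lambda>_. 0)" by (simp add: van_def)

lemma van_sum: "(\<And>x. x \<in> A \<Longrightarrow> van (a x)) \<Longrightarrow> van (\<lambda>k. \<Sum>x\<in>A. a x k)"
  by (induction A rule: infinite_finite_induct) (auto intro: van_add van_0)

lemma van_mult: assumes "van a" "\<And>k. av (b k) \<le> C" shows "van (\<lambda>k. b k * a k)"
  unfolding van_def
proof (intro allI impI)
  fix \<epsilon> :: real assume e: "\<epsilon> > 0"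
  define D where "D = max C 1"
  have D: "D > 0" by (simp add: D_def)
  then obtain k0 where k0: "\<forall>k\<ge>k0. av (a k) < \<epsilon> / D" using assms(1) e unfolding van_def by (meson divide_pos_pos)
  have "av (b k * a k) < \<epsilon>" if "k \<ge> k0" for k
  proof -
    have "av (b k) \<le> D" using assms(2)[of k] by (simp add: D_def)
    then have "av (b k * a k) \<le> D * av (a k)" unfolding av_mult by (intro mult_right_mono) auto
    also have "\<dots> < \<epsilon>" using k0 that D by (simp add: field_simps)
    finally show ?thesis .
  qed
  then show "\<exists>k0. \<forall>k\<ge>k0. av (b k * a k) < \<epsilon>" by blast
qed

lemma tendsto_iff_van: "av_tendsto av s L \<longleftrightarrow> van (\<lambda>k. s k - L)"
  by (simp add: av_tendsto_def van_def LIMSEQ_iff)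

lemma tendsto_unique:
  assumes "av_tendsto av s L" "av_tendsto av s L'" shows "L = L'"
proof (rule ccontr)
  assume "L \<noteq> L'"
  then have e: "av (L - L') > 0" by (simp add: av_pos)
  have "van (\<lambda>k. (s k - L') - (s k - L))" by (rule van_diff[OF assms(2)[unfolded tendsto_iff_van] assms(1)[unfolded tendsto_iff_van]])
  then have "van (\<lambda>k. L - L')" by simp
  then show False using e unfolding van_def by blast
qed

lemma av_lim_eq: "av_tendsto av s L \<Longrightarrow> av_lim av s = L"
  unfolding av_lim_def by (rule the_equality) (auto dest: tendsto_unique)

end

section \<open>Expansions of the Carlitz factors and of single terms\<close>

context carlitz_li
begin

definition XX :: "nat \<Rightarrow> 'c" where "XX k = inverse (lam ^ (q ^ k))"

lemma av_lam_pow: "av lam ^ (q - 1) = av \<theta>"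
  using lam by (metis av_minus av_power)

lemma av_lam_gt: "av lam > 1"
proof (rule ccontr)
  assume "\<not> av lam > 1"
  then have "av lam ^ (q - 1) \<le> 1" by (intro power_le_one) auto
  then show False using av_lam_pow theta_gt by simp
qed

lemma lam_nz: "lam \<noteq> 0" using av_lam_gt by auto

lemma theta_nz: "\<theta> \<noteq> 0" using theta_gt by auto

lemma av_XX: "av (XX k) = inverse (av lam) ^ (q ^ k)"
  by (simp add: XX_def av_inverse av_power power_inverse)

lemma XX_nz: "XX k \<noteq> 0" by (simp add: XX_def lam_nz)

lemma XX_Suc: "XX (Suc k) = XX k ^ q"
  by (simp add: XX_def power_inverse power_mult[symmetric] mult.commute)

lemma XX_lt: "av (XX k) < 1"
  unfolding av_XX using av_lam_gt q_ge_2 by (intro power_less_one_iff[THEN iffD2]) (auto simp: inverse_less_1_iff)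

lemma XX_lim: assumes "\<epsilon> > 0" shows "\<exists>k0. \<forall>k\<ge>k0. av (XX k) < \<epsilon>"
proof -
  have i: "inverse (av lam) < 1" "inverse (av lam) \<ge> 0" using av_lam_gt by (auto simp: inverse_less_1_iff)
  obtain k0 where k0: "inverse (av lam) ^ k0 < \<epsilon>" using real_arch_pow_inv[OF assms i(1)] by blast
  have "av (XX k) < \<epsilon>" if "k \<ge> k0" for k
  proof -
    have "k0 \<le> q ^ k" using that power_gt_expt[of q k] q_ge_2 by linarith
    then have "av (XX k) \<le> inverse (av lam) ^ k0" unfolding av_XX using i by (intro power_decreasing) auto
    then show ?thesis using k0 by simp
  qed
  then show ?thesis by blast
qed

sublocale ac: asy_const av XX phi q
proof
  show "rhom phi" by (rule rhom_phi)
  show "\<exists>C. \<forall>k::nat. av (phi m) \<le> C" for m by blast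
  show "2 \<le> q" by (rule q_ge_2)
qed (auto simp: XX_nz XX_lt XX_lim XX_Suc)

lemma neg_power_q: "(- x :: 'c) ^ (q ^ k) = - (x ^ (q ^ k))"
proof -
  have "(x + - x) ^ (q ^ k) = x ^ (q ^ k) + (- x) ^ (q ^ k)" unfolding q by (rule frobenius_add[OF iota])
  moreover have "(0 :: 'c) ^ (q ^ k) = 0" using q_ge_2 by (simp add: power_0_left)
  ultimately show ?thesis by (metis add.right_inverse add.inverse_unique)
qed

lemma phi_uu: "phi (uu k) = \<theta> ^ (q ^ k)"
  by (simp add: uu_def rhom_power[OF rhom_phi] phi_tvar)

lemma XX_pow: "XX k ^ (q - 1) = - 1 / \<theta> ^ (q ^ k)"
proof -
  have "XX k ^ (q - 1) = inverse ((lam ^ (q - 1)) ^ (q ^ k))"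
    by (simp add: XX_def power_inverse power_mult[symmetric] mult.commute)
  then show ?thesis unfolding lam by (simp add: neg_power_q divide_inverse)
qed

text \<open>Equal to -theta^(1 - q^(k+1)), so that 1 + \<open>tx k\<close> is the inverse of a
  factor in the product for \<pi>, written with a power of X to be expandable.\<close>

definition tx :: "nat \<Rightarrow> 'c" where "tx k = \<theta> * XX k ^ (q * (q - 1))"

lemma tx_eq: "tx k = - (\<theta> / \<theta> ^ (q ^ Suc k))"
proof -
  have "XX k ^ (q * (q - 1)) = (XX k ^ (q - 1)) ^ q" by (simp add: power_mult[symmetric] mult.commute)
  also have "\<dots> = XX (Suc k) ^ (q - 1)" by (simp add: XX_Suc power_mult[symmetric] mult.commute)
  also have "\<dots> = - 1 / \<theta> ^ (q ^ Suc k)" by (rule XX_pow)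
  finally show ?thesis by (simp add: tx_def)
qed

lemma av_tx: "av (tx k) \<le> av (XX k)"
proof -
  have X0: "av lam \<le> inverse (av (XX k))"
    using av_lam_gt q_ge_2 by (simp add: av_XX power_inverse self_le_power)
  have p: "av (XX k) > 0" using XX_nz by (simp add: av_pos)
  have e: "(q - 1) + (q - 1) * (q - 1) = q * (q - 1)" using q_ge_2 by (cases q) auto
  have "av (tx k) = av lam ^ (q - 1) * av (XX k) ^ (q * (q - 1))"
    unfolding av_lam_pow by (simp add: tx_def av_mult av_power)
  also have "\<dots> \<le> inverse (av (XX k)) ^ (q - 1) * av (XX k) ^ (q * (q - 1))"
    using X0 by (intro mult_right_mono power_mono) auto
  also have "\<dots> = av (XX k) ^ ((q - 1) * (q - 1))"
    using XX_nz[of k] unfolding e[symmetric] power_add power_inverse by simp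
  also have "\<dots> \<le> av (XX k) ^ 1"
    using XX_lt[of k] q_ge_2 by (intro power_decreasing) auto
  finally show ?thesis by simp
qed

lemma av_1_tx: "av (1 + tx k) = 1"
  using av_add_eq[of "tx k" 1] av_tx[of k] XX_lt[of k] by simp

lemma nz_1_tx: "1 + tx k \<noteq> 0" using av_1_tx[of k] by auto

definition dd :: "nat \<Rightarrow> 'c" where "dd k = inverse (1 + tx k)"

lemma av_dd: "av (dd k) = 1" by (simp add: dd_def av_inverse av_1_tx)

lemma av_dd_minus_1: "av (dd k - 1) \<le> av (XX k)"
proof -
  have "dd k - 1 = - (tx k * dd k)" using nz_1_tx[of k] by (simp add: dd_def field_simps)
  then show ?thesis using av_tx[of k] by (simp add: av_mult av_dd)
qed

lemma Asy_dd: "\<exists>f. ac.Asy dd f"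
proof -
  have "ac.Asy (\<lambda>k. 1 + phi tvar * XX k ^ (q * (q - 1))) (1 + fps_const tvar * fps_X ^ (q * (q - 1)))"
    by (intro ac.Asy_add ac.Asy_mult ac.Asy_power ac.Asy_X ac.Asy_const ac.Asy_1)
  moreover have "fps_nth (1 + fps_const tvar * fps_X ^ (q * (q - 1)) :: 'a poly fract fps) 0 \<noteq> 0"
    using q_ge_2 by (simp add: fps_X_power_nth)
  ultimately have "ac.Asy (\<lambda>k. inverse (1 + phi tvar * XX k ^ (q * (q - 1)))) (inverse (1 + fps_const tvar * fps_X ^ (q * (q - 1))))"
    using nz_1_tx av_1_tx by (intro ac.Asy_inverse) (auto simp: phi_tvar tx_def ac.bdd_def av_inverse)
  then show ?thesis by (auto simp: dd_def[abs_def] tx_def phi_tvar)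
qed

text \<open>L normalised to constant absolute value: the quotient of consecutive terms is 1 +
  \<open>tx k\<close>, and the limit is 1/\<pi>.\<close>

definition GG :: "nat \<Rightarrow> 'c" where "GG k = XX k ^ q * carlitz_L \<theta> q k"

lemma GG_Suc: "GG (Suc k) = GG k * (1 + tx k)"
proof -
  have "\<theta> * (XX k ^ (q * (q - 1)) * \<theta> ^ (q ^ Suc k)) = \<theta> * (- 1)"
    using tx_eq[of k] theta_nz by (simp add: tx_def field_simps)
  then have "XX k ^ (q * (q - 1)) * \<theta> ^ (q ^ Suc k) = - 1"
    using theta_nz by (simp only: mult_cancel_left) blast
  moreover have "XX k ^ (q * q) * (\<theta> - \<theta> ^ (q ^ Suc k))
      = XX k ^ q * (XX k ^ (q * (q - 1)) * \<theta> - XX k ^ (q * (q - 1)) * \<theta> ^ (q ^ Suc k))"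
  proof -
    have "q * q = q * (q - 1) + q" using q_ge_2 by (cases q) auto
    then have "XX k ^ (q * q) = XX k ^ (q * (q - 1)) * XX k ^ q" by (simp only: power_add)
    then show ?thesis unfolding right_diff_distrib by (simp only: mult_ac)
  qed
  ultimately have "XX k ^ (q * q) * (\<theta> - \<theta> ^ (q ^ Suc k)) = XX k ^ q * (tx k + 1)"
    by (simp only: tx_def) (simp add: mult.commute)
  then show ?thesis
    unfolding GG_def carlitz_L_Suc XX_Suc by (simp add: power_mult[symmetric] mult_ac add.commute)
qed

lemma GG_rec: "GG k = dd k * GG (Suc k)"
  using nz_1_tx[of k] by (simp add: GG_Suc dd_def)

lemma GG_nz: "GG k \<noteq> 0" by (simp add: GG_def XX_nz carlitz_L_nonzero)

lemma av_GG: "av (GG k) = av (GG 0)"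
  by (induction k) (auto simp: GG_Suc av_mult av_1_tx)

lemma bdd_GG: "ac.bdd (\<lambda>k. GG k ^ m)" "ac.bdd (\<lambda>k. inverse (GG k) ^ m)"
  unfolding ac.bdd_def av_power av_inverse by (metis av_GG order_refl)+

text \<open>Since U X^(q - 1) = -1 for U = theta^(q^k), this multiple of A(U) is a polynomial in
  X^(q - 1), with constant term coming from the leading coefficient of A.\<close>

definition nh :: "'a poly \<Rightarrow> nat \<Rightarrow> 'c" where
  "nh A k = peval \<iota> (\<theta> ^ (q ^ k)) A * XX k ^ ((q - 1) * degree A)"

lemma Asy_nh:
  assumes "A \<noteq> 0"
  shows "\<exists>f. ac.Asy (nh A) f \<and> fps_nth f 0 \<noteq> 0"
proof -
  define f :: "'a poly fract fps" where
    "f = (\<Sum>i\<le>degree A. fps_const (cst (coeff A i) * (-1) ^ i) * fps_X ^ ((q - 1) * (degree A - i)))"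
  have "ac.Asy (\<lambda>k. \<Sum>i\<le>degree A. phi (cst (coeff A i) * (-1) ^ i) * XX k ^ ((q - 1) * (degree A - i))) f"
    unfolding f_def by (intro ac.Asy_sum ac.Asy_mult ac.Asy_const ac.Asy_power ac.Asy_X)
  moreover have "(\<Sum>i\<le>degree A. phi (cst (coeff A i) * (-1) ^ i) * XX k ^ ((q - 1) * (degree A - i))) = nh A k" for k
  proof -
    define u where "u = \<theta> ^ (q ^ k)"
    have u: "u * XX k ^ (q - 1) = - 1" unfolding XX_pow u_def using theta_nz by simp
    have "u ^ i * XX k ^ ((q - 1) * degree A) = (-1) ^ i * XX k ^ ((q - 1) * (degree A - i))" if "i \<le> degree A" for i
    proof -
      have "(q - 1) * degree A = (q - 1) * i + (q - 1) * (degree A - i)"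
        using that by (simp add: distrib_left[symmetric])
      then have "u ^ i * XX k ^ ((q - 1) * degree A) = (u * XX k ^ (q - 1)) ^ i * XX k ^ ((q - 1) * (degree A - i))"
        by (simp add: power_add power_mult power_mult_distrib)
      then show ?thesis unfolding u .
    qed
    moreover have "phi (cst a) = \<iota> a" for a by (simp add: cst_def phi_Fract_1 iota)
    ultimately show ?thesis
      unfolding nh_def peval_altdef[of \<iota>, OF rhom_0[OF iota]] u_def[symmetric]
      by (simp add: sum_distrib_right rhom_simps[OF rhom_phi] mult.assoc)
  qed
  ultimately have "ac.Asy (nh A) f" by (simp add: ext)
  moreover have "fps_nth f 0 \<noteq> 0"
  proof -
    have "fps_nth f 0 = (\<Sum>i\<le>degree A. if i = degree A then cst (lead_coeff A) * (-1) ^ i else 0)"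
      unfolding f_def fps_sum_nth
    proof (rule sum.cong[OF refl])
      fix i assume "i \<in> {..degree A}"
      then have "0 = (q - 1) * (degree A - i) \<longleftrightarrow> i = degree A" using q_ge_2 by auto
      then show "fps_nth (fps_const (cst (coeff A i) * (-1) ^ i) * fps_X ^ ((q - 1) * (degree A - i))) 0
          = (if i = degree A then cst (lead_coeff A) * (-1) ^ i else 0)"
        by (simp only: fps_mult_left_const_nth fps_X_power_nth) simp
    qed
    moreover have "cst (lead_coeff A) \<noteq> 0" by (simp add: rhom_field_eq_0_iff[OF rhom_cst] assms)
    ultimately show ?thesis by simp
  qed
  ultimately show ?thesis by blast
qed

lemma av_nh: "A \<noteq> 0 \<Longrightarrow> av (nh A k) = 1"
proof -
  assume A: "A \<noteq> 0"
  have u: "av (\<theta> ^ (q ^ k)) > 1" using theta_gt q_ge_2 by (simp add: av_power one_less_power)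
  have "av (XX k ^ (q - 1)) * av (\<theta> ^ (q ^ k)) = 1"
    unfolding XX_pow using u by (simp add: av_divide theta_nz)
  moreover have "av (nh A k) = av (\<theta> ^ (q ^ k)) ^ degree A * av (XX k) ^ ((q - 1) * degree A)"
    by (simp only: nh_def av_mult av_peval[OF A u] av_power[of "XX k"])
  then have "av (nh A k) = (av (XX k ^ (q - 1)) * av (\<theta> ^ (q ^ k))) ^ degree A"
    by (metis power_mult power_mult_distrib av_power mult.commute)
  ultimately show ?thesis by simp
qed

definition beta :: "nat \<Rightarrow> nat \<Rightarrow> 'c" where "beta c k = XX k ^ (q * n c) * phi (\<alpha> c) ^ (q ^ k)"

text \<open>Here the convergence condition on \<alpha> enters: it says that the exponent E of X left
  after normalising numerator and denominator is positive, so the expansion has no constant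
  term.\<close>

lemma Asy_beta:
  assumes c: "c \<in> {1..d}"
  shows "\<exists>f. ac.Asy (beta c) f \<and> fps_nth f 0 = 0"
proof -
  have nd: "num c \<noteq> 0" "den c \<noteq> 0" using num_nz[OF c] num_den by auto
  obtain f where f: "ac.Asy (nh (num c)) f" using Asy_nh[OF nd(1)] by blast
  obtain g where g: "ac.Asy (nh (den c)) g" "fps_nth g 0 \<noteq> 0" using Asy_nh[OF nd(2)] by blast
  have nz: "nh (den c) k \<noteq> 0" for k using av_nh[OF nd(2), of k] by auto
  have gi: "ac.Asy (\<lambda>k. inverse (nh (den c) k)) (inverse g)"
    by (rule ac.Asy_inverse[OF g _ nz]) (auto simp: ac.bdd_def av_inverse av_nh[OF nd(2)])
  have al: "phi (\<alpha> c) = peval \<iota> \<theta> (num c) / peval \<iota> \<theta> (den c)"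
    using num_den(2)[of c] phi_Fract[OF nd(2)] by metis
  have "(av \<theta> ^ degree (num c) / av \<theta> ^ degree (den c)) ^ (q - 1) < av \<theta> ^ (n c * q)"
    using alpha_size[OF c] av_peval[OF nd(1) theta_gt] av_peval[OF nd(2) theta_gt] by (simp add: al av_divide)
  then have "av \<theta> ^ (degree (num c) * (q - 1)) < av \<theta> ^ (n c * q + degree (den c) * (q - 1))"
    using theta_gt by (simp add: power_divide power_mult[symmetric] power_add divide_simps)
  then have lt: "degree (num c) * (q - 1) < n c * q + degree (den c) * (q - 1)"
    using theta_gt power_strict_increasing_iff by blast
  define E where "E = n c * q + degree (den c) * (q - 1) - degree (num c) * (q - 1)"
  have E: "E > 0" "E + (q - 1) * degree (num c) = q * n c + (q - 1) * degree (den c)"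
    using lt by (auto simp: E_def mult.commute)
  have "ac.Asy (\<lambda>k. XX k ^ E * (nh (num c) k * inverse (nh (den c) k))) (fps_X ^ E * (f * inverse g))"
    by (intro ac.Asy_mult ac.Asy_power ac.Asy_X f gi)
  moreover have "XX k ^ E * (nh (num c) k * inverse (nh (den c) k)) = beta c k" for k
  proof -
    define u where "u = \<theta> ^ (q ^ k)"
    have "phi (\<alpha> c) ^ (q ^ k) = peval \<iota> u (num c) / peval \<iota> u (den c)"
      by (simp add: al u_def iota_frobenius power_divide)
    have D: "peval \<iota> u (den c) \<noteq> 0" using nz[of k] by (auto simp: nh_def u_def)
    have e: "XX k ^ E * XX k ^ ((q - 1) * degree (num c)) = XX k ^ (q * n c) * XX k ^ ((q - 1) * degree (den c))"
      using E(2) by (simp flip: power_add)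
    have "XX k ^ E * (nh (num c) k * inverse (nh (den c) k))
       = (XX k ^ E * XX k ^ ((q - 1) * degree (num c))) * (peval \<iota> u (num c) * inverse (nh (den c) k))"
      by (simp only: nh_def[of "num c"] u_def mult_ac)
    also have "\<dots> = XX k ^ (q * n c) * (peval \<iota> u (num c) * (XX k ^ ((q - 1) * degree (den c)) * inverse (nh (den c) k)))"
      unfolding e by (simp only: mult_ac)
    also have "XX k ^ ((q - 1) * degree (den c)) * inverse (nh (den c) k) = inverse (peval \<iota> u (den c))"
      using XX_nz[of k] D by (simp add: nh_def u_def)
    finally show ?thesis using \<open>phi (\<alpha> c) ^ (q ^ k) = peval \<iota> u (num c) / peval \<iota> u (den c)\<close>
      by (simp only: beta_def divide_inverse)
  qed
  moreover have "fps_nth (fps_X ^ E * (f * inverse g)) 0 = 0" using E(1) by (simp add: fps_X_power_mult_nth)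
  ultimately show ?thesis by (metis (no_types, lifting) ext)
qed

lemma Asy_bdd_quot: "ac.Asy a f \<Longrightarrow> fps_nth f 0 = 0 \<Longrightarrow> ac.bdd (\<lambda>k. a k / XX k)"
proof -
  assume "ac.Asy a f" "fps_nth f 0 = 0"
  then have "ac.asyS (Suc 0) a f" by (simp add: ac.Asy_def)
  then show ?thesis using \<open>fps_nth f 0 = 0\<close> by (simp add: rhom_0[OF rhom_phi])
qed

definition el :: "nat \<Rightarrow> nat \<Rightarrow> 'c" where "el c k = phi (\<alpha> c) ^ (q ^ k) / carlitz_L \<theta> q k ^ n c"

lemma el_beta: "GG k ^ n c * el c k = beta c k"
  using carlitz_L_nonzero[of k] by (simp add: el_def GG_def beta_def power_mult_distrib power_mult)

lemma bdd_el: "c \<in> {1..d} \<Longrightarrow> ac.bdd (\<lambda>k. el c k / XX k)"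
proof -
  assume "c \<in> {1..d}"
  then obtain f where "ac.Asy (beta c) f" "fps_nth f 0 = 0" using Asy_beta by blast
  then have "ac.bdd (\<lambda>k. inverse (GG k) ^ n c * (beta c k / XX k))"
    by (intro ac.bdd_mult bdd_GG Asy_bdd_quot)
  moreover have "inverse (GG k) ^ n c * (beta c k / XX k) = el c k / XX k" for k
    using GG_nz[of k] by (simp add: el_beta[symmetric] power_inverse)
  ultimately show ?thesis by (simp only:)
qed

text \<open>The terms are O(X), and for a nonarchimedean absolute value this bounds all later
  differences at once, so the partial sums are Cauchy and bounded.\<close>

lemma sum_converges:
  assumes rec: "\<And>k. s (Suc k) = s k + t k" and t: "ac.bdd (\<lambda>k. t k / XX k)"
  shows "\<exists>L. av_tendsto av s L" "ac.bdd s"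
proof -
  obtain C0 where C0: "\<And>k. av (t k / XX k) \<le> C0" using t by (auto simp: ac.bdd_def)
  define C where "C = max C0 1"
  have Xp: "av (XX k) > 0" for k using XX_nz by (simp add: av_pos)
  have tk: "av (t k) \<le> C * av (XX k)" for k
  proof -
    have "av (t k / XX k) \<le> C" using C0[of k] by (simp add: C_def)
    then show ?thesis using Xp[of k] by (simp add: av_divide field_simps)
  qed
  have dec: "av (XX (Suc k)) \<le> av (XX k)" for k
    using XX_lt[of k] q_ge_2 power_decreasing[of 1 q "av (XX k)"] by (simp add: XX_Suc av_power)
  have dec': "av (XX (k + m)) \<le> av (XX k)" for k m
    by (induction m) (auto intro: order_trans[OF dec])
  have diff: "av (s (k + m) - s k) \<le> C * av (XX k)" for k m
  proof (induction m)
    case 0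
    then show ?case using Xp[of k] by (simp add: C_def)
  next
    case (Suc m)
    have "av (t (k + m)) \<le> C * av (XX k)"
      by (rule order_trans[OF tk mult_left_mono[OF dec']]) (simp add: C_def)
    then have "av ((s (k + m) - s k) + t (k + m)) \<le> C * av (XX k)" using Suc by (intro av_add_bound)
    then show ?case by (simp add: rec algebra_simps)
  qed
  have "\<forall>e>0. \<exists>N. \<forall>m\<ge>N. \<forall>l\<ge>N. av (s m - s l) < e"
  proof (intro allI impI)
    fix e :: real assume "e > 0"
    then obtain N where "av (XX N) < e / C" using XX_lim[of "e / C"] by (auto simp: C_def)
    then have N: "C * av (XX N) < e" by (simp add: C_def field_simps)
    have "av (s m - s l) < e" if "m \<ge> N" "l \<ge> N" for m l
    proof -
      have "av (s m - s N) \<le> C * av (XX N)" "av (s l - s N) \<le> C * av (XX N)"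
        using diff[of N "m - N"] diff[of N "l - N"] that by auto
      then have "av ((s m - s N) - (s l - s N)) \<le> C * av (XX N)" by (rule av_diff_bound)
      then show ?thesis using N by simp
    qed
    then show "\<exists>N. \<forall>m\<ge>N. \<forall>l\<ge>N. av (s m - s l) < e" by blast
  qed
  then show "\<exists>L. av_tendsto av s L" using complete unfolding av_complete_def by blast
  have "av (s m) \<le> max (C * av (XX 0)) (av (s 0))" for m
    using av_add_le[of "s m - s 0" "s 0"] diff[of 0 m] by (auto simp: max_def split: if_splits)
  then show "ac.bdd s" by (auto simp: ac.bdd_def)
qed

section \<open>Truncations, limits and tails\<close>

definition Tc :: "nat \<Rightarrow> nat \<Rightarrow> nat \<Rightarrow> 'c" where "Tc a b k = phi (Tr a b k)"

definition Lam :: "nat \<Rightarrow> nat \<Rightarrow> 'c" where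
  "Lam a b = carlitz_Li av \<theta> q (map n [Suc a..<Suc b]) (map (\<lambda>i. phi (\<alpha> i)) [Suc a..<Suc b])"

lemma phi_Li_trunc: "phi (Li_trunc tvar q xs k) = Li_trunc \<theta> q (map (\<lambda>(m, z). (m, phi z)) xs) k"
proof (induction xs arbitrary: k)
  case (Cons x xs)
  obtain m z where x: "x = (m, z)" by (cases x)
  show ?case
    by (simp add: x rhom_sum[OF rhom_phi] rhom_mult[OF rhom_phi] rhom_divide[OF rhom_phi] rhom_power[OF rhom_phi]
        phi_carlitz_L Cons.IH)
qed (simp add: rhom_1[OF rhom_phi])

lemma Lam_eq: "Lam a b = av_lim av (Tc a b)"
proof -
  have "zip (map n [Suc a..<Suc b]) (map (\<lambda>i. phi (\<alpha> i)) [Suc a..<Suc b])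
    = map (\<lambda>(m, z). (m, phi z)) (map (\<lambda>i. (n i, \<alpha> i)) [Suc a..<Suc b])"
    by (simp add: zip_map_map zip_same_conv_map o_def del: upt_Suc)
  then have "Tc a b = (\<lambda>N. Li_trunc \<theta> q (zip (map n [Suc a..<Suc b]) (map (\<lambda>i. phi (\<alpha> i)) [Suc a..<Suc b])) N)"
    by (simp only: Tc_def[abs_def] Tr_def phi_Li_trunc)
  then show ?thesis by (simp only: Lam_def carlitz_Li_def)
qed

lemma Tc_Suc: "a < b \<Longrightarrow> Tc a b (Suc k) = Tc a b k + el (Suc a) k * Tc (Suc a) b k"
  by (simp add: Tc_def Tr_Suc rhom_simps[OF rhom_phi] rhom_divide[OF rhom_phi] el_def LL_def phi_carlitz_L)

lemma Tc_refl [simp]: "Tc a a k = 1" by (simp add: Tc_def rhom_1[OF rhom_phi])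

lemma Tc_conv: "b \<le> d \<Longrightarrow> a \<le> b \<Longrightarrow> ac.bdd (Tc a b) \<and> av_tendsto av (Tc a b) (Lam a b)"
proof (induction "b - a" arbitrary: a)
  case 0
  then have "a = b" by simp
  then have "Tc a b = (\<lambda>_. 1)" by auto
  moreover have "av_tendsto av (\<lambda>_. 1) 1" by (simp add: tendsto_iff_van van_0)
  ultimately show ?case using av_lim_eq by (auto simp: Lam_eq ac.bdd_const)
next
  case (Suc m)
  have IH: "ac.bdd (Tc (Suc a) b)" using Suc(1)[of "Suc a"] Suc(2-) by simp
  have t: "ac.bdd (\<lambda>k. el (Suc a) k * Tc (Suc a) b k / XX k)"
    using ac.bdd_mult[OF bdd_el[of "Suc a"] IH] Suc(2-) by simp
  have "\<And>k. Tc a b (Suc k) = Tc a b k + el (Suc a) k * Tc (Suc a) b k"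
    using Suc(2) by (intro Tc_Suc) simp
  from sum_converges[OF this t] show ?case using av_lim_eq by (auto simp: Lam_eq)
qed

text \<open>\<open>tail a b k\<close> is the part of \<open>\<Lambda>\<^sub>a\<^sub>b\<close> with all summation indices \<open>\<ge> k\<close>.\<close>
fun tail :: "nat \<Rightarrow> nat \<Rightarrow> nat \<Rightarrow> 'c" where
  "tail a b k = (if b \<le> a then 1 else Lam a b - (\<Sum>c\<in>{a..<b}. tail a c k * Tc c b k))"

declare tail.simps [simp del]

lemma tail_refl [simp]: "tail a a k = 1" by (simp add: tail.simps)

lemma Lam_refl: "a \<le> d \<Longrightarrow> Lam a a = 1"
  using Tc_conv[of a a] av_lim_eq[of "Tc a a" 1] by (simp add: Lam_eq tendsto_iff_van van_0)

lemma Lam_split: "b \<le> d \<Longrightarrow> a \<le> b \<Longrightarrow> Lam a b = (\<Sum>c\<in>{a..b}. tail a c k * Tc c b k)"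
proof (cases "a = b")
  case False
  assume "a \<le> b"
  then have "{a..b} = insert b {a..<b}" by auto
  then show ?thesis using False \<open>a \<le> b\<close> tail.simps[of a b k] by simp
qed (simp add: Lam_refl)

lemma van_tail: "b \<le> d \<Longrightarrow> a < b \<Longrightarrow> van (tail a b)"
proof (induction b rule: less_induct)
  case (less b)
  have e: "tail a b k = (Lam a b - Tc a b k) - (\<Sum>c\<in>{Suc a..<b}. Tc c b k * tail a c k)" for k
  proof -
    have "{a..<b} = insert a {Suc a..<b}" using less.prems by auto
    then show ?thesis using less.prems tail.simps[of a b k] by (simp add: mult.commute)
  qed
  have "van (\<lambda>k. Lam a b - Tc a b k)"
    using Tc_conv[of b a] less.prems van_minus[of "\<lambda>k. Tc a b k - Lam a b"] by (simp add: tendsto_iff_van)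
  moreover have "van (\<lambda>k. \<Sum>c\<in>{Suc a..<b}. Tc c b k * tail a c k)"
  proof (intro van_sum)
    fix c assume c: "c \<in> {Suc a..<b}"
    then obtain C where "\<And>k. av (Tc c b k) \<le> C" using Tc_conv[of b c] less.prems by (auto simp: ac.bdd_def)
    then show "van (\<lambda>k. Tc c b k * tail a c k)" using c less by (intro van_mult) auto
  qed
  ultimately have "van (\<lambda>k. (Lam a b - Tc a b k) - (\<Sum>c\<in>{Suc a..<b}. Tc c b k * tail a c k))" by (rule van_diff)
  then show ?case by (simp only: e[symmetric])
qed

text \<open>The smallest summation index is either larger than k, or equal to k and then contributes
  the factor \<open>el b k\<close>. Formally, the right-hand side solves the same triangular system
  as the tails.\<close>

lemma tail_rec: "b \<le> d \<Longrightarrow> a < b \<Longrightarrow> tail a b k = tail a b (Suc k) + tail a (b - 1) (Suc k) * el b k"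
proof -
  define R where "R c = tail a c (Suc k) + (if a < c then tail a (c - 1) (Suc k) * el c k else 0)" for c
  have sumR: "(\<Sum>c\<in>{a..b}. R c * Tc c b k) = Lam a b" if b: "b \<le> d" "a \<le> b" for b
  proof -
    have "(\<Sum>c\<in>{a..b}. (if a < c then tail a (c - 1) (Suc k) * el c k else 0) * Tc c b k)
        = (\<Sum>c\<in>{a..<b}. tail a c (Suc k) * (el (Suc c) k * Tc (Suc c) b k))"
    proof -
      have "{a..b} = insert a {Suc a..<Suc b}" using b by auto
      then show ?thesis by (simp add: sum.shift_bounds_Suc_ivl mult.assoc del: sum.op_ivl_Suc)
    qed
    moreover have "(\<Sum>c\<in>{a..b}. tail a c (Suc k) * Tc c b (Suc k))
        = (\<Sum>c\<in>{a..b}. tail a c (Suc k) * Tc c b k) + (\<Sum>c\<in>{a..<b}. tail a c (Suc k) * (el (Suc c) k * Tc (Suc c) b k))"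
    proof -
      have i: "{a..b} = insert b {a..<b}" using b by auto
      have "(\<Sum>c\<in>{a..<b}. tail a c (Suc k) * Tc c b (Suc k))
        = (\<Sum>c\<in>{a..<b}. tail a c (Suc k) * Tc c b k + tail a c (Suc k) * (el (Suc c) k * Tc (Suc c) b k))"
        by (intro sum.cong) (auto simp: Tc_Suc distrib_left)
      then show ?thesis unfolding i by (simp add: sum.distrib)
    qed
    ultimately show ?thesis using Lam_split[OF b, of "Suc k"] by (simp add: R_def distrib_right sum.distrib)
  qed
  have "R b = tail a b k" if "b \<le> d" "a \<le> b" for b
    using that
  proof (induction b rule: less_induct)
    case (less b)
    show ?case
    proof (cases "a = b")
      case False
      have i: "{a..b} = insert b {a..<b}" using less.prems by auto
      have "R b + (\<Sum>c\<in>{a..<b}. tail a c k * Tc c b k) = Lam a b"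
        using sumR[OF less.prems] less unfolding i by simp
      then show ?thesis using False less.prems tail.simps[of a b k] by (metis (no_types, lifting) eq_diff_eq leD le_neq_trans)
    qed (simp add: R_def)
  qed
  then show "b \<le> d \<Longrightarrow> a < b \<Longrightarrow> ?thesis" using R_def[of b] by (metis less_imp_le)
qed

definition Nn :: "nat \<Rightarrow> nat" where "Nn b = (\<Sum>i\<in>{1..b}. n i)"

lemma Nn_mono: "a \<le> b \<Longrightarrow> Nn a \<le> Nn b"
  unfolding Nn_def by (intro sum_mono2) auto

lemma Nn_Suc: "Nn (Suc b) = Nn b + n (Suc b)" by (simp add: Nn_def)

text \<open>The power of \<open>GG\<close> makes the recursion of the tails expandable: a step from
  k to k + 1 contributes powers of \<open>dd\<close>, and the term \<open>el\<close> becomes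
  \<open>beta\<close>.\<close>

definition fh :: "nat \<Rightarrow> nat \<Rightarrow> nat \<Rightarrow> 'c" where "fh a b k = GG k ^ (Nn b - Nn a) * tail a b k"

lemma fh_rec:
  assumes "b \<le> d" "a < b"
  shows "fh a b k = dd k ^ (Nn b - Nn a) * fh a b (Suc k) + beta b k * dd k ^ (Nn (b - 1) - Nn a) * fh a (b - 1) (Suc k)"
proof -
  obtain b' where b': "b = Suc b'" using assms by (cases b) auto
  have e: "Nn b - Nn a = (Nn b' - Nn a) + n b"
    using Nn_Suc[of b'] Nn_mono[of a b'] assms by (simp add: b')
  have "fh a b k = GG k ^ (Nn b - Nn a) * tail a b (Suc k) + GG k ^ (Nn b - Nn a) * (tail a b' (Suc k) * el b k)"
    using tail_rec[OF assms, of k] unfolding fh_def by (simp add: b' distrib_left)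
  moreover have "GG k ^ m = dd k ^ m * GG (Suc k) ^ m" for m
    by (subst GG_rec) (rule power_mult_distrib)
  moreover have "GG k ^ (Nn b - Nn a) * (tail a b' (Suc k) * el b k) = beta b k * (GG k ^ (Nn b' - Nn a) * tail a b' (Suc k))"
    unfolding e power_add by (simp add: el_beta[symmetric] mult_ac)
  ultimately show ?thesis by (simp add: fh_def b' mult_ac)
qed

text \<open>Induction on the depth b - a. The tail tends to 0 and the inhomogeneous term is O(X), so
  \<open>ac.decay\<close> allows the recursion to start from the constant 0.\<close>

lemma Asy_fh: "b \<le> d \<Longrightarrow> a \<le> b \<Longrightarrow> \<exists>f. ac.Asy (fh a b) f \<and> (a < b \<longrightarrow> ac.bdd (\<lambda>k. fh a b k / XX k))"
proof (induction "b - a" arbitrary: b)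
  case 0
  then have "fh a b = (\<lambda>_. 1)" by (auto simp: fh_def)
  then show ?case using ac.Asy_1 0 by auto
next
  case (Suc m)
  then have ab: "a < b" "b \<le> d" "b - 1 \<le> d" "a \<le> b - 1" "m = b - 1 - a" "b \<in> {1..d}" by auto
  obtain f0 where f0: "ac.Asy (fh a (b - 1)) f0" using Suc(1)[OF ab(5,3,4)] by blast
  obtain fd where fd: "ac.Asy dd fd" using Asy_dd by blast
  obtain fb where fb: "ac.Asy (beta b) fb" "fps_nth fb 0 = 0" using Asy_beta[OF ab(6)] by blast
  define A where "A k = dd k ^ (Nn b - Nn a)" for k
  define B where "B k = beta b k * dd k ^ (Nn (b - 1) - Nn a) * fh a (b - 1) (Suc k)" for k
  have rec: "fh a b k = A k * fh a b (Suc k) + B k" for k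
    unfolding A_def B_def by (rule fh_rec[OF ab(2,1)])
  have A: "ac.Asy A (fd ^ (Nn b - Nn a))" unfolding A_def[abs_def] by (intro ac.Asy_power fd)
  have B: "ac.Asy B (fb * fd ^ (Nn (b - 1) - Nn a) * ac.dil f0)"
    unfolding B_def[abs_def] by (intro ac.Asy_mult ac.Asy_power fb fd ac.Asy_dil f0)
  have BX: "ac.bdd (\<lambda>k. B k / XX k)" by (rule Asy_bdd_quot[OF B]) (simp add: fb(2))
  have "van (\<lambda>k. GG k ^ (Nn b - Nn a) * tail a b k)"
    using bdd_GG(1)[of "Nn b - Nn a"] van_tail[OF ab(2,1)] by (auto simp: ac.bdd_def intro: van_mult)
  then have v: "van (fh a b)" by (simp add: fh_def[abs_def])
  have q: "ac.bdd (\<lambda>k. fh a b k / XX k)"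
    by (rule ac.decay[OF rec _ BX]) (use v in \<open>auto simp: A_def av_power av_dd van_def\<close>)
  then have "\<exists>f. ac.Asy (fh a b) f"
    by (intro ac.Asy_recursion[OF rec A B, of 0]) (simp add: rhom_0[OF rhom_phi])
  then show ?case using q by blast
qed

section \<open>The period\<close>

definition Pi where "Pi = pi_tilde av \<theta> q lam"
definition ww :: "nat \<Rightarrow> 'c" where "ww k = Pi * GG k"

lemma ww_rec: "ww k = dd k * ww (Suc k)"
  using GG_rec[of k] by (simp add: ww_def)

text \<open>The partial products V of the period satisfy \<open>V k * GG k = GG 0\<close> with GG 0
  = lam^(-q). Hence \<open>ww k\<close> is the infinite product divided by V k and tends to
  1.\<close>

lemma ww_props: "ac.bdd (\<lambda>k. (ww k - 1) / XX k)" "av (ww k) = 1"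
proof -
  define V where "V N = (\<Prod>i\<in>{1..N}. inverse (1 - inverse (\<theta> ^ (q ^ i - 1))))" for N
  have VS: "V (Suc N) = V N * dd N" for N
  proof -
    have "\<theta> ^ (q ^ Suc N - 1) * \<theta> = \<theta> ^ (q ^ Suc N)"
      using q_ge_2 power_Suc2[of \<theta> "q ^ Suc N - 1"] by (metis Suc_diff_1 pos2 less_le_trans zero_less_power)
    then have "1 - inverse (\<theta> ^ (q ^ Suc N - 1)) = 1 + tx N"
      using theta_nz unfolding tx_eq by (simp add: field_simps)
    then show ?thesis by (simp add: V_def dd_def mult.commute)
  qed
  have VG: "V N * GG N = GG 0" for N
  proof (induction N)
    case (Suc N)
    have "V (Suc N) * GG (Suc N) = V N * GG N" using GG_rec[of N] by (simp add: VS)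
    then show ?case using Suc by simp
  qed (simp add: V_def)
  have G0: "GG 0 * lam ^ q = 1" by (simp add: GG_def XX_def carlitz_L_def power_inverse lam_nz)
  have avV: "av (V N) = 1" for N
  proof (induction N)
    case (Suc N)
    then show ?case unfolding VS av_mult av_dd by simp
  qed (simp add: V_def)
  have "\<exists>L. av_tendsto av V L"
  proof (rule sum_converges)
    show "V (Suc k) = V k + V k * (dd k - 1)" for k by (simp add: VS algebra_simps)
    have "av (V k * (dd k - 1) / XX k) \<le> 1" for k
      using av_dd_minus_1[of k] av_pos[OF XX_nz, of k] by (simp add: av_mult av_divide avV divide_le_eq_1)
    then show "ac.bdd (\<lambda>k. V k * (dd k - 1) / XX k)" by (auto simp: ac.bdd_def)
  qed
  then obtain L where L: "av_tendsto av V L" by blast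
  have Pi: "Pi = lam ^ q * L" unfolding Pi_def pi_tilde_def V_def[symmetric] using av_lim_eq[OF L] by simp
  have wV: "ww k - 1 = (L - V k) * (lam ^ q * GG k)" for k
  proof -
    have "V k * GG k * lam ^ q = 1" using VG[of k] G0 by simp
    then show ?thesis by (simp add: ww_def Pi algebra_simps)
  qed
  have "van (\<lambda>k. (lam ^ q * GG k) * (L - V k))"
  proof (rule van_mult)
    show "van (\<lambda>k. L - V k)" using L van_minus[of "\<lambda>k. V k - L"] by (simp add: tendsto_iff_van)
    show "av (lam ^ q * GG k) \<le> av (lam ^ q) * av (GG 0)" for k unfolding av_mult av_GG[of k] ..
  qed
  then have v: "van (\<lambda>k. ww k - 1)" by (simp only: wV mult.commute)
  have const: "av (ww k) = av (ww 0)" for k unfolding ww_def av_mult av_GG[of k] ..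
  obtain k0 where "av (ww k0 - 1) < 1" using v unfolding van_def by (metis order_refl zero_less_one)
  then have "av (ww k0) = 1" using av_add_eq[of "ww k0 - 1" 1] by simp
  then show w1: "av (ww k) = 1" for k using const by metis
  show "ac.bdd (\<lambda>k. (ww k - 1) / XX k)"
  proof (rule ac.decay[of _ "\<lambda>_. 1" "\<lambda>k. (dd k - 1) * ww (Suc k)"])
    show "ww k - 1 = 1 * (ww (Suc k) - 1) + (dd k - 1) * ww (Suc k)" for k
      by (subst ww_rec) (simp add: algebra_simps)
    have "av ((dd k - 1) * ww (Suc k) / XX k) \<le> 1" for k
      using av_dd_minus_1[of k] av_pos[OF XX_nz, of k] by (simp add: av_mult av_divide w1 divide_le_eq_1)
    then show "ac.bdd (\<lambda>k. (dd k - 1) * ww (Suc k) / XX k)" by (auto simp: ac.bdd_def)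
  qed (use v in \<open>auto simp: van_def\<close>)
qed

lemma Asy_ww: "\<exists>f. ac.Asy ww f"
proof -
  obtain fd where fd: "ac.Asy dd fd" using Asy_dd by blast
  show ?thesis
  proof (rule ac.Asy_recursion[OF _ fd ac.Asy_0, of _ 1])
    show "ww k = dd k * ww (Suc k) + 0" for k using ww_rec[of k] by simp
    show "ac.bdd (\<lambda>k. (ww k - phi 1) / XX k)" using ww_props(1) by (simp only: rhom_1[OF rhom_phi])
  qed
qed

end

section \<open>The power series of a hypothetical relation\<close>

context carlitz_li
begin

definition lift :: "'a poly fract fps \<Rightarrow> (nat \<times> nat, 'a poly fract) mpol fps" where
  "lift f = Abs_fps (\<lambda>n. mC (fps_nth f n))"

text \<open>The parameters g are left open: besides their true values \<open>gv\<close> they take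
  artificial values \<open>g2\<close>, which serve to show that the series of a relation is
  nonzero.\<close>

abbreviation psi :: "(nat \<Rightarrow> nat \<times> nat \<Rightarrow> 'c) \<Rightarrow> nat \<Rightarrow> (nat \<times> nat, 'a poly fract) mpol \<Rightarrow> 'c" where
  "psi g \<equiv> \<lambda>k. meval phi (g k)"

lemma asy_psi:
  assumes "\<And>v. ac.bdd (\<lambda>k. g k v)" shows "asy av XX (psi g)"
proof
  show "rhom (meval phi (g k))" for k by (rule rhom_meval[OF rhom_phi])
  fix m
  have "ac.bdd (\<lambda>k. meval phi (g k) m)"
    unfolding meval_def mon_def by (intro ac.bdd_sum ac.bdd_mult ac.bdd_const ac.bdd_prod ac.bdd_power assms)
  then show "\<exists>C. \<forall>k. av (meval phi (g k) m) \<le> C" by (simp add: ac.bdd_def)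
qed (auto simp: XX_nz XX_lt XX_lim)

lemma Asy_lift:
  assumes g: "asy av XX (psi g)" and a: "ac.Asy a f" shows "asy.Asy av XX (psi g) a (lift f)"
proof -
  interpret g: asy av XX "psi g" by (rule g)
  have "ac.asyS S a f \<Longrightarrow> g.asyS S a (lift f)" for S
  proof (induction S arbitrary: a f)
    case (Suc S)
    have "fps_shift 1 (lift f) = lift (fps_shift 1 f)" by (rule fps_ext) (simp add: lift_def)
    moreover have "psi g k (fps_nth (lift f) 0) = phi (fps_nth f 0)" for k
      by (simp add: lift_def meval_mC[OF rhom_phi])
    ultimately show ?case using Suc by simp
  qed simp
  then show ?thesis using a by (simp add: ac.Asy_def g.Asy_def)
qed

text \<open>The power of X^q with which the number attached to v becomes expandable: 1 for the
  period, and the sum of the exponents n for a polylogarithm.\<close>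

definition wtt :: "nat \<times> nat \<Rightarrow> nat" where
  "wtt v = (if v = (0, 0) then 1 else Nn (snd v) - Nn (fst v))"

definition fhs :: "nat \<Rightarrow> nat \<Rightarrow> 'a poly fract fps" where "fhs a b = (SOME f. ac.Asy (fh a b) f)"
definition wws :: "'a poly fract fps" where "wws = (SOME f. ac.Asy ww f)"

lemma Asy_fhs: "b \<le> d \<Longrightarrow> a \<le> b \<Longrightarrow> ac.Asy (fh a b) (fhs a b)"
  unfolding fhs_def using Asy_fh someI_ex by metis

lemma Asy_wws: "ac.Asy ww wws"
  unfolding wws_def using Asy_ww someI_ex by metis

text \<open>Expansions of \<open>X\<^sup>q \<pi> = L\<^sub>k\<^sup>-\<^sup>1 (\<pi> X\<^sup>q L\<^sub>k)\<close> and of the power of \<open>X\<close> times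
  \<open>\<Lambda>\<^sub>a\<^sub>b = \<Sum>\<^sub>c tail\<^sub>a\<^sub>c T\<^sub>c\<^sub>b\<close> that makes the tails expandable.\<close>
definition Ys :: "nat \<times> nat \<Rightarrow> (nat \<times> nat, 'a poly fract) mpol fps" where
  "Ys v = (if v = (0, 0) then fps_const (mX (0, 0)) * lift wws
     else \<Sum>c\<in>{fst v..snd v}. fps_const (mX (0, 0) ^ (Nn c - Nn (fst v)) * uent mX c (snd v))
       * fps_X ^ (q * (Nn (snd v) - Nn c)) * lift (fhs (fst v) c))"

definition yv :: "(nat \<Rightarrow> nat \<times> nat \<Rightarrow> 'c) \<Rightarrow> nat \<times> nat \<Rightarrow> nat \<Rightarrow> 'c" where
  "yv g v k = (if v = (0, 0) then g k (0, 0) * ww k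
     else \<Sum>c\<in>{fst v..snd v}. g k (0, 0) ^ (Nn c - Nn (fst v)) * uent (g k) c (snd v)
       * XX k ^ (q * (Nn (snd v) - Nn c)) * fh (fst v) c k)"

lemma Asy_Ys:
  assumes g: "asy av XX (psi g)" and v: "v \<in> Vx"
  shows "asy.Asy av XX (psi g) (yv g v) (Ys v)"
proof -
  interpret g: asy av XX "psi g" by (rule g)
  show ?thesis
  proof (cases "v = (0, 0)")
    case True
    have "g.Asy (\<lambda>k. psi g k (mX (0, 0)) * ww k) (fps_const (mX (0, 0)) * lift wws)"
      by (rule g.Asy_mult[OF g.Asy_const Asy_lift[OF g Asy_wws]])
    then show ?thesis using True by (simp add: Ys_def yv_def[abs_def] meval_mX[OF rhom_phi])
  next
    case False
    have r: "rhom (meval phi (g k))" for k by (rule rhom_meval[OF rhom_phi])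
    have "g.Asy (\<lambda>k. \<Sum>c\<in>{fst v..snd v}. psi g k (mX (0, 0) ^ (Nn c - Nn (fst v)) * uent mX c (snd v))
       * XX k ^ (q * (Nn (snd v) - Nn c)) * fh (fst v) c k) (Ys v)"
      unfolding Ys_def using False v
      by (simp only: if_False, intro g.Asy_sum g.Asy_mult[OF g.Asy_mult[OF g.Asy_const g.Asy_power[OF g.Asy_X]]]
          Asy_lift[OF g Asy_fhs]) (auto simp: Vx_def)
    moreover have "psi g k (mX (0, 0) ^ m * uent mX c b) = g k (0, 0) ^ m * uent (g k) c b" for k m c b
      by (simp add: rhom_mult[OF r] rhom_power[OF r] rhom_1[OF r] uent_def meval_mX[OF rhom_phi])
    ultimately show ?thesis using False by (simp add: yv_def[abs_def])
  qed
qed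

text \<open>Q times X^(q s): each monomial uses up the power of X belonging to its factors, and no
  negative power remains when s bounds the weights.\<close>

definition Fs :: "(nat \<times> nat, 'a poly fract) mpol \<Rightarrow> nat \<Rightarrow> (nat \<times> nat, 'a poly fract) mpol fps" where
  "Fs Q s = (\<Sum>e\<in>keys Q. fps_const (mC (lookup Q e)) * fps_X ^ (q * (s - wsum wtt e)) * mon Ys e)"

lemma Asy_Fs:
  assumes g: "asy av XX (psi g)" and Q: "\<And>e. e \<in> keys Q \<Longrightarrow> keys e \<subseteq> Vx \<and> wsum wtt e \<le> s"
    and z: "\<And>v k. v \<in> Vx \<Longrightarrow> yv g v k = XX k ^ (q * wtt v) * z v"
  shows "asy.Asy av XX (psi g) (\<lambda>k. XX k ^ (q * s) * meval phi z Q) (Fs Q s)"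
proof -
  interpret g: asy av XX "psi g" by (rule g)
  have "g.Asy (\<lambda>k. \<Sum>e\<in>keys Q. psi g k (mC (lookup Q e)) * XX k ^ (q * (s - wsum wtt e))
     * (\<Prod>v\<in>keys e. yv g v k ^ lookup e v)) (Fs Q s)"
    unfolding Fs_def mon_def using Q
    by (intro g.Asy_sum g.Asy_mult[OF g.Asy_mult[OF g.Asy_const g.Asy_power[OF g.Asy_X]]]
        g.Asy_prod g.Asy_power Asy_Ys[OF g]) auto
  moreover have "(\<Sum>e\<in>keys Q. psi g k (mC (lookup Q e)) * XX k ^ (q * (s - wsum wtt e))
     * (\<Prod>v\<in>keys e. yv g v k ^ lookup e v)) = XX k ^ (q * s) * meval phi z Q" for k
    unfolding meval_def[of phi z Q] sum_distrib_left
  proof (rule sum.cong[OF refl])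
    fix e assume e: "e \<in> keys Q"
    have "(\<Prod>v\<in>keys e. yv g v k ^ lookup e v)
        = (\<Prod>v\<in>keys e. XX k ^ (q * (lookup e v * wtt v)) * z v ^ lookup e v)"
      using Q[OF e] by (intro prod.cong) (auto simp: z power_mult_distrib power_mult[symmetric] mult_ac)
    also have "\<dots> = XX k ^ (q * wsum wtt e) * mon z e"
      by (simp add: prod.distrib power_sum wsum_def mon_def sum_distrib_left)
    finally have p: "(\<Prod>v\<in>keys e. yv g v k ^ lookup e v) = XX k ^ (q * wsum wtt e) * mon z e" .
    have "q * s = q * (s - wsum wtt e) + q * wsum wtt e" using Q[OF e] by (simp flip: distrib_left)
    then have X: "XX k ^ (q * s) = XX k ^ (q * (s - wsum wtt e)) * XX k ^ (q * wsum wtt e)" by (simp only: power_add)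
    show "psi g k (mC (lookup Q e)) * XX k ^ (q * (s - wsum wtt e))
       * (\<Prod>v\<in>keys e. yv g v k ^ lookup e v)
      = XX k ^ (q * s) * (phi (lookup Q e) * mon z e)"
      unfolding p X meval_mC[OF rhom_phi] by (simp only: mult_ac)
  qed
  ultimately show ?thesis by simp
qed

definition val :: "nat \<times> nat \<Rightarrow> 'c" where
  "val v = (if v = (0, 0) then Pi else Lam (fst v) (snd v))"

definition gv :: "nat \<Rightarrow> nat \<times> nat \<Rightarrow> 'c" where "gv k v = (if v \<in> Vx then phi (gk k v) else 0)"

lemma av_carlitz_L_ge: "av (carlitz_L \<theta> q k) \<ge> 1"
  using theta_gt by (simp add: av_carlitz_L one_le_power)

lemma bdd_gv: "ac.bdd (\<lambda>k. gv k v)"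
proof (cases "v \<in> Vx")
  case True
  show ?thesis
  proof (cases "v = (0, 0)")
    case True
    have "av (gv k v) \<le> 1" for k
      using True av_carlitz_L_ge[of k]
      by (simp add: gv_def gk_def LL_def rhom_divide[OF rhom_phi] rhom_1[OF rhom_phi] phi_carlitz_L av_divide Vx_def)
    then show ?thesis by (auto simp: ac.bdd_def)
  next
    case False
    then have "snd v \<le> d" "fst v \<le> snd v" using True by (auto simp: Vx_def)
    then show ?thesis using Tc_conv[of "snd v" "fst v"] True False by (simp add: gv_def gk_def Tc_def[abs_def])
  qed
qed (simp add: gv_def ac.bdd_const)

lemma uent_gv: "b \<le> d \<Longrightarrow> c \<le> b \<Longrightarrow> uent (gv k) c b = Tc c b k"
  by (auto simp: uent_def gv_def Vx_def gk_def Tc_def rhom_1[OF rhom_phi])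

lemma gv_00: "gv k (0, 0) = inverse (carlitz_L \<theta> q k)"
  by (simp add: gv_def Vx_def gk_def LL_def rhom_divide[OF rhom_phi] rhom_1[OF rhom_phi] phi_carlitz_L inverse_eq_divide)

lemma yv_gv:
  assumes "v \<in> Vx" shows "yv gv v k = XX k ^ (q * wtt v) * val v"
proof (cases "v = (0, 0)")
  case True
  then show ?thesis using carlitz_L_nonzero[of k]
    by (simp add: yv_def gv_00 ww_def GG_def wtt_def val_def)
next
  case False
  then obtain a b where v: "v = (a, b)" "a < b" "b \<le> d" using assms by (auto simp: Vx_def)
  have "gv k (0, 0) ^ (Nn c - Nn a) * uent (gv k) c b * XX k ^ (q * (Nn b - Nn c)) * fh a c k
      = XX k ^ (q * (Nn b - Nn a)) * (tail a c k * Tc c b k)" if "c \<in> {a..b}" for c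
  proof -
    have "q * (Nn b - Nn a) = q * (Nn b - Nn c) + q * (Nn c - Nn a)"
      using Nn_mono[of a c] Nn_mono[of c b] that by (simp flip: distrib_left)
    then have X: "XX k ^ (q * (Nn b - Nn a)) = XX k ^ (q * (Nn b - Nn c)) * (XX k ^ q) ^ (Nn c - Nn a)"
      by (simp only: power_add power_mult)
    have "inverse (carlitz_L \<theta> q k) ^ m * carlitz_L \<theta> q k ^ m = 1" for m
      using carlitz_L_nonzero[of k] by (simp add: power_inverse)
    then have "gv k (0, 0) ^ (Nn c - Nn a) * GG k ^ (Nn c - Nn a) = (XX k ^ q) ^ (Nn c - Nn a)"
      by (simp only: gv_00 GG_def power_mult_distrib mult.left_commute) simp
    then have "gv k (0, 0) ^ (Nn c - Nn a) * fh a c k = (XX k ^ q) ^ (Nn c - Nn a) * tail a c k"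
      unfolding fh_def by (simp only: mult.assoc[symmetric])
    then show ?thesis
      using that v uent_gv[of b c k] unfolding X by (simp only: atLeastAtMost_iff) (simp add: mult_ac)
  qed
  then show ?thesis
    using v Lam_split[of b a k] by (simp add: yv_def wtt_def val_def sum_distrib_left)
qed

text \<open>Parameters for which the expansions \<open>Ys\<close> represent prescribed numbers \<open>tt\<close> instead of the actual
  values; the triangular system for them is solved recursively.\<close>
function hh :: "(nat \<times> nat \<Rightarrow> 'c) \<Rightarrow> nat \<Rightarrow> nat \<Rightarrow> nat \<Rightarrow> 'c" where
  "hh tt a b k = (if b \<le> a then 1 else tt (a, b)
     - (\<Sum>c\<in>{Suc a..b}. (tt (0, 0) * inverse (ww k)) ^ (Nn c - Nn a) * hh tt c b k * fh a c k))"
  by pat_completeness auto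
termination by (relation "measure (\<lambda>(tt, a, b, k). b - a)") auto

declare hh.simps [simp del]

definition g2 :: "(nat \<times> nat \<Rightarrow> 'c) \<Rightarrow> nat \<Rightarrow> nat \<times> nat \<Rightarrow> 'c" where
  "g2 tt k v = (if v \<notin> Vx then 0 else if v = (0, 0) then XX k ^ q * (tt (0, 0) * inverse (ww k))
     else hh tt (fst v) (snd v) k)"

lemma bdd_wwi: "ac.bdd (\<lambda>k. tt * inverse (ww k))"
  using ww_props(2) by (auto simp: ac.bdd_def av_mult av_inverse)

lemma bdd_hh: "b \<le> d \<Longrightarrow> ac.bdd (hh tt a b)"
proof (induction "b - a" arbitrary: a rule: less_induct)
  case less
  show ?case
  proof (cases "b \<le> a")
    case True
    then show ?thesis by (simp add: hh.simps[abs_def] ac.bdd_const)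
  next
    case False
    have "ac.bdd (\<lambda>k. tt (a, b)
       - (\<Sum>c\<in>{Suc a..b}. (tt (0, 0) * inverse (ww k)) ^ (Nn c - Nn a) * hh tt c b k * fh a c k))"
    proof (intro ac.bdd_diff ac.bdd_const ac.bdd_sum ac.bdd_mult ac.bdd_power[OF bdd_wwi])
      fix c assume c: "c \<in> {Suc a..b}"
      show "ac.bdd (hh tt c b)" using less c False by auto
      show "ac.bdd (fh a c)"
        using Asy_fhs[of c a] c less.prems by (auto simp: ac.Asy_def dest: ac.asyS_bdd)
    qed
    moreover have "hh tt a b = (\<lambda>k. tt (a, b)
       - (\<Sum>c\<in>{Suc a..b}. (tt (0, 0) * inverse (ww k)) ^ (Nn c - Nn a) * hh tt c b k * fh a c k))"
      using False by (intro ext) (simp add: hh.simps[of tt a b])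
    ultimately show ?thesis by simp
  qed
qed

lemma bdd_g2: "ac.bdd (\<lambda>k. g2 tt k v)"
proof (cases "v \<in> Vx \<and> v \<noteq> (0, 0)")
  case True
  then have "snd v \<le> d" by (auto simp: Vx_def)
  then show ?thesis using True bdd_hh[of "snd v" tt "fst v"] by (simp add: g2_def)
next
  case False
  have "ac.bdd (\<lambda>k. XX k ^ q * (tt (0, 0) * inverse (ww k)))"
    by (intro ac.bdd_mult[OF ac.bdd_power[OF ac.bdd_X] bdd_wwi])
  moreover have "(\<lambda>k. g2 tt k v) = (if v \<in> Vx then \<lambda>k. XX k ^ q * (tt (0, 0) * inverse (ww k)) else (\<lambda>k. 0))"
    using False by (auto simp: g2_def fun_eq_iff)
  ultimately show ?thesis by (simp add: ac.bdd_const)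
qed

lemma yv_g2:
  assumes "v \<in> Vx" shows "yv (g2 tt) v k = XX k ^ (q * wtt v) * tt v"
proof (cases "v = (0, 0)")
  case True
  have "ww k \<noteq> 0" using ww_props(2)[of k] by auto
  then show ?thesis using True assms by (simp add: yv_def g2_def wtt_def)
next
  case False
  then obtain a b where v: "v = (a, b)" "a < b" "b \<le> d" using assms by (auto simp: Vx_def)
  define r where "r = tt (0, 0) * inverse (ww k)"
  have "g2 tt k (0, 0) ^ (Nn c - Nn a) * uent (g2 tt k) c b * XX k ^ (q * (Nn b - Nn c)) * fh a c k
      = XX k ^ (q * (Nn b - Nn a)) * (r ^ (Nn c - Nn a) * hh tt c b k * fh a c k)" if "c \<in> {a..b}" for c
  proof -
    have "q * (Nn b - Nn a) = q * (Nn c - Nn a) + q * (Nn b - Nn c)"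
      using Nn_mono[of a c] Nn_mono[of c b] that by (simp flip: distrib_left)
    then have X: "XX k ^ (q * (Nn b - Nn a)) = (XX k ^ q) ^ (Nn c - Nn a) * XX k ^ (q * (Nn b - Nn c))"
      by (simp only: power_add power_mult)
    have "uent (g2 tt k) c b = hh tt c b k"
      using that v by (auto simp: uent_def g2_def Vx_def hh.simps[of tt b b])
    moreover have "g2 tt k (0, 0) = XX k ^ q * r" by (simp add: g2_def Vx_def r_def)
    ultimately show ?thesis unfolding X by (simp only: power_mult_distrib mult_ac)
  qed
  then have "yv (g2 tt) v k
      = XX k ^ (q * (Nn b - Nn a)) * (\<Sum>c\<in>{a..b}. r ^ (Nn c - Nn a) * hh tt c b k * fh a c k)"
    unfolding sum_distrib_left using v by (simp only: yv_def prod.inject fst_conv snd_conv) (auto intro!: sum.cong)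
  also have "(\<Sum>c\<in>{a..b}. r ^ (Nn c - Nn a) * hh tt c b k * fh a c k) = tt v"
  proof -
    have "{a..b} = insert a {Suc a..b}" using v by auto
    moreover have "fh a a k = 1" by (simp add: fh_def)
    ultimately show ?thesis using v by (simp add: hh.simps[of tt a b] r_def)
  qed
  finally show ?thesis using v by (simp add: wtt_def)
qed

text \<open>Were the series \<open>0\<close>, then \<open>Q\<close> would vanish at every \<open>tt\<close>.\<close>
lemma relation_series:
  assumes Q0: "Q \<noteq> 0" and Q: "\<And>e. e \<in> keys Q \<Longrightarrow> keys e \<subseteq> Vx \<and> wsum wtt e \<le> s"
  shows "Fs Q s \<noteq> 0"
proof
  assume F0: "Fs Q s = 0"
  obtain t where t: "meval (\<lambda>x. x) t Q \<noteq> 0" using mpol_nonvanishing[OF infinite_K Q0] by blast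
  define tt where "tt v = phi (t v)" for v
  have "phi (meval (\<lambda>x. x) t Q) \<noteq> 0" using t by (simp add: rhom_field_eq_0_iff[OF rhom_phi])
  then have ne: "meval phi tt Q \<noteq> 0"
    unfolding rhom_comp_meval[OF rhom_phi] tt_def .
  have yv: "yv (g2 tt) v k = XX k ^ (q * wtt v) * tt v" if "v \<in> Vx" for v k
    using that by (rule yv_g2)
  interpret g: asy av XX "psi (g2 tt)" by (rule asy_psi[OF bdd_g2])
  have "g.Asy (\<lambda>k. XX k ^ (q * s) * meval phi tt Q) (Fs Q s)"
    using Q yv by (rule Asy_Fs[OF g.asy_axioms])
  then have "g.asyS (Suc (q * s)) (\<lambda>k. XX k ^ (q * s) * meval phi tt Q) 0"
    by (simp add: F0 g.Asy_def)
  \<comment> \<open>The product is O(X^(q s + 1)), but it is X^(q s) times a number independent of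
    k, which must therefore be 0.\<close>
  from g.asyS_small[OF this] obtain C where
    C: "av (XX k ^ (q * s) * meval phi tt Q) \<le> C * av (XX k) ^ Suc (q * s)" for k by auto
  have "av (meval phi tt Q) \<le> C * av (XX k)" for k
    using C[of k] av_pos[OF XX_nz, of k] by (simp add: av_mult av_power mult.assoc[symmetric] mult.commute)
  then have "meval phi tt Q = 0" by (rule ac.X_small_const)
  then show False using ne by simp
qed

end

section \<open>Monomials of bounded exponents and the auxiliary function\<close>

definition box :: "'v set \<Rightarrow> nat \<Rightarrow> ('v \<Rightarrow>\<^sub>0 nat) set" where
  "box A D = {m. keys m \<subseteq> A \<and> (\<forall>v. lookup m v \<le> D)}"

lemma box_card:
  assumes "finite A" shows "finite (box A D)" "card (box A D) = Suc D ^ card A"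
proof -
  define r where "r f = Abs_poly_mapping (\<lambda>v. if v \<in> A then f v else (0 :: nat))" for f
  have l: "lookup (r f) = (\<lambda>v. if v \<in> A then f v else 0)" for f
    unfolding r_def using assms by (intro lookup_Abs_poly_mapping) (auto elim: finite_subset[rotated])
  have "bij_betw (\<lambda>m. restrict (lookup m) A) (box A D) (A \<rightarrow>\<^sub>E {..D})"
    by (rule bij_betw_byWitness[where f' = r])
      (auto simp: box_def l in_keys_iff poly_mapping_eq_iff fun_eq_iff PiE_def Pi_def extensional_def split: if_splits)
  then show "finite (box A D)" "card (box A D) = Suc D ^ card A"
    using assms by (auto simp: bij_betw_finite finite_PiE bij_betw_same_card card_PiE)
qed

lemma box_mono: "D \<le> D' \<Longrightarrow> box A D \<subseteq> box A D'"
  by (auto simp: box_def intro: order_trans)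

lemma box_0: "0 \<in> box A D" by (simp add: box_def)

lemma box_add: "m \<in> box A D \<Longrightarrow> m' \<in> box A D' \<Longrightarrow> m + m' \<in> box A (D + D')"
  using keys_add[of m m'] by (auto simp: box_def lookup_add intro: add_mono)

text \<open>The bound on parameter exponents is uniform over all coefficients of the series; it
  limits the linear conditions per order of vanishing.\<close>

definition finb :: "'v set \<Rightarrow> nat \<Rightarrow> ('v, 'k::comm_ring_1) mpol fps \<Rightarrow> bool" where
  "finb A D f \<longleftrightarrow> (\<forall>n. keys (fps_nth f n) \<subseteq> box A D)"

lemma finb_mono: "finb A D f \<Longrightarrow> D \<le> D' \<Longrightarrow> finb A D' f"
  using box_mono[of D D' A] by (auto simp: finb_def)

lemma finb_add: "finb A D f \<Longrightarrow> finb A D g \<Longrightarrow> finb A D (f + g)"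
  using keys_add unfolding finb_def by (metis (no_types, lifting) fps_add_nth le_sup_iff order_trans)

lemma keys_mult_box:
  assumes "keys P \<subseteq> box A D" "keys Q \<subseteq> box A D'"
  shows "keys (P * Q) \<subseteq> box A (D + D')"
  using keys_mult[of P Q] assms box_add[of _ A D _ D'] by blast

lemma keys_sum_subset:
  fixes f :: "'i \<Rightarrow> ('v, 'k::comm_ring_1) mpol"
  assumes "\<And>i. i \<in> I \<Longrightarrow> keys (f i) \<subseteq> B" shows "keys (sum f I) \<subseteq> B"
  using assms
proof (induction I rule: infinite_finite_induct)
  case (insert i I)
  then show ?case using keys_add[of "f i" "sum f I"] by auto
qed auto

lemma finb_mult: "finb A D f \<Longrightarrow> finb A D' g \<Longrightarrow> finb A (D + D') (f * g)"
  unfolding finb_def fps_mult_nth by (intro allI keys_sum_subset keys_mult_box) auto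

lemma finb_const: "keys P \<subseteq> box A D \<Longrightarrow> finb A D (fps_const P)"
  by (auto simp: finb_def)

lemma finb_1: "finb A D 1"
  by (auto simp: finb_def box_0)

lemma finb_power: "finb A D f \<Longrightarrow> finb A (j * D) (f ^ j)"
  by (induction j) (auto intro: finb_1 finb_mult)

lemma finb_X_power: "finb A D (fps_X ^ m)"
  by (auto simp: finb_def fps_X_power_nth box_0)

lemma ex_finb_sum:
  assumes "finite I" "\<And>x. x \<in> I \<Longrightarrow> \<exists>D. finb A D (f x)" shows "\<exists>D. finb A D (sum f I)"
  using assms
proof (induction I rule: finite_induct)
  case empty
  then show ?case using finb_const[of 0] by auto
next
  case (insert x I)
  obtain D where "finb A D (f x)" using insert.prems by blast
  moreover obtain D' where "finb A D' (sum f I)" using insert.IH insert.prems by blast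
  ultimately have "finb A (max D D') (f x + sum f I)" by (intro finb_add) (auto elim: finb_mono)
  then show ?case using insert by auto
qed

lemma ex_finb_prod:
  assumes "finite I" "\<And>x. x \<in> I \<Longrightarrow> \<exists>D. finb A D (f x)" shows "\<exists>D. finb A D (prod f I)"
  using assms by (induction I rule: finite_induct) (auto intro: finb_1 finb_mult)

text \<open>The number of coefficients of the auxiliary function exceeds the number of conditions.\<close>
lemma auxiliary_series:
  fixes F :: "('v, 'k::field) mpol fps"
  assumes A: "finite A" and F: "finb A \<delta> F" and y: "y \<ge> 1"
  defines "C \<equiv> Suc \<delta> ^ card A"
  defines "N \<equiv> C * y - 1"
  shows "\<exists>c. (\<exists>j\<le>N. \<exists>x\<in>{..N} \<times> box A N. c (j, x) \<noteq> 0) \<and>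
    (\<forall>n<C * y ^ 2 - 1. fps_nth (\<Sum>j\<le>N. \<Sum>x\<in>{..N} \<times> box A N.
       fps_const (mC (c (j, x)) * Poly_Mapping.single (snd x) 1) * fps_X ^ (u * fst x) * F ^ j) n = 0)"
proof -
  define S where "S = {..N} \<times> box A N"
  define T where "T p = fps_const (Poly_Mapping.single (snd (snd p)) (1::'k)) * fps_X ^ (u * fst (snd p)) * F ^ fst p"
    for p :: "nat \<times> nat \<times> ('v \<Rightarrow>\<^sub>0 nat)"
  define I where "I = {..<C * y ^ 2 - 1} \<times> box A (N * Suc \<delta>)"
  define J where "J = {..N} \<times> S"
  have C: "C \<ge> 1" by (simp add: C_def)
  then have N: "Suc N = C * y" using y by (simp add: N_def)
  have cy: "C * y ^ 2 \<ge> 1" using C y by simp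
  \<comment> \<open>With N + 1 = C y and C = (\<delta> + 1)^v for v parameters, there are fewer than
    C y^2 C (N + 1)^v = (N + 1)^2 (N + 1)^v conditions, and the right side is the number of
    unknowns.\<close>
  have "card I = (C * y ^ 2 - 1) * Suc (N * Suc \<delta>) ^ card A"
    by (simp add: I_def box_card[OF A])
  also have "\<dots> \<le> (C * y ^ 2 - 1) * (Suc N * Suc \<delta>) ^ card A" by (intro mult_le_mono2 power_mono) auto
  also have "\<dots> < (C * y ^ 2) * (Suc N * Suc \<delta>) ^ card A"
  proof -
    have "C * y ^ 2 - 1 < C * y ^ 2" using cy by linarith
    then show ?thesis by (intro mult_strict_right_mono) auto
  qed
  also have "\<dots> = Suc N * (Suc N * Suc N ^ card A)"
    unfolding power_mult_distrib C_def[symmetric] by (simp only: N) (simp add: power2_eq_square)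
  also have "\<dots> = card J" by (simp add: J_def S_def box_card[OF A])
  finally have card: "card I < card J" .
  have fin: "finite I" "finite J" by (auto simp: I_def J_def S_def box_card[OF A])
  obtain c where c: "\<exists>p\<in>J. c p \<noteq> 0"
    "\<And>n \<nu>. (n, \<nu>) \<in> I \<Longrightarrow> (\<Sum>p\<in>J. lookup (fps_nth (T p) n) \<nu> * c p) = 0"
    using homogeneous_system_solvable[OF fin card, of "\<lambda>i p. lookup (fps_nth (T p) (fst i)) (snd i)"] by fastforce
  define E where "E = (\<Sum>p\<in>J. fps_const (mC (c p)) * T p)"
  have T: "finb A (N * Suc \<delta>) (T p)" if "p \<in> J" for p
  proof -
    obtain j a b where p: "p = (j, a, b)" by (cases p)
    then have j: "j \<le> N" "b \<in> box A N" using that by (auto simp: J_def S_def)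
    have "finb A (N + 0 + N * \<delta>) (T p)"
      unfolding T_def using j p
      by (intro finb_mult finb_const finb_X_power finb_mono[OF finb_power[OF F]]) auto
    then show ?thesis by simp
  qed
  have lk: "lookup (fps_nth E n) \<nu> = (\<Sum>p\<in>J. lookup (fps_nth (T p) n) \<nu> * c p)" for n \<nu>
    by (simp add: E_def fps_sum_nth lookup_sum lookup_mC_mult mult.commute)
  have E: "fps_nth E n = 0" if n: "n < C * y ^ 2 - 1" for n
  proof (rule poly_mapping_eqI)
    fix \<nu>
    show "lookup (fps_nth E n) \<nu> = lookup 0 \<nu>"
    proof (cases "\<nu> \<in> box A (N * Suc \<delta>)")
      case True
      then show ?thesis using c(2)[of n \<nu>] n by (simp add: lk I_def)
    next
      case False
      have "lookup (fps_nth (T p) n) \<nu> = 0" if "p \<in> J" for p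
        using T[OF that] False unfolding finb_def by (metis in_keys_iff subsetD)
      then show ?thesis by (simp add: lk)
    qed
  qed
  have "E = (\<Sum>j\<le>N. \<Sum>x\<in>S. fps_const (mC (c (j, x)) * Poly_Mapping.single (snd x) 1) * fps_X ^ (u * fst x) * F ^ j)"
    by (simp add: E_def J_def T_def sum.cartesian_product case_prod_unfold mult.assoc flip: fps_const_mult)
  then show ?thesis using c(1) E unfolding S_def[symmetric] by (intro exI[of _ c]) (auto simp: J_def)
qed

section \<open>A Liouville inequality\<close>

definition integral :: "'k::field poly fract \<Rightarrow> bool" where "integral z \<longleftrightarrow> (\<exists>A. z = Fract A 1)"

lemma integral_0: "integral 0" by (auto simp: integral_def Zero_fract_def)
lemma integral_1: "integral 1" by (auto simp: integral_def One_fract_def)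
lemma integral_add: "integral x \<Longrightarrow> integral y \<Longrightarrow> integral (x + y)" by (auto simp: integral_def)
lemma integral_diff: "integral x \<Longrightarrow> integral y \<Longrightarrow> integral (x - y)" by (auto simp: integral_def)
lemma integral_mult: "integral x \<Longrightarrow> integral y \<Longrightarrow> integral (x * y)" by (auto simp: integral_def)
lemma integral_power: "integral x \<Longrightarrow> integral (x ^ n)" by (induction n) (auto intro: integral_1 integral_mult)
lemma integral_prod: "(\<And>i. i \<in> I \<Longrightarrow> integral (f i)) \<Longrightarrow> integral (prod f I)"
  by (induction I rule: infinite_finite_induct) (auto intro: integral_1 integral_mult)
lemma integral_sum: "(\<And>i. i \<in> I \<Longrightarrow> integral (f i)) \<Longrightarrow> integral (sum f I)"
  by (induction I rule: infinite_finite_induct) (auto intro: integral_0 integral_add)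

lemma common_denominator:
  assumes "finite S" shows "\<exists>h. h \<noteq> 0 \<and> (\<forall>x\<in>S. integral (Fract h 1 * c x))"
  using assms
proof (induction S rule: finite_induct)
  case (insert x S)
  then obtain h where h: "h \<noteq> 0" "\<forall>x\<in>S. integral (Fract h 1 * c x)" by blast
  obtain a b where ab: "c x = Fract a b" "b \<noteq> 0" by (cases "c x") auto
  have "integral (Fract (b * h) 1 * c z)" if "z \<in> insert x S" for z
  proof (cases "z = x")
    case True
    have "Fract (b * h) 1 * c x = Fract (h * a) 1" using ab by (simp add: eq_fract)
    then show ?thesis using True by (auto simp: integral_def)
  next
    case False
    then have "integral (Fract b 1 * (Fract h 1 * c z))"
      using h that by (intro integral_mult[of "Fract b 1"]) (auto simp: integral_def)
    then show ?thesis by (simp add: mult.assoc[symmetric])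
  qed
  then show ?case using h ab by (intro exI[of _ "b * h"]) auto
qed (auto intro: exI[of _ 1])

context carlitz_li
begin

lemma av_integral: "integral z \<Longrightarrow> z \<noteq> 0 \<Longrightarrow> av (phi z) \<ge> 1"
  using theta_gt by (auto simp: integral_def phi_Fract_1 av_peval one_le_power Fract_1_eq_0)

lemma integral_tvar: "integral (tvar :: 'a poly fract)"
  by (auto simp: integral_def tvar_def)

lemma integral_uu: "integral (uu k)" unfolding uu_def by (intro integral_power integral_tvar)

lemma integral_LL: "integral (LL k)"
  unfolding LL_def carlitz_L_def by (intro integral_prod integral_diff integral_power integral_tvar)

definition de :: "nat \<Rightarrow> 'a poly fract" where "de i = Fract (den i) 1"

lemma integral_de: "integral (de i)" by (auto simp: integral_def de_def)

lemma de_alpha: "integral (de i * \<alpha> i)"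
proof -
  have "de i * \<alpha> i = Fract (num i) 1" using num_den[of i] by (simp add: de_def eq_fract)
  then show ?thesis by (auto simp: integral_def)
qed

lemma de_nz: "de i \<noteq> 0" using num_den(1)[of i] by (simp add: de_def Fract_1_eq_0)

definition Dn :: "nat \<Rightarrow> nat \<Rightarrow> nat \<Rightarrow> 'a poly fract" where
  "Dn a b k = (\<Prod>i\<in>{Suc a..b}. LL k ^ n i * de i ^ (q ^ k))"

lemma integral_Dn: "integral (Dn a b k)"
  unfolding Dn_def by (intro integral_prod integral_mult integral_power integral_LL integral_de)

text \<open>Passing from k to k + 1 multiplies the denominator by a polynomial in theta, and the new
  term has denominators L_k and powers \<open>de i ^ (q ^ k)\<close>, which the old denominator
  already clears.\<close>

lemma integral_Dn_Tr: "a \<le> b \<Longrightarrow> integral (Dn a b k * Tr a b k)"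
proof (induction k arbitrary: a)
  case 0
  then show ?case
  proof (cases "a = b")
    case False
    then have "[Suc a..<Suc b] = Suc a # [Suc (Suc a)..<Suc b]" using 0 by (simp add: upt_conv_Cons)
    then have "Tr a b 0 = 0" by (simp add: Tr_def)
    then show ?thesis by (simp add: integral_0)
  qed (simp add: Dn_def integral_1)
next
  case (Suc k)
  show ?case
  proof (cases "a = b")
    case False
    then have ab: "a < b" using Suc by simp
    have LS: "LL (Suc k) = (tvar - uu k ^ q) * LL k" by (rule LL_Suc)
    define f where "f i = (tvar - uu k ^ q) ^ n i * de i ^ (q ^ Suc k - q ^ k)" for i
    have "q ^ k \<le> q ^ Suc k" using q_ge_2 by simp
    then have "LL (Suc k) ^ n i * de i ^ (q ^ Suc k) = f i * (LL k ^ n i * de i ^ (q ^ k))" for i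
      unfolding f_def LS power_mult_distrib by (simp add: power_add[symmetric] mult_ac)
    then have D: "Dn a b (Suc k) = (\<Prod>i\<in>{Suc a..b}. f i) * Dn a b k"
      unfolding Dn_def by (simp add: prod.distrib)
    have f: "integral (\<Prod>i\<in>{Suc a..b}. f i)"
      unfolding f_def
      by (intro integral_prod integral_mult integral_power integral_de integral_diff integral_tvar integral_uu)
    have "{Suc a..b} = insert (Suc a) {Suc (Suc a)..b}" using ab by auto
    then have "Dn a b k = LL k ^ n (Suc a) * de (Suc a) ^ (q ^ k) * Dn (Suc a) b k" by (simp add: Dn_def)
    then have "Dn a b k * (\<alpha> (Suc a) ^ (q ^ k) / LL k ^ n (Suc a) * Tr (Suc a) b k)
        = (de (Suc a) * \<alpha> (Suc a)) ^ (q ^ k) * (Dn (Suc a) b k * Tr (Suc a) b k)"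
      using LL_nonzero[of k] by (simp add: power_mult_distrib field_simps)
    then have "integral (Dn a b k * Tr a b k + Dn a b k * (\<alpha> (Suc a) ^ (q ^ k) / LL k ^ n (Suc a) * Tr (Suc a) b k))"
      using Suc ab by (intro integral_add Suc.IH) (auto intro!: integral_mult integral_power de_alpha Suc.IH)
    then have "integral (Dn a b k * Tr a b (Suc k))" unfolding Tr_Suc[OF ab] distrib_left .
    then show ?thesis unfolding D mult.assoc by (rule integral_mult[OF f])
  qed (simp add: Dn_def integral_1)
qed

definition WW :: "nat \<Rightarrow> 'a poly fract" where "WW k = LL k * Dn 0 d k"

lemma WW_nz: "WW k \<noteq> 0"
  using LL_nonzero[of k] de_nz by (auto simp: WW_def Dn_def)

lemma integral_WW: "v \<in> Vx \<Longrightarrow> integral (WW k * gk k v)"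
proof (cases "v = (0, 0)")
  case True
  have "WW k * gk k v = Dn 0 d k" using LL_nonzero[of k] True by (simp add: WW_def gk_def)
  then show ?thesis by (simp add: integral_Dn)
next
  case False
  assume "v \<in> Vx"
  then obtain a b where v: "v = (a, b)" "a < b" "b \<le> d" using False by (auto simp: Vx_def)
  have "Dn 0 d k = Dn 0 a k * Dn a b k * Dn b d k"
  proof -
    have "{Suc 0..d} = ({Suc 0..a} \<union> {Suc a..b}) \<union> {Suc b..d}" using v by auto
    moreover have "{Suc 0..a} \<inter> {Suc a..b} = {}" "({Suc 0..a} \<union> {Suc a..b}) \<inter> {Suc b..d} = {}" using v by auto
    ultimately show ?thesis unfolding Dn_def by (simp add: prod.union_disjoint)
  qed
  then have "WW k * gk k v = LL k * Dn 0 a k * Dn b d k * (Dn a b k * Tr a b k)"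
    using v by (simp add: WW_def gk_def mult_ac)
  then show ?thesis using v by (simp add: integral_mult integral_LL integral_Dn integral_Dn_Tr)
qed

text \<open>The exponent is linear in q^k, like that of 1/|X k|, so a fixed power of X outweighs the
  denominator.\<close>

lemma av_WW: "\<exists>K. \<forall>k. av (phi (WW k)) \<le> av \<theta> ^ (q ^ k * K)"
proof -
  define K where "K = q + (\<Sum>i\<in>{Suc 0..d}. q * n i + degree (den i))"
  have L: "av (phi (LL k)) \<le> av \<theta> ^ (q ^ k * q)" for k
  proof -
    have "1 \<le> q - 1" using q_ge_2 by linarith
    then have "qs k \<le> qs k * (q - 1)" using mult_le_mono2[of 1 "q - 1" "qs k"] by (simp only: mult_1_right)
    then have "qs k \<le> q ^ k * q" using qs_closed[of k] by (simp only: power_Suc mult.commute)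
    then show ?thesis using theta_gt by (simp add: LL_def phi_carlitz_L av_carlitz_L)
  qed
  have "av (phi (WW k)) \<le> av \<theta> ^ (q ^ k * K)" for k
  proof -
    have "av (phi (LL k ^ n i * de i ^ (q ^ k))) \<le> av \<theta> ^ (q ^ k * (q * n i + degree (den i)))" for i
    proof -
      have "av (phi (de i ^ (q ^ k))) = av \<theta> ^ (q ^ k * degree (den i))"
        using av_peval[OF num_den(1) theta_gt, of i]
        by (simp add: de_def rhom_power[OF rhom_phi] phi_Fract_1 av_power power_mult[symmetric] mult.commute)
      moreover have "av (phi (LL k ^ n i)) \<le> av \<theta> ^ (q ^ k * q * n i)"
        using power_mono[OF L[of k], of "n i"] by (simp add: rhom_power[OF rhom_phi] av_power power_mult)
      ultimately show ?thesis
        using mult_right_mono[of "av (phi (LL k ^ n i))" "av \<theta> ^ (q ^ k * q * n i)" "av \<theta> ^ (q ^ k * degree (den i))"]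
        by (simp add: rhom_mult[OF rhom_phi] av_mult power_add[symmetric] distrib_left mult.assoc)
    qed
    then have "(\<Prod>i\<in>{Suc 0..d}. av (phi (LL k ^ n i * de i ^ (q ^ k))))
       \<le> (\<Prod>i\<in>{Suc 0..d}. av \<theta> ^ (q ^ k * (q * n i + degree (den i))))"
      by (intro prod_mono) auto
    then have "av (phi (Dn 0 d k)) \<le> av \<theta> ^ (q ^ k * (\<Sum>i\<in>{Suc 0..d}. q * n i + degree (den i)))"
      by (simp add: Dn_def rhom_prod[OF rhom_phi] av_prod power_sum sum_distrib_left)
    then have "av (phi (LL k)) * av (phi (Dn 0 d k))
        \<le> av \<theta> ^ (q ^ k * q) * av \<theta> ^ (q ^ k * (\<Sum>i\<in>{Suc 0..d}. q * n i + degree (den i)))"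
      using L[of k] by (intro mult_mono) auto
    then show ?thesis by (simp add: WW_def K_def rhom_mult[OF rhom_phi] av_mult power_add[symmetric] distrib_left)
  qed
  then show ?thesis by blast
qed

lemma finite_Vx: "finite Vx"
proof -
  have "Vx \<subseteq> {..d} \<times> {..d}" by (auto simp: Vx_def)
  then show ?thesis by (rule finite_subset) auto
qed

lemma integral_mon:
  assumes "b \<in> box Vx N" shows "integral (WW k ^ (card Vx * N) * mon (gk k) b)"
proof -
  have b: "keys b \<subseteq> Vx" "\<And>v. lookup b v \<le> N" using assms by (auto simp: box_def)
  have iW: "integral (WW k)" by (auto simp: WW_def intro: integral_mult integral_LL integral_Dn)
  have "WW k ^ (card Vx * N) * mon (gk k) b
      = (\<Prod>v\<in>Vx. WW k ^ (N - lookup b v) * (WW k * gk k v) ^ lookup b v)"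
  proof -
    have "(\<Prod>v\<in>Vx. WW k ^ (N - lookup b v) * (WW k * gk k v) ^ lookup b v)
      = (\<Prod>v\<in>Vx. WW k ^ N * gk k v ^ lookup b v)"
      using b(2) by (intro prod.cong refl) (simp add: power_mult_distrib mult.assoc[symmetric] power_add[symmetric])
    also have "\<dots> = WW k ^ (card Vx * N) * mon (gk k) b"
      by (simp add: prod.distrib mon_superset[OF finite_Vx b(1)] power_mult[symmetric] mult.commute)
    finally show ?thesis by simp
  qed
  then show ?thesis by (simp add: integral_prod integral_mult integral_power integral_WW iW)
qed

text \<open>K comes before N and c: the auxiliary construction fixes its ratio of order to degree
  from K, and only then N and c. The factor H absorbs the common denominator of the coefficients and
  does not depend on k.\<close>

lemma liouville:
  "\<exists>K. \<forall>N c. \<exists>H>0. \<forall>k. (let z = \<Sum>x\<in>{..N} \<times> box Vx N. c x * (- 1 / uu k) ^ fst x * mon (gk k) (snd x) in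
     z \<noteq> 0 \<longrightarrow> 1 \<le> H * av \<theta> ^ (q ^ k * (K * N)) * av (phi z))"
proof -
  obtain K where K: "\<And>k. av (phi (WW k)) \<le> av \<theta> ^ (q ^ k * K)" using av_WW by blast
  show ?thesis
  proof (intro exI[of _ "Suc (K * card Vx)"] allI)
    fix N and c :: "nat \<times> (nat \<times> nat \<Rightarrow>\<^sub>0 nat) \<Rightarrow> 'a poly fract"
    define S where "S = {..N} \<times> box Vx N"
    have "finite S" by (auto simp: S_def box_card[OF finite_Vx])
    from common_denominator[OF this, of c] obtain h where h: "h \<noteq> 0" "\<And>x. x \<in> S \<Longrightarrow> integral (Fract h 1 * c x)" by blast
    define H where "H = av (phi (Fract h 1))"
    have H: "H > 0" using h(1) by (simp add: H_def av_pos rhom_field_eq_0_iff[OF rhom_phi] Fract_1_eq_0)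
    have "1 \<le> H * av \<theta> ^ (q ^ k * (Suc (K * card Vx) * N)) * av (phi z)"
      if z: "z = (\<Sum>x\<in>S. c x * (- 1 / uu k) ^ fst x * mon (gk k) (snd x))" "z \<noteq> 0" for k z
    proof -
      define W where "W = Fract h 1 * uu k ^ N * WW k ^ (card Vx * N)"
      have "integral (W * (c x * (- 1 / uu k) ^ fst x * mon (gk k) (snd x)))" if x: "x \<in> S" for x
      proof -
        obtain a b where ab: "x = (a, b)" "a \<le> N" "b \<in> box Vx N" using x by (auto simp: S_def)
        have "uu k ^ N = uu k ^ (N - a) * uu k ^ a" using ab by (simp flip: power_add)
        then have e: "uu k ^ N * (- 1 / uu k) ^ a = uu k ^ (N - a) * (- 1) ^ a"
          using uu_nonzero[of k] by (simp add: mult.assoc power_mult_distrib[symmetric])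
        have "W * (c x * (- 1 / uu k) ^ fst x * mon (gk k) (snd x))
           = (Fract h 1 * c x) * (uu k ^ N * (- 1 / uu k) ^ a) * (WW k ^ (card Vx * N) * mon (gk k) b)"
          by (simp only: W_def ab(1) fst_conv snd_conv mult_ac)
        then have "W * (c x * (- 1 / uu k) ^ fst x * mon (gk k) (snd x))
           = (Fract h 1 * c x) * (uu k ^ (N - a) * (- 1) ^ a) * (WW k ^ (card Vx * N) * mon (gk k) b)" (is "?l = ?r")
          unfolding e .
        moreover have "integral ((- 1 :: 'a poly fract))"
          using integral_diff[OF integral_0 integral_1] by simp
        then have "integral ?r"
          using ab x by (intro integral_mult integral_power integral_uu integral_mon h(2))
        ultimately show ?thesis by (simp only:)
      qed
      then have "integral (W * z)" unfolding z sum_distrib_left by (rule integral_sum)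
      moreover have "W * z \<noteq> 0" using z(2) h(1) uu_nonzero WW_nz by (simp add: W_def Fract_1_eq_0)
      ultimately have "1 \<le> av (phi (W * z))" by (rule av_integral)
      also have "\<dots> = H * (av \<theta> ^ (q ^ k)) ^ N * av (phi (WW k)) ^ (card Vx * N) * av (phi z)"
        by (simp add: W_def H_def rhom_mult[OF rhom_phi] rhom_power[OF rhom_phi] av_mult av_power phi_uu)
      also have "\<dots> \<le> H * (av \<theta> ^ (q ^ k)) ^ N * (av \<theta> ^ (q ^ k * K)) ^ (card Vx * N) * av (phi z)"
        using H K[of k] by (intro mult_right_mono mult_left_mono power_mono) auto
      also have "(av \<theta> ^ (q ^ k)) ^ N * (av \<theta> ^ (q ^ k * K)) ^ (card Vx * N) = av \<theta> ^ (q ^ k * (Suc (K * card Vx) * N))"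
        by (simp add: power_mult[symmetric] power_add[symmetric] algebra_simps)
      then have "H * (av \<theta> ^ (q ^ k)) ^ N * (av \<theta> ^ (q ^ k * K)) ^ (card Vx * N) * av (phi z)
         = H * av \<theta> ^ (q ^ k * (Suc (K * card Vx) * N)) * av (phi z)" by (simp only: mult.assoc)
      finally show ?thesis .
    qed
    then show "\<exists>H>0. \<forall>k. (let z = \<Sum>x\<in>{..N} \<times> box Vx N. c x * (- 1 / uu k) ^ fst x * mon (gk k) (snd x) in
     z \<noteq> 0 \<longrightarrow> 1 \<le> H * av \<theta> ^ (q ^ k * (Suc (K * card Vx) * N)) * av (phi z))"
      using H unfolding S_def Let_def by blast
  qed
qed

section \<open>The transcendence argument over K\<close>

lemma ex_finb_Ys: "v \<in> Vx \<Longrightarrow> \<exists>D. finb Vx D (Ys v)"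
proof -
  assume v: "v \<in> Vx"
  have l: "finb Vx 0 (lift f)" for f
    by (auto simp: finb_def lift_def mC_def box_0)
  have X: "keys (mX w :: (nat \<times> nat, 'a poly fract) mpol) \<subseteq> box Vx 1" if "w \<in> Vx" for w
    using that by (auto simp: mX_def box_def lookup_single when_def)
  have c1: "finb Vx 1 (fps_const (mX w :: (nat \<times> nat, 'a poly fract) mpol))" if "w \<in> Vx" for w using X[OF that] by (rule finb_const)
  have z: "(0, 0) \<in> Vx" by (simp add: Vx_def)
  show ?thesis
  proof (cases "v = (0, 0)")
    case True
    then show ?thesis using finb_mult[OF c1[OF z] l] by (auto simp: Ys_def)
  next
    case False
    have "\<exists>D. finb Vx D (fps_const (mX (0, 0) ^ (Nn c - Nn (fst v)) * uent mX c (snd v))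
       * fps_X ^ (q * (Nn (snd v) - Nn c)) * lift (fhs (fst v) c))" if c: "c \<in> {fst v..snd v}" for c
    proof -
      have "finb Vx 1 (fps_const (uent mX c (snd v) :: (nat \<times> nat, 'a poly fract) mpol))"
        using c v False c1[of "(c, snd v)"] by (auto simp: uent_def Vx_def finb_1)
      from finb_mult[OF finb_mult[OF finb_mult[OF finb_power[OF c1[OF z]] this] finb_X_power] l]
      show ?thesis unfolding fps_const_power fps_const_mult by blast
    qed
    then show ?thesis unfolding Ys_def using False by (simp only: if_False) (intro ex_finb_sum, auto)
  qed
qed

lemma ex_finb_Fs:
  assumes "\<And>e. e \<in> keys Q \<Longrightarrow> keys e \<subseteq> Vx"
  shows "\<exists>D. finb Vx D (Fs Q s)"
  unfolding Fs_def
proof (rule ex_finb_sum)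
  fix e assume e: "e \<in> keys Q"
  have "\<exists>D. finb Vx D (mon Ys e)"
    unfolding mon_def
  proof (rule ex_finb_prod)
    fix v assume "v \<in> keys e"
    then obtain D where "finb Vx D (Ys v)" using ex_finb_Ys assms[OF e] by blast
    then show "\<exists>D. finb Vx D (Ys v ^ lookup e v)" using finb_power by blast
  qed simp
  then obtain D where D: "finb Vx D (mon Ys e)" by blast
  have "finb Vx 0 (fps_const (mC (lookup Q e)))" by (intro finb_const) (auto simp: mC_def box_0)
  from finb_mult[OF finb_mult[OF this finb_X_power] D]
  show "\<exists>D. finb Vx D (fps_const (mC (lookup Q e)) * fps_X ^ (q * (s - wsum wtt e)) * mon Ys e)" by blast
qed simp

theorem values_independent:
  assumes Q0: "Q \<noteq> 0" and Q: "\<And>e. e \<in> keys Q \<Longrightarrow> keys e \<subseteq> Vx"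
  shows "meval phi val Q \<noteq> 0"
proof
  assume zero: "meval phi val Q = 0"
  define s where "s = Max (wsum wtt ` keys Q)"
  have Qs: "keys e \<subseteq> Vx \<and> wsum wtt e \<le> s" if "e \<in> keys Q" for e
    using that Q by (auto simp: s_def)
  define F where "F = Fs Q s"
  have F0: "F \<noteq> 0" unfolding F_def by (rule relation_series[OF Q0 Qs])
  obtain \<delta> where fin: "finb Vx \<delta> F" using ex_finb_Fs[of Q s] Q by (auto simp: F_def)
  interpret g: asy av XX "psi gv" by (rule asy_psi[OF bdd_gv])
  have AF: "g.Asy (\<lambda>_. 0) F"
    using Asy_Fs[OF g.asy_axioms, of Q s val] Qs yv_gv zero by (simp add: F_def)
  obtain K where K: "\<And>N c. \<exists>H>0. \<forall>k. (let z = \<Sum>x\<in>{..N} \<times> box Vx N. c x * (- 1 / uu k) ^ fst x * mon (gk k) (snd x) in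
     z \<noteq> 0 \<longrightarrow> 1 \<le> H * av \<theta> ^ (q ^ k * (K * N)) * av (phi z))" using liouville by blast
  \<comment> \<open>The order of vanishing is about y N; the summands of y pay for the division by
    up to N factors F and for the Liouville exponent (q - 1) K N.\<close>
  define y where "y = subdegree F + (q - 1) * K + 2"
  define C where "C = Suc \<delta> ^ card Vx"
  define N where "N = C * y - 1"
  define S where "S = {..N} \<times> box Vx N"
  have S: "finite S" by (auto simp: S_def box_card[OF finite_Vx])
  have "y \<ge> 1" by (simp add: y_def)
  from auxiliary_series[OF finite_Vx fin this, folded C_def, folded N_def, folded S_def, of "q - 1"]
  obtain c where c0: "\<exists>j\<le>N. \<exists>x\<in>S. c (j, x) \<noteq> 0"
    and c: "\<And>n. n < C * y ^ 2 - 1 \<Longrightarrow> fps_nth (\<Sum>j\<le>N. \<Sum>x\<in>S.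
       fps_const (mC (c (j, x)) * Poly_Mapping.single (snd x) 1) * fps_X ^ ((q - 1) * fst x) * F ^ j) n = 0" by blast
  define T where "T j x = fps_const (mC (c (j, x)) * Poly_Mapping.single (snd x) 1) * fps_X ^ ((q - 1) * fst x)" for j x
  \<comment> \<open>The lowest power of F that occurs; division by F^i leaves a part free of F with
    a nonzero coefficient.\<close>
  define i where "i = (LEAST j. j \<le> N \<and> (\<exists>x\<in>S. c (j, x) \<noteq> 0))"
  have "i \<le> N \<and> (\<exists>x\<in>S. c (i, x) \<noteq> 0)" unfolding i_def by (rule LeastI_ex) (use c0 in blast)
  then obtain x0 where i: "i \<le> N" "x0 \<in> S" "c (i, x0) \<noteq> 0" by blast
  have ci: "c (j, x) = 0" if "j < i" "x \<in> S" for j x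
    using not_less_Least[of j "\<lambda>j. j \<le> N \<and> (\<exists>x\<in>S. c (j, x) \<noteq> 0)"] that i(1) unfolding i_def[symmetric] by auto
  define E where "E = (\<Sum>j\<le>N. \<Sum>x\<in>S. T j x * F ^ (j - i))"
  have E: "F ^ i * E = (\<Sum>j\<le>N. \<Sum>x\<in>S. T j x * F ^ j)"
    unfolding E_def sum_distrib_left
  proof (intro sum.cong refl)
    fix j x assume x: "x \<in> S"
    show "F ^ i * (T j x * F ^ (j - i)) = T j x * F ^ j"
    proof (cases "j < i")
      case True
      then show ?thesis using ci[OF True x] by (simp add: T_def rhom_0[OF rhom_mC])
    next
      case False
      then have "F ^ j = F ^ i * F ^ (j - i)" by (simp flip: power_add)
      then show ?thesis by (simp add: mult_ac)
    qed
  qed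
  define M where "M = C * y ^ 2 - 1 - N * subdegree F"
  have En: "fps_nth E n = 0" if n: "n < M" for n
  proof (cases "E = 0")
    case False
    have FE: "F ^ i * E \<noteq> 0" using F0 False by simp
    have "C * y ^ 2 - 1 \<le> subdegree (F ^ i * E)"
      using FE c unfolding E T_def by (intro subdegree_geI) auto
    also have "\<dots> = i * subdegree F + subdegree E" using F0 False by simp
    also have "\<dots> \<le> N * subdegree F + subdegree E" using i(1) by simp
    finally have "n < subdegree E" using n by (simp add: M_def)
    then show ?thesis by (rule nth_less_subdegree_zero)
  qed simp
  define z where "z k = (\<Sum>x\<in>S. c (i, x) * (- 1 / uu k) ^ fst x * mon (gk k) (snd x))" for k
  \<comment> \<open>F represents 0, so the terms with j > i contribute nothing to the sequence
    represented, although they do count in the series.\<close>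
  have AE: "g.Asy (\<lambda>k. phi (z k)) E"
  proof -
    have "g.Asy (\<lambda>k. \<Sum>j\<le>N. \<Sum>x\<in>S. psi gv k (mC (c (j, x)) * Poly_Mapping.single (snd x) 1) * XX k ^ ((q - 1) * fst x) * 0 ^ (j - i)) E"
      unfolding E_def T_def
      by (intro g.Asy_sum g.Asy_mult[OF g.Asy_mult[OF g.Asy_const g.Asy_power[OF g.Asy_X]] g.Asy_power[OF AF]])
    moreover have "(\<Sum>j\<le>N. \<Sum>x\<in>S. psi gv k (mC (c (j, x)) * Poly_Mapping.single (snd x) 1) * XX k ^ ((q - 1) * fst x) * 0 ^ (j - i))
        = phi (z k)" for k
    proof -
      have "(\<Sum>j\<le>N. \<Sum>x\<in>S. psi gv k (mC (c (j, x)) * Poly_Mapping.single (snd x) 1) * XX k ^ ((q - 1) * fst x) * 0 ^ (j - i))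
        = (\<Sum>j\<in>{i}. \<Sum>x\<in>S. psi gv k (mC (c (j, x)) * Poly_Mapping.single (snd x) 1) * XX k ^ ((q - 1) * fst x) * 0 ^ (j - i))"
      proof (rule sum.mono_neutral_right)
        show "\<forall>j\<in>{..N} - {i}. (\<Sum>x\<in>S. psi gv k (mC (c (j, x)) * Poly_Mapping.single (snd x) 1) * XX k ^ ((q - 1) * fst x) * 0 ^ (j - i)) = 0"
        proof
          fix j assume "j \<in> {..N} - {i}"
          then consider "j < i" | "j - i > 0" by fastforce
          then show "(\<Sum>x\<in>S. psi gv k (mC (c (j, x)) * Poly_Mapping.single (snd x) 1) * XX k ^ ((q - 1) * fst x) * 0 ^ (j - i)) = 0"
            by cases (auto intro!: sum.neutral simp: ci rhom_0[OF rhom_mC])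
        qed
      qed (use i(1) in auto)
      also have "\<dots> = (\<Sum>x\<in>S. phi (c (i, x)) * XX k ^ ((q - 1) * fst x) * mon (gv k) (snd x))"
        by (simp add: rhom_mult[OF rhom_meval[OF rhom_phi]] meval_mC[OF rhom_phi] meval_single[OF rhom_phi] rhom_1[OF rhom_phi] mult_ac)
      also have "\<dots> = phi (z k)"
        unfolding z_def rhom_sum[OF rhom_phi]
      proof (rule sum.cong[OF refl])
        fix x assume "x \<in> S"
        then have "keys (snd x) \<subseteq> Vx" by (auto simp: S_def box_def)
        then have "mon (gv k) (snd x) = phi (mon (gk k) (snd x))"
          unfolding rhom_mon[OF rhom_phi] by (intro mon_cong) (auto simp: gv_def)
        moreover have "XX k ^ ((q - 1) * fst x) = phi ((- 1 / uu k) ^ fst x)"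
          unfolding power_mult XX_pow
          by (simp add: rhom_power[OF rhom_phi] rhom_divide[OF rhom_phi] rhom_uminus[OF rhom_phi] rhom_1[OF rhom_phi] phi_uu)
        ultimately show "phi (c (i, x)) * XX k ^ ((q - 1) * fst x) * mon (gv k) (snd x)
          = phi (c (i, x) * (- 1 / uu k) ^ fst x * mon (gk k) (snd x))"
          by (simp only: rhom_mult[OF rhom_phi])
      qed
      finally show ?thesis .
    qed
    ultimately show ?thesis by simp
  qed
  have "g.asyS M (\<lambda>k. phi (z k)) E" using AE by (simp add: g.Asy_def)
  from g.asyS_small[OF this En] obtain B0 where B0: "\<And>k. av (phi (z k)) \<le> B0 * av (XX k) ^ M" by auto
  obtain H where H: "H > 0" "\<And>k. z k \<noteq> 0 \<Longrightarrow> 1 \<le> H * av \<theta> ^ (q ^ k * (K * N)) * av (phi (z k))"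
    using K[where N = N and c = "\<lambda>x. c (i, x)"] unfolding S_def[symmetric] z_def[symmetric] Let_def by blast
  define B where "B = max B0 1"
  \<comment> \<open>The order left after the division exceeds the Liouville exponent by at least one
    factor X.\<close>
  have M: "M \<ge> (q - 1) * (K * N) + 1"
  proof -
    have "C \<ge> 1" by (simp add: C_def)
    then have "Suc N = C * y" by (simp add: N_def y_def)
    then have "C * y ^ 2 = Suc N * y" by (simp add: power2_eq_square mult.assoc[symmetric])
    moreover obtain L where L: "(q - 1) * (K * N) = L * N" "y = subdegree F + L + 2"
      by (rule that[of "(q - 1) * K"]) (simp_all only: y_def mult.assoc)
    ultimately have e: "C * y ^ 2 = Suc N * (subdegree F + L + 2)" by (simp only:)
    show ?thesis unfolding M_def L(1) e by (simp add: algebra_simps)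
  qed
  have small: "1 \<le> H * B * av (XX k)" if "z k \<noteq> 0" for k
  proof -
    have tX: "av \<theta> ^ (q ^ k) * av (XX k) ^ (q - 1) = 1"
      using XX_pow[of k] theta_nz by (simp add: av_power[symmetric] av_mult[symmetric])
    have "1 \<le> H * av \<theta> ^ (q ^ k * (K * N)) * av (phi (z k))" by (rule H(2)[OF that])
    also have "\<dots> \<le> H * av \<theta> ^ (q ^ k * (K * N)) * (B * av (XX k) ^ ((q - 1) * (K * N) + 1))"
    proof (intro mult_left_mono)
      have "av (phi (z k)) \<le> B * av (XX k) ^ M"
        using B0[of k] mult_right_mono[of B0 B "av (XX k) ^ M"] by (simp add: B_def)
      also have "\<dots> \<le> B * av (XX k) ^ ((q - 1) * (K * N) + 1)"
        using XX_lt[of k] by (intro mult_left_mono power_decreasing[OF M]) (auto simp: B_def)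
      finally show "av (phi (z k)) \<le> B * av (XX k) ^ ((q - 1) * (K * N) + 1)" .
    qed (use H(1) in auto)
    also have "\<dots> = H * B * av (XX k) * (av \<theta> ^ (q ^ k) * av (XX k) ^ (q - 1)) ^ (K * N)"
    proof -
      have p: "(av \<theta> ^ (q ^ k) * av (XX k) ^ (q - 1)) ^ (K * N)
          = av \<theta> ^ (q ^ k * (K * N)) * av (XX k) ^ ((q - 1) * (K * N))"
        by (simp only: power_mult_distrib power_mult[symmetric])
      show ?thesis unfolding p power_add power_one_right by (simp only: mult_ac)
    qed
    finally show ?thesis unfolding tX by simp
  qed
  have HB: "H * B > 0" using H(1) by (simp add: B_def)
  then obtain k0 where k0: "\<And>k. k \<ge> k0 \<Longrightarrow> av (XX k) < 1 / (H * B)" using XX_lim[of "1 / (H * B)"] by auto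
  \<comment> \<open>For large k the upper bound falls below the lower one, so z vanishes from some
    index on, against the independence of the parameters.\<close>
  have "z k = 0" if "k \<ge> k0" for k
  proof (rule ccontr)
    assume "z k \<noteq> 0"
    then show False using small[of k] k0[OF that] HB by (simp add: field_simps)
  qed
  then have ev: "eventually (\<lambda>k. (\<Sum>(a, m)\<in>S. c (i, a, m) * (- 1 / uu k) ^ a * mon (gk k) m) = 0) sequentially"
    unfolding eventually_sequentially z_def by (auto simp: case_prod_unfold)
  have "c (i, x0) = 0"
    by (rule parameters_independent[where c = "\<lambda>x. c (i, x)" and S = S and ?x0.0 = x0])
      (use S ev i(2) in \<open>auto simp: S_def box_def\<close>)
  then show False using i(3) by blast
qed

end

section \<open>Algebraic coefficients\<close>

locale scalars =
  fixes \<phi> :: "'k::field \<Rightarrow> 'c::field"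
  assumes hom: "rhom \<phi>"
begin

sublocale vs: vector_space "\<lambda>k x. \<phi> k * x"
  by unfold_locales (simp_all add: rhom_add[OF hom] rhom_mult[OF hom] rhom_1[OF hom] algebra_simps)

lemma span_mult_closed:
  assumes "\<And>w. w \<in> A \<Longrightarrow> g * w \<in> vs.span B" "x \<in> vs.span A" shows "g * x \<in> vs.span B"
  using assms(2)
proof (induction x rule: vs.span_induct_alt)
  case (step k x y)
  have "\<phi> k * (g * x) + g * y \<in> vs.span B" using assms(1)[OF step(1)] step(2) by (intro vs.span_add vs.span_scale)
  then show ?case by (simp add: algebra_simps)
qed (simp add: vs.span_zero)

text \<open>Elements are adjoined one at a time: multiplying a finite spanning set by the powers g^i
  below the degree of an equation of g keeps it finite and makes it stable under g, while stability
  under the earlier elements persists.\<close>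

lemma finite_algebra:
  assumes "finite G" "\<And>g. g \<in> G \<Longrightarrow> \<exists>f. f \<noteq> 0 \<and> (\<forall>i. coeff f i \<in> range \<phi>) \<and> poly f g = 0"
  shows "\<exists>\<Omega>. finite \<Omega> \<and> 1 \<in> \<Omega> \<and> (\<forall>g\<in>G. \<forall>w\<in>\<Omega>. g * w \<in> vs.span \<Omega>)"
  using assms
proof (induction G rule: finite_induct)
  case empty
  then show ?case by (intro exI[of _ "{1}"]) auto
next
  case (insert g G)
  have "\<exists>\<Omega>. finite \<Omega> \<and> 1 \<in> \<Omega> \<and> (\<forall>g\<in>G. \<forall>w\<in>\<Omega>. g * w \<in> vs.span \<Omega>)"
    by (rule insert.IH) (use insert.prems in blast)
  then obtain \<Omega> where \<Omega>: "finite \<Omega>" "1 \<in> \<Omega>" "\<And>h w. h \<in> G \<Longrightarrow> w \<in> \<Omega> \<Longrightarrow> h * w \<in> vs.span \<Omega>" by blast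
  obtain f where f: "f \<noteq> 0" "\<And>i. coeff f i \<in> range \<phi>" "poly f g = 0" using insert.prems by blast
  have "\<exists>x. coeff f i = \<phi> x" for i using f(2)[of i] by blast
  then obtain k where k: "\<And>i. coeff f i = \<phi> (k i)" by metis
  define m where "m = degree f"
  have m: "m > 0"
  proof (rule ccontr)
    assume "\<not> m > 0"
    then obtain a where "f = [:a:]" unfolding m_def using degree_eq_zeroE by blast
    then show False using f by simp
  qed
  define \<Omega>' where "\<Omega>' = (\<lambda>(w, i). w * g ^ i) ` (\<Omega> \<times> {..<m})"
  have mem: "w * g ^ i \<in> \<Omega>'" if "w \<in> \<Omega>" "i < m" for w i using that by (auto simp: \<Omega>'_def)
  have top: "w * g ^ m \<in> vs.span \<Omega>'" if w: "w \<in> \<Omega>" for w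
  proof -
    have "0 = (\<Sum>i<m. coeff f i * g ^ i) + coeff f m * g ^ m"
      using f(3) by (simp add: poly_altdef m_def lessThan_Suc_atMost[symmetric])
    moreover have "coeff f m \<noteq> 0" using f(1) by (simp add: m_def)
    ultimately have "g ^ m = (\<Sum>i<m. coeff f i * g ^ i) * (- inverse (coeff f m))"
      by (simp add: field_simps eq_neg_iff_add_eq_0)
    also have "\<dots> = (\<Sum>i<m. \<phi> (- k i * inverse (k m)) * g ^ i)"
      by (simp add: sum_distrib_right sum_distrib_left sum_negf k rhom_mult[OF hom] rhom_uminus[OF hom] rhom_inverse[OF hom] mult_ac)
    finally have "w * g ^ m = (\<Sum>i<m. \<phi> (- k i * inverse (k m)) * (w * g ^ i))"
      by (simp add: sum_distrib_left mult_ac)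
    also have "\<dots> \<in> vs.span \<Omega>'" using mem[OF w] by (intro vs.span_sum vs.span_scale vs.span_base) auto
    finally show ?thesis .
  qed
  have "h * x \<in> vs.span \<Omega>'" if h: "h \<in> insert g G" and x: "x \<in> \<Omega>'" for h x
  proof -
    obtain w i where wi: "x = w * g ^ i" "w \<in> \<Omega>" "i < m" using x by (auto simp: \<Omega>'_def)
    show ?thesis
    proof (cases "h = g")
      case True
      then have "h * x = w * g ^ Suc i" by (simp add: wi mult_ac)
      then show ?thesis
        using mem[OF wi(2), of "Suc i"] top[OF wi(2)] wi(3) by (cases "Suc i = m") (auto intro: vs.span_base)
    next
      case False
      then have "h * w \<in> vs.span \<Omega>" using h wi \<Omega> by auto
      then have "g ^ i * (h * w) \<in> vs.span \<Omega>'"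
      proof (rule span_mult_closed[rotated])
        fix w' assume "w' \<in> \<Omega>"
        then show "g ^ i * w' \<in> vs.span \<Omega>'" using vs.span_base[OF mem[OF _ wi(3)]] by (subst mult.commute)
      qed
      then show ?thesis by (simp add: wi mult_ac)
    qed
  qed
  moreover have "1 \<in> \<Omega>'" using mem[OF \<Omega>(2) m] by simp
  moreover have "finite \<Omega>'" using \<Omega>(1) by (simp add: \<Omega>'_def)
  ultimately show ?case by blast
qed

lemma card_box_slice:
  assumes "finite V" "v \<in> V" shows "card {m \<in> box V t. lookup m v = i} \<le> Suc t ^ (card V - 1)"
proof -
  have "{m \<in> box V t. lookup m v = i} \<subseteq> (\<lambda>m. m + Poly_Mapping.single v i) ` box (V - {v}) t"
  proof
    fix m assume m: "m \<in> {m \<in> box V t. lookup m v = i}"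
    have "m = Poly_Mapping.update v 0 m + Poly_Mapping.single v i"
      using m by (intro poly_mapping_eqI) (auto simp: lookup_add lookup_update lookup_single when_def)
    moreover have "Poly_Mapping.update v 0 m \<in> box (V - {v}) t"
      using m by (auto simp: box_def in_keys_iff lookup_update subset_iff)
    ultimately show "m \<in> (\<lambda>m. m + Poly_Mapping.single v i) ` box (V - {v}) t" by blast
  qed
  then have "card {m \<in> box V t. lookup m v = i} \<le> card (box (V - {v}) t)"
    using assms by (intro surj_card_le box_card) auto
  then show ?thesis using assms by (simp add: box_card)
qed

text \<open>Reducing all monomials modulo the leading monomial of the relation, over a finite-dimensional
  algebra containing the coefficients, makes the dimension of the space of monomials grow too slowly.\<close>
theorem independent_over_algebraic:
  fixes val :: "'v \<Rightarrow> 'c"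
  assumes V: "finite V"
    and indep: "\<And>Q. Q \<noteq> 0 \<Longrightarrow> (\<And>e. e \<in> keys Q \<Longrightarrow> keys e \<subseteq> V) \<Longrightarrow> meval \<phi> val Q \<noteq> 0"
    and S: "finite S" "\<And>e. e \<in> S \<Longrightarrow> keys e \<subseteq> V"
    and c: "\<And>e. e \<in> S \<Longrightarrow> c e \<noteq> 0 \<and> (\<exists>f. f \<noteq> 0 \<and> (\<forall>i. coeff f i \<in> range \<phi>) \<and> poly f (c e) = 0)"
    and rel: "(\<Sum>e\<in>S. c e * mon val e) = 0"
  shows "S = {}"
proof (rule ccontr)
  assume ne: "S \<noteq> {}"
  \<comment> \<open>The weight, injective on S, singles out a leading monomial \<open>es\<close> of
    the relation.\<close>
  obtain w where w: "\<And>v. w v \<ge> 1" "inj_on (wsum w) S" using ex_injective_weight[OF S(1)] by blast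
  have "Max (wsum w ` S) \<in> wsum w ` S" using S(1) ne by (intro Max_in) auto
  then obtain es where es: "es \<in> S" "wsum w es = Max (wsum w ` S)" by auto
  have lt: "wsum w e < wsum w es" if "e \<in> S - {es}" for e
  proof -
    have "wsum w e \<le> wsum w es" using that S(1) es(2) by auto
    moreover have "wsum w e \<noteq> wsum w es" using w(2) that es(1) by (auto dest: inj_onD)
    ultimately show ?thesis by simp
  qed
  \<comment> \<open>The inverse of the leading coefficient joins the multipliers, so that solving
    for the leading monomial stays in the algebra; the reversed polynomial shows that it is
    algebraic.\<close>
  define b where "b = inverse (c es)"
  define G where "G = insert b (c ` S)"
  have "\<exists>f. f \<noteq> 0 \<and> (\<forall>i. coeff f i \<in> range \<phi>) \<and> poly f g = 0" if "g \<in> G" for g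
  proof (cases "g = b")
    case True
    obtain f where f: "f \<noteq> 0" "\<And>i. coeff f i \<in> range \<phi>" "poly f (c es) = 0" and nz: "c es \<noteq> 0" using c[OF es(1)] by blast
    have "poly (reflect_poly f) b = 0" using f(3) nz by (simp add: b_def poly_reflect_poly_nz)
    moreover have "0 \<in> range \<phi>" using rhom_0[OF hom] by (metis rangeI)
    then have "coeff (reflect_poly f) i \<in> range \<phi>" for i using f(2) by (simp add: coeff_reflect_poly)
    ultimately show ?thesis using True f(1) by (intro exI[of _ "reflect_poly f"]) simp
  next
    case False
    then show ?thesis using that c by (auto simp: G_def)
  qed
  then obtain \<Omega> where \<Omega>: "finite \<Omega>" "1 \<in> \<Omega>" "\<And>g w. g \<in> G \<Longrightarrow> w \<in> \<Omega> \<Longrightarrow> g * w \<in> vs.span \<Omega>"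
    using finite_algebra[of G] S(1) unfolding G_def by (metis (no_types, lifting) finite_imageI finite_insert)
  define E where "E = (\<Sum>v\<in>V. lookup es v)"
  define W where "W = (\<Sum>v\<in>V. w v)"
  \<comment> \<open>Chosen so that the bound y (y + 1)^(v - 1) for the spanning set, v > 0 being the
    number of variables, stays below the (y + 1)^v monomials with exponents at most y; these have
    weight at most t.\<close>
  define y where "y = card \<Omega> * (E * Suc W ^ (card V - 1))"
  define t where "t = W * y"
  define R where "R = {m \<in> box V t. \<exists>v\<in>V. lookup m v < lookup es v}"
  define A where "A = (\<lambda>(w, m). w * mon val m) ` (\<Omega> \<times> R)"
  have RU: "R = (\<Union>v\<in>V. \<Union>i<lookup es v. {m \<in> box V t. lookup m v = i})"
    by (auto simp: R_def)
  have "card R \<le> (\<Sum>v\<in>V. card (\<Union>i<lookup es v. {m \<in> box V t. lookup m v = i}))"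
    unfolding RU by (rule card_UN_le[OF V])
  also have "\<dots> \<le> (\<Sum>v\<in>V. \<Sum>i<lookup es v. Suc t ^ (card V - 1))"
    by (intro sum_mono order_trans[OF card_UN_le] card_box_slice V) auto
  also have "\<dots> = E * Suc t ^ (card V - 1)" by (simp add: E_def sum_distrib_right)
  finally have R: "card R \<le> E * Suc t ^ (card V - 1)" .
  have finR: "finite R" using box_card(1)[OF V] by (simp add: R_def)
  have "card A \<le> card \<Omega> * card R"
    unfolding A_def using card_image_le[of "\<Omega> \<times> R"] \<Omega>(1) finR by (simp add: card_cartesian_product)
  also have "\<dots> \<le> card \<Omega> * (E * (Suc W * Suc y) ^ (card V - 1))"
    by (intro mult_le_mono order_refl order_trans[OF R] power_mono) (auto simp: t_def)
  also have "\<dots> = card \<Omega> * (E * Suc W ^ (card V - 1)) * Suc y ^ (card V - 1)"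
    by (simp only: power_mult_distrib mult.assoc)
  also have "\<dots> = y * Suc y ^ (card V - 1)" by (simp only: y_def)
  also have "\<dots> < Suc y ^ card V"
  proof (cases "card V")
    case 0
    then have "y = 0" using V by (simp add: y_def E_def)
    then show ?thesis by simp
  qed simp
  finally have card: "card A < Suc y ^ card V" .
  have step: "g * x \<in> vs.span A" if "g \<in> G" "x \<in> vs.span A" for g x
    using _ that(2)
  proof (rule span_mult_closed)
    fix x assume "x \<in> A"
    then obtain w m where x: "x = w * mon val m" "w \<in> \<Omega>" "m \<in> R" by (auto simp: A_def)
    have "mon val m * (g * w) \<in> vs.span A"
    proof (rule span_mult_closed)
      show "g * w \<in> vs.span \<Omega>" by (rule \<Omega>(3)[OF that(1) x(2)])
      show "mon val m * w' \<in> vs.span A" if "w' \<in> \<Omega>" for w'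
        using that x(3) by (intro vs.span_base) (auto simp: A_def mult.commute)
    qed
    then show "g * x \<in> vs.span A" by (simp add: x mult_ac)
  qed
  have wle: "lookup e v \<le> wsum w e" for e v
  proof (cases "v \<in> keys e")
    case True
    have "lookup e v * 1 \<le> lookup e v * w v" using w(1) by (intro mult_le_mono2) auto
    also have "\<dots> \<le> wsum w e" unfolding wsum_def using True by (intro member_le_sum) auto
    finally show ?thesis by simp
  qed (simp add: in_keys_iff)
  have reduce: "mon val e \<in> vs.span A" if "keys e \<subseteq> V" "wsum w e \<le> t" for e
    using that
  proof (induction "wsum w e" arbitrary: e rule: less_induct)
    case less
    show ?case
    proof (cases "\<exists>v\<in>V. lookup e v < lookup es v")
      case True
      then have "e \<in> R" using less.prems wle order_trans[OF wle] by (auto simp: R_def box_def)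
      then have "1 * mon val e \<in> A" using \<Omega>(2) unfolding A_def by force
      then show ?thesis by (simp add: vs.span_base)
    next
      case False
      have ge: "lookup es v \<le> lookup e v" for v
        using False S(2)[OF es(1)] by (metis in_keys_iff not_le subsetD zero_le)
      define e' where "e' = e - es"
      have e: "e = e' + es" using ge by (intro poly_mapping_eqI) (simp add: e'_def lookup_add lookup_minus)
      have ke: "keys e' \<subseteq> V"
        using less.prems(1) by (auto simp: e'_def in_keys_iff lookup_minus subset_iff)
      have "mon val es = (\<Sum>x\<in>S - {es}. - (b * (c x * mon val x)))"
      proof -
        have "c es * mon val es + (\<Sum>x\<in>S - {es}. c x * mon val x) = 0"
          using rel sum.remove[OF S(1) es(1), of "\<lambda>x. c x * mon val x"] by simp
        then have "c es * mon val es = - (\<Sum>x\<in>S - {es}. c x * mon val x)" by (simp add: eq_neg_iff_add_eq_0)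
        then have "b * (c es * mon val es) = b * (- (\<Sum>x\<in>S - {es}. c x * mon val x))" by simp
        moreover have "b * c es = 1" using c[OF es(1)] by (simp add: b_def)
        ultimately show ?thesis by (simp add: sum_distrib_left sum_negf mult.assoc[symmetric])
      qed
      then have "mon val e = (\<Sum>x\<in>S - {es}. - (b * (c x * mon val (e' + x))))"
        by (simp add: e mon_add sum_distrib_left mult_ac)
      also have "\<dots> \<in> vs.span A"
      proof (intro vs.span_sum vs.span_neg)
        fix x assume x: "x \<in> S - {es}"
        have "wsum w (e' + x) < wsum w e" using lt[OF x] by (simp add: e wsum_add)
        moreover have "keys (e' + x) \<subseteq> V" using keys_add[of e' x] ke S(2)[of x] x by blast
        ultimately have "mon val (e' + x) \<in> vs.span A" using less by simp
        then show "b * (c x * mon val (e' + x)) \<in> vs.span A" using x by (intro step) (auto simp: G_def)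
      qed
      finally show ?thesis .
    qed
  qed
  have "finite A" using \<Omega>(1) finR by (simp add: A_def)
  moreover have inj: "inj_on (mon val) (box V y)"
  proof (rule inj_onI, rule ccontr)
    fix e e' assume e: "e \<in> box V y" "e' \<in> box V y" "mon val e = mon val e'" "e \<noteq> e'"
    define Q where "Q = Poly_Mapping.single e (1::'k) - Poly_Mapping.single e' 1"
    have "lookup Q e = 1" using e(4) by (simp add: Q_def lookup_minus lookup_single)
    then have "Q \<noteq> 0" by auto
    moreover have "keys x \<subseteq> V" if "x \<in> keys Q" for x
      using that e(1,2) by (auto simp: Q_def in_keys_iff lookup_minus lookup_single box_def when_def split: if_splits)
    moreover have "meval \<phi> val Q = 0"
      using e(3) by (simp add: Q_def rhom_diff[OF rhom_meval[OF hom]] meval_single[OF hom])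
    ultimately show False using indep by blast
  qed
  \<comment> \<open>A linear dependence over K between these monomials would be a polynomial
    relation over K. So (y + 1)^v independent vectors lie in the span of the smaller set A.\<close>
  moreover have "vs.independent (mon val ` box V y)"
  proof (rule vs.independent_if_scalars_zero)
    fix f x assume f: "(\<Sum>x\<in>mon val ` box V y. \<phi> (f x) * x) = 0" and x: "x \<in> mon val ` box V y"
    define Q where "Q = (\<Sum>e\<in>box V y. Poly_Mapping.single e (f (mon val e)))"
    have lk: "lookup Q e = (if e \<in> box V y then f (mon val e) else 0)" for e
      using box_card(1)[OF V] by (simp add: Q_def lookup_sum lookup_single when_def)
    have "meval \<phi> val Q = 0"
      using f inj by (simp add: Q_def meval_sum[OF hom] meval_single[OF hom] sum.reindex)
    moreover have "keys e \<subseteq> V" if "e \<in> keys Q" for e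
      using that lk[of e] by (auto simp: in_keys_iff box_def split: if_splits)
    ultimately have "Q = 0" using indep by blast
    obtain e where "x = mon val e" "e \<in> box V y" using x by blast
    then show "f x = 0" using lk[of e] \<open>Q = 0\<close> by simp
  qed (simp add: box_card[OF V])
  moreover have "mon val ` box V y \<subseteq> vs.span A"
  proof
    fix x assume "x \<in> mon val ` box V y"
    then obtain e where e: "x = mon val e" "e \<in> box V y" by blast
    have k: "keys e \<subseteq> V" using e by (simp add: box_def)
    have "wsum w e \<le> (\<Sum>v\<in>V. y * w v)"
      unfolding wsum_superset[OF V k] using e(2) by (intro sum_mono mult_le_mono1) (auto simp: box_def)
    then have "wsum w e \<le> t" by (simp add: t_def W_def sum_distrib_left mult.commute)
    then show "x \<in> vs.span A" using reduce[OF k] e by simp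
  qed
  ultimately have "card (mon val ` box V y) \<le> card A" using vs.independent_span_bound by blast
  then show False using card card_image[OF inj] box_card(2)[OF V, of y] by simp
qed

end

section \<open>The set of values\<close>

context carlitz_li
begin

text \<open>Two equal values would give the linear relation of a difference of variables. As
  \<open>val\<close> is thus injective, exponent functions on the set of values can be reindexed by
  \<open>Vx\<close>, with \<open>en\<close> and \<open>dc\<close> as the two directions.\<close>

lemma val_independent: "inj_on val Vx" "alg_indep_over (Kbar \<iota> \<theta>) (val ` Vx)"
proof -
  interpret sc: scalars phi by unfold_locales (rule rhom_phi)
  show inj: "inj_on val Vx"
  proof (rule inj_onI, rule ccontr)
    fix v v' assume v: "v \<in> Vx" "v' \<in> Vx" "val v = val v'" "v \<noteq> v'"
    define Q :: "(nat \<times> nat, 'a poly fract) mpol" where "Q = mX v - mX v'"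
    have "Poly_Mapping.single v' (1::nat) \<noteq> Poly_Mapping.single v 1"
      using v(4) by (metis lookup_single_eq lookup_single_not_eq zero_neq_one)
    then have "lookup Q (Poly_Mapping.single v 1) = 1"
      by (simp add: Q_def mX_def lookup_minus lookup_single_not_eq)
    then have "Q \<noteq> 0" by auto
    moreover have "keys e \<subseteq> Vx" if "e \<in> keys Q" for e
      using that v(1,2) by (auto simp: Q_def mX_def in_keys_iff lookup_minus lookup_single when_def split: if_splits)
    ultimately have "meval phi val Q \<noteq> 0" by (rule values_independent)
    then show False
      using v(3) by (simp add: Q_def rhom_diff[OF rhom_meval[OF rhom_phi]] meval_mX[OF rhom_phi])
  qed
  show "alg_indep_over (Kbar \<iota> \<theta>) (val ` Vx)"
    unfolding alg_indep_over_def
  proof (intro conjI allI impI)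
    show "finite (val ` Vx)" using finite_Vx by simp
    fix c :: "('c \<Rightarrow> nat) \<Rightarrow> 'c" and e0
    define S where "S = {e. c e \<noteq> 0}"
    assume "finite {e. c e \<noteq> 0} \<and> (\<forall>e. c e \<noteq> 0 \<longrightarrow> (\<forall>x. x \<notin> val ` Vx \<longrightarrow> e x = 0)) \<and>
       (\<forall>e. c e \<in> Kbar \<iota> \<theta>) \<and> (\<Sum>e\<in>{e. c e \<noteq> 0}. c e * (\<Prod>x\<in>val ` Vx. x ^ e x)) = 0"
    then have S: "finite S" "\<And>e x. e \<in> S \<Longrightarrow> x \<notin> val ` Vx \<Longrightarrow> e x = 0"
      and K: "\<And>e. c e \<in> Kbar \<iota> \<theta>" and z: "(\<Sum>e\<in>S. c e * (\<Prod>x\<in>val ` Vx. x ^ e x)) = 0"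
      unfolding S_def by blast+
    define en where "en e = Abs_poly_mapping (\<lambda>v. if v \<in> Vx then e (val v) else 0)" for e :: "'c \<Rightarrow> nat"
    define dc where "dc m = (\<lambda>x. if x \<in> val ` Vx then lookup m (inv_into Vx val x) else 0)"
      for m :: "nat \<times> nat \<Rightarrow>\<^sub>0 nat"
    have en: "lookup (en e) = (\<lambda>v. if v \<in> Vx then e (val v) else 0)" for e
      unfolding en_def using finite_Vx by (intro lookup_Abs_poly_mapping) (auto elim: finite_subset[rotated])
    have ken: "keys (en e) \<subseteq> Vx" for e by (auto simp: in_keys_iff en split: if_splits)
    have dc: "dc (en e) = e" if "e \<in> S" for e
      using S(2)[OF that] by (auto simp: dc_def en fun_eq_iff inv_into_into f_inv_into_f)
    have inj_en: "inj_on en S" using dc by (metis inj_onI)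
    have mon: "mon val (en e) = (\<Prod>x\<in>val ` Vx. x ^ e x)" for e
      unfolding mon_superset[OF finite_Vx ken] using inj by (simp add: prod.reindex en)
    have "en ` S = {}"
    proof (rule sc.independent_over_algebraic[OF finite_Vx, of val "en ` S" "\<lambda>m. c (dc m)"])
      show "meval phi val Q \<noteq> 0" if "Q \<noteq> 0" "\<And>e. e \<in> keys Q \<Longrightarrow> keys e \<subseteq> Vx" for Q
        using that by (rule values_independent)
      show "(\<Sum>m\<in>en ` S. c (dc m) * mon val m) = 0"
        using z inj_en by (simp add: sum.reindex dc mon cong: sum.cong)
      show "c (dc m) \<noteq> 0 \<and> (\<exists>f. f \<noteq> 0 \<and> (\<forall>i. coeff f i \<in> range phi) \<and> poly f (c (dc m)) = 0)" if "m \<in> en ` S" for m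
        using that K dc by (auto simp: S_def Kbar_def Kset_eq)
    qed (use S(1) ken in auto)
    then have "S = {}" by simp
    then show "c e0 = 0" by (auto simp: S_def)
  qed
qed

lemma card_Vx: "card Vx = 1 + d * (d + 1) div 2"
proof -
  have "{(a, b). a < b \<and> b \<le> d} = prod.swap ` (SIGMA b:{0..d}. {..<b})" by force
  then have "card {(a, b). a < b \<and> b \<le> d} = (\<Sum>b\<in>{0..d}. b)"
    by (simp add: card_image)
  also have "\<dots> = d * (d + 1) div 2" using gauss_sum_nat[of d] by simp
  finally have "card {(a, b). a < b \<and> b \<le> d} = d * (d + 1) div 2" .
  moreover have "finite {(a, b). a < b \<and> b \<le> d}" using finite_Vx by (simp add: Vx_def)
  ultimately show ?thesis by (simp add: Vx_def)
qed

lemma val_image: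
  "val ` Vx = {Pi} \<union> {carlitz_Li av \<theta> q (map n [l..<Suc k]) (map (\<lambda>i. phi (\<alpha> i)) [l..<Suc k]) | l k. 1 \<le> l \<and> l \<le> k \<and> k \<le> d}"
proof -
  have "val ` {(a, b). a < b \<and> b \<le> d} = {Lam (l - 1) k | l k. 1 \<le> l \<and> l \<le> k \<and> k \<le> d}"
  proof (intro equalityI subsetI)
    fix x assume "x \<in> val ` {(a, b). a < b \<and> b \<le> d}"
    then obtain a b where "x = val (a, b)" "a < b" "b \<le> d" by auto
    then have "x = Lam (Suc a - 1) b \<and> 1 \<le> Suc a \<and> Suc a \<le> b \<and> b \<le> d" by (simp add: val_def)
    then show "x \<in> {Lam (l - 1) k | l k. 1 \<le> l \<and> l \<le> k \<and> k \<le> d}" by blast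
  next
    fix x assume "x \<in> {Lam (l - 1) k | l k. 1 \<le> l \<and> l \<le> k \<and> k \<le> d}"
    then obtain l k where "x = Lam (l - 1) k" "1 \<le> l" "l \<le> k" "k \<le> d" by blast
    then show "x \<in> val ` {(a, b). a < b \<and> b \<le> d}" by (intro image_eqI[of _ _ "(l - 1, k)"]) (auto simp: val_def)
  qed
  moreover have "Lam (l - 1) k = carlitz_Li av \<theta> q (map n [l..<Suc k]) (map (\<lambda>i. phi (\<alpha> i)) [l..<Suc k])" if "1 \<le> l" for l k
    using that by (simp add: Lam_def del: upt_Suc)
  then have "{Lam (l - 1) k | l k. 1 \<le> l \<and> l \<le> k \<and> k \<le> d}
     = {carlitz_Li av \<theta> q (map n [l..<Suc k]) (map (\<lambda>i. phi (\<alpha> i)) [l..<Suc k]) | l k. 1 \<le> l \<and> l \<le> k \<and> k \<le> d}"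
    by (metis (no_types, lifting))
  moreover have "val (0, 0) = Pi" by (simp add: val_def)
  ultimately show ?thesis unfolding Vx_def image_insert by (simp only: insert_is_Un[symmetric])
qed

end

theorem theorem1p5:
  fixes \<iota> :: "'a::{field,finite} \<Rightarrow> 'c::field"
    and av :: "'c \<Rightarrow> real" and \<theta> lam :: 'c
    and d :: nat and n :: "nat \<Rightarrow> nat" and \<alpha> :: "nat \<Rightarrow> 'c"
  assumes hom: "\<iota> 1 = 1" "\<And>a b. \<iota> (a + b) = \<iota> a + \<iota> b" "\<And>a b. \<iota> (a * b) = \<iota> a * \<iota> b"
    and av: "nonarch_abs av"
    and theta_gt: "av \<theta> > 1"
    and complete: "av_complete av"
    and closed: "alg_closed TYPE('c)"
    and dense: "\<And>x e. e > 0 \<Longrightarrow> \<exists>y\<in>Kbar \<iota> \<theta>. av (x - y) < e"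
    and lam: "lam ^ (CARD('a) - 1) = - \<theta>"
    and d: "d \<ge> 1"
    and n_pos: "\<And>i. i \<in> {1..d} \<Longrightarrow> n i \<ge> 1"
    and n_dist: "inj_on n {1..d}"
    and n_ndvd: "\<And>i. i \<in> {1..d} \<Longrightarrow> \<not> (CARD('a) - 1) dvd n i"
    and n_ppow: "\<And>i j k. i \<in> {1..d} \<Longrightarrow> j \<in> {1..d} \<Longrightarrow> i \<noteq> j \<Longrightarrow>
                   (of_nat (n i) / of_nat (n j) :: rat) \<noteq> of_nat CHAR('a) powi k"
    and alpha_K: "\<And>i. i \<in> {1..d} \<Longrightarrow> \<alpha> i \<in> Kset \<iota> \<theta> \<and> \<alpha> i \<noteq> 0"
    and alpha_abs: "\<And>i. i \<in> {1..d} \<Longrightarrow>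
                   av (\<alpha> i) < av \<theta> powr (real (n i) * real CARD('a) / (real CARD('a) - 1))"
  shows "card ({pi_tilde av \<theta> CARD('a) lam} \<union>
                {carlitz_Li av \<theta> CARD('a) (map n [l..<Suc k]) (map \<alpha> [l..<Suc k]) | l k. 1 \<le> l \<and> l \<le> k \<and> k \<le> d})
           = 1 + d * (d + 1) div 2
       \<and> alg_indep_over (Kbar \<iota> \<theta>)
           ({pi_tilde av \<theta> CARD('a) lam} \<union>
              {carlitz_Li av \<theta> CARD('a) (map n [l..<Suc k]) (map \<alpha> [l..<Suc k]) | l k. 1 \<le> l \<and> l \<le> k \<and> k \<le> d})"
proof -
  have iota: "rhom \<iota>" using hom by (rule rhomI)
  interpret c: carlitz \<iota> av \<theta> lam "CARD('a)" "CHAR('a)"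
    by unfold_locales (use iota av theta_gt complete closed lam in auto)
  \<comment> \<open>Preimages of the \<alpha> in the abstract K.\<close>
  define \<beta> where "\<beta> i = (SOME x. c.phi x = \<alpha> i)" for i
  have \<beta>: "c.phi (\<beta> i) = \<alpha> i" if "i \<in> {1..d}" for i
    using alpha_K[OF that] unfolding c.Kset_eq \<beta>_def by (metis (mono_tags, lifting) imageE someI)
  interpret cl: carlitz_li \<iota> av \<theta> lam "CARD('a)" "CHAR('a)" d n \<beta>
  proof
    fix i assume i: "i \<in> {1..d}"
    show "n i \<ge> 1" "\<not> (CARD('a) - 1) dvd n i" using n_pos n_ndvd i by auto
    show "\<beta> i \<noteq> 0" using alpha_K[OF i] \<beta>[OF i] rhom_0[OF c.rhom_phi] by auto
    have q: "real CARD('a) - 1 = real (CARD('a) - 1)" "CARD('a) - 1 > 0" using c.q_ge_2 by auto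
    \<comment> \<open>The size condition has a real exponent; its (q - 1)-th power has a natural
      one.\<close>
    have "av (\<alpha> i) ^ (CARD('a) - 1)
        < (av \<theta> powr (real (n i) * real CARD('a) / (real CARD('a) - 1))) ^ (CARD('a) - 1)"
      using q(2) by (intro power_strict_mono alpha_abs[OF i]) auto
    also have "\<dots> = (av \<theta> powr (real (n i) * real CARD('a) / (real CARD('a) - 1))) powr (real CARD('a) - 1)"
      unfolding q(1) using theta_gt by (subst powr_realpow) auto
    also have "\<dots> = av \<theta> powr (real (n i * CARD('a)))"
      using q unfolding powr_powr by simp
    also have "\<dots> = av \<theta> ^ (n i * CARD('a))" using theta_gt by (intro powr_realpow) simp
    finally show "av (c.phi (\<beta> i)) ^ (CARD('a) - 1) < av \<theta> ^ (n i * CARD('a))" by (simp only: \<beta>[OF i])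
    fix i' j j' assume i': "i' \<in> {1..d}" and e: "n i * CHAR('a) ^ j = n i' * CHAR('a) ^ j'"
    show "i = i'"
    proof (rule ccontr)
      assume "i \<noteq> i'"
      have p: "(of_nat CHAR('a) :: rat) \<noteq> 0" using c.prime_p by auto
      have "(of_nat (n i) :: rat) * of_nat CHAR('a) ^ j = of_nat (n i') * of_nat CHAR('a) ^ j'"
        using e by (metis of_nat_mult of_nat_power)
      moreover have "n i' \<noteq> 0" using n_pos[OF i'] by simp
      ultimately have "(of_nat (n i) / of_nat (n i') :: rat) = of_nat CHAR('a) ^ j' / of_nat CHAR('a) ^ j"
        using p by (simp add: field_simps)
      also have "\<dots> = of_nat CHAR('a) powi (int j' - int j)" using p by (simp add: power_int_diff)
      finally show False using n_ppow[OF i i' \<open>i \<noteq> i'\<close>] by blast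
    qed
  qed
  have "{carlitz_Li av \<theta> CARD('a) (map n [l..<Suc k]) (map \<alpha> [l..<Suc k]) | l k. 1 \<le> l \<and> l \<le> k \<and> k \<le> d}
      = {carlitz_Li av \<theta> CARD('a) (map n [l..<Suc k]) (map (\<lambda>i. c.phi (\<beta> i)) [l..<Suc k]) | l k. 1 \<le> l \<and> l \<le> k \<and> k \<le> d}"
  proof -
    have "map \<alpha> [l..<Suc k] = map (\<lambda>i. c.phi (\<beta> i)) [l..<Suc k]" if "1 \<le> l" "k \<le> d" for l k
      using that \<beta> by (intro map_cong) auto
    then show ?thesis by (metis (no_types, lifting))
  qed
  then have "{pi_tilde av \<theta> CARD('a) lam} \<union>
      {carlitz_Li av \<theta> CARD('a) (map n [l..<Suc k]) (map \<alpha> [l..<Suc k]) | l k. 1 \<le> l \<and> l \<le> k \<and> k \<le> d} = cl.val ` cl.Vx"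
    unfolding cl.val_image cl.Pi_def by simp
  then show ?thesis
    using cl.val_independent cl.card_Vx card_image by metis
qed

end
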